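(* Let $d\ge2$, let $Q_1,Q_2$ be quadratic forms on $\mathbb{R}^d$, let $\mathcal{T}=\mathcal{T}_{Q_1,Q_2}$ be the associated restricted $2$-plane transform, and let $C>0$ be fixed. (1) Suppose that the quadratic surface $\Sigma(Q_1,Q_2)$ is flat but $\det(s\nabla^2Q_1+t\nabla^2Q_2)$ is not identically vanishing. Let $m_*>d/2$ denote the largest multiplicity among its roots. Then for every $1\le p,q\le\infty$ such that $$1+\frac{m_*}{q}\ge\frac{m_*+1}{p}\quad\text{ and }\quad\frac2q\ge\frac1p,$$ with the exception of $p=(m_*+2)/2$, $q=m_*+2$, there is a constant $K$ (depending on $p,q,Q_1,Q_2$ and $C$) such that $$\|\mathcal{T}f\|_{L^q(\mathbb{R}^d\times[-1,1]^d)}\le K\,\|f\|_{L^p(\mathbb{R}^{d+2})}$$ for every function $f$ supported in $B(0,C)\times[-1,1]^2$. Moreover, every $L^p\to L^q$ estimate with $1+m_*/q<(m_*+1)/p$ and $2/q=1/p$ is false. (2) If instead $\det(s\nabla^2Q_1+t\nabla^2Q_2)$ vanishes identically, then there is an $\epsilon=\epsilon_{Q_1,Q_2}$ with $0<\epsilon<1$ such that every $L^p\to L^q$ estimate with $\frac{2-\epsilon}{q}<\frac1p$ is false (this includes in particular estimates with $2/q=1/p$ for $(p,q)\ne(\infty,\infty)$).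
   Context: $B(0,C)$ is the ball of radius $C$ centred at $0$ in $\mathbb{R}^d$. Convention: $1/\infty=0$. For $1\le p,q\le\infty$, "the $L^p\to L^q$ estimate is false" means that there is no finite constant $K$ such that $\|\mathcal{T}f\|_{L^q(\mathbb{R}^d\times[-1,1]^d)}\le K\|f\|_{L^p(\mathbb{R}^{d+2})}$ for all $f$ supported in $B(0,C)\times[-1,1]^2$. The operator is $$\mathcal{T}f(x,\xi):=\iint_{|s|,|t|\le1}f\big(x-s\nabla Q_1(\xi)-t\nabla Q_2(\xi),s,t\big)\,ds\,dt,\qquad x\in\mathbb{R}^d,\ \xi\in[-1,1]^d.$$ A root of a homogeneous polynomial in $\mathbb{R}[s,t]$ is a homogeneous linear divisor $as+bt$ in $\mathbb{C}[s,t]$ (with $(a,b)\neq(0,0)$), and its multiplicity is the largest $m$ such that $(as+bt)^m$ is still a divisor. Flatness. Let $\phi(\xi)=(\xi,Q_1(\xi),Q_2(\xi))$, $\xi\in[-1,1]^d$, and $\Sigma(Q_1,Q_2)=\phi([-1,1]^d)\subset\mathbb{R}^{d+2}$. The density with respect to $d\xi$ of Gressman's affine invariant surface measure $\nu$ on $\Sigma(Q_1,Q_2)$ is $$\frac{d\nu}{d\xi}=\Big[\inf_{M\in SL(\mathbb{R}^d)}\Big(\sum_{i_1,\dots,i_d,\,j_1,j_2,\,k_1,k_2=1}^d\big|\det\big(X_{i_1}\phi,\dots,X_{i_d}\phi,\;X_{j_1}X_{j_2}\phi,\;X_{k_1}X_{k_2}\phi\big)\big|^2\Big)^{1/2}\Big]^{d/(d+4)},$$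 where $X_i=\sum_{k=1}^dM_{ik}\partial_k$. For this $\phi$ it is constant in $\xi$; with $A=\nabla^2Q_1$, $B=\nabla^2Q_2$ (constant Hessians), it equals a positive dimensional constant times $$\Big[\inf_{M\in SL(\mathbb{R}^d)}\Big(\sum_{j_1,j_2,k_1,k_2=1}^d\big((MAM^\top)_{j_1j_2}(MBM^\top)_{k_1k_2}-(MAM^\top)_{k_1k_2}(MBM^\top)_{j_1j_2}\big)^2\Big)^{1/2}\Big]^{d/(d+4)}.$$ $\Sigma(Q_1,Q_2)$ is flat if this constant is zero. (By the paper's characterisation of well-curvedness, when the surface is flat and $\det(s\nabla^2Q_1+t\nabla^2Q_2)\not\equiv0$, this polynomial has a root of multiplicity larger than $d/2$.) *)

theory Defs
  imports "HOL-Probability.Probability" "HOL-Computational_Algebra.Computational_Algebra"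
begin

definition quadratic_form :: "(real^'n \<Rightarrow> real) \<Rightarrow> bool" where
  "quadratic_form Q \<longleftrightarrow>
     (\<exists>c :: 'n \<Rightarrow> 'n \<Rightarrow> real. \<forall>x. Q x = (\<Sum>i\<in>UNIV. \<Sum>j\<in>UNIV. c i j * x$i * x$j))"

definition partial_deriv :: "'n::finite \<Rightarrow> (real^'n \<Rightarrow> 'b::real_normed_vector) \<Rightarrow> real^'n \<Rightarrow> 'b" where
  "partial_deriv i F x = frechet_derivative F (at x) (axis i 1)"

definition gradient :: "(real^'n::finite \<Rightarrow> real) \<Rightarrow> real^'n \<Rightarrow> real^'n" where
  "gradient Q x = (\<chi> i. partial_deriv i Q x)"

definition hessian :: "(real^'n::finite \<Rightarrow> real) \<Rightarrow> real^'n \<Rightarrow> real^'n^'n" where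
  "hessian Q x = (\<chi> i j. partial_deriv i (partial_deriv j Q) x)"

definition unit_cube :: "(real^'n) set" where
  "unit_cube = {\<xi>. \<forall>i. \<xi>$i \<in> {-1..1}}"

text \<open>The ring $R[s,t]$ is represented as $R[s][t]$, that is, as the type of polynomials in $t$
  with coefficients that are polynomials in $s$.\<close>

definition var_s :: "'a::comm_ring_1 poly poly" where "var_s = [: [:0, 1:] :]"

definition var_t :: "'a::comm_ring_1 poly poly" where "var_t = [: 0, 1 :]"

definition const2 :: "'a::comm_ring_1 \<Rightarrow> 'a poly poly" where "const2 a = [: [: a :] :]"

text \<open>The polynomial $\det(s\nabla^2 Q_1 + t\nabla^2 Q_2)$ in $\mathbb{R}[s,t]$. The Hessians of
  quadratic forms are constant, so they may be taken at the origin.\<close>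

definition pencil_det ::
    "(real^'n::finite \<Rightarrow> real) \<Rightarrow> (real^'n \<Rightarrow> real) \<Rightarrow> real poly poly" where
  "pencil_det Q1 Q2 =
     det (\<chi> i j. var_s * const2 (hessian Q1 0 $ i $ j) + var_t * const2 (hessian Q2 0 $ i $ j))"

definition complexify :: "real poly poly \<Rightarrow> complex poly poly" where
  "complexify = map_poly (map_poly complex_of_real)"

definition linear_poly :: "complex \<Rightarrow> complex \<Rightarrow> complex poly poly" where
  "linear_poly a b = const2 a * var_s + const2 b * var_t"

definition is_root :: "real poly poly \<Rightarrow> complex poly poly \<Rightarrow> bool" where
  "is_root P l \<longleftrightarrow> (\<exists>a b. (a, b) \<noteq> (0, 0) \<and> l = linear_poly a b) \<and> l dvd complexify P"

definition root_multiplicity :: "complex poly poly \<Rightarrow> real poly poly \<Rightarrow> nat" where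
  "root_multiplicity l P = (GREATEST m. l ^ m dvd complexify P)"

definition max_root_multiplicity :: "real poly poly \<Rightarrow> nat" where
  "max_root_multiplicity P = Max {root_multiplicity l P | l. is_root P l}"

text \<open>The space $\mathbb{R}^{d+2}$ containing the surface is indexed by \<^typ>\<open>'n + bool\<close>, the
  two additional coordinates being \<^term>\<open>Inr False\<close> and \<^term>\<open>Inr True\<close>.\<close>

definition surface_param ::
    "(real^'n \<Rightarrow> real) \<Rightarrow> (real^'n \<Rightarrow> real) \<Rightarrow> real^'n \<Rightarrow> real^('n::finite + bool)" where
  "surface_param Q1 Q2 \<xi> =
     (\<chi> k. case k of Inl i \<Rightarrow> \<xi>$i | Inr b \<Rightarrow> (if b then Q2 \<xi> else Q1 \<xi>))"

definition frame_deriv ::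
    "real^'n^'n \<Rightarrow> 'n::finite \<Rightarrow> (real^'n \<Rightarrow> 'b::real_normed_vector) \<Rightarrow> real^'n \<Rightarrow> 'b" where
  "frame_deriv M i F x = (\<Sum>k\<in>UNIV. M$i$k *\<^sub>R partial_deriv k F x)"

text \<open>The determinant of the matrix with columns
  $X_{i_1}\phi, \dots, X_{i_d}\phi, X_{j_1}X_{j_2}\phi, X_{k_1}X_{k_2}\phi$ at the point $\xi$; the
  multi-index $(i_1,\dots,i_d)$ is a function \<^term>\<open>i :: 'n \<Rightarrow> 'n\<close>.\<close>

definition frame_det ::
    "(real^'n \<Rightarrow> real^('n + bool)) \<Rightarrow> real^'n \<Rightarrow> real^'n^'n \<Rightarrow>
       ('n \<Rightarrow> 'n::finite) \<Rightarrow> 'n \<times> 'n \<Rightarrow> 'n \<times> 'n \<Rightarrow> real" where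
  "frame_det \<phi> \<xi> M i j k =
     det (transpose (\<chi> c. case c of
            Inl l \<Rightarrow> frame_deriv M (i l) \<phi> \<xi>
          | Inr b \<Rightarrow> (if b then frame_deriv M (fst k) (frame_deriv M (snd k) \<phi>) \<xi>
                           else frame_deriv M (fst j) (frame_deriv M (snd j) \<phi>) \<xi>)))"

definition affine_density :: "(real^'n::finite \<Rightarrow> real^('n + bool)) \<Rightarrow> real^'n \<Rightarrow> real" where
  "affine_density \<phi> \<xi> =
     (INF M \<in> {M :: real^'n^'n. det M = 1}.
        sqrt (\<Sum>i\<in>UNIV. \<Sum>j\<in>UNIV. \<Sum>k\<in>UNIV. \<bar>frame_det \<phi> \<xi> M i j k\<bar>\<^sup>2))
     powr (real CARD('n) / (real CARD('n) + 4))"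

definition flat_surface :: "(real^'n::finite \<Rightarrow> real) \<Rightarrow> (real^'n \<Rightarrow> real) \<Rightarrow> bool" where
  "flat_surface Q1 Q2 \<longleftrightarrow> (\<forall>\<xi>\<in>unit_cube. affine_density (surface_param Q1 Q2) \<xi> = 0)"

text \<open>Real powers of extended nonnegative reals, used only for positive exponents.\<close>

definition ennreal_powr :: "ennreal \<Rightarrow> real \<Rightarrow> ennreal" where
  "ennreal_powr x r = (if x = \<infinity> then \<infinity> else ennreal (enn2real x powr r))"

definition Lp_norm :: "'a measure \<Rightarrow> ennreal \<Rightarrow> ('a \<Rightarrow> 'b::real_normed_vector) \<Rightarrow> ennreal" where
  "Lp_norm M p f =
     (if p = \<infinity> then esssup M (\<lambda>x. ennreal (norm (f x)))
      else ennreal_powr (\<integral>\<^sup>+x. ennreal (norm (f x) powr enn2real p) \<partial>M) (1 / enn2real p))"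

text \<open>For integrable \<^term>\<open>f\<close> the integral below converges absolutely for almost every
  \<^term>\<open>(x, \<xi>)\<close>; it takes the junk value 0 on the exceptional null set.\<close>

definition two_plane_transform ::
    "(real^'n::finite \<Rightarrow> real) \<Rightarrow> (real^'n \<Rightarrow> real) \<Rightarrow>
      ((real^'n) \<times> real \<times> real \<Rightarrow> complex) \<Rightarrow> (real^'n) \<times> (real^'n) \<Rightarrow> complex" where
  "two_plane_transform Q1 Q2 f = (\<lambda>(x, \<xi>).
     (LINT (s, t) : {-1..1} \<times> {-1..1} | lebesgue.
        f (x - s *\<^sub>R gradient Q1 \<xi> - t *\<^sub>R gradient Q2 \<xi>, s, t)))"

definition Lp_Lq_estimate ::
    "(real^'n::finite \<Rightarrow> real) \<Rightarrow> (real^'n \<Rightarrow> real) \<Rightarrow> real \<Rightarrow> ennreal \<Rightarrow> ennreal \<Rightarrow> bool" where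
  "Lp_Lq_estimate Q1 Q2 C p q \<longleftrightarrow>
     (\<exists>K::real. K \<ge> 0 \<and>
       (\<forall>f :: (real^'n) \<times> real \<times> real \<Rightarrow> complex.
          f \<in> borel_measurable lebesgue \<longrightarrow> Lp_norm lebesgue p f < \<infinity> \<longrightarrow>
          (\<forall>z. z \<notin> ball 0 C \<times> {-1..1} \<times> {-1..1} \<longrightarrow> f z = 0) \<longrightarrow>
          Lp_norm (lebesgue_on (UNIV \<times> unit_cube)) q (two_plane_transform Q1 Q2 f)
            \<le> ennreal K * Lp_norm lebesgue p f))"

end

theory Submission
  imports Defs "HOL-Complex_Analysis.Complex_Analysis"
begin

text \<open>Let \<open>A\<close>, \<open>B\<close> be the Hessians. Flatness means that along suitable linear changes of coordinates
  and rotations of the \<open>(s,t)\<close>-plane one matrix of the pencil becomes negligible against the other, and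
  this forces \<open>det(sA + tB)\<close> to vanish to an order \<open>m > d/2\<close> along a line. The remaining factor has degree
  \<open>d - m < m\<close>, so that \<open>{|det(sA + tB)| \<le> \<epsilon>}\<close> has measure \<open>O(\<epsilon>\<^bsup>1/m\<^esup>)\<close>, that is,
  $|\det|^{-1/(m+1)}$ is in weak $L^{(m+1)/m}$.
  For two points \<open>z\<close>, \<open>z'\<close> of the \<open>(s,t)\<close>-plane the substitution in \<open>\<xi>\<close> has Jacobian \<open>det\<close> at \<open>z - z'\<close>, so
  Minkowski's inequality in \<open>\<xi>\<close> and weak Young inequalities for this kernel give the estimate
  \<open>L\<^bsup>(m+2)/2\<^esup> \<rightarrow> L\<^bsup>m+2\<^esup>\<close>; the other exponents follow by interpolation with the
  trivial bounds.

  For the converse, rotate the pencil to matrices \<open>M\<close>, \<open>N\<close> with the multiple root at \<open>M\<close>, and let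
  \<open>E = M + \<delta>N\<close> and \<open>Y = \<delta>E\<^bsup>-1\<^esup>N\<close>. Then \<open>det E = O(\<delta>\<^bsup>m\<^esup>)\<close>, the powers of \<open>Y\<close> grow at most
  like \<open>2\<^bsup>i\<^esup>\<close>, and the test function is the indicator of \<open>E\<Xi>\<close> times a strip of width \<open>\<delta>\<close>, where
  \<open>\<Xi>\<close> is given by \<open>|Y\<^bsup>i\<^esup>\<xi>| \<le> \<kappa> 2\<^bsup>i\<^esup>\<close> for all \<open>i\<close>. If \<open>det(sA + tB)\<close> vanishes identically, there is
  a subspace \<open>U\<close> with \<open>BU \<subseteq> AU\<close> and \<open>dim AU < dim U\<close>, and the \<open>\<delta>\<close>-neighbourhoods of \<open>AU\<close> and \<open>U\<close> are
  tested.\<close>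

text \<open>The kernel is only of weak type, yet the endpoint bound is of strong type. The (m+2)-nd
  power of the plane integral reduces to the integral of F (k F)^(m+1), where k has the kernel
  |det|^(-1/(m+1)) and F(z) is the L^a norm of the slice at z, a = (m+2)/2. That form is bounded by
  splitting pairs of points according to which of the two normalised functions is larger: on each
  half one function is bounded by a level set by the other, and no operator interpolation is needed.

  In the converse the norm of Y may blow up as \<delta> tends to 0, since only the resolvent on the
  unit disc is controlled. A ball need not be carried into itself under the displacements, hence the
  set cut out by all iterates. Its volume is unknown, but on the line q = 2p it occurs on both sides
  with the same power and cancels; what remains is |det E|.

  In the singular case the gap dim U - dim AU of at least 1, measured against the codimension of AU,
  which is at most d, is what yields \<epsilon> = 1/d.\<close>

no_notation fps_nth (infixl "$" 75)

section \<open>Linear changes of variables for Lebesgue measure\<close>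

lemma measure_swap_image_cbox:
  fixes a b :: "real^'n"
  shows "measure lebesgue ((\<lambda>x. \<chi> i. x $ Transposition.transpose m n i) ` cbox a b) = measure lebesgue (cbox a b)"
proof -
  define h :: "real^'n \<Rightarrow> real^'n" where "h v = (\<chi> i. v $ Transposition.transpose m n i)" for v
  have hh: "h (h x) = x" for x by (simp add: vec_eq_iff h_def)
  have all: "(\<forall>i. P (Transposition.transpose m n i)) \<longleftrightarrow> (\<forall>i. P i)" for P
    by (metis transpose_involutory)
  have mem: "h x \<in> cbox a b \<longleftrightarrow> x \<in> cbox (h a) (h b)" for x
    unfolding mem_box_cart h_def using all[of "\<lambda>i. a$i \<le> h x$i \<and> h x$i \<le> b$i"]
    by (simp only: vec_lambda_beta transpose_involutory h_def)
  have eq: "h ` cbox a b = cbox (h a) (h b)"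
  proof (intro subset_antisym subsetI)
    fix x assume "x \<in> h ` cbox a b"
    then obtain y where "x = h y" "y \<in> cbox a b" by blast
    then show "x \<in> cbox (h a) (h b)" using mem[of "h y"] hh[of y] by simp
  next
    fix x assume "x \<in> cbox (h a) (h b)"
    then show "x \<in> h ` cbox a b" using mem[of x] hh[of x] by (intro image_eqI[of x h "h x"]) simp_all
  qed
  have "measure lebesgue (h ` cbox a b) = measure lebesgue (cbox a b)"
  proof (cases "cbox a b = {}")
    case False
    then have "cbox (h a) (h b) \<noteq> {}" unfolding eq[symmetric] by blast
    then show ?thesis
      using prod.permute[OF permutes_swap_id, where S=UNIV and g="\<lambda>i. (b - a)$i", of m n]
      unfolding eq by (simp add: content_cbox_cart False o_def h_def)
  qed simp
  then show ?thesis by (simp add: h_def[abs_def])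
qed

lemma measure_shear_image_cbox:
  fixes a b :: "real^'n"
  assumes "m \<noteq> n"
  shows "measure lebesgue ((\<lambda>x. \<chi> i. if i = m then x$m + x$n else x$i) ` cbox a b)
    = measure lebesgue (cbox a b)"
proof (cases "cbox a b = {}")
  case False
  let ?h = "\<lambda>x::real^'n. \<chi> i. if i = m then x$m + x$n else x$i"
  \<comment> \<open>\<open>measure_shear_interval\<close> asks for a nonnegative lower corner in
    direction \<open>n\<close>. Translating by \<open>v\<close> moves that corner to 0, and the
    shear turns the translation into another translation, so no volume changes.\<close>
  define v :: "real^'n" where "v = - axis n (a$n)"
  have lin: "linear ?h"
    by (rule linearI) (auto simp: vec_eq_iff algebra_simps)
  have v: "cbox (v + a) (v + b) = (+) v ` cbox a b"
    by (simp add: cbox_translation)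
  have "measure lebesgue (?h ` cbox a b) = measure lebesgue ((+) (?h v) ` ?h ` cbox a b)"
    by (simp add: measure_translation)
  also have "(+) (?h v) ` ?h ` cbox a b = ?h ` cbox (v + a) (v + b)"
    unfolding v image_image linear_add[OF lin] ..
  also have "measure lebesgue \<dots> = measure lebesgue (cbox (v + a) (v + b))"
    using False by (intro measure_shear_interval assms) (auto simp only: v image_is_empty, simp add: v_def)
  also have "\<dots> = measure lebesgue (cbox a b)"
    unfolding v by (rule measure_translation)
  finally show ?thesis .
qed simp

lemma det_shear:
  assumes "m \<noteq> n"
  shows "det (matrix (\<lambda>x::real^'n. \<chi> i. if i = m then x$m + x$n else x$i)) = 1"
proof -
  have "matrix (\<lambda>x::real^'n. \<chi> i. if i = m then x$m + x$n else x$i)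
      = (\<chi> k. if k = m then row m (mat 1) + 1 *s row n (mat 1) else row k (mat 1))"
    by (auto simp: matrix_def row_def mat_def vec_eq_iff axis_def)
  then show ?thesis
    using det_row_operation[OF assms, of "mat 1" 1] by simp
qed

text \<open>Both sides are multiplicative under composition, so elementary maps suffice. A map that
  kills a coordinate has negligible image and determinant 0. For a swap only |det| matters, and it
  equals 1 because the swap is an involution.\<close>

lemma lmeasurable_linear_image_cart:
  fixes f :: "real^'n \<Rightarrow> real^'n"
  assumes "linear f" "S \<in> lmeasurable"
  shows "f ` S \<in> lmeasurable \<and> measure lebesgue (f ` S) = \<bar>det (matrix f)\<bar> * measure lebesgue S"
proof -
  have "\<forall>S\<in>lmeasurable. f ` S \<in> lmeasurable \<and> measure lebesgue (f ` S) = \<bar>det (matrix f)\<bar> * measure lebesgue S"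
  proof (rule induct_linear_elementary[OF assms(1)], goal_cases)
    case (1 f g)
    then show ?case
      unfolding image_comp[symmetric] matrix_compose[OF 1(2) 1(1)] det_mul abs_mult by simp
  next
    case (2 f i)
    then have ninj: "\<not> inj f"
      by (metis (full_types) linear_injective_imp_surjective one_neq_zero surjE vec_component)
    then have "det (matrix f) = 0"
      using det_nz_iff_inj[OF 2(1)] by blast
    moreover have "negligible (f ` S)" for S
      using negligible_linear_singular_image[OF 2(1) ninj] by simp
    ultimately show ?case
      by (auto simp: negligible_iff_measure)
  next
    case (3 c)
    show ?case
      using measurable_stretch[of _ c] measure_stretch[of _ c]
      by (simp add: axis_def matrix_def det_diagonal)
  next
    case (4 m n)
    let ?h = "\<lambda>v::real^'n. \<chi> i. v $ Transposition.transpose m n i"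
    have lin: "linear ?h"
      by (rule linearI) (simp_all add: vec_eq_iff)
    have "matrix ?h ** matrix ?h = mat 1"
      unfolding matrix_compose[OF lin lin, symmetric] o_def by (simp add: matrix_id_mat_1[unfolded id_def])
    then have "det (matrix ?h) * det (matrix ?h) = 1"
      by (metis det_I det_mul)
    then have "\<bar>det (matrix ?h)\<bar> = 1"
      by (auto simp: square_eq_1_iff)
    moreover have "?h ` S \<in> lmeasurable \<and> 1 * measure lebesgue S = measure lebesgue (?h ` S)"
      if "S \<in> lmeasurable" for S
      by (rule measure_linear_sufficient[OF lin that]) (simp only: measure_swap_image_cbox mult_1)
    ultimately show ?case
      by metis
  next
    case (5 m n)
    let ?h = "\<lambda>x::real^'n. \<chi> i. if i = m then x$m + x$n else x$i"
    have lin: "linear ?h"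
      by (rule linearI) (auto simp: vec_eq_iff algebra_simps)
    have "?h ` S \<in> lmeasurable \<and> 1 * measure lebesgue S = measure lebesgue (?h ` S)"
      if "S \<in> lmeasurable" for S
      by (rule measure_linear_sufficient[OF lin that]) (simp only: measure_shear_image_cbox[OF 5] mult_1)
    then show ?case
      unfolding det_shear[OF 5] abs_one by (intro ballI) (simp only: mult_1)
  qed
  then show ?thesis using assms(2) by blast
qed

text \<open>Lebesgue measure is determined by its values on open boxes. It is therefore enough that
  the push-forward under \<open>M\<close>, weighted by |det M|, gives each box its volume, and the
  preimage of a box is its image under the inverse matrix.\<close>

lemma nn_integral_matrix_vector_mult:
  fixes M :: "real^'n^'n" and g :: "real^'n \<Rightarrow> ennreal"
  assumes M: "det M \<noteq> 0" and g[measurable]: "g \<in> borel_measurable borel"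
  shows "(\<integral>\<^sup>+x. g x \<partial>lborel) = ennreal \<bar>det M\<bar> * (\<integral>\<^sup>+x. g (M *v x) \<partial>lborel)"
proof -
  have meas[measurable]: "(*v) M \<in> borel_measurable borel"
    by (intro borel_measurable_continuous_onI linear_continuous_on) (simp add: matrix_vector_mul_bounded_linear)
  obtain M' where inv: "M ** M' = mat 1" "M' ** M = mat 1"
    using M unfolding invertible_det_nz[symmetric] invertible_def by blast
  have d': "\<bar>det M'\<bar> * \<bar>det M\<bar> = 1" by (metis inv(2) abs_1 abs_mult det_I det_mul)
  have "lborel = density (distr lborel borel ((*v) M)) (\<lambda>_. ennreal \<bar>det M\<bar>)" (is "_ = ?D")
  proof (rule lborel_eqI)
    fix l u :: "real^'n" assume le: "\<And>b. b \<in> Basis \<Longrightarrow> l \<bullet> b \<le> u \<bullet> b"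
    have eq: "(*v) M -` box l u = (*v) M' ` box l u"
      using inv by (auto simp: matrix_vector_mul_assoc image_iff) (metis matrix_vector_mul_assoc matrix_vector_mul_lid)
    have "emeasure ?D (box l u) = ennreal \<bar>det M\<bar> * emeasure lborel ((*v) M -` box l u)"
      by (simp add: emeasure_density emeasure_distr nn_integral_cmult)
    also have "emeasure lborel ((*v) M -` box l u) = emeasure lebesgue ((*v) M' ` box l u)"
    proof -
      have "(*v) M -` box l u \<in> sets borel"
        using measurable_sets[OF meas, of "box l u"] by simp
      then show ?thesis by (simp add: eq)
    qed
    also have "\<dots> = ennreal (\<bar>det M'\<bar> * measure lebesgue (box l u))"
      using lmeasurable_linear_image_cart[of "(*v) M'" "box l u"]
      by (simp add: emeasure_eq_measure2 fmeasurableD2)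
    finally have "emeasure ?D (box l u) = ennreal (\<bar>det M'\<bar> * \<bar>det M\<bar> * measure lebesgue (box l u))"
      by (simp add: ennreal_mult' mult_ac)
    then show "emeasure ?D (box l u) = ennreal (\<Prod>b\<in>Basis. (u - l) \<bullet> b)"
      using d' le by (simp add: measure_lborel_box inner_diff_left)
  qed simp
  then have "(\<integral>\<^sup>+x. g x \<partial>lborel) = (\<integral>\<^sup>+x. g x \<partial>?D)" by simp
  also have "\<dots> = ennreal \<bar>det M\<bar> * (\<integral>\<^sup>+x. g (M *v x) \<partial>lborel)"
    by (simp add: nn_integral_density nn_integral_distr nn_integral_cmult)
  finally show ?thesis .
qed

section \<open>Hoelder and weak Young inequalities\<close>

lemma powr_exp_ln: "x > 0 \<Longrightarrow> x powr r = exp (r * ln (x::real))"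
  by (simp add: powr_def)

lemma ennreal_lincomb:
  assumes "u \<ge> 0" "v \<ge> 0" "x \<ge> 0" "y \<ge> 0"
  shows "ennreal (u * x + v * y) = ennreal u * ennreal x + ennreal v * ennreal y"
  using assms by (simp add: ennreal_mult)

text \<open>Weighted arithmetic-geometric means for f/A and g/B, integrated. The powers \<theta> and
  1 - \<theta> sit on the integrand and the integrals enter through upper bounds, which is the shape
  in which the inequality interpolates. If A or B is 0, one function vanishes almost everywhere and
  the division is avoided.\<close>

lemma nn_integral_Holder:
  fixes f g :: "'a \<Rightarrow> real"
  assumes [measurable]: "f \<in> borel_measurable M" "g \<in> borel_measurable M"
    and f: "\<And>x. x \<in> space M \<Longrightarrow> f x \<ge> 0" and g: "\<And>x. x \<in> space M \<Longrightarrow> g x \<ge> 0" and \<theta>: "0 < \<theta>" "\<theta> < 1"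
    and A: "(\<integral>\<^sup>+x. ennreal (f x) \<partial>M) \<le> ennreal A" "A \<ge> 0"
    and B: "(\<integral>\<^sup>+x. ennreal (g x) \<partial>M) \<le> ennreal B" "B \<ge> 0"
  shows "(\<integral>\<^sup>+x. ennreal (f x powr \<theta> * g x powr (1 - \<theta>)) \<partial>M) \<le> ennreal (A powr \<theta> * B powr (1 - \<theta>))"
proof -
  have zero: "(\<integral>\<^sup>+x. ennreal (f x powr \<theta> * g x powr (1 - \<theta>)) \<partial>M) = 0"
    if "(\<integral>\<^sup>+x. ennreal (f x) \<partial>M) = 0 \<or> (\<integral>\<^sup>+x. ennreal (g x) \<partial>M) = 0"
  proof -
    have "(AE x in M. f x \<le> 0) \<or> (AE x in M. g x \<le> 0)"
      using that by (simp add: nn_integral_0_iff_AE ennreal_eq_0_iff)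
    then have "AE x in M. f x = 0 \<or> g x = 0"
    proof
      assume "AE x in M. f x \<le> 0"
      then show ?thesis using AE_space by eventually_elim (use f in force)
    next
      assume "AE x in M. g x \<le> 0"
      then show ?thesis using AE_space by eventually_elim (use g in force)
    qed
    then have "AE x in M. ennreal (f x powr \<theta> * g x powr (1 - \<theta>)) = 0"
      by eventually_elim auto
    then show ?thesis by (subst nn_integral_0_iff_AE) auto
  qed
  show ?thesis
  proof (cases "A = 0 \<or> B = 0")
    case True
    then show ?thesis using zero A(1) B(1) by auto
  next
    case False
    then have AB: "A > 0" "B > 0" using A B by auto
    let ?c = "A powr \<theta> * B powr (1 - \<theta>)"
    have c: "?c > 0" using AB by simp
    have "(\<integral>\<^sup>+x. ennreal (f x powr \<theta> * g x powr (1 - \<theta>)) \<partial>M)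
       \<le> (\<integral>\<^sup>+x. ennreal (?c * \<theta> / A) * ennreal (f x) + ennreal (?c * (1 - \<theta>) / B) * ennreal (g x) \<partial>M)"
    proof (rule nn_integral_mono)
      fix x assume x: "x \<in> space M"
      have "(f x / A) powr \<theta> * (g x / B) powr (1 - \<theta>) \<le> \<theta> * (f x / A) + (1 - \<theta>) * (g x / B)"
      proof (cases "f x = 0 \<or> g x = 0")
        case True
        then show ?thesis using f[OF x] g[OF x] AB \<theta> by auto
      next
        case False
        then show ?thesis using f[OF x] g[OF x] AB \<theta> by (intro Youngs_inequality_0) auto
      qed
      then have "?c * ((f x / A) powr \<theta> * (g x / B) powr (1 - \<theta>)) \<le> ?c * (\<theta> * (f x / A) + (1 - \<theta>) * (g x / B))"
        using c by (intro mult_left_mono) auto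
      also have "?c * ((f x / A) powr \<theta> * (g x / B) powr (1 - \<theta>)) = f x powr \<theta> * g x powr (1 - \<theta>)"
        using f[OF x] g[OF x] AB by (simp add: powr_divide)
      finally have "f x powr \<theta> * g x powr (1 - \<theta>) \<le> (?c * \<theta> / A) * f x + (?c * (1 - \<theta>) / B) * g x"
        by (simp add: algebra_simps)
      then have "ennreal (f x powr \<theta> * g x powr (1 - \<theta>)) \<le> ennreal ((?c * \<theta> / A) * f x + (?c * (1 - \<theta>) / B) * g x)"
        by (rule ennreal_leI)
      also have "\<dots> = ennreal (?c * \<theta> / A) * ennreal (f x) + ennreal (?c * (1 - \<theta>) / B) * ennreal (g x)"
        using AB \<theta> f[OF x] g[OF x] by (intro ennreal_lincomb) auto
      finally show "ennreal (f x powr \<theta> * g x powr (1 - \<theta>)) \<le> \<dots>" .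
    qed
    also have "\<dots> = ennreal (?c * \<theta> / A) * (\<integral>\<^sup>+x. ennreal (f x) \<partial>M) + ennreal (?c * (1 - \<theta>) / B) * (\<integral>\<^sup>+x. ennreal (g x) \<partial>M)"
      by (simp add: nn_integral_add nn_integral_cmult)
    also have "\<dots> \<le> ennreal (?c * \<theta> / A) * ennreal A + ennreal (?c * (1 - \<theta>) / B) * ennreal B"
      using A B by (intro add_mono mult_left_mono) auto
    also have "\<dots> = ennreal (?c * \<theta> / A * A + ?c * (1 - \<theta>) / B * B)"
      using AB \<theta> by (intro ennreal_lincomb[symmetric]) auto
    also have "?c * \<theta> / A * A + ?c * (1 - \<theta>) / B * B = ?c"
      using AB by (simp add: field_simps)
    finally show ?thesis .
  qed
qed

lemma nn_integral_powr_0_to: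
  assumes "s < 1" "c > 0"
  shows "(\<integral>\<^sup>+x. ennreal (x powr (-s)) * indicator {0..c} x \<partial>lborel) = ennreal (c powr (1 - s) / (1 - s))"
proof -
  have "((\<lambda>x. x powr (-s)) has_integral (c powr (-s+1) / (-s+1))) {0..c}"
    using assms by (intro has_integral_powr_from_0) auto
  then have "(\<integral>\<^sup>+x. ennreal (x powr (-s)) * indicator {0..c} x \<partial>lborel) = ennreal (c powr (-s+1) / (-s+1))"
    using nn_integral_has_integral_lebesgue[of "{0..c}" "\<lambda>x. x powr (-s)"]
    by (simp add: mult.commute flip: ennreal_indicator ennreal_mult'')
  then show ?thesis by (simp add: add.commute)
qed

lemma nn_integral_powr_from:
  assumes "r > 1" "c > 0"
  shows "(\<integral>\<^sup>+x. ennreal (x powr (-r)) * indicator {c..} x \<partial>lborel) = ennreal (c powr (1 - r) / (r - 1))"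
proof -
  have "((\<lambda>x. x powr (-r)) has_integral (- (c powr (-r+1)) / (-r+1))) {c..}"
    using assms by (intro has_integral_powr_to_inf) auto
  then have "(\<integral>\<^sup>+x. ennreal (x powr (-r)) * indicator {c..} x \<partial>lborel) = ennreal (- (c powr (-r+1)) / (-r+1))"
    using nn_integral_has_integral_lebesgue[of "{c..}" "\<lambda>x. x powr (-r)"]
    by (simp add: mult.commute flip: ennreal_indicator ennreal_mult'')
  also have "- (c powr (-r+1)) / (-r+1) = c powr (1 - r) / (r - 1)"
    using assms by (simp add: divide_simps add.commute) (simp add: algebra_simps)
  finally show ?thesis .
qed

text \<open>If \<open>k\<close> is in weak $L^{n/(n-1)}$ and \<open>G \<le> B\<close>, the layer cake formula for \<open>k\<close> is split at the level
  where the $L^\infty$ bound and the $L^a$ bound for \<open>G\<close> balance.\<close>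

lemma weak_kernel_bound:
  fixes k G :: "'a \<Rightarrow> real"
  assumes "sigma_finite_measure M"
    and [measurable]: "k \<in> borel_measurable M" "G \<in> borel_measurable M"
    and G0: "\<And>x. x \<in> space M \<Longrightarrow> 0 \<le> G x"
    and U: "U > 0" and weak: "\<And>c. c > 0 \<Longrightarrow> emeasure M {x\<in>space M. k x > c} \<le> ennreal (U * c powr (- (n / (n - 1))))"
    and a: "1 < a" "a < n"
    and N: "(\<integral>\<^sup>+x. ennreal (G x powr a) \<partial>M) \<le> ennreal N" "N > 0"
    and B: "\<And>x. x \<in> space M \<Longrightarrow> G x \<le> B" "B > 0"
  shows "(\<integral>\<^sup>+x. ennreal (k x * G x) \<partial>M)
    \<le> ennreal ((U powr (1 - 1 / a) / (1 - (n / (n - 1)) * (1 - 1 / a)) + U * (n - 1)) * (B powr (1 - a / n) * N powr (1 / n)))"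
proof -
  interpret sigma_finite_measure M by fact
  interpret P: pair_sigma_finite M lborel ..
  define r where "r = n / (n - 1)"
  have n: "n > 1" using a by simp
  have r: "r > 1" "1 / r = 1 - 1 / n" "1 - r = - (1 / (n - 1))" using n by (auto simp: r_def field_simps)
  define s where "s = r * (1 - 1 / a)"
  \<comment> \<open>This is where a < n enters: it is equivalent to integrability of t^(-s) at 0.
    Integrability of t^(-r) at infinity is r > 1.\<close>
  have s: "s < 1" using a n by (simp add: s_def r_def field_simps)
  \<comment> \<open>At this level the bounds \<open>I1\<close> and \<open>I2\<close> agree up to a
    power of \<open>U\<close>. Leaving \<open>U\<close> out of \<open>c\<close> keeps it inside the
    constant, and both tails come out as the same monomial in \<open>B\<close> and
    \<open>N\<close>.\<close>
  define c where "c = (B powr a / N) powr (1 / r)"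
  have c: "c > 0" using B N by (simp add: c_def)
  define I where "I t = (\<integral>\<^sup>+x. ennreal (G x) * indicator {x\<in>space M. k x > t} x \<partial>M)" for t
  have I1: "I t \<le> ennreal (B * U) * ennreal (t powr (-r))" if "t > 0" for t
  proof -
    have "I t \<le> (\<integral>\<^sup>+x. ennreal B * indicator {x\<in>space M. k x > t} x \<partial>M)"
      unfolding I_def using B by (intro nn_integral_mono mult_right_mono) (auto intro: ennreal_leI)
    also have "\<dots> = ennreal B * emeasure M {x\<in>space M. k x > t}"
      by (subst nn_integral_cmult_indicator) auto
    also have "\<dots> \<le> ennreal B * ennreal (U * t powr (-r))"
      using weak[OF that] by (intro mult_left_mono) (auto simp: r_def)
    finally show ?thesis using B U by (simp add: ennreal_mult[symmetric] mult.assoc)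
  qed
  have I2: "I t \<le> ennreal (N powr (1/a) * U powr (1 - 1/a)) * ennreal (t powr (-s))" if "t > 0" for t
  proof -
    have "I t = (\<integral>\<^sup>+x. ennreal ((G x powr a) powr (1/a) * indicator {x\<in>space M. k x > t} x powr (1 - 1/a)) \<partial>M)"
      unfolding I_def using a G0
      by (intro nn_integral_cong) (auto simp: powr_powr indicator_def)
    also have "\<dots> \<le> ennreal (N powr (1/a) * (U * t powr (-r)) powr (1 - 1/a))"
    proof (rule nn_integral_Holder)
      show "(\<integral>\<^sup>+x. ennreal (indicator {x\<in>space M. k x > t} x) \<partial>M) \<le> ennreal (U * t powr (-r))"
        using weak[OF that] by (simp add: r_def ennreal_indicator)
    qed (use a N U in auto)
    also have "(U * t powr (-r)) powr (1 - 1/a) = U powr (1 - 1/a) * t powr (-s)"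
      using U by (simp add: powr_mult powr_powr s_def)
    finally show ?thesis using that by (simp add: ennreal_mult[symmetric] mult.assoc)
  qed
  have "(\<integral>\<^sup>+x. ennreal (k x * G x) \<partial>M) \<le> (\<integral>\<^sup>+x. (\<integral>\<^sup>+t. ennreal (G x) * indicator {0<..<k x} t \<partial>lborel) \<partial>M)"
  proof (rule nn_integral_mono)
    fix x assume x: "x \<in> space M"
    have "(\<integral>\<^sup>+t. ennreal (G x) * indicator {0<..<k x} t \<partial>lborel) = ennreal (G x) * ennreal (max 0 (k x))"
      by (simp add: nn_integral_cmult_indicator max_def)
    then show "ennreal (k x * G x) \<le> (\<integral>\<^sup>+t. ennreal (G x) * indicator {0<..<k x} t \<partial>lborel)"
      using G0[OF x] by (auto simp: ennreal_mult'[symmetric] mult.commute intro!: ennreal_leI mult_right_mono)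
  qed
  also have "\<dots> = (\<integral>\<^sup>+t. (\<integral>\<^sup>+x. ennreal (G x) * indicator {(x, t). 0 < t \<and> t < k x} (x, t) \<partial>M) \<partial>lborel)"
    by (subst P.Fubini') (auto simp: indicator_def intro!: nn_integral_cong)
  also have "\<dots> \<le> (\<integral>\<^sup>+t. ennreal (N powr (1/a) * U powr (1 - 1/a)) * (ennreal (t powr (-s)) * indicator {0..c} t)
      + ennreal (B * U) * (ennreal (t powr (-r)) * indicator {c..} t) \<partial>lborel)"
  proof (rule nn_integral_mono)
    fix t :: real
    have *: "(\<integral>\<^sup>+x. ennreal (G x) * indicator {(x, t). 0 < t \<and> t < k x} (x, t) \<partial>M) = (if t > 0 then I t else 0)"
      by (auto simp: I_def indicator_def intro!: nn_integral_cong)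
    show "(\<integral>\<^sup>+x. ennreal (G x) * indicator {(x, t). 0 < t \<and> t < k x} (x, t) \<partial>M)
      \<le> ennreal (N powr (1/a) * U powr (1 - 1/a)) * (ennreal (t powr (-s)) * indicator {0..c} t)
      + ennreal (B * U) * (ennreal (t powr (-r)) * indicator {c..} t)"
      unfolding * using I1[of t] I2[of t] c by (cases "t \<le> c") (auto intro: add_increasing2)
  qed
  also have "\<dots> = ennreal (N powr (1/a) * U powr (1 - 1/a)) * ennreal (c powr (1 - s) / (1 - s))
      + ennreal (B * U) * ennreal (c powr (1 - r) / (r - 1))"
    using nn_integral_powr_0_to[OF s c] nn_integral_powr_from[OF r(1) c]
    by (simp add: nn_integral_add nn_integral_cmult)
  also have "\<dots> = ennreal (N powr (1/a) * U powr (1 - 1/a) * (c powr (1 - s) / (1 - s)) + B * U * (c powr (1 - r) / (r - 1)))"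
    using s r(1) B U N by (intro ennreal_lincomb[symmetric]) auto
  also have "N powr (1/a) * U powr (1 - 1/a) * (c powr (1 - s) / (1 - s)) + B * U * (c powr (1 - r) / (r - 1))
     = (U powr (1 - 1 / a) / (1 - s) + U * (n - 1)) * (B powr (1 - a / n) * N powr (1 / n))"
  proof -
    have lc: "ln c = (a * ln B - ln N) / r"
      using B N by (simp add: c_def ln_powr ln_div)
    have "(1 - s) / r = 1 / r - (1 - 1 / a)"
      using r(1) by (simp add: s_def diff_divide_distrib)
    then have e1: "(1 - s) / r = 1 / a - 1 / n"
      unfolding r(2) by simp
    have e2: "(1 - r) / r = - 1 / n"
      using r n by (simp add: r_def field_simps)
    have "N powr (1/a) * c powr (1 - s) = exp (ln N * (1 / a) + (1 - s) / r * (a * ln B - ln N))"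
      using N c by (simp add: powr_exp_ln lc exp_add[symmetric])
    also have "\<dots> = exp ((1 - a / n) * ln B + (1 / n) * ln N)"
      unfolding e1 using a n by (simp add: field_simps)
    also have "\<dots> = B powr (1 - a / n) * N powr (1 / n)"
      using B N by (simp add: powr_exp_ln exp_add)
    finally have 1: "N powr (1/a) * c powr (1 - s) = B powr (1 - a / n) * N powr (1 / n)" .
    have "B * c powr (1 - r) = exp (ln B + (1 - r) / r * (a * ln B - ln N))"
      using B c by (simp add: powr_exp_ln lc exp_add)
    also have "\<dots> = exp ((1 - a / n) * ln B + (1 / n) * ln N)"
      unfolding e2 using a n by (simp add: field_simps)
    also have "\<dots> = B powr (1 - a / n) * N powr (1 / n)"
      using B N by (simp add: powr_exp_ln exp_add)
    finally have 2: "B * c powr (1 - r) = B powr (1 - a / n) * N powr (1 / n)" .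
    have 3: "1 / (r - 1) = n - 1" using n by (simp add: r_def field_simps)
    have "N powr (1/a) * U powr (1 - 1/a) * (c powr (1 - s) / (1 - s)) + B * U * (c powr (1 - r) / (r - 1))
       = U powr (1 - 1/a) / (1 - s) * (N powr (1/a) * c powr (1 - s)) + U * (1 / (r - 1)) * (B * c powr (1 - r))"
      by (simp add: mult_ac)
    then show ?thesis unfolding 1 2 3 by (simp add: algebra_simps)
  qed
  finally show ?thesis by (simp add: s_def r_def)
qed

text \<open>The constant of \<open>weak_kernel_bound\<close>; its denominator vanishes as
  \<open>a\<close> approaches \<open>n\<close>.\<close>

definition weak_const :: "real \<Rightarrow> real \<Rightarrow> real \<Rightarrow> real" where
  "weak_const U n a = U powr (1 - 1 / a) / (1 - (n / (n - 1)) * (1 - 1 / a)) + U * (n - 1)"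

lemma weak_const_pos:
  assumes "U > 0" "1 < a" "a < n"
  shows "weak_const U n a > 0"
proof -
  have "(n / (n - 1)) * (1 - 1 / a) < 1" using assms by (simp add: field_simps)
  then show ?thesis using assms by (auto simp: weak_const_def intro!: add_nonneg_pos)
qed

text \<open>On the half where F(y)^a / N is at most h(x)^b / L the function F is bounded by a level
  depending on h(x) alone, so the weak kernel bound applies to the inner integral for each x. The
  relation 1/a + 1/b = 1 + 1/n is what turns the resulting power of h(x) into exactly
  h(x)^b.\<close>

lemma weak_Young_half:
  fixes \<kappa> :: "'a \<Rightarrow> 'a \<Rightarrow> real"
  assumes "sigma_finite_measure M"
    and \<kappa>[measurable]: "case_prod \<kappa> \<in> borel_measurable (M \<Otimes>\<^sub>M M)"
    and U: "U > 0"
    and weak: "\<And>x c. x \<in> space M \<Longrightarrow> c > 0 \<Longrightarrow> emeasure M {y\<in>space M. \<kappa> x y > c} \<le> ennreal (U * c powr (- (n / (n - 1))))"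
    and [measurable]: "h \<in> borel_measurable M" "F \<in> borel_measurable M"
    and h0: "\<And>x. x \<in> space M \<Longrightarrow> 0 \<le> h x" and F0: "\<And>x. x \<in> space M \<Longrightarrow> 0 \<le> F x"
    and ab: "1 < a" "a < n" "1 < b" "b < n" "1 / a + 1 / b = 1 + 1 / n"
    and N: "(\<integral>\<^sup>+x. ennreal (F x powr a) \<partial>M) \<le> ennreal N" "N > 0"
    and L: "(\<integral>\<^sup>+x. ennreal (h x powr b) \<partial>M) \<le> ennreal L" "L > 0"
  shows "(\<integral>\<^sup>+x. (\<integral>\<^sup>+y. ennreal (h x * (\<kappa> x y * (if F y powr a * L \<le> h x powr b * N then F y else 0))) \<partial>M) \<partial>M)
    \<le> ennreal (weak_const U n a * (N powr (1 / a) * L powr (1 / b)))"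
proof -
  let ?C = "weak_const U n a"
  have C: "?C > 0" using U ab weak_const_pos by blast
  let ?K = "?C * (N powr (1 / a) * L powr (1 / b - 1))"
  have "(\<integral>\<^sup>+x. (\<integral>\<^sup>+y. ennreal (h x * (\<kappa> x y * (if F y powr a * L \<le> h x powr b * N then F y else 0))) \<partial>M) \<partial>M)
     \<le> (\<integral>\<^sup>+x. ennreal ?K * ennreal (h x powr b) \<partial>M)"
  proof (rule nn_integral_mono)
    fix x assume x: "x \<in> space M"
    let ?G = "\<lambda>y. if F y powr a * L \<le> h x powr b * N then F y else 0"
    show "(\<integral>\<^sup>+y. ennreal (h x * (\<kappa> x y * ?G y)) \<partial>M) \<le> ennreal ?K * ennreal (h x powr b)"
    proof (cases "h x = 0")
      case False
      then have h: "h x > 0" using h0[OF x] by simp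
      \<comment> \<open>The largest value that F can take on this half, for the given x.\<close>
      define B where "B = (h x powr b * N / L) powr (1 / a)"
      have B: "B > 0" using h N L by (simp add: B_def)
      have meas: "(\<lambda>y. \<kappa> x y) \<in> borel_measurable M"
        using x by measurable
      have "(\<integral>\<^sup>+y. ennreal (\<kappa> x y * ?G y) \<partial>M) \<le> ennreal (?C * (B powr (1 - a / n) * N powr (1 / n)))"
        unfolding weak_const_def
      proof (rule weak_kernel_bound)
        show "(\<integral>\<^sup>+y. ennreal (?G y powr a) \<partial>M) \<le> ennreal N"
          by (rule order_trans[OF nn_integral_mono N(1)]) (auto intro!: ennreal_leI)
        fix y assume y: "y \<in> space M"
        show "?G y \<le> B"
        proof (cases "F y powr a * L \<le> h x powr b * N")
          case True
          then have "F y powr a \<le> h x powr b * N / L" using L by (simp add: field_simps)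
          then have "(F y powr a) powr (1 / a) \<le> B"
            unfolding B_def using ab by (intro powr_mono2) auto
          then show ?thesis using F0[OF y] ab True by (simp add: powr_powr)
        qed (use B in simp)
      qed (use assms meas x in \<open>auto simp: B\<close>)
      then have "ennreal (h x) * (\<integral>\<^sup>+y. ennreal (\<kappa> x y * ?G y) \<partial>M) \<le> ennreal (h x) * ennreal (?C * (B powr (1 - a / n) * N powr (1 / n)))"
        by (intro mult_left_mono) auto
      also have "ennreal (h x) * (\<integral>\<^sup>+y. ennreal (\<kappa> x y * ?G y) \<partial>M) = (\<integral>\<^sup>+y. ennreal (h x * (\<kappa> x y * ?G y)) \<partial>M)"
        using meas h by (subst nn_integral_cmult[symmetric]) (auto simp: ennreal_mult' intro!: nn_integral_cong)
      also have "ennreal (h x) * ennreal (?C * (B powr (1 - a / n) * N powr (1 / n))) = ennreal (?C * (h x * (B powr (1 - a / n) * N powr (1 / n))))"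
        using h C by (simp add: ennreal_mult[symmetric] mult_ac)
      also have "h x * (B powr (1 - a / n) * N powr (1 / n)) = N powr (1 / a) * L powr (1 / b - 1) * h x powr b"
      proof -
        have lB: "ln B = (b * ln (h x) + ln N - ln L) / a"
          using h N L by (simp add: B_def ln_powr ln_div ln_mult)
        have e: "1 / b - 1 = 1 / n - 1 / a" using ab by simp
        have e2: "(1 - a / n) / a = 1 / a - 1 / n" using ab by (simp add: field_simps)
        have e3: "b * (1 / a - 1 / n) = b - 1" using ab(5) ab(3) by (simp add: field_simps)
        have "h x * (B powr (1 - a / n) * N powr (1 / n)) = exp (ln (h x) + ((1 - a / n) / a * (b * ln (h x) + ln N - ln L) + 1 / n * ln N))"
          using h B N by (simp add: powr_exp_ln lB exp_add)
        also have "\<dots> = exp (1 / a * ln N + (1 / n - 1 / a) * ln L + (1 + b * (1 / a - 1 / n)) * ln (h x))"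
          unfolding e2 by (simp add: algebra_simps)
        also have "\<dots> = N powr (1 / a) * L powr (1 / b - 1) * h x powr b"
          unfolding e e3 using h N L by (simp add: powr_exp_ln exp_add)
        finally show ?thesis .
      qed
      finally show ?thesis using C by (simp add: ennreal_mult[symmetric] mult_ac)
    qed simp
  qed
  also have "\<dots> = ennreal ?K * (\<integral>\<^sup>+x. ennreal (h x powr b) \<partial>M)"
    by (simp add: nn_integral_cmult)
  also have "\<dots> \<le> ennreal ?K * ennreal L"
    using L by (intro mult_left_mono) auto
  also have "\<dots> = ennreal (?K * L)"
    using C L by (simp add: ennreal_mult)
  also have "?K * L = ?C * (N powr (1 / a) * L powr (1 / b))"
    using L by (simp add: powr_diff)
  finally show ?thesis .
qed

text \<open>Each pair of points lies in at least one of the two halves. On the second half F and h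
  exchange their roles, which the symmetry of the kernel and Fubini allow.\<close>

lemma weak_Young_bilinear:
  fixes \<kappa> :: "'a \<Rightarrow> 'a \<Rightarrow> real"
  assumes M: "sigma_finite_measure M"
    and \<kappa>[measurable]: "case_prod \<kappa> \<in> borel_measurable (M \<Otimes>\<^sub>M M)"
    and sym: "\<And>x y. \<kappa> x y = \<kappa> y x" and U: "U > 0"
    and weak: "\<And>x c. x \<in> space M \<Longrightarrow> c > 0 \<Longrightarrow> emeasure M {y\<in>space M. \<kappa> x y > c} \<le> ennreal (U * c powr (- (n / (n - 1))))"
    and hF[measurable]: "h \<in> borel_measurable M" "F \<in> borel_measurable M"
    and h0: "\<And>x. x \<in> space M \<Longrightarrow> 0 \<le> h x" and F0: "\<And>x. x \<in> space M \<Longrightarrow> 0 \<le> F x"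
    and ab: "1 < a" "a < n" "1 < b" "b < n" "1 / a + 1 / b = 1 + 1 / n"
    and N: "(\<integral>\<^sup>+x. ennreal (F x powr a) \<partial>M) \<le> ennreal N" "N > 0"
    and L: "(\<integral>\<^sup>+x. ennreal (h x powr b) \<partial>M) \<le> ennreal L" "L > 0"
  shows "(\<integral>\<^sup>+x. (\<integral>\<^sup>+y. ennreal (h x * (\<kappa> x y * F y)) \<partial>M) \<partial>M)
    \<le> ennreal ((weak_const U n a + weak_const U n b) * (N powr (1 / a) * L powr (1 / b)))"
proof -
  interpret sigma_finite_measure M by fact
  interpret P: pair_sigma_finite M M ..
  let ?A = "\<lambda>x y. ennreal (h x * (\<kappa> x y * (if F y powr a * L \<le> h x powr b * N then F y else 0)))"
  let ?B = "\<lambda>y x. ennreal (F y * (\<kappa> y x * (if h x powr b * N \<le> F y powr a * L then h x else 0)))"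
  have ba: "1 / b + 1 / a = 1 + 1 / n" using ab by simp
  have "(\<integral>\<^sup>+x. (\<integral>\<^sup>+y. ennreal (h x * (\<kappa> x y * F y)) \<partial>M) \<partial>M) \<le> (\<integral>\<^sup>+x. (\<integral>\<^sup>+y. ?A x y + ?B y x \<partial>M) \<partial>M)"
    by (intro nn_integral_mono) (auto simp: sym[of _ "_ :: 'a"] mult_ac intro: add_increasing2)
  also have "\<dots> = (\<integral>\<^sup>+x. (\<integral>\<^sup>+y. ?A x y \<partial>M) + (\<integral>\<^sup>+y. ?B y x \<partial>M) \<partial>M)"
    by (intro nn_integral_cong nn_integral_add) measurable
  also have "\<dots> = (\<integral>\<^sup>+x. (\<integral>\<^sup>+y. ?A x y \<partial>M) \<partial>M) + (\<integral>\<^sup>+x. (\<integral>\<^sup>+y. ?B y x \<partial>M) \<partial>M)"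
    by (intro nn_integral_add) measurable
  also have "(\<integral>\<^sup>+x. (\<integral>\<^sup>+y. ?B y x \<partial>M) \<partial>M) = (\<integral>\<^sup>+y. (\<integral>\<^sup>+x. ?B y x \<partial>M) \<partial>M)"
    by (rule P.Fubini') measurable
  also have "(\<integral>\<^sup>+x. (\<integral>\<^sup>+y. ?A x y \<partial>M) \<partial>M) + \<dots>
     \<le> ennreal (weak_const U n a * (N powr (1 / a) * L powr (1 / b))) + ennreal (weak_const U n b * (L powr (1 / b) * N powr (1 / a)))"
    by (intro add_mono weak_Young_half[OF M \<kappa> U weak hF h0 F0 ab N L]
        weak_Young_half[OF M \<kappa> U weak hF(2,1) F0 h0 ab(3,4,1,2) ba L N])
  also have "\<dots> = ennreal ((weak_const U n a + weak_const U n b) * (N powr (1 / a) * L powr (1 / b)))"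
    using weak_const_pos[OF U ab(1,2)] weak_const_pos[OF U ab(3,4)]
    by (subst ennreal_plus[symmetric]) (auto simp: algebra_simps)
  finally show ?thesis .
qed

text \<open>The bilinear bound is tested with h = F H^(n-1), so that the form dominates S, the
  integral of F H^n. Hoelder bounds the L^b norm of h by S^((n-1)/n) times a power of N; this
  exponent is below 1, so the power of S can be divided out.\<close>

lemma weak_Young_power:
  fixes \<kappa> :: "'a \<Rightarrow> 'a \<Rightarrow> real"
  assumes M: "finite_measure M"
    and \<kappa>[measurable]: "case_prod \<kappa> \<in> borel_measurable (M \<Otimes>\<^sub>M M)"
    and \<kappa>0: "\<And>x y. 0 \<le> \<kappa> x y" and sym: "\<And>x y. \<kappa> x y = \<kappa> y x" and U: "U > 0"
    and weak: "\<And>x c. x \<in> space M \<Longrightarrow> c > 0 \<Longrightarrow> emeasure M {y\<in>space M. \<kappa> x y > c} \<le> ennreal (U * c powr (- (n / (n - 1))))"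
    and F[measurable]: "F \<in> borel_measurable M"
    and F0: "\<And>x. x \<in> space M \<Longrightarrow> 0 \<le> F x" and FB: "\<And>x. x \<in> space M \<Longrightarrow> F x \<le> B"
    and n: "n > 1" and a: "a = (n + 1) / 2" and b: "b = 1 / (1 + 1 / n - 1 / a)"
    and N: "(\<integral>\<^sup>+x. ennreal (F x powr a) \<partial>M) \<le> ennreal N" "N > 0"
    and H: "\<And>x. x \<in> space M \<Longrightarrow> H x \<ge> 0"
      "\<And>x. x \<in> space M \<Longrightarrow> ennreal (H x) = (\<integral>\<^sup>+y. ennreal (\<kappa> x y * F y) \<partial>M)"
    and HB: "\<And>x. x \<in> space M \<Longrightarrow> H x \<le> HB"
  shows "(\<integral>\<^sup>+x. ennreal (F x * H x powr n) \<partial>M)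
    \<le> ennreal ((weak_const U n a + weak_const U n b) powr n * N\<^sup>2)"
proof -
  interpret finite_measure M by fact
  have M': "sigma_finite_measure M" ..
  let ?C = "weak_const U n a + weak_const U n b"
  have b': "1 / b = 1 + 1 / n - 1 / a" unfolding b by simp
  have na: "1 < a" "a < n" using n by (auto simp: a)
  have 1: "1 / b > 1 / n" "1 / b < 1" using na n unfolding b' by (auto simp: field_simps)
  moreover have "0 < 1 / n" using n by simp
  ultimately have "0 < 1 / b" by linarith
  then have "b > 0" by simp
  with 1 n have nb: "1 < b" "b < n" by (auto simp: field_simps)
  have C: "?C > 0" using weak_const_pos[OF U na] weak_const_pos[OF U nb] by simp
  have meas_H[measurable]: "H \<in> borel_measurable M"
  proof -
    have "(\<lambda>x. enn2real (\<integral>\<^sup>+y. ennreal (\<kappa> x y * F y) \<partial>M)) \<in> borel_measurable M" by measurable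
    moreover have "H x = enn2real (\<integral>\<^sup>+y. ennreal (\<kappa> x y * F y) \<partial>M)" if "x \<in> space M" for x
      using H[OF that] by (metis enn2real_ennreal)
    ultimately show ?thesis by (simp cong: measurable_cong)
  qed
  \<comment> \<open>Dividing by a power of S presupposes that S is finite. The crude bounds
    \<open>B\<close> and \<open>HB\<close> and the finiteness of the measure serve only this
    purpose; they do not enter the final constant.\<close>
  define S where "S = enn2real (\<integral>\<^sup>+x. ennreal (F x * H x powr n) \<partial>M)"
  have "(\<integral>\<^sup>+x. ennreal (F x * H x powr n) \<partial>M) \<le> (\<integral>\<^sup>+x. ennreal (B * HB powr n) \<partial>M)"
    using H(1) F0 FB HB n
    by (intro nn_integral_mono ennreal_leI mult_mono powr_mono2) (auto intro: order_trans)
  also have "\<dots> < \<infinity>"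
    by (simp add: ennreal_mult_eq_top_iff emeasure_finite less_top[symmetric])
  finally have S: "ennreal S = (\<integral>\<^sup>+x. ennreal (F x * H x powr n) \<partial>M)"
    by (simp add: S_def)
  have S0: "S \<ge> 0" by (simp add: S_def)
  show ?thesis
  proof (cases "S = 0")
    case True
    then show ?thesis using S by (metis ennreal_0 zero_le)
  next
    case False
    then have Sp: "S > 0" using S0 by simp
    \<comment> \<open>Chosen so that h^b = (F H^n)^t (F^a)^(1-t): the power of H forces this t, and
      the power of F then fits because 2a/n = 1 + 1/n.\<close>
    define t where "t = (n - 1) * b / n"
    define h where "h x = F x * H x powr (n - 1)" for x
    have [measurable]: "h \<in> borel_measurable M" unfolding h_def by measurable
    have t: "0 < t" "t < 1"
    proof -
      show "0 < t" using n nb by (simp add: t_def)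
      have "(n - 1) / n = 1 - 1 / n" using n by (simp add: field_simps)
      also have "1 - 1 / n < 1 / b"
      proof -
        have "2 / (n + 1) < 2 / n" using n by (simp add: field_simps)
        then show ?thesis unfolding b' a by simp
      qed
      finally show "t < 1" using n nb by (simp add: t_def field_simps)
    qed
    have tb: "t / b = (n - 1) / n" using nb by (simp add: t_def)
    have e: "b = t + a * (1 - t)"
    proof -
      have "t / b = 1 - 1 / n" using n by (simp add: tb field_simps)
      moreover have "a * (2 / n - 1 / a) = 2 * a / n - 1" using na by (simp add: field_simps)
      moreover have "2 * a / n = 1 + 1 / n" using n by (simp add: a field_simps)
      moreover have "1 / b - t / b = 2 / n - 1 / a" using \<open>t / b = 1 - 1 / n\<close> b' by simp
      ultimately have "t / b + a * (1 / b - t / b) = (1 - 1 / n) + ((1 + 1 / n) - 1)" by (simp only:)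
      then have "t / b + a * (1 / b - t / b) = 1" by simp
      then have "b * (t / b + a * (1 / b - t / b)) = b" by simp
      moreover have "b * (t / b + a * (1 / b - t / b)) = t + a * (1 - t)" using nb by (simp add: field_simps)
      ultimately show ?thesis by simp
    qed
    have L: "(\<integral>\<^sup>+x. ennreal (h x powr b) \<partial>M) \<le> ennreal (S powr t * N powr (1 - t))"
    proof -
      have "(\<integral>\<^sup>+x. ennreal (h x powr b) \<partial>M) = (\<integral>\<^sup>+x. ennreal ((F x * H x powr n) powr t * (F x powr a) powr (1 - t)) \<partial>M)"
      proof (rule nn_integral_cong)
        fix x assume x: "x \<in> space M"
        have "h x powr b = F x powr (t + a * (1 - t)) * H x powr (n * t)"
          using F0[OF x] H(1)[OF x] e n by (simp add: h_def powr_mult powr_powr t_def)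
        also have "\<dots> = (F x * H x powr n) powr t * (F x powr a) powr (1 - t)"
          using F0[OF x] H(1)[OF x] by (simp add: powr_mult powr_powr powr_add)
        finally show "ennreal (h x powr b) = ennreal ((F x * H x powr n) powr t * (F x powr a) powr (1 - t))" by simp
      qed
      also have "\<dots> \<le> ennreal (S powr t * N powr (1 - t))"
        using F0 H(1) t N S S0 by (intro nn_integral_Holder) auto
      finally show ?thesis .
    qed
    have "ennreal S \<le> (\<integral>\<^sup>+x. (\<integral>\<^sup>+y. ennreal (h x * (\<kappa> x y * F y)) \<partial>M) \<partial>M)"
      unfolding S
    proof (rule nn_integral_mono)
      fix x assume x: "x \<in> space M"
      have meas: "(\<lambda>y. \<kappa> x y) \<in> borel_measurable M"
        using x by measurable
      have "F x * H x powr n = h x * H x"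
        using H(1)[OF x] n by (cases "H x = 0") (auto simp: h_def powr_diff)
      then have "ennreal (F x * H x powr n) = ennreal (h x) * ennreal (H x)"
        using F0[OF x] H(1)[OF x] by (simp add: ennreal_mult[symmetric] h_def)
      also have "\<dots> = ennreal (h x) * (\<integral>\<^sup>+y. ennreal (\<kappa> x y * F y) \<partial>M)"
        using H(2)[OF x] by simp
      also have "\<dots> = (\<integral>\<^sup>+y. ennreal (h x * (\<kappa> x y * F y)) \<partial>M)"
        using meas F0[OF x] by (subst nn_integral_cmult[symmetric]) (auto simp: ennreal_mult' h_def intro!: nn_integral_cong)
      finally show "ennreal (F x * H x powr n) \<le> (\<integral>\<^sup>+y. ennreal (h x * (\<kappa> x y * F y)) \<partial>M)" by simp
    qed
    also have "\<dots> \<le> ennreal (?C * (N powr (1 / a) * (S powr t * N powr (1 - t)) powr (1 / b)))"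
      using na nb b' N L Sp F0 H(1)
      by (intro weak_Young_bilinear[OF M' \<kappa> sym U weak]) (auto simp: h_def)
    finally have "S \<le> ?C * (N powr (1 / a) * (S powr t * N powr (1 - t)) powr (1 / b))"
      using C by (subst (asm) ennreal_le_iff) auto
    also have "N powr (1 / a) * (S powr t * N powr (1 - t)) powr (1 / b) = S powr ((n - 1) / n) * N powr (2 / n)"
    proof -
      have "1 / a + (1 - t) / b = 2 / n"
        using tb b' n by (simp add: diff_divide_distrib)
      then show ?thesis
        using N Sp by (simp add: powr_mult powr_powr tb powr_add[symmetric] mult.left_commute)
    qed
    finally have "S * S powr (- ((n - 1) / n)) \<le> ?C * (S powr ((n - 1) / n) * N powr (2 / n)) * S powr (- ((n - 1) / n))"
      by (intro mult_right_mono) auto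
    also have "\<dots> = ?C * N powr (2 / n)"
      using Sp by (simp add: powr_minus field_simps)
    also have "S * S powr (- ((n - 1) / n)) = S powr (1 - (n - 1) / n)"
      using Sp by (simp add: powr_diff powr_minus field_simps)
    also have "1 - (n - 1) / n = 1 / n" using n by (simp add: field_simps)
    finally have "(S powr (1 / n)) powr n \<le> (?C * N powr (2 / n)) powr n"
      using n by (intro powr_mono2) auto
    also have "(S powr (1 / n)) powr n = S" using n Sp by (simp add: powr_powr)
    also have "(?C * N powr (2 / n)) powr n = ?C powr n * N\<^sup>2"
      using n C N by (simp add: powr_mult powr_powr)
    finally show ?thesis unfolding S[symmetric] by (rule ennreal_leI)
  qed
qed

subsection \<open>Quadratic forms\<close>

lemma partial_deriv_eq:
  assumes "(F has_derivative F') (at x)"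
  shows "partial_deriv i F x = F' (axis i 1)"
  using frechet_derivative_at[OF assms] by (simp add: partial_deriv_def)

lemma has_derivative_vec_lambda:
  assumes "\<And>i. ((\<lambda>x. f x i) has_derivative (\<lambda>h. f' h i)) (at x)"
  shows "((\<lambda>x. \<chi> i. f x i) has_derivative (\<lambda>h. (\<chi> i. f' h i) :: real^'n)) (at x)"
  using assms by (subst has_derivative_componentwise_within) (auto simp: Basis_vec_def inner_axis)

text \<open>The coefficients \<open>c\<close> of the form may be asymmetric; the Hessian is c plus
  its transpose, without a factor 1/2, and therefore the gradient is exactly the Hessian applied to
  the point.\<close>

lemma quadratic_form_hessian:
  fixes Q :: "real^'n \<Rightarrow> real"
  assumes "quadratic_form Q"
  obtains "transpose (hessian Q 0) = hessian Q 0"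
    "\<And>x. (Q has_derivative (\<lambda>h. (hessian Q 0 *v x) \<bullet> h)) (at x)"
    "\<And>x. gradient Q x = hessian Q 0 *v x"
proof -
  obtain c where c: "Q x = (\<Sum>i\<in>UNIV. \<Sum>j\<in>UNIV. c i j * x$i * x$j)" for x
    using assms unfolding quadratic_form_def by blast
  define A :: "real^'n^'n" where "A = (\<chi> i j. c i j + c j i)"
  have D: "(Q has_derivative (\<lambda>h. (A *v x) \<bullet> h)) (at x)" for x
  proof -
    have Q: "Q = (\<lambda>x. \<Sum>i\<in>UNIV. \<Sum>j\<in>UNIV. c i j * x$i * x$j)" using c by blast
    have "(Q has_derivative (\<lambda>h. \<Sum>i\<in>UNIV. \<Sum>j\<in>UNIV. c i j * x$i * h$j + c i j * h$i * x$j)) (at x)"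
      unfolding Q by (auto intro!: derivative_eq_intros bounded_linear_imp_has_derivative[OF bounded_linear_vec_nth] sum.cong simp: fun_eq_iff)
    also have "(\<lambda>h. \<Sum>i\<in>UNIV. \<Sum>j\<in>UNIV. c i j * x$i * h$j + c i j * h$i * x$j) = (\<lambda>h. (A *v x) \<bullet> h)"
    proof
      fix h :: "real^'n"
      have "(\<Sum>i\<in>UNIV. \<Sum>j\<in>UNIV. c i j * x$i * h$j) = (\<Sum>j\<in>UNIV. \<Sum>i\<in>UNIV. c i j * x$i * h$j)"
        by (rule sum.swap)
      then show "(\<Sum>i\<in>UNIV. \<Sum>j\<in>UNIV. c i j * x$i * h$j + c i j * h$i * x$j) = (A *v x) \<bullet> h"
        by (simp add: A_def inner_vec_def matrix_vector_mult_def sum.distrib sum_distrib_left sum_distrib_right algebra_simps)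
    qed
    finally show ?thesis .
  qed
  have pd: "partial_deriv i Q = (\<lambda>x. (A *v x) $ i)" for i
    by (rule ext) (simp add: partial_deriv_eq[OF D] inner_axis)
  have d: "((\<lambda>x. (A *v x) $ i) has_derivative (\<lambda>h. (A *v h) $ i)) (at x)" for i x
    by (intro bounded_linear_imp_has_derivative bounded_linear_compose[OF bounded_linear_vec_nth]
        matrix_vector_mul_bounded_linear)
  have "partial_deriv i (\<lambda>x. (A *v x) $ j) 0 = A $ j $ i" for i j
    unfolding partial_deriv_eq[OF d] by (simp add: matrix_vector_mul_component inner_axis)
  then have "hessian Q 0 = transpose A"
    unfolding hessian_def pd by (simp only: transpose_def)
  moreover have "transpose A = A" by (simp add: A_def transpose_def vec_eq_iff)
  ultimately have "hessian Q 0 = A" by simp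
  then show ?thesis
    using D pd \<open>transpose A = A\<close> by (intro that) (simp_all add: gradient_def)
qed

subsection \<open>The determinant of a matrix padded by an identity block\<close>

definition pad_matrix :: "('a \<Rightarrow> 'c) \<Rightarrow> real^'a^'a \<Rightarrow> real^'c^'c" where
  "pad_matrix f M = (\<chi> i j. if i \<in> range f \<and> j \<in> range f then M $ inv f i $ inv f j else of_bool (i = j))"

lemma pad_matrix_nth [simp]:
  assumes "inj f"
  shows "pad_matrix f M $ f i $ f j = M $ i $ j"
    and "k \<notin> range f \<Longrightarrow> pad_matrix f M $ k $ l = of_bool (k = l)"
    and "k \<notin> range f \<Longrightarrow> pad_matrix f M $ l $ k = of_bool (k = l)"
  using assms by (auto simp: pad_matrix_def)

lemma pad_matrix_eqI:
  assumes "inj f" "\<And>i j. X $ f i $ f j = M $ i $ j"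
    "\<And>k l. k \<notin> range f \<Longrightarrow> X $ k $ l = of_bool (k = l)" "\<And>k l. k \<notin> range f \<Longrightarrow> X $ l $ k = of_bool (k = l)"
  shows "pad_matrix f M = X"
  using assms by (auto simp: pad_matrix_def vec_eq_iff)

lemma sum_range_inj:
  fixes f :: "'a::finite \<Rightarrow> 'c::finite"
  assumes "inj f" "\<And>k. k \<notin> range f \<Longrightarrow> g k = 0"
  shows "(\<Sum>k\<in>UNIV. g k) = (\<Sum>i\<in>UNIV. (g (f i) :: real))"
proof -
  have "(\<Sum>k\<in>UNIV. g k) = (\<Sum>k\<in>range f. g k)"
    by (rule sum.mono_neutral_right) (use assms in auto)
  then show ?thesis using assms(1) by (simp add: sum.reindex)
qed

text \<open>Padding is multiplicative and sends each kind of elementary matrix to the same kind with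
  the same determinant, so the claim follows by induction over elementary factors instead of a
  comparison of permutation sums.\<close>

lemma det_pad_matrix:
  fixes f :: "'a::finite \<Rightarrow> 'c::finite"
  assumes f: "inj f"
  shows "det (pad_matrix f M) = det M"
proof (rule induct_matrix_elementary[where P = "\<lambda>M. det (pad_matrix f M) = det M"], goal_cases)
  case (1 A B)
  have "pad_matrix f (A ** B) = pad_matrix f A ** pad_matrix f B"
  proof (rule pad_matrix_eqI[OF f])
    show "(pad_matrix f A ** pad_matrix f B) $ f i $ f j = (A ** B) $ i $ j" for i j
      unfolding matrix_matrix_mult_def vec_lambda_beta
      by (subst sum_range_inj[OF f]) (use f in auto)
    fix k l assume k: "k \<notin> range f"
    show "(pad_matrix f A ** pad_matrix f B) $ k $ l = of_bool (k = l)"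
      using f k by (simp add: matrix_matrix_mult_def of_bool_def if_distrib[where f = "\<lambda>x. x * _"] cong: if_cong)
    show "(pad_matrix f A ** pad_matrix f B) $ l $ k = of_bool (k = l)"
      using f k by (simp add: matrix_matrix_mult_def of_bool_def if_distrib[where f = "\<lambda>x. _ * x"] cong: if_cong)
  qed
  then show ?case using 1 by (simp add: det_mul)
next
  case (2 A i)
  then have "A $ i $ j = 0" for j by (simp add: row_def vec_eq_iff)
  then have "pad_matrix f A $ f i $ k = 0" for k
    using f by (cases "k \<in> range f") auto
  then have "row (f i) (pad_matrix f A) = 0" by (simp add: row_def vec_eq_iff)
  then show ?case using det_zero_row(2) 2 by metis
next
  case (3 A)
  have "pad_matrix f A $ k $ l = 0" if "k \<noteq> l" for k l
    using f that 3 by (cases "k \<in> range f"; cases "l \<in> range f") (auto simp: inj_eq)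
  then have "det (pad_matrix f A) = (\<Prod>k\<in>UNIV. pad_matrix f A $ k $ k)"
    by (rule det_diagonal)
  also have "\<dots> = (\<Prod>k\<in>range f. pad_matrix f A $ k $ k)"
    using f by (intro prod.mono_neutral_right) auto
  also have "\<dots> = det A"
    using f det_diagonal[of A] 3 by (simp add: prod.reindex)
  finally show ?case .
next
  case (4 m n)
  let ?S = "\<lambda>m n. (\<chi> i j. mat 1 $ i $ Transposition.transpose m n j)"
  have tr: "Transposition.transpose (f m) (f n) (f j) = f (Transposition.transpose m n j)" for j
    using f by (auto simp: Transposition.transpose_def inj_eq)
  have tr': "Transposition.transpose (f m) (f n) k = k" if "k \<notin> range f" for k
    using that by (auto simp: Transposition.transpose_def)
  have tr'': "k = Transposition.transpose (f m) (f n) l \<longleftrightarrow> k = l" if "k \<notin> range f" for k l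
    using that tr'[OF that] by (metis transpose_involutory)
  have d: "det (?S x y :: real^'z^'z) = - 1" if "x \<noteq> y" for x y :: "'z::finite"
    using det_permute_columns[OF permutes_swap_id[of x UNIV y], of "mat 1 :: real^'z^'z"] that
    by (simp add: sign_swap_id)
  have "pad_matrix f (?S m n) = ?S (f m) (f n)"
    by (rule pad_matrix_eqI[OF f]) (use f in \<open>auto simp: mat_def tr tr' tr'' inj_eq\<close>)
  then show ?case using d[of m n] d[of "f m" "f n"] 4 f by (simp add: inj_eq)
next
  case (5 m n c)
  let ?S = "\<lambda>m n. (\<chi> i j. if i = m \<and> j = n then c else of_bool (i = j))"
  have d: "det (?S x y :: real^'z^'z) = 1" if "x \<noteq> y" for x y :: "'z::finite"
  proof -
    have "(?S x y :: real^'z^'z) = (\<chi> k. if k = x then row x (mat 1) + c *s row y (mat 1) else row k (mat 1))"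
      using that by (auto simp: row_def mat_def vec_eq_iff)
    then show ?thesis using det_row_operation[OF that, of "mat 1" c] by simp
  qed
  have "pad_matrix f (?S m n) = ?S (f m) (f n)"
    by (rule pad_matrix_eqI[OF f]) (use f in \<open>auto simp: inj_eq\<close>)
  then show ?case using d[of m n] d[of "f m" "f n"] 5 f by (simp add: inj_eq)
qed

lemma det_bool:
  fixes E :: "real^bool^bool"
  shows "det E = E$False$False * E$True$True - E$False$True * E$True$False"
proof -
  have f: "finite {True}" "False \<notin> {True}" by auto
  have U: "(UNIV :: bool set) = insert False {True}" by auto
  show ?thesis
    unfolding det_def U sum_over_permutations_insert[OF f] permutes_sing
    by (simp add: sign_swap_id sign_id sign_compose permutation_swap_id)
qed

text \<open>A block diagonal matrix is the product of its two blocks, each padded by the identity on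
  the index set of the other.\<close>

lemma det_block_diagonal:
  fixes X :: "real^('n::finite + bool)^('n + bool)"
  assumes "\<And>i b. X $ Inl i $ Inr b = 0" "\<And>i b. X $ Inr b $ Inl i = 0"
  shows "det X = det (\<chi> i j. X $ Inl i $ Inl j)
     * (X $ Inr False $ Inr False * X $ Inr True $ Inr True - X $ Inr False $ Inr True * X $ Inr True $ Inr False)"
proof -
  define M :: "real^'n^'n" where "M = (\<chi> i j. X $ Inl i $ Inl j)"
  define E :: "real^bool^bool" where "E = (\<chi> i j. X $ Inr i $ Inr j)"
  have i: "inj (Inl :: 'n \<Rightarrow> 'n + bool)" "inj (Inr :: bool \<Rightarrow> 'n + bool)" by auto
  have p: "pad_matrix Inl M $ Inl i $ Inl j = M $ i $ j" "pad_matrix Inl M $ Inl i $ Inr b = 0"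
    "pad_matrix Inl M $ Inr b $ Inl i = 0" "pad_matrix Inl M $ Inr b $ Inr b' = of_bool (b = b')"
    "pad_matrix Inr E $ Inr b $ Inr b' = E $ b $ b'" "pad_matrix Inr E $ Inl i $ Inr b = 0"
    "pad_matrix Inr E $ Inr b $ Inl i = 0" "pad_matrix Inr E $ Inl i $ Inl j = of_bool (i = j)" for i j b b'
    by (auto simp: pad_matrix_def)
  have sum_Plus: "(\<Sum>k\<in>UNIV. g k) = (\<Sum>i\<in>UNIV. g (Inl i)) + (\<Sum>b\<in>UNIV. g (Inr b))" for g :: "'n + bool \<Rightarrow> real"
    by (simp add: UNIV_Plus_UNIV[symmetric] sum.Plus del: UNIV_Plus_UNIV)
  have "X $ k $ l = (pad_matrix Inl M ** pad_matrix Inr E) $ k $ l" for k l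
    using assms p by (cases k; cases l)
      (auto simp: matrix_matrix_mult_def sum_Plus M_def E_def
        of_bool_def if_distrib[where f = "\<lambda>x. x * _"] if_distrib[where f = "\<lambda>x. _ * x"] cong: if_cong)
  then have "X = pad_matrix Inl M ** pad_matrix Inr E" by (simp add: vec_eq_iff)
  then have "det X = det M * det E" by (simp add: det_mul det_pad_matrix i)
  then show ?thesis unfolding det_bool by (simp add: M_def E_def)
qed

subsection \<open>Flat surfaces\<close>

text \<open>At the origin both gradients vanish, so first-order frame vectors lie in the first d
  coordinates, while second-order ones lie in the last two. This makes the frame determinant block
  diagonal there.\<close>

lemma surface_param_frame:
  fixes Q1 Q2 :: "real^'n::finite \<Rightarrow> real"
  assumes "quadratic_form Q1" "quadratic_form Q2"
  defines "A \<equiv> hessian Q1 0" and "B \<equiv> hessian Q2 0"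
  shows "frame_deriv M i (surface_param Q1 Q2) 0 = (\<chi> c. case c of Inl l \<Rightarrow> M$i$l | Inr b \<Rightarrow> 0)"
    and "frame_deriv M j (frame_deriv M i (surface_param Q1 Q2)) 0 =
      (\<chi> c. case c of Inl l \<Rightarrow> 0 | Inr b \<Rightarrow> (M ** (if b then B else A) ** transpose M) $ j $ i)"
proof -
  have tA: "transpose A = A" and dA: "\<And>x. (Q1 has_derivative (\<lambda>h. (A *v x) \<bullet> h)) (at x)"
    using quadratic_form_hessian[OF assms(1)] unfolding A_def by blast+
  have tB: "transpose B = B" and dB: "\<And>x. (Q2 has_derivative (\<lambda>h. (B *v x) \<bullet> h)) (at x)"
    using quadratic_form_hessian[OF assms(2)] unfolding B_def by blast+
  define P where "P b = (if b then B else A)" for b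
  have D: "(surface_param Q1 Q2 has_derivative
      (\<lambda>h. \<chi> c. case c of Inl i \<Rightarrow> h$i | Inr b \<Rightarrow> (P b *v x) \<bullet> h)) (at x)" for x
    unfolding surface_param_def[abs_def]
    apply (rule has_derivative_vec_lambda)
    subgoal for c
      by (cases c) (auto simp: P_def intro!: dA dB bounded_linear_imp_has_derivative[OF bounded_linear_vec_nth])
    done
  have pd: "partial_deriv k (surface_param Q1 Q2) x
      = (\<chi> c. case c of Inl i \<Rightarrow> axis k 1 $ i | Inr b \<Rightarrow> (P b *v x) $ k)" for k x
    unfolding partial_deriv_eq[OF D]
    apply (rule vec_lambda_unique[THEN iffD1, OF allI, symmetric])
    subgoal for c
      by (cases c) (simp_all add: inner_axis)
    done
  have fd: "frame_deriv M i (surface_param Q1 Q2) x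
      = (\<chi> c. case c of Inl l \<Rightarrow> M$i$l | Inr b \<Rightarrow> (M ** P b *v x) $ i)" for i x
    apply (rule vec_lambda_unique[THEN iffD1, OF allI, symmetric])
    subgoal for c
      by (cases c) (simp_all add: frame_deriv_def pd axis_def matrix_vector_mul_assoc[symmetric]
          matrix_vector_mult_def[of M] if_distrib cong: if_cong)
    done
  then show "frame_deriv M i (surface_param Q1 Q2) 0 = (\<chi> c. case c of Inl l \<Rightarrow> M$i$l | Inr b \<Rightarrow> 0)"
    by (simp add: vec_eq_iff split: sum.split)
  have "((\<lambda>x. \<chi> c. case c of Inl l \<Rightarrow> M$i$l | Inr b \<Rightarrow> (M ** P b *v x) $ i) has_derivative
      (\<lambda>h. \<chi> c. case c of Inl l \<Rightarrow> 0 | Inr b \<Rightarrow> (M ** P b *v h) $ i)) (at 0)"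
    apply (rule has_derivative_vec_lambda)
    subgoal for c
      by (cases c) (auto intro!: bounded_linear_imp_has_derivative matrix_vector_mul_bounded_linear
          bounded_linear_compose[OF bounded_linear_vec_nth])
    done
  then have D2: "(frame_deriv M i (surface_param Q1 Q2) has_derivative
      (\<lambda>h. \<chi> c. case c of Inl l \<Rightarrow> 0 | Inr b \<Rightarrow> (M ** P b *v h) $ i)) (at 0)"
    by (simp add: fd[abs_def])
  have tP: "P b $ k $ l = P b $ l $ k" for b k l
    using tA tB by (auto simp: P_def transpose_def vec_eq_iff)
  have tr: "transpose (M ** P b ** transpose M) = M ** P b ** transpose M" for b
    using tA tB by (simp add: P_def matrix_transpose_mul matrix_mul_assoc)
  have sw: "(M ** P b ** transpose M) $ i $ j = (M ** P b ** transpose M) $ j $ i" for b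
  proof -
    have "transpose (M ** P b ** transpose M) $ j $ i = (M ** P b ** transpose M) $ i $ j"
      by (simp only: transpose_def vec_lambda_beta)
    then show ?thesis unfolding tr by simp
  qed
  show "frame_deriv M j (frame_deriv M i (surface_param Q1 Q2)) 0 =
      (\<chi> c. case c of Inl l \<Rightarrow> 0 | Inr b \<Rightarrow> (M ** (if b then B else A) ** transpose M) $ j $ i)"
    unfolding P_def[symmetric] sw[symmetric]
    apply (rule vec_lambda_unique[THEN iffD1, OF allI, symmetric])
    subgoal for c
      by (cases c) (simp_all add: frame_deriv_def[of M j] partial_deriv_eq[OF D2] matrix_vector_mul_component
          inner_axis transpose_def matrix_matrix_mult_def[of "M ** _"] mult.commute)
    done
qed

text \<open>Of the sum over multi-indices only the identity is kept; there the first block is M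
  itself, of determinant 1. The infimum over M need not be attained, hence a matrix for each
  \<epsilon>.\<close>

lemma flat_surface_obtain:
  fixes Q1 Q2 :: "real^'n::finite \<Rightarrow> real"
  assumes Q: "quadratic_form Q1" "quadratic_form Q2" and flat: "flat_surface Q1 Q2" and \<epsilon>: "\<epsilon> > 0"
  defines "A \<equiv> hessian Q1 0" and "B \<equiv> hessian Q2 0"
  obtains M :: "real^'n^'n" where "det M = 1"
    "(\<Sum>j\<in>UNIV. \<Sum>k\<in>UNIV. ((M ** A ** transpose M) $ fst j $ snd j * (M ** B ** transpose M) $ fst k $ snd k
      - (M ** B ** transpose M) $ fst j $ snd j * (M ** A ** transpose M) $ fst k $ snd k)\<^sup>2) < \<epsilon>"
proof -
  let ?\<phi> = "surface_param Q1 Q2"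
  let ?S = "\<lambda>M. sqrt (\<Sum>i\<in>UNIV. \<Sum>j\<in>UNIV. \<Sum>k\<in>UNIV. \<bar>frame_det ?\<phi> 0 M i j k\<bar>\<^sup>2)"
  have "affine_density ?\<phi> 0 = 0"
    using flat by (auto simp: flat_surface_def unit_cube_def)
  then have "(INF M \<in> {M :: real^'n^'n. det M = 1}. ?S M) = 0"
    by (simp add: affine_density_def)
  then have "(INF M \<in> {M :: real^'n^'n. det M = 1}. ?S M) < sqrt \<epsilon>" using \<epsilon> by simp
  then obtain M :: "real^'n^'n" where M: "det M = 1" "?S M < sqrt \<epsilon>"
    using cInf_lessD[of "?S ` {M :: real^'n^'n. det M = 1}" "sqrt \<epsilon>"] det_I by fastforce
  have fdet: "frame_det ?\<phi> 0 M id j k = (M ** A ** transpose M) $ fst j $ snd j * (M ** B ** transpose M) $ fst k $ snd k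
      - (M ** B ** transpose M) $ fst j $ snd j * (M ** A ** transpose M) $ fst k $ snd k" for j k
    unfolding frame_det_def det_transpose surface_param_frame[OF Q] A_def B_def
    by (subst det_block_diagonal) (auto simp: M)
  have "(\<Sum>j\<in>UNIV. \<Sum>k\<in>UNIV. \<bar>frame_det ?\<phi> 0 M id j k\<bar>\<^sup>2) \<le> (\<Sum>i\<in>UNIV. \<Sum>j\<in>UNIV. \<Sum>k\<in>UNIV. \<bar>frame_det ?\<phi> 0 M i j k\<bar>\<^sup>2)"
    by (rule member_le_sum[of id UNIV "\<lambda>i. \<Sum>j\<in>UNIV. \<Sum>k\<in>UNIV. \<bar>frame_det ?\<phi> 0 M i j k\<bar>\<^sup>2"])
      (auto intro!: sum_nonneg)
  also have "\<dots> < \<epsilon>" using M(2) by simp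
  finally show ?thesis using M(1) that by (simp add: fdet)
qed

subsection \<open>The determinant of a pencil of matrices\<close>

text \<open>The dehomogenised determinant det(A + tB): its coefficient of index j belongs to t^j
  s^(d-j) in det(sA + tB). Its order of vanishing at 0 is therefore the multiplicity of the factor
  t.\<close>

definition pencil_poly :: "real^'n^'n \<Rightarrow> real^'n^'n \<Rightarrow> real poly" where
  "pencil_poly A B = det (\<chi> i j. [:A$i$j, B$i$j:])"

text \<open>The embedding \<iota> of the reals is kept abstract so that the determinant expansion
  built on this serves real numbers, complex numbers and polynomials in two variables alike.\<close>

lemma prod_linear_homogeneous:
  fixes \<iota> :: "real \<Rightarrow> 'r::comm_ring_1"
  assumes h: "\<iota> 0 = 0" "\<iota> 1 = 1" "\<And>x y. \<iota> (x + y) = \<iota> x + \<iota> y" "\<And>x y. \<iota> (x * y) = \<iota> x * \<iota> y"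
    and "finite S"
  shows "(\<Prod>i\<in>S. \<iota> (a i) * X + \<iota> (b i) * Y)
      = (\<Sum>j\<le>card S. \<iota> (coeff (\<Prod>i\<in>S. [:a i, b i:]) j) * Y ^ j * X ^ (card S - j))"
  using \<open>finite S\<close>
proof (induction S rule: finite_induct)
  case (insert x F)
  let ?q = "\<Prod>i\<in>F. [:a i, b i:]"
  let ?n = "card F"
  have deg: "coeff ?q (Suc ?n) = 0"
  proof (rule coeff_eq_0)
    have "degree ?q \<le> sum (\<lambda>i. degree [:a i, b i:]) F"
      using degree_prod_sum_le[OF insert(1), of "\<lambda>i. [:a i, b i:]"] by (simp add: o_def)
    also have "\<dots> \<le> sum (\<lambda>i. 1) F" by (rule sum_mono) simp
    finally show "degree ?q < Suc ?n" by simp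
  qed
  have co: "coeff ([:a x, b x:] * ?q) j = a x * coeff ?q j + (case j of 0 \<Rightarrow> 0 | Suc i \<Rightarrow> b x * coeff ?q i)" for j
    by (cases j) auto
  have "(\<Sum>j\<le>Suc ?n. \<iota> (coeff ([:a x, b x:] * ?q) j) * Y ^ j * X ^ (Suc ?n - j))
      = (\<Sum>j\<le>Suc ?n. \<iota> (a x) * \<iota> (coeff ?q j) * Y ^ j * X ^ (Suc ?n - j))
      + (\<Sum>j\<le>Suc ?n. \<iota> (case j of 0 \<Rightarrow> 0 | Suc i \<Rightarrow> b x * coeff ?q i) * Y ^ j * X ^ (Suc ?n - j))"
    unfolding co h by (simp add: sum.distrib[symmetric] algebra_simps)
  also have "(\<Sum>j\<le>Suc ?n. \<iota> (a x) * \<iota> (coeff ?q j) * Y ^ j * X ^ (Suc ?n - j))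
      = \<iota> (a x) * X * (\<Sum>j\<le>?n. \<iota> (coeff ?q j) * Y ^ j * X ^ (?n - j))"
    using deg h by (simp add: sum_distrib_left Suc_diff_le mult_ac)
  also have "(\<Sum>j\<le>Suc ?n. \<iota> (case j of 0 \<Rightarrow> 0 | Suc i \<Rightarrow> b x * coeff ?q i) * Y ^ j * X ^ (Suc ?n - j))
      = \<iota> (b x) * Y * (\<Sum>j\<le>?n. \<iota> (coeff ?q j) * Y ^ j * X ^ (?n - j))"
    unfolding sum.atMost_Suc_shift using h by (simp add: sum_distrib_left mult_ac)
  finally show ?case using insert by (simp add: algebra_simps)
qed (use h in simp)

lemma det_pencil_homogeneous:
  fixes \<iota> :: "real \<Rightarrow> 'r::comm_ring_1" and A B :: "real^'n^'n"
  assumes h: "\<iota> 0 = 0" "\<iota> 1 = 1" "\<And>x y. \<iota> (x + y) = \<iota> x + \<iota> y" "\<And>x y. \<iota> (x * y) = \<iota> x * \<iota> y"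
  shows "det (\<chi> i j. \<iota> (A$i$j) * X + \<iota> (B$i$j) * Y)
     = (\<Sum>j\<le>CARD('n). \<iota> (coeff (pencil_poly A B) j) * Y ^ j * X ^ (CARD('n) - j))"
proof -
  have neg: "\<iota> (- x) = - \<iota> x" for x
    using h(3)[of x "- x"] h(1) by (simp add: eq_neg_iff_add_eq_0 add.commute)
  have sgn: "\<iota> (of_int (sign \<sigma>) * x) = of_int (sign \<sigma>) * \<iota> x" for \<sigma> :: "'n \<Rightarrow> 'n" and x
    by (cases \<sigma> rule: sign_cases) (simp_all add: neg)
  have sum: "\<iota> (sum g S) = (\<Sum>x\<in>S. \<iota> (g x))" for g :: "('n \<Rightarrow> 'n) \<Rightarrow> real" and S
    by (induction S rule: infinite_finite_induct) (auto simp: h)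
  have co: "coeff (of_int k * q) j = of_int k * coeff q j" for k and q :: "real poly" and j
    by (simp add: of_int_poly)
  show ?thesis
    unfolding det_def pencil_poly_def vec_lambda_beta
    by (simp add: prod_linear_homogeneous[OF h] coeff_sum co sum sgn sum_distrib_left sum_distrib_right mult.assoc)
      (rule sum.swap)
qed

lemma poly_pencil_poly: "poly (pencil_poly A B) t = det (A + t *\<^sub>R B)"
proof -
  have "degree (pencil_poly A B) \<le> CARD('n)" for A B :: "real^'n^'n"
    unfolding pencil_poly_def det_def
  proof (rule degree_sum_le)
    fix p assume "p \<in> {p. p permutes (UNIV :: 'n set)}"
    have "degree (\<Prod>i\<in>UNIV. (\<chi> i j. [:A$i$j, B$i$j:]) $ i $ p i) \<le> sum (\<lambda>i. degree [:A$i$p i, B$i$p i:]) UNIV"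
      using degree_prod_sum_le[of UNIV "\<lambda>i. [:A$i$p i, B$i$p i:]"] by (simp add: o_def)
    also have "\<dots> \<le> sum (\<lambda>i. 1) (UNIV :: 'n set)" by (rule sum_mono) simp
    finally show "degree (of_int (sign p) * (\<Prod>i\<in>UNIV. (\<chi> i j. [:A$i$j, B$i$j:]) $ i $ p i)) \<le> CARD('n)"
      by (cases p rule: sign_cases) auto
  qed simp
  then have "poly (pencil_poly A B) t = (\<Sum>j\<le>CARD('a). coeff (pencil_poly A B) j * t ^ j)"
    by (auto simp: poly_altdef intro!: sum.mono_neutral_left coeff_eq_0)
  also have "\<dots> = det (\<chi> i j. A$i$j * 1 + B$i$j * t)"
    using det_pencil_homogeneous[of "\<lambda>x. x" A 1 B t] by simp
  also have "(\<chi> i j. A$i$j * 1 + B$i$j * t) = A + t *\<^sub>R B"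
    by (simp add: vec_eq_iff)
  finally show ?thesis .
qed

lemma det_pencil_eq_sum:
  fixes A B :: "real^'n^'n"
  shows "det (s *\<^sub>R A + t *\<^sub>R B) = (\<Sum>j\<le>CARD('n). coeff (pencil_poly A B) j * t ^ j * s ^ (CARD('n) - j))"
proof -
  have "(\<chi> i j. A$i$j * s + B$i$j * t) = s *\<^sub>R A + t *\<^sub>R B"
    by (simp add: vec_eq_iff)
  then show ?thesis using det_pencil_homogeneous[of "\<lambda>x. x" A s B t] by simp
qed

lemma pencil_poly_congruence:
  fixes A B M :: "real^'n^'n"
  assumes "det M = 1"
  shows "pencil_poly (M ** A ** transpose M) (M ** B ** transpose M) = pencil_poly A B"
proof -
  have "M ** A ** transpose M + t *\<^sub>R (M ** B ** transpose M) = M ** (A + t *\<^sub>R B) ** transpose M" for t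
    by (simp add: matrix_matrix_mult_def vec_eq_iff sum.distrib sum_distrib_left sum_distrib_right algebra_simps)
  then have "poly (pencil_poly (M ** A ** transpose M) (M ** B ** transpose M)) t = poly (pencil_poly A B) t" for t
    using assms by (simp add: poly_pencil_poly det_mul det_transpose)
  then show ?thesis by (simp add: poly_eq_poly_eq_iff[symmetric] fun_eq_iff)
qed

lemma coeff_prod_linear_bound:
  assumes "finite S" "\<And>i. i \<in> S \<Longrightarrow> \<bar>a i\<bar> \<le> \<alpha>" "\<And>i. i \<in> S \<Longrightarrow> \<bar>b i\<bar> \<le> (\<beta> :: real)" "0 \<le> \<alpha>" "0 \<le> \<beta>"
    "j \<le> card S"
  shows "\<bar>coeff (\<Prod>i\<in>S. [:a i, b i:]) j\<bar> \<le> 2 ^ card S * \<alpha> ^ (card S - j) * \<beta> ^ j"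
  using assms
proof (induction S arbitrary: j rule: finite_induct)
  case (insert x F)
  let ?q = "\<Prod>i\<in>F. [:a i, b i:]"
  let ?n = "card F"
  have IH: "\<bar>coeff ?q i\<bar> \<le> 2 ^ ?n * \<alpha> ^ (?n - i) * \<beta> ^ i" if "i \<le> ?n" for i
    using insert that by auto
  have z: "coeff ?q (Suc ?n) = 0"
  proof (rule coeff_eq_0)
    have "degree ?q \<le> sum (\<lambda>i. degree [:a i, b i:]) F"
      using degree_prod_sum_le[OF insert(1), of "\<lambda>i. [:a i, b i:]"] by (simp add: o_def)
    also have "\<dots> \<le> sum (\<lambda>i. 1) F" by (rule sum_mono) simp
    finally show "degree ?q < Suc ?n" by simp
  qed
  have 1: "\<bar>a x * coeff ?q j\<bar> \<le> 2 ^ ?n * \<alpha> ^ (Suc ?n - j) * \<beta> ^ j"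
  proof (cases "j \<le> ?n")
    case True
    then have "\<bar>a x * coeff ?q j\<bar> \<le> \<alpha> * (2 ^ ?n * \<alpha> ^ (?n - j) * \<beta> ^ j)"
      unfolding abs_mult using insert.prems IH by (intro mult_mono) auto
    then show ?thesis using True by (simp add: Suc_diff_le mult_ac)
  next
    case False
    then have "j = Suc ?n" using insert by simp
    then show ?thesis using z insert.prems by simp
  qed
  have 2: "\<bar>case j of 0 \<Rightarrow> 0 | Suc i \<Rightarrow> b x * coeff ?q i\<bar> \<le> 2 ^ ?n * \<alpha> ^ (Suc ?n - j) * \<beta> ^ j"
  proof (cases j)
    case (Suc i)
    then have "\<bar>b x * coeff ?q i\<bar> \<le> \<beta> * (2 ^ ?n * \<alpha> ^ (?n - i) * \<beta> ^ i)"
      unfolding abs_mult using insert IH by (intro mult_mono) auto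
    then show ?thesis using Suc by (simp add: mult_ac)
  qed (use insert.prems in simp)
  have "coeff ([:a x, b x:] * ?q) j = a x * coeff ?q j + (case j of 0 \<Rightarrow> 0 | Suc i \<Rightarrow> b x * coeff ?q i)"
    by (cases j) auto
  then have "\<bar>coeff ([:a x, b x:] * ?q) j\<bar> \<le> 2 * (2 ^ ?n * \<alpha> ^ (Suc ?n - j) * \<beta> ^ j)"
    using 1 2 by linarith
  then show ?case using insert by (simp add: mult_ac)
qed simp

text \<open>The coefficient of index j is homogeneous of degree d - j in A and of degree j in B. The
  factor d! counts permutations and 2^d bounds the number of terms of each expanded product.\<close>

lemma coeff_pencil_poly_bound:
  fixes A B :: "real^'n^'n"
  assumes j: "j \<le> CARD('n)"
  shows "\<bar>coeff (pencil_poly A B) j\<bar> \<le> (fact CARD('n) * 2 ^ CARD('n)) * (norm A ^ (CARD('n) - j) * norm B ^ j)"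
proof -
  have nrm: "\<bar>X$i$j\<bar> \<le> norm X" for X :: "real^'n^'n" and i j
    using Finite_Cartesian_Product.norm_nth_le[of X i] component_le_norm_cart[of "X$i" j] by linarith
  let ?K = "2 ^ CARD('n) * norm A ^ (CARD('n) - j) * norm B ^ j"
  have "\<bar>coeff (pencil_poly A B) j\<bar> = \<bar>\<Sum>p | p permutes (UNIV :: 'n set). coeff (of_int (sign p) * (\<Prod>i\<in>UNIV. [:A$i$p i, B$i$p i:])) j\<bar>"
    by (simp add: pencil_poly_def det_def coeff_sum)
  also have "\<dots> \<le> (\<Sum>p | p permutes (UNIV :: 'n set). \<bar>coeff (of_int (sign p) * (\<Prod>i\<in>UNIV. [:A$i$p i, B$i$p i:])) j\<bar>)"
    by (rule sum_abs)
  also have "\<dots> \<le> (\<Sum>p | p permutes (UNIV :: 'n set). ?K)"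
  proof (rule sum_mono)
    fix p assume "p \<in> {p. p permutes (UNIV :: 'n set)}"
    have "\<bar>coeff (of_int (sign p) * (\<Prod>i\<in>UNIV. [:A$i$p i, B$i$p i:])) j\<bar> = \<bar>coeff (\<Prod>i\<in>UNIV. [:A$i$p i, B$i$p i:]) j\<bar>"
      by (cases p rule: sign_cases) auto
    also have "\<dots> \<le> ?K"
      by (rule coeff_prod_linear_bound) (use nrm j in auto)
    finally show "\<bar>coeff (of_int (sign p) * (\<Prod>i\<in>UNIV. [:A$i$p i, B$i$p i:])) j\<bar> \<le> ?K" .
  qed
  also have "\<dots> = fact CARD('n) * ?K"
    using card_permutations[of "UNIV :: 'n set" "CARD('n)"] by simp
  finally show ?thesis by (simp add: mult_ac)
qed

lemma tendsto_coeff_prod_linear: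
  assumes "finite S" "\<And>i. i \<in> S \<Longrightarrow> (\<lambda>n. a n i) \<longlonglongrightarrow> a' i" "\<And>i. i \<in> S \<Longrightarrow> (\<lambda>n. b n i) \<longlonglongrightarrow> (b' i :: real)"
  shows "(\<lambda>n. coeff (\<Prod>i\<in>S. [:a n i, b n i:]) j) \<longlonglongrightarrow> coeff (\<Prod>i\<in>S. [:a' i, b' i:]) j"
  using assms
proof (induction S arbitrary: j rule: finite_induct)
  case (insert x F)
  then show ?case
    by (cases j) (auto intro!: tendsto_intros)
qed simp

lemma tendsto_coeff_pencil_poly:
  fixes A B :: "nat \<Rightarrow> real^'n^'n"
  assumes "A \<longlonglongrightarrow> A'" "B \<longlonglongrightarrow> B'"
  shows "(\<lambda>n. coeff (pencil_poly (A n) (B n)) j) \<longlonglongrightarrow> coeff (pencil_poly A' B') j"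
proof -
  have co: "coeff (of_int k * q) j = of_int k * coeff q j" for k and q :: "real poly" and j
    by (simp add: of_int_poly)
  show ?thesis
    unfolding pencil_poly_def det_def vec_lambda_beta coeff_sum co
    by (intro tendsto_intros tendsto_coeff_prod_linear tendsto_vec_nth assms) auto
qed

text \<open>The inner product of the rotated pair changes sign over a quarter turn, so it vanishes
  somewhere in between. If the norms then come in the wrong order, one more quarter turn exchanges
  the two vectors up to sign.\<close>

lemma rotate_to_orthogonal:
  fixes A B :: "'a::real_inner"
  obtains c s :: real where "c\<^sup>2 + s\<^sup>2 = 1" "(c *\<^sub>R A + s *\<^sub>R B) \<bullet> ((- s) *\<^sub>R A + c *\<^sub>R B) = 0"
    "norm (c *\<^sub>R A + s *\<^sub>R B) \<le> norm ((- s) *\<^sub>R A + c *\<^sub>R B)"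
proof -
  define g where "g \<theta> = (cos \<theta> *\<^sub>R A + sin \<theta> *\<^sub>R B) \<bullet> ((- sin \<theta>) *\<^sub>R A + cos \<theta> *\<^sub>R B)" for \<theta>
  have cont: "continuous_on S g" for S unfolding g_def by (intro continuous_intros)
  have g0: "g 0 = A \<bullet> B" "g (pi / 2) = - (A \<bullet> B)"
    by (simp_all add: g_def inner_commute)
  have "\<exists>\<theta>. g \<theta> = 0"
  proof (cases "A \<bullet> B \<le> 0")
    case True
    then show ?thesis using IVT'[of g 0 0 "pi/2"] g0 cont by auto
  next
    case False
    then show ?thesis using IVT2'[of g "pi/2" 0 0] g0 cont by auto
  qed
  then obtain \<theta> where \<theta>: "g \<theta> = 0" by blast
  define c s where "c = cos \<theta>" and "s = sin \<theta>"
  have 1: "c\<^sup>2 + s\<^sup>2 = 1" by (simp add: c_def s_def)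
  have 2: "(c *\<^sub>R A + s *\<^sub>R B) \<bullet> ((- s) *\<^sub>R A + c *\<^sub>R B) = 0"
    using \<theta> by (simp add: g_def c_def s_def)
  show ?thesis
  proof (cases "norm (c *\<^sub>R A + s *\<^sub>R B) \<le> norm ((- s) *\<^sub>R A + c *\<^sub>R B)")
    case True
    then show ?thesis using that 1 2 by blast
  next
    case False
    have e: "(- c) *\<^sub>R A + (- s) *\<^sub>R B = - (c *\<^sub>R A + s *\<^sub>R B)" by simp
    show ?thesis
    proof (rule that[of "- s" c])
      show "(- s)\<^sup>2 + c\<^sup>2 = 1" using 1 by simp
      show "((- s) *\<^sub>R A + c *\<^sub>R B) \<bullet> ((- c) *\<^sub>R A + (- s) *\<^sub>R B) = 0"
        unfolding e inner_minus_right using 2 by (metis inner_commute minus_zero)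
      show "norm ((- s) *\<^sub>R A + c *\<^sub>R B) \<le> norm ((- c) *\<^sub>R A + (- s) *\<^sub>R B)"
        unfolding e using False by (simp only: norm_minus_cancel)
    qed
  qed
qed

text \<open>The Gram determinant of a pair is invariant under rotation of the pair, and for an
  orthogonal pair it is the product of the squared norms.\<close>

lemma gram_rotate:
  fixes A B :: "'a::real_inner"
  assumes "c\<^sup>2 + s\<^sup>2 = 1" "(c *\<^sub>R A + s *\<^sub>R B) \<bullet> ((- s) *\<^sub>R A + c *\<^sub>R B) = 0"
  shows "(norm (c *\<^sub>R A + s *\<^sub>R B) * norm ((- s) *\<^sub>R A + c *\<^sub>R B))\<^sup>2 = (A \<bullet> A) * (B \<bullet> B) - (A \<bullet> B)\<^sup>2"
proof -
  let ?X = "c *\<^sub>R A + s *\<^sub>R B" and ?Y = "(- s) *\<^sub>R A + c *\<^sub>R B"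
  have "(?X \<bullet> ?X) * (?Y \<bullet> ?Y) - (?X \<bullet> ?Y)\<^sup>2 = (c\<^sup>2 + s\<^sup>2)\<^sup>2 * ((A \<bullet> A) * (B \<bullet> B) - (A \<bullet> B)\<^sup>2)"
    by (simp add: inner_add_left inner_add_right inner_commute[of B A] power2_eq_square algebra_simps)
  then show ?thesis using assms by (simp add: power_mult_distrib dot_square_norm)
qed

text \<open>Lagrange's identity: the quantity in the affine density is twice the Gram determinant of
  the two Hessians, regarded as vectors in the space of matrices.\<close>

lemma sum_wedge_squares:
  fixes A B :: "real^'n^'n"
  shows "(\<Sum>j\<in>UNIV. \<Sum>k\<in>UNIV. (A $ fst j $ snd j * B $ fst k $ snd k - B $ fst j $ snd j * A $ fst k $ snd k)\<^sup>2)
    = 2 * ((A \<bullet> A) * (B \<bullet> B) - (A \<bullet> B)\<^sup>2)"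
proof -
  let ?a = "\<lambda>j :: 'n \<times> 'n. A $ fst j $ snd j" and ?b = "\<lambda>j :: 'n \<times> 'n. B $ fst j $ snd j"
  have ip: "X \<bullet> Y = (\<Sum>j\<in>UNIV. X $ fst j $ snd j * Y $ fst j $ snd j)" for X Y :: "real^'n^'n"
    by (simp add: inner_vec_def sum.cartesian_product UNIV_Times_UNIV split_def)
  have "(\<Sum>j\<in>UNIV. \<Sum>k\<in>UNIV. (?a j * ?b k - ?b j * ?a k)\<^sup>2)
    = (\<Sum>j\<in>UNIV. \<Sum>k\<in>UNIV. (?a j * ?a j) * (?b k * ?b k) + (?b j * ?b j) * (?a k * ?a k) - 2 * ((?a j * ?b j) * (?a k * ?b k)))"
    by (intro sum.cong refl) (simp add: power2_eq_square algebra_simps)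
  also have "\<dots> = (A \<bullet> A) * (B \<bullet> B) + (B \<bullet> B) * (A \<bullet> A) - 2 * ((A \<bullet> B) * (A \<bullet> B))"
    unfolding ip by (simp add: sum.distrib sum_subtractf sum_product) (simp add: sum_distrib_left)
  finally show ?thesis by (simp add: power2_eq_square algebra_simps)
qed

text \<open>A rotation of the pencil makes the two matrices orthogonal with product of norms tending to
  zero along the minimising sequence; in the limit rotation the lower half of the coefficients of the
  determinant has to vanish.\<close>

lemma flat_surface_pencil:
  fixes Q1 Q2 :: "real^'n::finite \<Rightarrow> real"
  assumes Q: "quadratic_form Q1" "quadratic_form Q2" and flat: "flat_surface Q1 Q2"
  defines "A \<equiv> hessian Q1 0" and "B \<equiv> hessian Q2 0"
  obtains c s where "c\<^sup>2 + s\<^sup>2 = 1"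
    "\<And>j. 2 * j \<le> CARD('n) \<Longrightarrow> coeff (pencil_poly (c *\<^sub>R A + s *\<^sub>R B) ((- s) *\<^sub>R A + c *\<^sub>R B)) j = 0"
proof -
  let ?d = "CARD('n)"
  let ?p = "\<lambda>c s. pencil_poly (c *\<^sub>R A + s *\<^sub>R B) ((- s) *\<^sub>R A + c *\<^sub>R B)"
  define K where "K = (fact ?d * 2 ^ ?d :: real)"
  have ex: "\<exists>c s. c\<^sup>2 + s\<^sup>2 = 1 \<and> (\<forall>j. 2 * j \<le> ?d \<longrightarrow> (coeff (?p c s) j)\<^sup>2 \<le> K\<^sup>2 * \<delta>)" if \<delta>: "0 < \<delta>" "\<delta> < 1" for \<delta> :: real
  proof -
    obtain M :: "real^'n^'n" where M: "det M = 1"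
      "(\<Sum>j\<in>UNIV. \<Sum>k\<in>UNIV. ((M ** A ** transpose M) $ fst j $ snd j * (M ** B ** transpose M) $ fst k $ snd k
      - (M ** B ** transpose M) $ fst j $ snd j * (M ** A ** transpose M) $ fst k $ snd k)\<^sup>2) < \<delta>\<^sup>2"
      using flat_surface_obtain[OF Q flat, of "\<delta>\<^sup>2"] \<delta> unfolding A_def B_def by auto
    define A' B' where "A' = M ** A ** transpose M" and "B' = M ** B ** transpose M"
    obtain c s where cs: "c\<^sup>2 + s\<^sup>2 = 1" "(c *\<^sub>R A' + s *\<^sub>R B') \<bullet> ((- s) *\<^sub>R A' + c *\<^sub>R B') = 0"
      "norm (c *\<^sub>R A' + s *\<^sub>R B') \<le> norm ((- s) *\<^sub>R A' + c *\<^sub>R B')"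
      using rotate_to_orthogonal .
    define \<alpha> \<beta> where "\<alpha> = norm (c *\<^sub>R A' + s *\<^sub>R B')" and "\<beta> = norm ((- s) *\<^sub>R A' + c *\<^sub>R B')"
    have "2 * (\<alpha> * \<beta>)\<^sup>2 < \<delta>\<^sup>2"
      unfolding \<alpha>_def \<beta>_def gram_rotate[OF cs(1,2)] using M(2) sum_wedge_squares[of A' B'] by (simp add: A'_def B'_def)
    then have "(\<alpha> * \<beta>)\<^sup>2 \<le> \<delta>\<^sup>2" using zero_le_power2[of "\<alpha> * \<beta>"] by linarith
    then have ab: "\<alpha> * \<beta> \<le> \<delta>" by (rule power2_le_imp_le) (use \<delta> in simp)
    have ab0: "0 \<le> \<alpha>" "\<alpha> \<le> \<beta>" using cs(3) by (simp_all add: \<alpha>_def \<beta>_def)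
    have lin: "x *\<^sub>R A' + y *\<^sub>R B' = M ** (x *\<^sub>R A + y *\<^sub>R B) ** transpose M" for x y
      by (simp add: A'_def B'_def matrix_matrix_mult_def vec_eq_iff sum.distrib sum_distrib_left sum_distrib_right algebra_simps)
    have "(coeff (?p c s) j)\<^sup>2 \<le> K\<^sup>2 * \<delta>" if j: "2 * j \<le> ?d" for j
    proof -
      have "\<bar>coeff (?p c s) j\<bar> \<le> K * (\<alpha> ^ (?d - j) * \<beta> ^ j)"
        using coeff_pencil_poly_bound[of j "c *\<^sub>R A' + s *\<^sub>R B'" "(- s) *\<^sub>R A' + c *\<^sub>R B'"] j
        unfolding \<alpha>_def \<beta>_def K_def lin pencil_poly_congruence[OF M(1)] by simp
      \<comment> \<open>After squaring, the product of norms splits into powers of \<alpha>\<beta>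
        and of \<alpha>\<alpha> with the natural exponents 2j and d - 2j. Both bases are at most
        \<delta>, the second because \<alpha> is the smaller norm.\<close>
      then have "(coeff (?p c s) j)\<^sup>2 \<le> (K * (\<alpha> ^ (?d - j) * \<beta> ^ j))\<^sup>2"
        using power_mono[of "\<bar>coeff (?p c s) j\<bar>" _ 2] by (simp only: power2_abs abs_ge_zero)
      also have "\<dots> = K\<^sup>2 * ((\<alpha> * \<beta>) ^ (2 * j) * (\<alpha> * \<alpha>) ^ (?d - 2 * j))"
      proof -
        have dj: "?d - j = j + (?d - 2 * j)" using j by simp
        show ?thesis
          unfolding dj mult_2 power_add power_mult_distrib power2_eq_square by (simp only: mult_ac)
      qed
      also have "\<dots> \<le> K\<^sup>2 * (\<delta> ^ (2 * j) * \<delta> ^ (?d - 2 * j))"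
      proof -
        have "\<alpha> * \<alpha> \<le> \<delta>" using ab ab0 mult_left_mono[of \<alpha> \<beta> \<alpha>] by linarith
        then show ?thesis using ab ab0 \<delta> by (intro mult_left_mono mult_mono power_mono) auto
      qed
      also have "\<dots> = K\<^sup>2 * \<delta> ^ ?d" using j by (simp add: power_add[symmetric])
      also have "\<dots> \<le> K\<^sup>2 * \<delta> ^ 1"
        using \<delta> by (intro mult_left_mono power_decreasing) (auto simp: Suc_leI)
      finally show ?thesis by simp
    qed
    then show ?thesis using cs(1) by blast
  qed
  have "\<forall>n. \<exists>cs. (fst cs)\<^sup>2 + (snd cs)\<^sup>2 = 1 \<and> (\<forall>j. 2 * j \<le> ?d \<longrightarrow> (coeff (?p (fst cs) (snd cs)) j)\<^sup>2 \<le> K\<^sup>2 * (1 / real (n + 2)))"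
  proof
    fix n
    have "0 < 1 / real (n + 2)" "1 / real (n + 2) < 1" by simp_all
    from ex[OF this] obtain c s where "c\<^sup>2 + s\<^sup>2 = 1 \<and> (\<forall>j. 2 * j \<le> ?d \<longrightarrow> (coeff (?p c s) j)\<^sup>2 \<le> K\<^sup>2 * (1 / real (n + 2)))"
      by blast
    then show "\<exists>cs. (fst cs)\<^sup>2 + (snd cs)\<^sup>2 = 1 \<and> (\<forall>j. 2 * j \<le> ?d \<longrightarrow> (coeff (?p (fst cs) (snd cs)) j)\<^sup>2 \<le> K\<^sup>2 * (1 / real (n + 2)))"
      by (intro exI[of _ "(c, s)"]) simp
  qed
  then obtain z :: "nat \<Rightarrow> real \<times> real" where z: "\<And>n. (fst (z n))\<^sup>2 + (snd (z n))\<^sup>2 = 1"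
    "\<And>n j. 2 * j \<le> ?d \<Longrightarrow> (coeff (?p (fst (z n)) (snd (z n))) j)\<^sup>2 \<le> K\<^sup>2 * (1 / real (n + 2))"
    by metis
  have "norm (z n) = 1" for n using z(1)[of n] by (simp add: norm_prod_def)
  then have "\<forall>n. z n \<in> sphere 0 1" by simp
  then obtain l r where lr: "strict_mono (r :: nat \<Rightarrow> nat)" "(z \<circ> r) \<longlonglongrightarrow> l"
    using compact_sphere[of "0 :: real \<times> real" 1] unfolding compact_def by metis
  have f: "(\<lambda>n. fst (z (r n))) \<longlonglongrightarrow> fst l" "(\<lambda>n. snd (z (r n))) \<longlonglongrightarrow> snd l"
    using tendsto_fst[OF lr(2)] tendsto_snd[OF lr(2)] by (simp_all add: o_def)
  show ?thesis
  proof (rule that)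
    have "(\<lambda>n. (fst (z (r n)))\<^sup>2 + (snd (z (r n)))\<^sup>2) \<longlonglongrightarrow> (fst l)\<^sup>2 + (snd l)\<^sup>2"
      by (intro tendsto_intros f)
    then show "(fst l)\<^sup>2 + (snd l)\<^sup>2 = 1" using z(1) by (simp add: LIMSEQ_const_iff)
    fix j assume j: "2 * j \<le> ?d"
    have "(\<lambda>n. (coeff (?p (fst (z (r n))) (snd (z (r n)))) j)\<^sup>2) \<longlonglongrightarrow> (coeff (?p (fst l) (snd l)) j)\<^sup>2"
      by (intro tendsto_intros tendsto_coeff_pencil_poly f)
    moreover have "(\<lambda>n. K\<^sup>2 * (1 / real (r n + 2))) \<longlonglongrightarrow> K\<^sup>2 * 0"
    proof (intro tendsto_intros)
      have "(\<lambda>n. 1 / real (n + 2)) \<longlonglongrightarrow> 0"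
        using LIMSEQ_ignore_initial_segment[OF lim_1_over_n, of 2] by simp
      then show "(\<lambda>n. 1 / real (r n + 2)) \<longlonglongrightarrow> 0"
        using LIMSEQ_subseq_LIMSEQ[OF _ lr(1)] by (fastforce simp: o_def)
    qed
    ultimately have "(coeff (?p (fst l) (snd l)) j)\<^sup>2 \<le> K\<^sup>2 * 0"
      by (rule LIMSEQ_le) (use z(2)[OF j] in blast)
    then show "coeff (?p (fst l) (snd l)) j = 0" by simp
  qed
qed

subsection \<open>Root multiplicities\<close>

lemma map_poly_mult_hom:
  fixes f :: "'a::comm_semiring_0 \<Rightarrow> 'b::comm_semiring_0"
  assumes f: "f 0 = 0" "\<And>x y. f (x + y) = f x + f y" "\<And>x y. f (x * y) = f x * f y"
  shows "map_poly f (p * q) = map_poly f p * map_poly f q"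
proof -
  have "f (sum g S) = (\<Sum>i\<in>S. f (g i))" for g :: "nat \<Rightarrow> 'a" and S
    by (induction S rule: infinite_finite_induct) (auto simp: f)
  then show ?thesis by (intro poly_eqI) (simp add: coeff_map_poly coeff_mult f)
qed

lemma map_poly_add_hom:
  assumes "f 0 = 0" "\<And>x y. f (x + y) = f x + f y"
  shows "map_poly f (p + q) = map_poly f p + map_poly f q"
  using assms by (intro poly_eqI) (simp add: coeff_map_poly)

lemma complexify_hom:
  "complexify 0 = 0" "complexify 1 = 1"
  "complexify (p + q) = complexify p + complexify q"
  "complexify (p * q) = complexify p * complexify q"
  "complexify (const2 x) = const2 (complex_of_real x)"
  "complexify var_s = var_s" "complexify var_t = var_t"
proof -
  have a: "map_poly complex_of_real (x + y) = map_poly complex_of_real x + map_poly complex_of_real y" for x y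
    by (rule map_poly_add_hom) simp_all
  have m: "map_poly complex_of_real (x * y) = map_poly complex_of_real x * map_poly complex_of_real y" for x y
    by (rule map_poly_mult_hom) simp_all
  show "complexify (p + q) = complexify p + complexify q" "complexify (p * q) = complexify p * complexify q"
    unfolding complexify_def using a m by (auto intro: map_poly_add_hom map_poly_mult_hom)
qed (simp_all add: complexify_def const2_def var_s_def var_t_def map_poly_pCons)

lemma complexify_power: "complexify (p ^ n) = complexify p ^ n"
  by (induction n) (simp_all add: complexify_hom)

lemma complexify_sum: "complexify (sum f S) = (\<Sum>i\<in>S. complexify (f i))"
  by (induction S rule: infinite_finite_induct) (simp_all add: complexify_hom)

lemma const2_hom: "const2 0 = 0" "const2 1 = 1" "const2 (x + y) = const2 x + const2 y"
  "const2 (x * y) = const2 x * const2 y" "const2 (- x) = - const2 x" "const2 (x - y) = const2 x - const2 y"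
  by (simp_all add: const2_def one_pCons)

text \<open>The rotation of the two matrices is undone by rotating the two variables, so the
  determinant becomes a form in the rotated variables whose coefficients are those of the rotated
  pencil.\<close>

lemma pencil_det_rotated:
  fixes Q1 Q2 :: "real^'n::finite \<Rightarrow> real"
  defines "A \<equiv> hessian Q1 0" and "B \<equiv> hessian Q2 0"
  assumes cs: "c\<^sup>2 + s\<^sup>2 = 1"
  shows "pencil_det Q1 Q2 = (\<Sum>j\<le>CARD('n). const2 (coeff (pencil_poly (c *\<^sub>R A + s *\<^sub>R B) ((- s) *\<^sub>R A + c *\<^sub>R B)) j)
    * (const2 (- s) * var_s + const2 c * var_t) ^ j * (const2 c * var_s + const2 s * var_t) ^ (CARD('n) - j))"
proof -
  have cs': "c * c + s * s = 1" using cs by (simp add: power2_eq_square)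
  have e: "const2 c * const2 c + const2 s * const2 s = (1 :: real poly poly)"
    using cs' by (simp flip: const2_hom)
  have "var_s * const2 x + var_t * const2 y
      = const2 ((c *\<^sub>R A + s *\<^sub>R B) $ i $ j) * (const2 c * var_s + const2 s * var_t)
      + const2 (((- s) *\<^sub>R A + c *\<^sub>R B) $ i $ j) * (const2 (- s) * var_s + const2 c * var_t)"
    if "x = A $ i $ j" "y = B $ i $ j" for x y i j
  proof -
    have "const2 ((c *\<^sub>R A + s *\<^sub>R B) $ i $ j) * (const2 c * var_s + const2 s * var_t)
      + const2 (((- s) *\<^sub>R A + c *\<^sub>R B) $ i $ j) * (const2 (- s) * var_s + const2 c * var_t)
      = (const2 c * const2 c + const2 s * const2 s) * (var_s * const2 x + var_t * const2 y)"
      using that by (simp add: const2_hom algebra_simps)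
    then show ?thesis unfolding e by simp
  qed
  then have "pencil_det Q1 Q2 = det (\<chi> i j. const2 ((c *\<^sub>R A + s *\<^sub>R B) $ i $ j) * (const2 c * var_s + const2 s * var_t)
      + const2 (((- s) *\<^sub>R A + c *\<^sub>R B) $ i $ j) * (const2 (- s) * var_s + const2 c * var_t))"
    unfolding pencil_det_def A_def B_def by simp
  then show ?thesis
    by (subst (asm) det_pencil_homogeneous) (simp_all add: const2_hom)
qed

text \<open>Restriction to a line turns a polynomial in two variables into one in a single variable,
  where multiplicities can be compared through orders of vanishing and degrees.\<close>

lemma poly_poly_along_line:
  fixes R :: "complex poly poly"
  shows "\<exists>r. \<forall>u. poly r u = poly (poly R [:\<gamma> + \<delta> * u:]) (\<alpha> + \<beta> * u)"
proof (induction R)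
  case (pCons a R)
  then obtain r where "\<forall>u. poly r u = poly (poly R [:\<gamma> + \<delta> * u:]) (\<alpha> + \<beta> * u)" by blast
  then show ?case
    by (intro exI[of _ "pcompose a [:\<alpha>, \<beta>:] + [:\<gamma>, \<delta>:] * r"]) (simp add: poly_pcompose algebra_simps)
qed (intro exI[of _ 0], simp)

text \<open>With T and S the rotated linear forms, the determinant is the sum of p_j T^j S^(d-j), so
  T^m divides it. Let l^k be another divisor. If l is a multiple of T, that is a c + b s = 0,
  restriction to the line S = 1 gives a polynomial vanishing at 0 to order exactly m, so k is at
  most m. Otherwise l stays of degree 1 on the line T = 1, where the determinant has degree d - m <
  m.\<close>

lemma max_root_multiplicity_pencil:
  fixes Q1 Q2 :: "real^'n::finite \<Rightarrow> real"
  defines "A \<equiv> hessian Q1 0" and "B \<equiv> hessian Q2 0"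
  assumes cs: "c\<^sup>2 + s\<^sup>2 = 1"
    and p: "p = pencil_poly (c *\<^sub>R A + s *\<^sub>R B) ((- s) *\<^sub>R A + c *\<^sub>R B)"
    and low: "\<And>j. j < m \<Longrightarrow> coeff p j = 0" and m: "coeff p m \<noteq> 0" "m \<le> CARD('n)" "CARD('n) < 2 * m"
  shows "max_root_multiplicity (pencil_det Q1 Q2) = m"
proof -
  let ?d = "CARD('n)"
  let ?P = "complexify (pencil_det Q1 Q2)"
  define T S where "T = linear_poly (complex_of_real (- s)) (complex_of_real c)"
    and "S = linear_poly (complex_of_real c) (complex_of_real s)"
  have cs': "c * c + s * s = 1" using cs by (simp add: power2_eq_square)
  have P: "?P = (\<Sum>j\<le>?d. const2 (complex_of_real (coeff p j)) * T ^ j * S ^ (?d - j))"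
    unfolding pencil_det_rotated[OF cs, of Q1 Q2] p A_def B_def
    by (simp add: complexify_sum complexify_hom complexify_power T_def S_def linear_poly_def)
  have evT: "poly (poly T [:y:]) x = - s * x + c * y" and evS: "poly (poly S [:y:]) x = c * x + s * y" for x y :: complex
    by (simp_all add: T_def S_def linear_poly_def const2_def var_s_def var_t_def algebra_simps)
  have evP: "poly (poly ?P [:y:]) x = (\<Sum>j\<le>?d. complex_of_real (coeff p j) * (- s * x + c * y) ^ j * (c * x + s * y) ^ (?d - j))" for x y :: complex
    unfolding P by (simp add: poly_sum poly_mult poly_power evT evS const2_def mult.assoc)
  have Tdvd: "T ^ m dvd ?P"
    unfolding P
  proof (rule dvd_sum)
    fix j
    show "T ^ m dvd const2 (complex_of_real (coeff p j)) * T ^ j * S ^ (?d - j)"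
    proof (cases "j < m")
      case False
      then show ?thesis by (intro dvd_mult2 dvd_mult[OF le_imp_power_dvd]) simp
    qed (simp add: low const2_hom)
  qed
  have bound: "k \<le> m" if dvd: "linear_poly a b ^ k dvd ?P" and ab: "(a, b) \<noteq> (0, 0)" for a b k
  proof -
    obtain R where R: "?P = linear_poly a b ^ k * R" using dvd by (elim dvdE)
    have evl: "poly (poly (linear_poly a b) [:y:]) x = a * x + b * y" for x y :: complex
      by (simp add: linear_poly_def const2_def var_s_def var_t_def algebra_simps)
    have ev: "(\<Sum>j\<le>?d. complex_of_real (coeff p j) * (- s * x + c * y) ^ j * (c * x + s * y) ^ (?d - j))
        = (a * x + b * y) ^ k * poly (poly R [:y:]) x" for x y :: complex
      unfolding evP[symmetric] R by (simp add: poly_mult poly_power evl)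
    have csC: "complex_of_real c * c + complex_of_real s * s = 1"
      using cs' by (simp flip: of_real_mult of_real_add)
    show "k \<le> m"
    proof (cases "a * c + b * s = 0")
      case True
      obtain r where r: "\<And>u::complex. poly r u = poly (poly R [:s + c * u:]) (c + (- s) * u)"
        using poly_poly_along_line[of R s c c "- s"] by blast
      define pc where "pc = (\<Sum>j\<le>?d. monom (complex_of_real (coeff p j)) j)"
      have "poly pc u = poly ([:0, b * c - a * s:] ^ k * r) u" for u :: complex
      proof -
        have 1: "- s * (c + (- s) * u) + c * (s + c * u) = u"
        proof -
          have "- s * (c + (- s) * u) + c * (s + c * u) = (complex_of_real c * c + complex_of_real s * s) * u"
            by (simp add: algebra_simps)
          then show ?thesis by (simp add: csC)
        qed
        have 2: "c * (c + (- s) * u) + s * (s + c * u) = 1"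
          using csC by (simp add: algebra_simps)
        have 3: "a * (c + (- s) * u) + b * (s + c * u) = u * (b * c - a * s)"
        proof -
          have "a * (c + (- s) * u) + b * (s + c * u) = (a * c + b * s) + u * (b * c - a * s)"
            by (simp add: algebra_simps)
          then show ?thesis using True by simp
        qed
        show ?thesis
          using ev[of "c + (- s) * u" "s + c * u"] unfolding 1 2 3 pc_def
          by (simp add: poly_sum poly_monom poly_power r)
      qed
      then have "pc = [:0, b * c - a * s:] ^ k * r"
        by (simp add: poly_eq_poly_eq_iff[symmetric] fun_eq_iff)
      also have "[:0, b * c - a * s:] = monom (b * c - a * s) 1" by (simp add: monom_altdef)
      finally have "coeff pc m = coeff (monom ((b * c - a * s) ^ k) k * r) m"
        by (simp add: monom_power)
      moreover have "coeff pc m = complex_of_real (coeff p m)"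
        using m by (simp add: pc_def coeff_sum)
      ultimately show ?thesis
        using m by (cases "m < k") (auto simp: coeff_monom_mult)
    next
      case False
      obtain r where r: "\<And>u::complex. poly r u = poly (poly R [:c + s * u:]) ((- s) + c * u)"
        using poly_poly_along_line[of R c s "- s" c] by (auto simp flip: of_real_minus)
      define pc where "pc = (\<Sum>j\<le>?d. monom (complex_of_real (coeff p j)) (?d - j))"
      have "poly pc u = poly ([:b * c - a * s, a * c + b * s:] ^ k * r) u" for u :: complex
      proof -
        have 1: "- s * ((- s) + c * u) + c * (c + s * u) = 1"
          using csC by (simp add: algebra_simps)
        have 2: "c * ((- s) + c * u) + s * (c + s * u) = u"
        proof -
          have "c * ((- s) + c * u) + s * (c + s * u) = (complex_of_real c * c + complex_of_real s * s) * u"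
            by (simp add: algebra_simps)
          then show ?thesis by (simp add: csC)
        qed
        have 3: "a * ((- s) + c * u) + b * (c + s * u) = (b * c - a * s) + u * (a * c + b * s)"
          by (simp add: algebra_simps)
        show ?thesis
          using ev[of "(- s) + c * u" "c + s * u"] unfolding 1 2 3 pc_def
          by (simp add: poly_sum poly_monom poly_power r)
      qed
      then have pc: "pc = [:b * c - a * s, a * c + b * s:] ^ k * r"
        by (simp add: poly_eq_poly_eq_iff[symmetric] fun_eq_iff)
      have "coeff pc (?d - m) = (\<Sum>j\<le>?d. if j = m then complex_of_real (coeff p j) else 0)"
        unfolding pc_def coeff_sum using m by (intro sum.cong refl) auto
      then have "coeff pc (?d - m) \<noteq> 0" using m by simp
      then have "pc \<noteq> 0" by auto
      then have "r \<noteq> 0" unfolding pc by auto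
      then have "degree pc = k + degree r"
        unfolding pc using False by (simp add: degree_mult_eq degree_power_eq)
      moreover have "degree pc \<le> ?d - m"
        unfolding pc_def
      proof (rule degree_sum_le)
        fix j assume "j \<in> {..?d}"
        show "degree (monom (complex_of_real (coeff p j)) (?d - j)) \<le> ?d - m"
          using low[of j] degree_monom_le[of "complex_of_real (coeff p j)" "?d - j"] by (cases "j < m") auto
      qed simp
      ultimately show ?thesis using m by linarith
    qed
  qed
  have ab: "(complex_of_real (- s), complex_of_real c) \<noteq> (0, 0)"
    using cs by auto
  have rmT: "root_multiplicity T (pencil_det Q1 Q2) = m"
    unfolding root_multiplicity_def
    using Tdvd bound[OF _ ab] unfolding T_def by (intro Greatest_equality)
  have "m > 0" using m by simp
  then have "T dvd ?P" using Tdvd by (meson dvd_power dvd_trans)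
  then have rootT: "is_root (pencil_det Q1 Q2) T"
    using ab unfolding is_root_def T_def by blast
  have le: "root_multiplicity l (pencil_det Q1 Q2) \<le> m" if "is_root (pencil_det Q1 Q2) l" for l
  proof -
    from that have "\<exists>a b. (a, b) \<noteq> (0, 0) \<and> l = linear_poly a b"
      unfolding is_root_def by (rule conjunct1)
    then obtain a b where l: "(a, b) \<noteq> (0, 0)" "l = linear_poly a b"
      by (elim exE conjE)
    have "l ^ root_multiplicity l (pencil_det Q1 Q2) dvd ?P"
      unfolding root_multiplicity_def
    proof (rule GreatestI_nat[where P = "\<lambda>k. l ^ k dvd ?P" and k = 0])
      show "k \<le> m" if "l ^ k dvd ?P" for k
        using bound[OF _ l(1)] that unfolding l(2) by blast
    qed simp
    then show ?thesis using bound[OF _ l(1)] unfolding l(2) by blast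
  qed
  let ?X = "{root_multiplicity l (pencil_det Q1 Q2) | l. is_root (pencil_det Q1 Q2) l}"
  have "?X \<subseteq> {..m}" using le by blast
  then have "finite ?X" by (rule finite_subset) simp
  moreover have "m \<in> ?X" using rmT rootT by blast
  ultimately show ?thesis
    unfolding max_root_multiplicity_def using le by (intro Max_eqI) blast+
qed

subsection \<open>Sublevel sets of the determinant\<close>

text \<open>Two successive affine substitutions in one variable. The substitution in the general
  case divides by \<open>c\<close>, so the quarter turns c = 0 are treated apart.\<close>

lemma nn_integral_rotate:
  fixes g :: "real \<times> real \<Rightarrow> ennreal"
  assumes g[measurable]: "g \<in> borel_measurable borel" and cs: "c\<^sup>2 + s\<^sup>2 = 1"
  shows "(\<integral>\<^sup>+z. g (c * fst z + s * snd z, - s * fst z + c * snd z) \<partial>lborel) = (\<integral>\<^sup>+z. g z \<partial>lborel)"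
proof -
  have gm[measurable]: "g \<in> borel_measurable (lborel \<Otimes>\<^sub>M lborel)"
    using g by (simp add: lborel_prod)
  have "(\<lambda>z. g (c * fst z + s * snd z, - s * fst z + c * snd z)) \<in> borel_measurable (lborel \<Otimes>\<^sub>M lborel)"
    unfolding lborel_prod measurable_lborel2
    by (rule measurable_compose[OF borel_measurable_continuous_onI g]) (intro continuous_intros)
  then have "(\<integral>\<^sup>+z. g (c * fst z + s * snd z, - s * fst z + c * snd z) \<partial>lborel)
      = (\<integral>\<^sup>+y. (\<integral>\<^sup>+x. g (c * x + s * y, - s * x + c * y) \<partial>lborel) \<partial>lborel)"
    using lborel_pair.nn_integral_snd by (fastforce simp: lborel_prod)
  also have "\<dots> = (\<integral>\<^sup>+u. (\<integral>\<^sup>+v. g (u, v) \<partial>lborel) \<partial>lborel)"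
  proof (cases "c = 0")
    case True
    then have s: "s \<noteq> 0" "\<bar>s\<bar> = 1" using cs by (auto simp: power2_eq_1_iff)
    have "(\<integral>\<^sup>+x. g (s * y, - s * x) \<partial>lborel) = (\<integral>\<^sup>+v. g (s * y, v) \<partial>lborel)" for y
      using nn_integral_real_affine[of "\<lambda>v. g (s * y, v)" "- s" 0] s by simp
    moreover have "(\<integral>\<^sup>+y. (\<integral>\<^sup>+v. g (s * y, v) \<partial>lborel) \<partial>lborel) = (\<integral>\<^sup>+u. (\<integral>\<^sup>+v. g (u, v) \<partial>lborel) \<partial>lborel)"
      using nn_integral_real_affine[of "\<lambda>u. \<integral>\<^sup>+v. g (u, v) \<partial>lborel" s 0] s by simp
    ultimately show ?thesis using True by simp
  next
    case False
    have e: "- s * x + c * y = (y - s * (c * x + s * y)) / c" for x y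
    proof -
      have "y * (c\<^sup>2 + s\<^sup>2) = y" using cs by simp
      then show ?thesis using False by (simp add: field_simps power2_eq_square)
    qed
    have "(\<integral>\<^sup>+x. g (c * x + s * y, - s * x + c * y) \<partial>lborel)
        = ennreal (1 / \<bar>c\<bar>) * (\<integral>\<^sup>+u. g (u, (y - s * u) / c) \<partial>lborel)" for y
      using nn_integral_real_affine[of "\<lambda>u. g (u, (y - s * u) / c)" c "s * y"] False
      unfolding e by (simp add: mult.assoc[symmetric] ennreal_mult[symmetric] add.commute)
    then have "(\<integral>\<^sup>+y. (\<integral>\<^sup>+x. g (c * x + s * y, - s * x + c * y) \<partial>lborel) \<partial>lborel)
        = (\<integral>\<^sup>+y. ennreal (1 / \<bar>c\<bar>) * (\<integral>\<^sup>+u. g (u, (y - s * u) / c) \<partial>lborel) \<partial>lborel)"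
      by simp
    also have "\<dots> = (\<integral>\<^sup>+y. (\<integral>\<^sup>+u. ennreal (1 / \<bar>c\<bar>) * g (u, (y - s * u) / c) \<partial>lborel) \<partial>lborel)"
      by (simp add: nn_integral_cmult)
    also have "\<dots> = (\<integral>\<^sup>+u. (\<integral>\<^sup>+y. ennreal (1 / \<bar>c\<bar>) * g (u, (y - s * u) / c) \<partial>lborel) \<partial>lborel)"
      by (rule lborel_pair.Fubini') measurable
    also have "\<dots> = (\<integral>\<^sup>+u. (\<integral>\<^sup>+v. g (u, v) \<partial>lborel) \<partial>lborel)"
    proof (rule nn_integral_cong)
      fix u
      have "(\<integral>\<^sup>+v. g (u, v) \<partial>lborel) = ennreal \<bar>1 / c\<bar> * (\<integral>\<^sup>+y. g (u, - (s * u) / c + 1 / c * y) \<partial>lborel)"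
        using False by (intro nn_integral_real_affine) auto
      also have "(\<lambda>y. g (u, - (s * u) / c + 1 / c * y)) = (\<lambda>y. g (u, (y - s * u) / c))"
        by (simp add: diff_divide_distrib)
      finally show "(\<integral>\<^sup>+y. ennreal (1 / \<bar>c\<bar>) * g (u, (y - s * u) / c) \<partial>lborel) = (\<integral>\<^sup>+v. g (u, v) \<partial>lborel)"
        by (simp add: nn_integral_cmult)
    qed
    finally show ?thesis .
  qed
  also have "\<dots> = (\<integral>\<^sup>+z. g z \<partial>lborel)"
    using lborel.nn_integral_fst[OF gm] by (simp add: lborel_prod)
  finally show ?thesis .
qed

text \<open>A real x satisfies |x - r| \<ge> |x - Re r| for each complex root r. If x were farther
  than \<rho> from the real parts of all roots, the factorisation would make |q(x)| exceed \<eta>.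
  Only the degree and the leading coefficient enter, which makes the bound uniform over
  families.\<close>

lemma poly_sublevel:
  fixes q :: "real poly"
  assumes e: "degree q = e" "e > 0" and \<eta>: "\<eta> > 0"
  shows "emeasure lborel {x. \<bar>poly q x\<bar> \<le> \<eta>} \<le> ennreal (2 * real e * (\<eta> / \<bar>lead_coeff q\<bar>) powr (1 / e))"
proof -
  let ?l = "\<bar>lead_coeff q\<bar>"
  have l: "?l > 0" using e by auto
  define \<rho> where "\<rho> = (\<eta> / ?l) powr (1 / e)"
  have \<rho>: "\<rho> > 0" using \<eta> l by (simp add: \<rho>_def)
  have \<rho>e: "\<rho> ^ e = \<eta> / ?l"
    using \<eta> l e \<rho> by (simp add: \<rho>_def powr_realpow[symmetric] powr_powr)
  let ?qc = "map_poly complex_of_real q"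
  have "coeff ?qc e \<noteq> 0" using e leading_coeff_neq_0[of q] by (auto simp: coeff_map_poly)
  then have qc0: "?qc \<noteq> 0" by auto
  obtain X where X: "size X = degree ?qc" "?qc = smult (lead_coeff ?qc) (\<Prod>x\<in>#X. [:- x, 1:])"
    using alg_closed_imp_factorization[of ?qc] qc0 by metis
  have sX: "size X = e" using X(1) e by (simp add: degree_map_poly)
  have val: "\<bar>poly q x\<bar> = ?l * (\<Prod>r\<in>#X. cmod (of_real x - r))" for x
  proof -
    have "\<bar>poly q x\<bar> = cmod (poly ?qc (of_real x))"
    proof -
      have "poly ?qc (of_real x) = of_real (poly q x)" by (induction q) (auto simp: map_poly_pCons)
      then show ?thesis by simp
    qed
    also have "\<dots> = cmod (lead_coeff ?qc) * cmod (poly (\<Prod>x\<in>#X. [:- x, 1:]) (of_real x))"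
      by (subst X(2)) (simp add: norm_mult)
    also have "poly (\<Prod>x\<in>#X. [:- x, 1:]) (of_real x) = (\<Prod>r\<in>#X. of_real x - r)"
      by (induction X) (auto simp: algebra_simps)
    also have "cmod (\<Prod>r\<in>#X. of_real x - r) = (\<Prod>r\<in>#X. cmod (of_real x - r))"
      by (induction X) (auto simp: norm_mult)
    finally show ?thesis by (simp add: degree_map_poly coeff_map_poly)
  qed
  have "{x. \<bar>poly q x\<bar> \<le> \<eta>} \<subseteq> (\<Union>r\<in>set_mset X. {Re r - \<rho>..Re r + \<rho>})"
  proof
    fix x assume "x \<in> {x. \<bar>poly q x\<bar> \<le> \<eta>}"
    then have le: "?l * (\<Prod>r\<in>#X. cmod (of_real x - r)) \<le> \<eta>" by (simp add: val)
    show "x \<in> (\<Union>r\<in>set_mset X. {Re r - \<rho>..Re r + \<rho>})"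
    proof (rule ccontr)
      assume "x \<notin> (\<Union>r\<in>set_mset X. {Re r - \<rho>..Re r + \<rho>})"
      then have far: "cmod (of_real x - r) > \<rho>" if "r \<in># X" for r
        using that abs_Re_le_cmod[of "of_real x - r"] by (force simp: abs_if split: if_splits)
      have "\<rho> ^ size Y \<le> (\<Prod>r\<in>#Y. cmod (of_real x - r)) \<and> (Y \<noteq> {#} \<longrightarrow> \<rho> ^ size Y < (\<Prod>r\<in>#Y. cmod (of_real x - r)))"
        if "Y \<subseteq># X" for Y
        using that
      proof (induction Y)
        case (add r Y)
        have "r \<in># X" using add.prems by (meson mset_subset_eqD union_single_eq_member)
        then have "\<rho> < cmod (of_real x - r)" by (rule far)
        moreover have "\<rho> ^ size Y \<le> (\<Prod>r\<in>#Y. cmod (of_real x - r))"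
          using add by (meson mset_subset_eq_insertD subset_mset.less_imp_le)
        ultimately have "\<rho> * \<rho> ^ size Y < cmod (of_real x - r) * (\<Prod>r\<in>#Y. cmod (of_real x - r))"
          using \<rho> by (intro mult_less_le_imp_less) auto
        then show ?case by simp
      qed simp
      then have "\<rho> ^ e < (\<Prod>r\<in>#X. cmod (of_real x - r))" using sX e by force
      then have "\<eta> < ?l * (\<Prod>r\<in>#X. cmod (of_real x - r))" using l unfolding \<rho>e by (simp add: field_simps)
      with le show False by simp
    qed
  qed
  then have "emeasure lborel {x. \<bar>poly q x\<bar> \<le> \<eta>} \<le> emeasure lborel (\<Union>r\<in>set_mset X. {Re r - \<rho>..Re r + \<rho>})"
    by (intro emeasure_mono) auto
  also have "\<dots> \<le> (\<Sum>r\<in>set_mset X. emeasure lborel {Re r - \<rho>..Re r + \<rho>})"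
    by (intro emeasure_subadditive_finite) auto
  also have "\<dots> = (\<Sum>r\<in>set_mset X. ennreal (2 * \<rho>))"
    using \<rho> by (intro sum.cong) auto
  also have "\<dots> = of_nat (card (set_mset X)) * ennreal (2 * \<rho>)" by simp
  also have "\<dots> \<le> of_nat e * ennreal (2 * \<rho>)"
  proof -
    have "card (set_mset X) \<le> e"
      using sX size_mset_mono[OF mset_set_set_mset_msubset[of X]] by simp
    then show ?thesis by (intro mult_right_mono) simp_all
  qed
  also have "\<dots> = ennreal (2 * real e * \<rho>)"
    using \<rho> by (simp add: ennreal_of_nat_eq_real_of_nat ennreal_mult[symmetric] mult_ac)
  finally show ?thesis by (simp add: \<rho>_def)
qed

lemma continuous_on_det:
  fixes F :: "'a::topological_space \<Rightarrow> real^'n^'n"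
  assumes "continuous_on S F"
  shows "continuous_on S (\<lambda>x. det (F x))"
  unfolding det_def
  by (intro continuous_intros bounded_linear.continuous_on[OF bounded_linear_vec_nth] assms)

text \<open>In rotated variables the determinant is v^m H_v(u), where H_v has degree e = d - m and a
  leading coefficient p_m independent of v. For |v| up to a = (\<epsilon>/|p_m|)^(1/m) the u-slice
  is bounded trivially; beyond, it is at most a constant times |v|^(-m/e), which is integrable at
  infinity because m > e. Both ranges contribute a multiple of a.\<close>

lemma pencil_sublevel:
  fixes A B :: "real^'n^'n"
  assumes cs: "c\<^sup>2 + s\<^sup>2 = 1"
    and p: "p = pencil_poly (c *\<^sub>R A + s *\<^sub>R B) ((- s) *\<^sub>R A + c *\<^sub>R B)"
    and low: "\<And>j. j < m \<Longrightarrow> coeff p j = 0" and m: "coeff p m \<noteq> 0" "m \<le> CARD('n)" "CARD('n) < 2 * m"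
    and R: "R > 0"
  obtains U :: real where "U > 0"
    "\<And>\<epsilon>. \<epsilon> > 0 \<Longrightarrow> emeasure lborel {z :: real \<times> real. \<bar>fst z\<bar> \<le> R \<and> \<bar>snd z\<bar> \<le> R \<and> \<bar>det (fst z *\<^sub>R A + snd z *\<^sub>R B)\<bar> \<le> \<epsilon>}
      \<le> ennreal (U * \<epsilon> powr (1 / m))"
proof -
  let ?d = "CARD('n)"
  define M N where "M = c *\<^sub>R A + s *\<^sub>R B" and "N = (- s) *\<^sub>R A + c *\<^sub>R B"
  define e where "e = ?d - m"
  have m0: "m > 0" "e < m" using m by (auto simp: e_def)
  define H where "H v = (\<Sum>i\<le>e. monom (coeff p (m + i) * v ^ i) (e - i))" for v
  let ?l = "\<bar>coeff p m\<bar>"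
  have l: "?l > 0" using m by simp
  have csm: "c * c + s * s = 1" using cs by (simp add: power2_eq_square)
  have AB: "x *\<^sub>R A + y *\<^sub>R B = (c * x + s * y) *\<^sub>R M + (- s * x + c * y) *\<^sub>R N" for x y
  proof -
    have "(c * x + s * y) *\<^sub>R M + (- s * x + c * y) *\<^sub>R N = ((c * c + s * s) * x) *\<^sub>R A + ((c * c + s * s) * y) *\<^sub>R B"
      by (simp add: M_def N_def algebra_simps)
    then show ?thesis by (simp add: csm)
  qed
  have D: "det (u *\<^sub>R M + v *\<^sub>R N) = v ^ m * poly (H v) u" for u v
  proof -
    have "det (u *\<^sub>R M + v *\<^sub>R N) = (\<Sum>j\<in>{0..?d}. coeff p j * v ^ j * u ^ (?d - j))"
      unfolding det_pencil_eq_sum p M_def N_def atMost_atLeast0 ..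
    also have "\<dots> = (\<Sum>j\<in>{0+m..e+m}. coeff p j * v ^ j * u ^ (?d - j))"
      using m low by (intro sum.mono_neutral_right) (auto simp: e_def)
    also have "\<dots> = (\<Sum>i\<in>{0..e}. coeff p (i + m) * v ^ (i + m) * u ^ (?d - (i + m)))"
      by (rule sum.shift_bounds_cl_nat_ivl)
    also have "\<dots> = v ^ m * poly (H v) u"
      unfolding H_def poly_sum poly_monom sum_distrib_left atMost_atLeast0
      by (intro sum.cong refl) (auto simp: e_def power_add add.commute diff_diff_left mult_ac)
    finally show ?thesis .
  qed
  have degH: "degree (H v) = e" "lead_coeff (H v) = coeff p m" for v
  proof -
    have "coeff (H v) e = (\<Sum>i\<le>e. if i = 0 then coeff p (m + i) * v ^ i else 0)"
      unfolding H_def coeff_sum by (intro sum.cong refl) auto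
    then have 1: "coeff (H v) e = coeff p m" by simp
    have "degree (H v) \<le> e"
      unfolding H_def by (intro degree_sum_le) (auto intro: order_trans[OF degree_monom_le])
    moreover have "e \<le> degree (H v)" using 1 m by (intro le_degree) auto
    ultimately show "degree (H v) = e" by simp
    then show "lead_coeff (H v) = coeff p m" using 1 by simp
  qed
  define U where "U = 8 * R * ?l powr (- (1 / m)) + (if e = 0 then 0 else 4 * real e / (m / e - 1) * ?l powr (- (1 / m)))"
  have U: "U > 0" unfolding U_def using l R m0 by (auto intro!: add_pos_nonneg)
  have bound: "emeasure lborel {z :: real \<times> real. \<bar>fst z\<bar> \<le> R \<and> \<bar>snd z\<bar> \<le> R \<and> \<bar>det (fst z *\<^sub>R A + snd z *\<^sub>R B)\<bar> \<le> \<epsilon>}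
      \<le> ennreal (U * \<epsilon> powr (1 / m))" (is "emeasure _ ?E \<le> _") if \<epsilon>: "\<epsilon> > 0" for \<epsilon> :: real
  proof -
    define \<eta> where "\<eta> = \<epsilon> / ?l"
    have \<eta>: "\<eta> > 0" using \<epsilon> l by (simp add: \<eta>_def)
    define a where "a = \<eta> powr (1 / m)"
    have a: "a > 0" using \<eta> by (simp add: a_def)
    have am: "a ^ m = \<eta>" using \<eta> m0 a by (simp add: a_def powr_realpow[symmetric] powr_powr)
    \<comment> \<open>The rotation maps the square of half side R into the strip |u| \<le> 2R. No
      bound on v is kept, since the integral over large v converges.\<close>
    define G where "G = {(u, v). \<bar>u\<bar> \<le> 2 * R \<and> \<bar>det (u *\<^sub>R M + v *\<^sub>R N)\<bar> \<le> \<epsilon>}"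
    have G_closed: "closed G" unfolding G_def split_def
      by (intro closed_Collect_conj closed_Collect_le continuous_intros continuous_on_det) 
    have G[measurable]: "G \<in> sets borel" using G_closed by (rule borel_closed)
    have E: "closed ?E" by (intro closed_Collect_conj closed_Collect_le continuous_intros continuous_on_det)
    have small: "\<bar>c\<bar> \<le> 1" "\<bar>s\<bar> \<le> 1"
    proof -
      have "c\<^sup>2 \<le> 1\<^sup>2" "s\<^sup>2 \<le> 1\<^sup>2" unfolding power_one using cs zero_le_power2[of c] zero_le_power2[of s] by linarith+
      then show "\<bar>c\<bar> \<le> 1" "\<bar>s\<bar> \<le> 1" by (simp_all add: abs_square_le_1)
    qed
    have "emeasure lborel ?E = (\<integral>\<^sup>+z. indicator ?E z \<partial>lborel)"
      using E by (simp add: borel_closed)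
    also have "\<dots> \<le> (\<integral>\<^sup>+z. indicator G (c * fst z + s * snd z, - s * fst z + c * snd z) \<partial>lborel)"
    proof (rule nn_integral_mono)
      fix z :: "real \<times> real"
      have "(c * fst z + s * snd z, - s * fst z + c * snd z) \<in> G" if "z \<in> ?E"
      proof -
        have "\<bar>c * fst z + s * snd z\<bar> \<le> \<bar>c\<bar> * \<bar>fst z\<bar> + \<bar>s\<bar> * \<bar>snd z\<bar>"
          unfolding abs_mult[symmetric] by (rule abs_triangle_ineq)
        also have "\<dots> \<le> 1 * R + 1 * R" using that small R by (intro add_mono mult_mono) auto
        finally show ?thesis using that by (simp add: G_def AB)
      qed
      then show "indicator ?E z \<le> (indicator G (c * fst z + s * snd z, - s * fst z + c * snd z) :: ennreal)"
        by (auto simp: indicator_def)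
    qed
    also have "\<dots> = (\<integral>\<^sup>+z. indicator G z \<partial>lborel)"
      by (rule nn_integral_rotate[OF _ cs]) measurable
    also have "\<dots> = (\<integral>\<^sup>+v. (\<integral>\<^sup>+u. indicator G (u, v) \<partial>lborel) \<partial>lborel)"
      using lborel_pair.nn_integral_snd[of "indicator G"] G by (simp add: lborel_prod)
    also have "\<dots> \<le> (\<integral>\<^sup>+v. ennreal (4 * R) * indicator {-a..a} v
        + ennreal (if e = 0 then 0 else 2 * real e * \<eta> powr (1 / e)) * (ennreal (v powr (- (m / e))) * indicator {a..} v)
        + ennreal (if e = 0 then 0 else 2 * real e * \<eta> powr (1 / e)) * (ennreal ((- v) powr (- (m / e))) * indicator {a..} (- v)) \<partial>lborel)"
    proof (rule nn_integral_mono)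
      fix v :: real
      have eq: "(\<integral>\<^sup>+u. indicator G (u, v) \<partial>lborel) = emeasure lborel {u. (u, v) \<in> G}"
      proof -
        have "{u. (u, v) \<in> G} \<in> sets borel"
          using measurable_sets[of "\<lambda>u. (u, v)" borel borel G] G by (simp add: vimage_def)
        then have "(\<integral>\<^sup>+u. indicator {u. (u, v) \<in> G} u \<partial>lborel) = emeasure lborel {u. (u, v) \<in> G}" by simp
        then show ?thesis by (simp add: indicator_def)
      qed
      have 1: "(\<integral>\<^sup>+u. indicator G (u, v) \<partial>lborel) \<le> ennreal (4 * R)"
      proof -
        have "emeasure lborel {u. (u, v) \<in> G} \<le> emeasure lborel {- (2 * R)..2 * R}"
          by (intro emeasure_mono) (auto simp: G_def)
        then show ?thesis using R by (simp add: eq)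
      qed
      have 2: "(\<integral>\<^sup>+u. indicator G (u, v) \<partial>lborel)
          \<le> ennreal (if e = 0 then 0 else 2 * real e * \<eta> powr (1 / e)) * ennreal (\<bar>v\<bar> powr (- (m / e)))" if v: "\<bar>v\<bar> > a"
      proof -
        have vp: "\<bar>v\<bar> > 0" using v a by simp
        have sub: "{u. (u, v) \<in> G} \<subseteq> {u. \<bar>poly (H v) u\<bar> \<le> \<epsilon> / \<bar>v\<bar> ^ m}"
          using vp by (auto simp: G_def D abs_mult power_abs field_simps)
        show ?thesis
        proof (cases "e = 0")
          \<comment> \<open>Here the determinant is p_m v^m, so the slices with |v| > a are empty;
            this matches the value 0 of the constant for e = 0.\<close>
          case True
          then have "poly (H v) u = coeff p m" for u
            using degH[of v] by (metis degree_0_id lead_coeff_pCons(2) mult_zero_right poly_0 poly_pCons add.right_neutral coeff_pCons_0)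
          moreover have "\<epsilon> / \<bar>v\<bar> ^ m < ?l"
          proof -
            have "\<eta> < \<bar>v\<bar> ^ m" unfolding am[symmetric] using v a m0 by (intro power_strict_mono) auto
            then show ?thesis using l vp by (simp add: \<eta>_def field_simps)
          qed
          ultimately have "{u. (u, v) \<in> G} = {}" using sub by auto
          then show ?thesis by (simp add: eq)
        next
          case False
          have "emeasure lborel {u. (u, v) \<in> G} \<le> emeasure lborel {u. \<bar>poly (H v) u\<bar> \<le> \<epsilon> / \<bar>v\<bar> ^ m}"
            by (intro emeasure_mono sub) (auto intro!: borel_closed closed_Collect_le continuous_intros)
          also have "\<dots> \<le> ennreal (2 * real e * (\<epsilon> / \<bar>v\<bar> ^ m / \<bar>lead_coeff (H v)\<bar>) powr (1 / e))"
            using degH[of v] False \<epsilon> vp by (intro poly_sublevel) auto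
          also have "\<epsilon> / \<bar>v\<bar> ^ m / \<bar>lead_coeff (H v)\<bar> = \<eta> * \<bar>v\<bar> powr (- m)"
            using vp degH[of v] by (simp add: \<eta>_def powr_minus powr_realpow field_simps)
          also have "(\<eta> * \<bar>v\<bar> powr (- m)) powr (1 / e) = \<eta> powr (1 / e) * \<bar>v\<bar> powr (- (m / e))"
            using \<eta> by (simp add: powr_mult powr_powr)
          finally show ?thesis using False \<eta> by (simp add: eq ennreal_mult[symmetric] mult.assoc)
        qed
      qed
      show "(\<integral>\<^sup>+u. indicator G (u, v) \<partial>lborel) \<le> ennreal (4 * R) * indicator {-a..a} v
        + ennreal (if e = 0 then 0 else 2 * real e * \<eta> powr (1 / e)) * (ennreal (v powr (- (m / e))) * indicator {a..} v)
        + ennreal (if e = 0 then 0 else 2 * real e * \<eta> powr (1 / e)) * (ennreal ((- v) powr (- (m / e))) * indicator {a..} (- v))"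
      proof -
        consider "\<bar>v\<bar> \<le> a" | "v > a" | "- v > a" by linarith
        then show ?thesis
        proof cases
          case 1
          then have "v \<in> {-a..a}" by auto
          then show ?thesis using \<open>(\<integral>\<^sup>+u. indicator G (u, v) \<partial>lborel) \<le> ennreal (4 * R)\<close>
            by (simp add: add_increasing2 add.assoc)
        next
          case 2
          then have "\<bar>v\<bar> = v" "v \<notin> {-a..a}" "v \<in> {a..}" "- v \<notin> {a..}" "\<bar>v\<bar> > a" using a by auto
          then show ?thesis using \<open>\<bar>v\<bar> > a \<Longrightarrow> _\<close> by simp
        next
          case 3
          then have "\<bar>v\<bar> = - v" "v \<notin> {-a..a}" "v \<notin> {a..}" "- v \<in> {a..}" "\<bar>v\<bar> > a" using a by auto
          then show ?thesis using \<open>\<bar>v\<bar> > a \<Longrightarrow> _\<close> by simp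
        qed
      qed
    qed
    also have "\<dots> = ennreal (4 * R) * ennreal (2 * a)
        + ennreal (if e = 0 then 0 else 2 * real e * \<eta> powr (1 / e)) * (\<integral>\<^sup>+v. ennreal (v powr (- (m / e))) * indicator {a..} v \<partial>lborel)
        + ennreal (if e = 0 then 0 else 2 * real e * \<eta> powr (1 / e)) * (\<integral>\<^sup>+v. ennreal (v powr (- (m / e))) * indicator {a..} v \<partial>lborel)"
    proof -
      have "(\<integral>\<^sup>+v. ennreal ((- v) powr (- (m / e))) * indicator {a..} (- v) \<partial>lborel)
          = (\<integral>\<^sup>+v. ennreal (v powr (- (m / e))) * indicator {a..} v \<partial>lborel)"
        using nn_integral_real_affine[of "\<lambda>v. ennreal (v powr (- (m / e))) * indicator {a..} v" "-1" 0] by simp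
      then show ?thesis using a by (simp add: nn_integral_add nn_integral_cmult)
    qed
    also have "\<dots> \<le> ennreal (U * \<epsilon> powr (1 / m))"
    proof -
      have aU: "a = \<epsilon> powr (1 / m) * ?l powr (- (1 / m))"
        using \<epsilon> l by (simp add: a_def \<eta>_def powr_divide powr_minus field_simps)
      show ?thesis
      proof (cases "e = 0")
        case True
        then show ?thesis using R a by (simp add: U_def aU ennreal_mult[symmetric] mult_ac)
      next
        case False
        have me: "m / e > 1" using m0 False by simp
        have "\<eta> powr (1 / e) * a powr (1 - m / e) = a"
          unfolding a_def using \<eta> m0 False by (simp add: powr_powr powr_add[symmetric] diff_divide_distrib)
        then have eqE: "2 * real e * \<eta> powr (1 / e) * (a powr (1 - m / e) / (m / e - 1)) = 2 * real e / (m / e - 1) * a"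
          by simp
        have "ennreal (2 * real e * \<eta> powr (1 / e)) * ennreal (a powr (1 - m / e) / (m / e - 1))
            = ennreal (2 * real e * \<eta> powr (1 / e) * (a powr (1 - m / e) / (m / e - 1)))"
          using me \<eta> by (intro ennreal_mult[symmetric]) auto
        also note eqE
        finally have *: "ennreal (2 * real e * \<eta> powr (1 / e)) * ennreal (a powr (1 - m / e) / (m / e - 1))
            = ennreal (2 * real e / (m / e - 1) * a)" .
        have "ennreal (4 * R) * ennreal (2 * a)
          + ennreal (2 * real e * \<eta> powr (1 / e)) * ennreal (a powr (1 - m / e) / (m / e - 1))
          + ennreal (2 * real e * \<eta> powr (1 / e)) * ennreal (a powr (1 - m / e) / (m / e - 1))
          = ennreal (4 * R * (2 * a) + 2 * real e / (m / e - 1) * a + 2 * real e / (m / e - 1) * a)"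
        proof -
          have "ennreal (4 * R) * ennreal (2 * a) + ennreal q + ennreal q = ennreal (4 * R * (2 * a) + q + q)" if "q \<ge> 0" for q
            using R a that by (simp add: ennreal_mult[symmetric] flip: ennreal_plus)
          from this[of "2 * real e / (m / e - 1) * a"] show ?thesis
            using a me by (simp only: *) simp
        qed
        also have "4 * R * (2 * a) + 2 * real e / (m / e - 1) * a + 2 * real e / (m / e - 1) * a = U * \<epsilon> powr (1 / m)"
          using False by (simp add: U_def aU algebra_simps)
        finally show ?thesis using False nn_integral_powr_from[OF me a] by simp
      qed
    qed
    finally show ?thesis .
  qed
  show ?thesis using that[OF U bound] .
qed

subsection \<open>Measurability and Fubini in Borel form\<close>

lemma borel_measurable_comp_continuous:
  assumes "g \<in> borel_measurable borel" "continuous_on UNIV \<phi>"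
  shows "(\<lambda>p. g (\<phi> p)) \<in> borel_measurable borel"
  by (rule measurable_compose[OF borel_measurable_continuous_onI[OF assms(2)] assms(1)])

lemma borel_measurable_nn_integral_lborel:
  fixes f :: "'a::second_countable_topology \<Rightarrow> 'b::euclidean_space \<Rightarrow> ennreal"
  assumes "(\<lambda>p. f (fst p) (snd p)) \<in> borel_measurable borel"
  shows "(\<lambda>x. \<integral>\<^sup>+y. f x y \<partial>lborel) \<in> borel_measurable borel"
proof (rule lborel.borel_measurable_nn_integral)
  have "(\<lambda>p. f (fst p) (snd p)) \<in> borel_measurable (borel \<Otimes>\<^sub>M borel)"
    using assms by (simp add: borel_prod)
  then show "(\<lambda>(x, y). f x y) \<in> borel_measurable (borel \<Otimes>\<^sub>M lborel)"
    by (simp add: split_def cong: measurable_cong_sets)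
qed

lemma nn_integral_lborel_swap:
  fixes f :: "'a::euclidean_space \<Rightarrow> 'b::euclidean_space \<Rightarrow> ennreal"
  assumes "(\<lambda>p. f (fst p) (snd p)) \<in> borel_measurable borel"
  shows "(\<integral>\<^sup>+x. (\<integral>\<^sup>+y. f x y \<partial>lborel) \<partial>lborel) = (\<integral>\<^sup>+y. (\<integral>\<^sup>+x. f x y \<partial>lborel) \<partial>lborel)"
proof (rule lborel_pair.Fubini'[symmetric])
  show "(\<lambda>(y, x). f y x) \<in> borel_measurable (lborel \<Otimes>\<^sub>M lborel)"
    using assms by (simp add: lborel_prod split_def)
qed

lemma nn_integral_lborel_pair:
  fixes f :: "'a::euclidean_space \<times> 'b::euclidean_space \<Rightarrow> ennreal"
  assumes "f \<in> borel_measurable borel"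
  shows "(\<integral>\<^sup>+p. f p \<partial>lborel) = (\<integral>\<^sup>+x. (\<integral>\<^sup>+y. f (x, y) \<partial>lborel) \<partial>lborel)"
proof -
  have "f \<in> borel_measurable (lborel \<Otimes>\<^sub>M lborel)" using assms by (simp add: lborel_prod)
  from lborel.nn_integral_fst[OF this] show ?thesis by (simp add: lborel_prod)
qed

lemma nn_integral_lborel_translate:
  fixes h :: "'a::euclidean_space \<Rightarrow> ennreal"
  assumes [measurable]: "h \<in> borel_measurable borel"
  shows "(\<integral>\<^sup>+x. h (x + y) \<partial>lborel) = (\<integral>\<^sup>+x. h x \<partial>lborel)"
proof -
  have "(\<integral>\<^sup>+x. h x \<partial>lborel) = (\<integral>\<^sup>+x. h x \<partial>(distr lborel borel ((+) y)))"
    by (simp only: lborel_distr_plus)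
  also have "\<dots> = (\<integral>\<^sup>+x. h (x + y) \<partial>lborel)"
    by (simp add: nn_integral_distr add.commute)
  finally show ?thesis by simp
qed

lemma translate_borel:
  fixes X :: "'a::euclidean_space set"
  assumes "X \<in> sets borel"
  shows "{z. z + y \<in> X} \<in> sets borel" "emeasure lborel {z. z + y \<in> X} = emeasure lborel X"
proof -
  have "(\<lambda>z. z + y) \<in> borel_measurable borel" by simp
  from measurable_sets[OF this assms] show m: "{z. z + y \<in> X} \<in> sets borel"
    unfolding vimage_def space_borel Int_UNIV_right .
  have "emeasure lborel {z. z + y \<in> X} = (\<integral>\<^sup>+z. indicator {z. z + y \<in> X} z \<partial>lborel)"
    using m by (intro nn_integral_indicator[symmetric]) (simp only: sets_lborel)
  also have "\<dots> = (\<integral>\<^sup>+z. indicator X (z + y) \<partial>lborel)"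
    by (simp only: indicator_def mem_Collect_eq)
  also have "\<dots> = (\<integral>\<^sup>+z. indicator X z \<partial>lborel)"
    using assms by (intro nn_integral_lborel_translate borel_measurable_indicator)
  also have "\<dots> = emeasure lborel X"
    using assms by (intro nn_integral_indicator) (simp only: sets_lborel)
  finally show "emeasure lborel {z. z + y \<in> X} = emeasure lborel X" .
qed

lemma nn_integral_lborel_reflect:
  fixes h :: "'a::euclidean_space \<Rightarrow> ennreal"
  assumes [measurable]: "h \<in> borel_measurable borel"
  shows "(\<integral>\<^sup>+x. h (y - x) \<partial>lborel) = (\<integral>\<^sup>+x. h x \<partial>lborel)"
proof -
  have "lborel = distr lborel borel (\<lambda>x::'a. y + (-1) *\<^sub>R x)"
    using lborel_affine[of "-1" y] by (simp add: density_1)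
  then have "(\<integral>\<^sup>+x. h x \<partial>lborel) = (\<integral>\<^sup>+x. h x \<partial>(distr lborel borel (\<lambda>x. y + (-1) *\<^sub>R x)))" by simp
  also have "\<dots> = (\<integral>\<^sup>+x. h (y - x) \<partial>lborel)"
    by (subst nn_integral_distr) auto
  finally show ?thesis by simp
qed

lemma continuous_on_matrix_vector_mult [continuous_intros]:
  fixes A :: "real^'n^'m"
  assumes "continuous_on S f"
  shows "continuous_on S (\<lambda>x. A *v f x)"
  by (rule bounded_linear.continuous_on[OF matrix_vector_mul_bounded_linear assms])

text \<open>The integrals may be 0 or infinite. If one factor on the right is 0, f vanishes almost
  everywhere; if none is 0 and one is infinite, the right-hand side is infinite; the rest is
  \<open>nn_integral_Holder\<close> with \<theta> = 1/(n+1).\<close>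

lemma nn_integral_Holder_power:
  fixes f g h :: "'a \<Rightarrow> real"
  assumes [measurable]: "f \<in> borel_measurable M" "g \<in> borel_measurable M" "h \<in> borel_measurable M"
    and f: "\<And>x. f x \<ge> 0" and g: "\<And>x. g x \<ge> 0" and h: "\<And>x. h x \<ge> 0" and n: "n > 0"
    and le: "AE x in M. f x ^ Suc n \<le> g x * h x ^ n"
  shows "(\<integral>\<^sup>+x. ennreal (f x) \<partial>M) ^ Suc n \<le> (\<integral>\<^sup>+x. ennreal (g x) \<partial>M) * (\<integral>\<^sup>+x. ennreal (h x) \<partial>M) ^ n"
proof -
  let ?G = "\<integral>\<^sup>+x. ennreal (g x) \<partial>M" and ?H = "\<integral>\<^sup>+x. ennreal (h x) \<partial>M"
  consider "?G = 0 \<or> ?H = 0" | "?G \<noteq> 0" "?H \<noteq> 0" "?G = \<infinity> \<or> ?H = \<infinity>" | "?G \<noteq> 0" "?H \<noteq> 0" "?G < \<infinity>" "?H < \<infinity>"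
    by (auto simp: less_top[symmetric])
  then show ?thesis
  proof cases
    case 1
    then have "(AE x in M. g x \<le> 0) \<or> (AE x in M. h x \<le> 0)"
      by (simp add: nn_integral_0_iff_AE ennreal_eq_0_iff)
    then have "AE x in M. g x * h x ^ n = 0"
    proof
      assume "AE x in M. g x \<le> 0"
      then show ?thesis by eventually_elim (use g in \<open>force intro: antisym\<close>)
    next
      assume "AE x in M. h x \<le> 0"
      then show ?thesis
      proof eventually_elim
        fix x assume "h x \<le> 0"
        then have "h x = 0" using h[of x] by simp
        then show "g x * h x ^ n = 0" using n by simp
      qed
    qed
    with le have "AE x in M. ennreal (f x) = 0"
    proof eventually_elim
      fix x assume "f x ^ Suc n \<le> g x * h x ^ n" "g x * h x ^ n = 0"
      then have "f x ^ Suc n \<le> 0" by simp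
      then show "ennreal (f x) = 0"
        using f[of x] by (metis ennreal_0 order_antisym power_eq_0_iff zero_le_power)
    qed
    then have "(\<integral>\<^sup>+x. ennreal (f x) \<partial>M) = 0" by (subst nn_integral_0_iff_AE) auto
    then show ?thesis by simp
  next
    case 2
    then have "?G * ?H ^ n = \<infinity>"
      using n by (auto simp: ennreal_mult_eq_top_iff ennreal_top_mult power_eq_top_ennreal)
    then show ?thesis by simp
  next
    case 3
    define a b where "a = enn2real ?G" and "b = enn2real ?H"
    have ab: "?G = ennreal a" "?H = ennreal b" "a \<ge> 0" "b \<ge> 0" using 3 by (auto simp: a_def b_def)
    define t where "t = 1 / real (Suc n)"
    have t: "0 < t" "t < 1" "1 - t = real n / real (Suc n)" using n by (auto simp: t_def field_simps)
    have "(\<integral>\<^sup>+x. ennreal (f x) \<partial>M) \<le> (\<integral>\<^sup>+x. ennreal (g x powr t * h x powr (1 - t)) \<partial>M)"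
    proof (rule nn_integral_mono_AE, use le in eventually_elim)
      fix x assume le: "f x ^ Suc n \<le> g x * h x ^ n"
      have "f x = (f x ^ Suc n) powr t"
        using f[of x] by (simp add: t_def powr_realpow'[symmetric] powr_powr del: power_Suc)
      also have "\<dots> \<le> (g x * h x ^ n) powr t"
        using f[of x] t le by (intro powr_mono2) auto
      also have "\<dots> = g x powr t * h x powr (1 - t)"
        using g[of x] h[of x] n unfolding t(3) by (simp add: powr_mult t_def powr_realpow'[symmetric] powr_powr)
      finally show "ennreal (f x) \<le> ennreal (g x powr t * h x powr (1 - t))" by (rule ennreal_leI)
    qed
    also have "\<dots> \<le> ennreal (a powr t * b powr (1 - t))"
      using g h t ab by (intro nn_integral_Holder) auto
    finally have "(\<integral>\<^sup>+x. ennreal (f x) \<partial>M) ^ Suc n \<le> ennreal (a powr t * b powr (1 - t)) ^ Suc n"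
      by (rule power_mono) simp
    also have "\<dots> = ennreal ((a powr t * b powr (1 - t)) ^ Suc n)"
      by (rule ennreal_power) simp
    also have "(a powr t * b powr (1 - t)) ^ Suc n = a * b ^ n"
      using ab n unfolding t(3) by (simp add: power_mult_distrib powr_realpow'[symmetric] powr_powr t_def del: power_Suc)
    also have "ennreal (a * b ^ n) = ?G * ?H ^ n"
      using ab by (simp add: ennreal_mult ennreal_power)
    finally show ?thesis .
  qed
qed

subsection \<open>The fibre estimate\<close>

text \<open>For Hessians A and B and z = (s, t) this is the displacement of the transform. It is
  linear both in z, so that displacements can be subtracted, and in \<xi>, so that \<xi> can be
  substituted.\<close>

definition shift :: "real^'n^'n \<Rightarrow> real^'n^'n \<Rightarrow> real^'n \<Rightarrow> real \<times> real \<Rightarrow> real^'n" where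
  "shift A B \<xi> z = fst z *\<^sub>R (A *v \<xi>) + snd z *\<^sub>R (B *v \<xi>)"

definition det_form :: "real^'n^'n \<Rightarrow> real^'n^'n \<Rightarrow> real \<times> real \<Rightarrow> real" where
  "det_form A B z = det (fst z *\<^sub>R A + snd z *\<^sub>R B)"

lemma shift_eq: "shift A B \<xi> z = (fst z *\<^sub>R A + snd z *\<^sub>R B) *v \<xi>"
  by (simp add: shift_def matrix_vector_mult_add_rdistrib scaleR_matrix_vector_assoc)

lemma continuous_on_shift [continuous_intros]:
  "continuous_on S f \<Longrightarrow> continuous_on S g \<Longrightarrow> continuous_on S (\<lambda>x. shift A B (f x) (g x))"
  unfolding shift_def by (intro continuous_intros)

lemma shift_diff: "shift A B \<xi> z - shift A B \<xi> w = shift A B \<xi> (z - w)"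
  by (simp add: shift_def algebra_simps)

lemma nn_integral_fibre:
  fixes A B :: "real^'n^'n" and h :: "real^'n \<Rightarrow> ennreal"
  assumes [measurable]: "h \<in> borel_measurable borel" and D: "det_form A B z \<noteq> 0"
  shows "(\<integral>\<^sup>+\<xi>. h (y - shift A B \<xi> z) \<partial>lborel) = ennreal (1 / \<bar>det_form A B z\<bar>) * (\<integral>\<^sup>+x. h x \<partial>lborel)"
proof -
  let ?L = "fst z *\<^sub>R A + snd z *\<^sub>R B"
  have m: "(\<lambda>v. h (y - v)) \<in> borel_measurable borel" by measurable
  have "(\<integral>\<^sup>+x. h x \<partial>lborel) = (\<integral>\<^sup>+v. h (y - v) \<partial>lborel)"
    by (rule nn_integral_lborel_reflect[symmetric]) measurable
  also have "\<dots> = ennreal \<bar>det ?L\<bar> * (\<integral>\<^sup>+\<xi>. h (y - ?L *v \<xi>) \<partial>lborel)"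
    using nn_integral_matrix_vector_mult[OF _ m, of ?L] D by (simp add: det_form_def)
  finally have "ennreal (1 / \<bar>det_form A B z\<bar>) * (\<integral>\<^sup>+x. h x \<partial>lborel)
      = ennreal (1 / \<bar>det_form A B z\<bar>) * ennreal \<bar>det_form A B z\<bar> * (\<integral>\<^sup>+\<xi>. h (y - shift A B \<xi> z) \<partial>lborel)"
    by (simp add: shift_eq det_form_def mult.assoc)
  then show ?thesis using D by (simp add: ennreal_mult[symmetric])
qed

text \<open>Minkowski's inequality in L^(m+1) of \<xi>, over all planes through the point y at
  height z1. The weight w(z) majorises the norm of the slice at z after the substitution in \<xi>.
  Hoelder with this weight bounds the (m+1)-st power of the plane integral by the integral of
  f^(m+1) w^(-m) times the m-th power of the integral of w, and integration in \<xi> turns the first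
  factor into at most one more integral of w.\<close>

lemma fibre_Minkowski:
  fixes A B :: "real^'n^'n" and f :: "(real^'n) \<times> real \<times> real \<Rightarrow> real" and w :: "real \<times> real \<Rightarrow> real"
  assumes f[measurable]: "f \<in> borel_measurable borel" and w[measurable]: "w \<in> borel_measurable borel"
    and f0: "\<And>p. f p \<ge> 0" and w0: "\<And>z. w z \<ge> 0" and m: "m > 0"
    and AE: "AE z in lborel. (\<forall>x. f (x, z) = 0) \<or> (w z > 0 \<and> det_form A B (z - z1) \<noteq> 0
      \<and> (\<integral>\<^sup>+x. ennreal (f (x, z) ^ Suc m) \<partial>lborel) \<le> ennreal (\<bar>det_form A B (z - z1)\<bar> * w z ^ Suc m))"
  shows "(\<integral>\<^sup>+\<xi>. (\<integral>\<^sup>+z. ennreal (f (y + shift A B \<xi> z1 - shift A B \<xi> z, z)) \<partial>lborel) ^ Suc m \<partial>lborel)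
    \<le> (\<integral>\<^sup>+z. ennreal (w z) \<partial>lborel) ^ Suc m"
proof -
  let ?W = "\<integral>\<^sup>+z. ennreal (w z) \<partial>lborel"
  have cf: "(\<lambda>p. f (y + shift A B (\<phi> p) z1 - shift A B (\<phi> p) (\<psi> p), \<psi> p)) \<in> borel_measurable borel"
    if "continuous_on UNIV \<phi>" "continuous_on UNIV \<psi>" for \<phi> :: "'z::topological_space \<Rightarrow> _" and \<psi>
    by (rule borel_measurable_comp_continuous[OF f]) (intro continuous_intros that)
  let ?f = "\<lambda>\<xi> z. f (y + shift A B \<xi> z1 - shift A B \<xi> z, z)"
  have [measurable]: "(\<lambda>z. ?f \<xi> z) \<in> borel_measurable borel" "(\<lambda>\<xi>. ?f \<xi> z) \<in> borel_measurable borel" for \<xi> z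
    by (intro cf continuous_intros)+
  have fm[measurable]: "(\<lambda>p. ?f (fst p) (snd p)) \<in> borel_measurable borel"
    by (intro cf continuous_intros)
  have wm[measurable]: "(\<lambda>p::(real^'n) \<times> (real \<times> real). w (snd p)) \<in> borel_measurable borel"
    by (intro borel_measurable_comp_continuous[OF w] continuous_intros)
  let ?g = "\<lambda>\<xi> z. ?f \<xi> z ^ Suc m * inverse (w z ^ m)"
  have gm: "(\<lambda>p. ennreal (?g (fst p) (snd p))) \<in> borel_measurable borel" by measurable
  have "(\<integral>\<^sup>+\<xi>. (\<integral>\<^sup>+z. ennreal (?f \<xi> z) \<partial>lborel) ^ Suc m \<partial>lborel)
      \<le> (\<integral>\<^sup>+\<xi>. (\<integral>\<^sup>+z. ennreal (?g \<xi> z) \<partial>lborel) * ?W ^ m \<partial>lborel)"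
  proof (intro nn_integral_mono nn_integral_Holder_power)
    fix \<xi>
    show "AE z in lborel. ?f \<xi> z ^ Suc m \<le> ?g \<xi> z * w z ^ m"
      using AE by eventually_elim (use m in \<open>auto simp: mult.assoc\<close>)
  qed (use f0 w0 m in \<open>auto\<close>)
  also have "\<dots> = (\<integral>\<^sup>+\<xi>. (\<integral>\<^sup>+z. ennreal (?g \<xi> z) \<partial>lborel) \<partial>lborel) * ?W ^ m"
    by (intro nn_integral_multc) (simp only: measurable_lborel2, rule borel_measurable_nn_integral_lborel[OF gm])
  also have "(\<integral>\<^sup>+\<xi>. (\<integral>\<^sup>+z. ennreal (?g \<xi> z) \<partial>lborel) \<partial>lborel) = (\<integral>\<^sup>+z. (\<integral>\<^sup>+\<xi>. ennreal (?g \<xi> z) \<partial>lborel) \<partial>lborel)"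
    by (rule nn_integral_lborel_swap[OF gm])
  also have "\<dots> \<le> ?W"
  proof (rule nn_integral_mono_AE, use AE in eventually_elim)
    fix z assume z: "(\<forall>x. f (x, z) = 0) \<or> (w z > 0 \<and> det_form A B (z - z1) \<noteq> 0
      \<and> (\<integral>\<^sup>+x. ennreal (f (x, z) ^ Suc m) \<partial>lborel) \<le> ennreal (\<bar>det_form A B (z - z1)\<bar> * w z ^ Suc m))"
    show "(\<integral>\<^sup>+\<xi>. ennreal (?g \<xi> z) \<partial>lborel) \<le> ennreal (w z)"
      using z
    proof
      assume "\<forall>x. f (x, z) = 0"
      then show ?thesis by simp
    next
      assume *: "w z > 0 \<and> det_form A B (z - z1) \<noteq> 0
        \<and> (\<integral>\<^sup>+x. ennreal (f (x, z) ^ Suc m) \<partial>lborel) \<le> ennreal (\<bar>det_form A B (z - z1)\<bar> * w z ^ Suc m)"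
      let ?D = "\<bar>det_form A B (z - z1)\<bar>"
      have fz[measurable]: "(\<lambda>x. f (x, z)) \<in> borel_measurable borel"
        by (intro borel_measurable_comp_continuous[OF f] continuous_intros)
      have "(\<integral>\<^sup>+\<xi>. ennreal (?g \<xi> z) \<partial>lborel) = (\<integral>\<^sup>+\<xi>. ennreal (f (y - shift A B \<xi> (z - z1), z) ^ Suc m) * ennreal (inverse (w z ^ m)) \<partial>lborel)"
        using * f0 by (intro nn_integral_cong) (simp add: ennreal_mult shift_diff[symmetric] algebra_simps del: power_Suc)
      also have "\<dots> = (\<integral>\<^sup>+\<xi>. ennreal (f (y - shift A B \<xi> (z - z1), z) ^ Suc m) \<partial>lborel) * ennreal (inverse (w z ^ m))"
      proof (rule nn_integral_multc)
        have "(\<lambda>\<xi>. f (y - shift A B \<xi> (z - z1), z)) \<in> borel_measurable borel"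
          by (intro borel_measurable_comp_continuous[OF f] continuous_intros)
        then show "(\<lambda>\<xi>. ennreal (f (y - shift A B \<xi> (z - z1), z) ^ Suc m)) \<in> borel_measurable lborel" by measurable
      qed
      also have "(\<integral>\<^sup>+\<xi>. ennreal (f (y - shift A B \<xi> (z - z1), z) ^ Suc m) \<partial>lborel)
          = ennreal (1 / ?D) * (\<integral>\<^sup>+x. ennreal (f (x, z) ^ Suc m) \<partial>lborel)"
        using * by (intro nn_integral_fibre[where h = "\<lambda>x. ennreal (f (x, z) ^ Suc m)"]) auto
      also have "\<dots> * ennreal (inverse (w z ^ m)) \<le> ennreal (1 / ?D) * ennreal (?D * w z ^ Suc m) * ennreal (inverse (w z ^ m))"
        using * by (intro mult_right_mono mult_left_mono) auto
      also have "\<dots> = ennreal (w z)"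
        using * by (simp add: ennreal_mult[symmetric])
      finally show ?thesis .
    qed
  qed
  finally show ?thesis by (simp add: mult_right_mono)
qed

text \<open>Hoelder on each plane separates one factor carrying \<open>f0\<close> from m + 1 factors
  carrying \<open>f1\<close>. The single factor selects a point (x, z1) of the plane; once x is
  translated along the plane, the other factors run over all planes through that point, where
  Minkowski in \<xi> applies.\<close>

lemma star_estimate:
  fixes A B :: "real^'n^'n" and f f0 f1 :: "(real^'n) \<times> real \<times> real \<Rightarrow> real"
    and w :: "real \<times> real \<Rightarrow> real \<times> real \<Rightarrow> real"
  assumes f[measurable]: "f \<in> borel_measurable borel" and f0[measurable]: "f0 \<in> borel_measurable borel"
    and f1[measurable]: "f1 \<in> borel_measurable borel"
    and w[measurable]: "\<And>z1. w z1 \<in> borel_measurable borel"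
    and pos: "\<And>p. f p \<ge> 0" "\<And>p. f0 p \<ge> 0" "\<And>p. f1 p \<ge> 0" "\<And>z z'. w z z' \<ge> 0" and m: "m > 0"
    and le: "\<And>p. f p ^ Suc (Suc m) \<le> f0 p * f1 p ^ Suc m"
    and S: "\<And>x z. z \<notin> S \<Longrightarrow> f0 (x, z) = 0"
    and AE: "\<And>z1. z1 \<in> S \<Longrightarrow> AE z in lborel. (\<forall>x. f1 (x, z) = 0) \<or> (w z1 z > 0 \<and> det_form A B (z - z1) \<noteq> 0
      \<and> (\<integral>\<^sup>+x. ennreal (f1 (x, z) ^ Suc m) \<partial>lborel) \<le> ennreal (\<bar>det_form A B (z - z1)\<bar> * w z1 z ^ Suc m))"
  shows "(\<integral>\<^sup>+\<xi>. (\<integral>\<^sup>+x. (\<integral>\<^sup>+z. ennreal (f (x - shift A B \<xi> z, z)) \<partial>lborel) ^ Suc (Suc m) \<partial>lborel) \<partial>lborel)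
    \<le> (\<integral>\<^sup>+z1. (\<integral>\<^sup>+x. ennreal (f0 (x, z1)) \<partial>lborel) * (\<integral>\<^sup>+z. ennreal (w z1 z) \<partial>lborel) ^ Suc m \<partial>lborel)"
proof -
  define W where "W q = (\<integral>\<^sup>+z. ennreal (f1 (fst q - shift A B (snd q) z, z)) \<partial>lborel)" for q
  have cm: "(\<lambda>p. h (\<phi> p - shift A B (\<psi> p) (\<chi>' p), \<chi>' p)) \<in> borel_measurable borel"
    if "h \<in> borel_measurable borel" "continuous_on UNIV \<phi>" "continuous_on UNIV \<psi>" "continuous_on UNIV \<chi>'"
    for h :: "(real^'n) \<times> real \<times> real \<Rightarrow> real" and \<phi> \<psi> :: "'z::topological_space \<Rightarrow> real^'n" and \<chi>'
    by (rule borel_measurable_comp_continuous[OF that(1)]) (intro continuous_intros that(2-))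
  have [measurable]: "(\<lambda>z. h (x - shift A B \<xi> z, z)) \<in> borel_measurable borel"
    if "h \<in> borel_measurable borel" for h :: "(real^'n) \<times> real \<times> real \<Rightarrow> real" and x \<xi>
    by (intro cm that continuous_intros)
  have W[measurable]: "W \<in> borel_measurable borel"
    unfolding W_def
    by (intro borel_measurable_nn_integral_lborel measurable_compose[OF _ measurable_ennreal] cm f1 continuous_intros)
  have Wc: "(\<lambda>p. W (\<phi> p)) \<in> borel_measurable borel" if "continuous_on UNIV \<phi>" for \<phi> :: "'z::topological_space \<Rightarrow> _"
    by (rule borel_measurable_comp_continuous[OF W that])
  have f0c: "(\<lambda>p. ennreal (f0 (\<phi> p))) \<in> borel_measurable borel" if "continuous_on UNIV \<phi>" for \<phi> :: "'z::topological_space \<Rightarrow> _"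
    by (intro measurable_compose[OF _ measurable_ennreal] borel_measurable_comp_continuous[OF f0 that])
  have prod: "(\<lambda>p. ennreal (f0 (\<phi> p)) * W (\<psi> p) ^ Suc m) \<in> borel_measurable borel"
    if "continuous_on UNIV \<phi>" "continuous_on UNIV \<psi>" for \<phi> :: "'z::topological_space \<Rightarrow> _" and \<psi>
    by (intro borel_measurable_times_ennreal borel_measurable_power_ennreal f0c Wc that)
  have "(\<integral>\<^sup>+\<xi>. (\<integral>\<^sup>+x. (\<integral>\<^sup>+z. ennreal (f (x - shift A B \<xi> z, z)) \<partial>lborel) ^ Suc (Suc m) \<partial>lborel) \<partial>lborel)
    \<le> (\<integral>\<^sup>+\<xi>. (\<integral>\<^sup>+x. (\<integral>\<^sup>+z. ennreal (f0 (x - shift A B \<xi> z, z)) \<partial>lborel) * W (x, \<xi>) ^ Suc m \<partial>lborel) \<partial>lborel)"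
    unfolding W_def fst_conv snd_conv
    using f f0 f1 pos le by (intro nn_integral_mono nn_integral_Holder_power) auto
  also have "\<dots> = (\<integral>\<^sup>+\<xi>. (\<integral>\<^sup>+x. (\<integral>\<^sup>+z. ennreal (f0 (x - shift A B \<xi> z, z)) * W (x, \<xi>) ^ Suc m \<partial>lborel) \<partial>lborel) \<partial>lborel)"
    using f0 by (intro nn_integral_cong nn_integral_multc[symmetric]) auto
  also have "\<dots> = (\<integral>\<^sup>+\<xi>. (\<integral>\<^sup>+z. (\<integral>\<^sup>+x. ennreal (f0 (x - shift A B \<xi> z, z)) * W (x, \<xi>) ^ Suc m \<partial>lborel) \<partial>lborel) \<partial>lborel)"
    by (intro nn_integral_cong nn_integral_lborel_swap prod continuous_intros)
  also have "\<dots> = (\<integral>\<^sup>+\<xi>. (\<integral>\<^sup>+z. (\<integral>\<^sup>+x. ennreal (f0 (x, z)) * W (x + shift A B \<xi> z, \<xi>) ^ Suc m \<partial>lborel) \<partial>lborel) \<partial>lborel)"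
  proof (rule nn_integral_cong, rule nn_integral_cong)
    fix \<xi> z
    have "(\<integral>\<^sup>+x. ennreal (f0 (x - shift A B \<xi> z, z)) * W (x, \<xi>) ^ Suc m \<partial>lborel)
        = (\<integral>\<^sup>+x. ennreal (f0 (x + shift A B \<xi> z - shift A B \<xi> z, z)) * W (x + shift A B \<xi> z, \<xi>) ^ Suc m \<partial>lborel)"
      by (rule nn_integral_lborel_translate[symmetric]) (intro prod continuous_intros)
    then show "(\<integral>\<^sup>+x. ennreal (f0 (x - shift A B \<xi> z, z)) * W (x, \<xi>) ^ Suc m \<partial>lborel)
        = (\<integral>\<^sup>+x. ennreal (f0 (x, z)) * W (x + shift A B \<xi> z, \<xi>) ^ Suc m \<partial>lborel)"
      by simp
  qed
  also have "\<dots> = (\<integral>\<^sup>+z. (\<integral>\<^sup>+\<xi>. (\<integral>\<^sup>+x. ennreal (f0 (x, z)) * W (x + shift A B \<xi> z, \<xi>) ^ Suc m \<partial>lborel) \<partial>lborel) \<partial>lborel)"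
    by (intro nn_integral_lborel_swap borel_measurable_nn_integral_lborel prod continuous_intros)
  also have "\<dots> = (\<integral>\<^sup>+z. (\<integral>\<^sup>+x. (\<integral>\<^sup>+\<xi>. ennreal (f0 (x, z)) * W (x + shift A B \<xi> z, \<xi>) ^ Suc m \<partial>lborel) \<partial>lborel) \<partial>lborel)"
    by (intro nn_integral_cong nn_integral_lborel_swap prod continuous_intros)
  also have "\<dots> \<le> (\<integral>\<^sup>+z1. (\<integral>\<^sup>+x. ennreal (f0 (x, z1)) * (\<integral>\<^sup>+z. ennreal (w z1 z) \<partial>lborel) ^ Suc m \<partial>lborel) \<partial>lborel)"
  proof (intro nn_integral_mono)
    fix z1 :: "real \<times> real" and x :: "real^'n"
    show "(\<integral>\<^sup>+\<xi>. ennreal (f0 (x, z1)) * W (x + shift A B \<xi> z1, \<xi>) ^ Suc m \<partial>lborel)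
        \<le> ennreal (f0 (x, z1)) * (\<integral>\<^sup>+z. ennreal (w z1 z) \<partial>lborel) ^ Suc m"
    proof (cases "z1 \<in> S")
      case True
      have "(\<integral>\<^sup>+\<xi>. ennreal (f0 (x, z1)) * W (x + shift A B \<xi> z1, \<xi>) ^ Suc m \<partial>lborel)
          = ennreal (f0 (x, z1)) * (\<integral>\<^sup>+\<xi>. W (x + shift A B \<xi> z1, \<xi>) ^ Suc m \<partial>lborel)"
        by (intro nn_integral_cmult) (simp only: measurable_lborel2, intro borel_measurable_power_ennreal Wc continuous_intros)
      also have "\<dots> \<le> ennreal (f0 (x, z1)) * (\<integral>\<^sup>+z. ennreal (w z1 z) \<partial>lborel) ^ Suc m"
        unfolding W_def fst_conv snd_conv
        using pos m AE[OF True] by (intro mult_left_mono fibre_Minkowski f1 w) auto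
      finally show ?thesis .
    qed (simp add: S)
  qed
  also have "\<dots> = (\<integral>\<^sup>+z1. (\<integral>\<^sup>+x. ennreal (f0 (x, z1)) \<partial>lborel) * (\<integral>\<^sup>+z. ennreal (w z1 z) \<partial>lborel) ^ Suc m \<partial>lborel)"
    by (intro nn_integral_cong nn_integral_multc) (simp only: measurable_lborel2, intro f0c continuous_intros)
  finally show ?thesis .
qed

section \<open>The weak-type kernel and the endpoint estimate\<close>

definition zcube :: "(real \<times> real) set" where "zcube = {-1..1} \<times> {-1..1}"

lemma zcube_iff: "z \<in> zcube \<longleftrightarrow> \<bar>fst z\<bar> \<le> 1 \<and> \<bar>snd z\<bar> \<le> 1"
  by (cases z) (auto simp: zcube_def)

lemma zcube_borel [measurable]: "zcube \<in> sets borel"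
  unfolding zcube_def by (intro borel_closed closed_Times) auto

lemma emeasure_zcube: "emeasure lborel zcube = 4"
proof -
  have "emeasure (lborel \<Otimes>\<^sub>M lborel) ({-1..1::real} \<times> {-1..1::real}) = emeasure lborel {-1..1::real} * emeasure lborel {-1..1::real}"
    by (rule lborel.emeasure_pair_measure_Times) auto
  then show ?thesis by (simp add: zcube_def lborel_prod flip: ennreal_numeral ennreal_mult)
qed

lemma det_form_minus:
  fixes A B :: "real^'n^'n"
  shows "\<bar>det_form A B (- z)\<bar> = \<bar>det_form A B z\<bar>"
proof -
  let ?X = "fst z *\<^sub>R A + snd z *\<^sub>R B"
  have "fst (- z) *\<^sub>R A + snd (- z) *\<^sub>R B = (\<chi> i. (- 1) *s (?X $ i))"
    by (simp add: vec_eq_iff)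
  then have "det_form A B (- z) = prod (\<lambda>i::'n. - 1) UNIV * det ?X"
    unfolding det_form_def by (simp only: det_rows_mul vec_lambda_eta)
  then show ?thesis by (simp add: det_form_def abs_mult power_abs)
qed

lemma continuous_on_det_form [continuous_intros]:
  "continuous_on S f \<Longrightarrow> continuous_on S (\<lambda>x. det_form A B (f x))"
  unfolding det_form_def by (intro continuous_on_det continuous_intros)

text \<open>Where the determinant vanishes, \<open>powr\<close> makes the value 0 instead of
  infinity. Under the sublevel bounds below this concerns a null set only.\<close>

definition kernel :: "real^'n^'n \<Rightarrow> real^'n^'n \<Rightarrow> real \<Rightarrow> real \<times> real \<Rightarrow> real" where
  "kernel A B n z = \<bar>det_form A B z\<bar> powr (- (1 / n))"

lemma kernel_measurable [measurable]: "kernel A B n \<in> borel_measurable borel"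
proof -
  have [measurable]: "det_form A B \<in> borel_measurable borel"
    by (intro borel_measurable_continuous_onI continuous_intros)
  show ?thesis unfolding kernel_def[abs_def] by measurable
qed

text \<open>The kernel exceeds c only where |det| < c^(-n), and (c^(-n))^(1/m) = c^(-n/(n-1))
  because m = n - 1. Differences of points of the square have coordinates up to 2, hence the larger
  square in the hypothesis.\<close>

lemma kernel_weak:
  fixes A B :: "real^'n^'n"
  assumes sub: "\<And>\<epsilon>. \<epsilon> > 0 \<Longrightarrow> emeasure lborel {z. \<bar>fst z\<bar> \<le> 2 \<and> \<bar>snd z\<bar> \<le> 2 \<and> \<bar>det_form A B z\<bar> \<le> \<epsilon>}
      \<le> ennreal (U * \<epsilon> powr (1 / m))"
    and m: "m > (0 :: real)" and n: "n = m + 1" and x: "x \<in> zcube" and c: "c > 0"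
  shows "emeasure lborel {z \<in> zcube. kernel A B n (z - x) > c} \<le> ennreal (U * c powr (- (n / (n - 1))))"
proof -
  define \<epsilon> where "\<epsilon> = c powr (- n)"
  let ?S = "{z. \<bar>fst z\<bar> \<le> 2 \<and> \<bar>snd z\<bar> \<le> 2 \<and> \<bar>det_form A B z\<bar> \<le> \<epsilon>}"
  have S[measurable]: "?S \<in> sets borel"
    by (intro borel_closed closed_Collect_conj closed_Collect_le continuous_intros)
  have sub1: "{z \<in> zcube. kernel A B n (z - x) > c} \<subseteq> {z. z + (- x) \<in> ?S}"
  proof safe
    fix a b assume z: "(a, b) \<in> zcube" and k: "kernel A B n ((a, b) - x) > c"
    let ?D = "\<bar>det_form A B ((a, b) - x)\<bar>"
    have "?D \<noteq> 0" using k c by (auto simp: kernel_def)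
    then have D: "?D > 0" by simp
    have "(?D powr (- (1 / n))) powr (- n) \<le> c powr (- n)"
      using k c n m unfolding kernel_def by (intro powr_mono2') auto
    then show "\<bar>det_form A B ((a, b) + - x)\<bar> \<le> \<epsilon>"
    proof -
      have "n \<noteq> 0" using n m by simp
      then have "- (1 / n) * - n = 1" by simp
      then have "(?D powr (- (1 / n))) powr (- n) = ?D" using D by (simp only: powr_powr powr_one)
      then show ?thesis using \<open>_ \<le> c powr (- n)\<close> by (simp add: \<epsilon>_def)
    qed
    show "\<bar>fst ((a, b) + - x)\<bar> \<le> 2" "\<bar>snd ((a, b) + - x)\<bar> \<le> 2"
      using z x by (auto simp: zcube_iff)
  qed
  have "emeasure lborel {z \<in> zcube. kernel A B n (z - x) > c} \<le> emeasure lborel {z. z + (- x) \<in> ?S}"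
    using translate_borel(1)[OF S] by (intro emeasure_mono sub1) (simp only: sets_lborel)
  also have "\<dots> = emeasure lborel ?S"
    by (rule translate_borel(2)[OF S])
  also have "\<dots> \<le> ennreal (U * \<epsilon> powr (1 / m))"
    using c by (intro sub) (simp add: \<epsilon>_def)
  also have "\<epsilon> powr (1 / m) = c powr (- (n / (n - 1)))"
    using c n by (simp add: \<epsilon>_def powr_powr minus_divide_left)
  finally show ?thesis .
qed

text \<open>The zero set lies in every sublevel set, whose measure tends to 0 with
  \<epsilon>.\<close>

lemma det_form_AE_nonzero:
  fixes A B :: "real^'n^'n"
  assumes sub: "\<And>\<epsilon>. \<epsilon> > 0 \<Longrightarrow> emeasure lborel {z. \<bar>fst z\<bar> \<le> 2 \<and> \<bar>snd z\<bar> \<le> 2 \<and> \<bar>det_form A B z\<bar> \<le> \<epsilon>}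
      \<le> ennreal (U * \<epsilon> powr (1 / m))"
    and m: "m > (0 :: real)" and x: "x \<in> zcube"
  shows "AE z in lborel. z \<in> zcube \<longrightarrow> det_form A B (z - x) \<noteq> 0"
proof -
  let ?S = "\<lambda>\<epsilon>. {z. \<bar>fst z\<bar> \<le> 2 \<and> \<bar>snd z\<bar> \<le> 2 \<and> \<bar>det_form A B z\<bar> \<le> \<epsilon>}"
  have cl[measurable]: "?S \<epsilon> \<in> sets borel" for \<epsilon>
    by (intro borel_closed closed_Collect_conj closed_Collect_le continuous_intros)
  have "emeasure lborel (?S 0) \<le> ennreal (U * \<epsilon> powr (1 / m))" if "\<epsilon> > 0" for \<epsilon>
    using that by (intro order_trans[OF emeasure_mono sub[OF that]]) auto
  moreover have "((\<lambda>\<epsilon>. ennreal (U * \<epsilon> powr (1 / m))) \<longlongrightarrow> ennreal (U * 0)) (at_right 0)"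
  proof (intro tendsto_intros)
    show "((\<lambda>\<epsilon>. \<epsilon> powr (1 / m)) \<longlongrightarrow> 0) (at_right 0)"
      using m by (intro tendsto_zero_powrI[where b = "1 / m"] tendsto_intros)
        (auto simp: eventually_at_filter)
  qed
  ultimately have "emeasure lborel (?S 0) \<le> ennreal (U * 0)"
    by (intro tendsto_lowerbound[where F = "at_right (0::real)"])
      (auto simp: eventually_at_filter)
  then have null: "emeasure lborel (?S 0) = 0" by simp
  have "{z. z + (- x) \<in> ?S 0} \<in> null_sets lborel"
    by (rule null_setsI) (simp_all only: translate_borel[OF cl[of 0]] null sets_lborel)
  then have "AE z in lborel. z \<notin> {z. z + (- x) \<in> ?S 0}" by (rule AE_not_in)
  then show ?thesis
    by eventually_elim (use x in \<open>auto simp: zcube_iff\<close>)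
qed

text \<open>The constant K depends on U and m alone. The bound and the radius of g are there to make
  every quantity finite, as \<open>weak_Young_power\<close> requires, and disappear from the
  result.\<close>

lemma endpoint_estimate:
  fixes A B :: "real^'n^'n" and m :: nat
  assumes sub: "\<And>\<epsilon>. \<epsilon> > 0 \<Longrightarrow> emeasure lborel {z. \<bar>fst z\<bar> \<le> 2 \<and> \<bar>snd z\<bar> \<le> 2 \<and> \<bar>det_form A B z\<bar> \<le> \<epsilon>}
      \<le> ennreal (U * \<epsilon> powr (1 / m))"
    and U: "U > 0" and m: "m > 0"
  obtains K :: real where "K \<ge> 0"
    "\<And>g :: (real^'n) \<times> real \<times> real \<Rightarrow> real. \<And>b R. g \<in> borel_measurable borel \<Longrightarrow> (\<And>p. 0 \<le> g p) \<Longrightarrow> (\<And>p. g p \<le> b)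
       \<Longrightarrow> (\<And>y z. norm y > R \<or> z \<notin> zcube \<Longrightarrow> g (y, z) = 0) \<Longrightarrow>
     (\<integral>\<^sup>+\<xi>. (\<integral>\<^sup>+x. (\<integral>\<^sup>+z. ennreal (g (x - shift A B \<xi> z, z)) \<partial>lborel) ^ (m + 2) \<partial>lborel) \<partial>lborel)
     \<le> ennreal K * (\<integral>\<^sup>+p. ennreal (g p powr ((real m + 2) / 2)) \<partial>lborel)\<^sup>2"
proof -
  \<comment> \<open>n is the exponent of Minkowski's inequality, 2a = n + 1 = m + 2 is the power of
    the plane integral, and b completes a to the weak Young relation 1/a + 1/b = 1 + 1/n.\<close>
  define n a b where "n = real m + 1" and "a = (n + 1) / 2" and "b = 1 / (1 + 1 / n - 1 / a)"
  have n: "n > 1" using m by (simp add: n_def)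
  have a: "a > 1" "2 * a = n + 1" "a = (real m + 2) / 2" using n by (simp_all add: a_def n_def)
  define M where "M = restrict_space (lborel :: (real \<times> real) measure) zcube"
  have spM: "space M = zcube" by (simp add: M_def space_restrict_space)
  have em: "emeasure M X = emeasure lborel X" if "X \<subseteq> zcube" for X
    unfolding M_def using that by (intro emeasure_restrict_space) auto
  have fin: "finite_measure M"
    by (rule finite_measureI) (simp add: spM em emeasure_zcube)
  have sf: "sigma_finite_measure M" using fin by (rule finite_measure.axioms(1))
  have measM: "f \<in> borel_measurable M" if "f \<in> borel_measurable borel" for f :: "real \<times> real \<Rightarrow> real"
    unfolding M_def by (intro measurable_restrict_space1) (use that in simp)
  have intM: "(\<integral>\<^sup>+z. f z \<partial>M) = (\<integral>\<^sup>+z. f z * indicator zcube z \<partial>lborel)" for f :: "real \<times> real \<Rightarrow> ennreal"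
    unfolding M_def by (subst nn_integral_restrict_space) auto
  define \<kappa> where "\<kappa> x z = kernel A B n (z - x)" for x z
  have \<kappa>0: "\<kappa> x z \<ge> 0" for x z by (simp add: \<kappa>_def kernel_def)
  have \<kappa>sym: "\<kappa> x z = \<kappa> z x" for x z
    using det_form_minus[of A B "z - x"] by (simp add: \<kappa>_def kernel_def)
  have \<kappa>meas: "case_prod \<kappa> \<in> borel_measurable (M \<Otimes>\<^sub>M M)"
  proof -
    have id: "(\<lambda>z. z) \<in> borel_measurable M"
      unfolding M_def by (intro measurable_restrict_space1) simp
    have "fst \<in> borel_measurable (M \<Otimes>\<^sub>M M)"
      by (rule measurable_compose[OF measurable_fst id])
    moreover have "snd \<in> borel_measurable (M \<Otimes>\<^sub>M M)"
      by (rule measurable_compose[OF measurable_snd id])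
    ultimately have "(\<lambda>p. snd p - fst p) \<in> borel_measurable (M \<Otimes>\<^sub>M M)" by (rule borel_measurable_diff[rotated])
    from measurable_compose[OF this kernel_measurable] show ?thesis
      by (simp add: \<kappa>_def split_def)
  qed
  have \<kappa>1: "\<kappa> x \<in> borel_measurable borel" for x
    unfolding \<kappa>_def by (intro borel_measurable_comp_continuous[OF kernel_measurable] continuous_intros)
  have weak: "emeasure M {z \<in> space M. \<kappa> x z > c} \<le> ennreal (U * c powr (- (n / (n - 1))))"
    if "x \<in> space M" "c > 0" for x c
    using kernel_weak[of A B U m n x c] sub m that by (subst em) (auto simp: spM \<kappa>_def n_def)
  \<comment> \<open>The weak kernel bound for the constant function 1, with 4 the area of the
    square. It gives uniformly bounded kernel integrals, which later make \<open>H\<close>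
    bounded.\<close>
  obtain hc where hc: "\<And>x. x \<in> zcube \<Longrightarrow> (\<integral>\<^sup>+z. ennreal (\<kappa> x z * 1) \<partial>M) \<le> ennreal hc"
  proof -
    have "(\<integral>\<^sup>+z. ennreal (\<kappa> x z * 1) \<partial>M)
      \<le> ennreal ((U powr (1 - 1 / a) / (1 - (n / (n - 1)) * (1 - 1 / a)) + U * (n - 1)) * (1 powr (1 - a / n) * 4 powr (1 / n)))"
      if "x \<in> zcube" for x
      using that n
      by (intro weak_kernel_bound[OF sf measM[OF \<kappa>1] _ _ U weak])
        (auto simp: spM a_def em emeasure_zcube)
    then show ?thesis using that by blast
  qed
  define K where "K = (weak_const U n a + weak_const U n b) powr n"
  show ?thesis
  proof (rule that[of K])
    show "K \<ge> 0" by (simp add: K_def)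
    fix g :: "(real^'n) \<times> real \<times> real \<Rightarrow> real" and B0 R
    assume g[measurable]: "g \<in> borel_measurable borel" and g0: "\<And>p. 0 \<le> g p" and gB: "\<And>p. g p \<le> B0"
      and supp: "\<And>y z. norm y > R \<or> z \<notin> zcube \<Longrightarrow> g (y, z) = 0"
    let ?V = "\<integral>\<^sup>+\<xi>. (\<integral>\<^sup>+x. (\<integral>\<^sup>+z. ennreal (g (x - shift A B \<xi> z, z)) \<partial>lborel) ^ (m + 2) \<partial>lborel) \<partial>lborel"
    define P where "P z = enn2real (\<integral>\<^sup>+y. ennreal (g (y, z) powr a) \<partial>lborel)" for z
    have gz[measurable]: "(\<lambda>y. g (y, z)) \<in> borel_measurable borel" for z
      by (intro borel_measurable_comp_continuous[OF g] continuous_intros)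
    define PB where "PB = B0 powr a * measure lborel (cball (0 :: real^'n) R)"
    have Pfin: "(\<integral>\<^sup>+y. ennreal (g (y, z) powr a) \<partial>lborel) \<le> ennreal PB" for z
    proof -
      have "(\<integral>\<^sup>+y. ennreal (g (y, z) powr a) \<partial>lborel) \<le> (\<integral>\<^sup>+y. ennreal (B0 powr a) * indicator (cball (0 :: real^'n) R) y \<partial>lborel)"
      proof (rule nn_integral_mono)
        fix y :: "real^'n"
        show "ennreal (g (y, z) powr a) \<le> ennreal (B0 powr a) * indicator (cball 0 R) y"
        proof (cases "norm y > R")
          case True
          then have "g (y, z) = 0" by (intro supp) simp
          then show ?thesis by simp
        next
          case False
          then show ?thesis using g0[of "(y, z)"] gB[of "(y, z)"] a by (auto intro!: ennreal_leI powr_mono2)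
        qed
      qed
      also have "\<dots> = ennreal (B0 powr a) * emeasure lborel (cball (0 :: real^'n) R)"
        by (subst nn_integral_cmult_indicator) auto
      also have "\<dots> = ennreal PB"
        using emeasure_lborel_cball_finite[of "0 :: real^'n" R]
        by (simp add: PB_def ennreal_mult emeasure_eq_ennreal_measure less_top)
      finally show ?thesis .
    qed
    have P: "ennreal (P z) = (\<integral>\<^sup>+y. ennreal (g (y, z) powr a) \<partial>lborel)" and P0: "P z \<ge> 0" for z
      using order_le_less_trans[OF Pfin[of z] ennreal_less_top] by (auto simp: P_def)
    have PB: "P z \<le> PB" for z
    proof -
      have "PB \<ge> 0" by (simp add: PB_def)
      then show ?thesis using Pfin[of z] unfolding P[symmetric] by (simp add: ennreal_le_iff)
    qed
    have gp: "(\<lambda>p. ennreal (g p powr a)) \<in> borel_measurable borel" by measurable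
    have Pm[measurable]: "P \<in> borel_measurable borel"
    proof -
      have "(\<lambda>z. \<integral>\<^sup>+y. ennreal (g (y, z) powr a) \<partial>lborel) \<in> borel_measurable borel"
        by (intro borel_measurable_nn_integral_lborel borel_measurable_comp_continuous[OF gp] continuous_intros)
      then show ?thesis unfolding P_def[abs_def] by measurable
    qed
    let ?N = "\<integral>\<^sup>+p. ennreal (g p powr a) \<partial>lborel"
    have PN: "(\<integral>\<^sup>+z. ennreal (P z) \<partial>lborel) = ?N"
    proof -
      have "(\<integral>\<^sup>+z. (\<integral>\<^sup>+y. ennreal (g (y, z) powr a) \<partial>lborel) \<partial>lborel) = (\<integral>\<^sup>+y. (\<integral>\<^sup>+z. ennreal (g (y, z) powr a) \<partial>lborel) \<partial>lborel)"
        by (rule nn_integral_lborel_swap) (intro borel_measurable_comp_continuous[OF gp] continuous_intros)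
      then show ?thesis unfolding P nn_integral_lborel_pair[OF gp] .
    qed
    have Pz: "P z = 0" if "z \<notin> zcube" for z using that supp by (simp add: P_def)
    have Nfin: "?N < \<infinity>"
    proof -
      have "?N \<le> (\<integral>\<^sup>+z. ennreal PB * indicator zcube z \<partial>lborel)"
        unfolding PN[symmetric] using PB Pz by (intro nn_integral_mono) (auto simp: indicator_def intro!: ennreal_leI)
      also have "\<dots> = ennreal PB * 4" by (subst nn_integral_cmult_indicator) (auto simp: emeasure_zcube)
      also have "\<dots> < \<infinity>" by (simp add: ennreal_mult_less_top)
      finally show ?thesis .
    qed
    define N where "N = enn2real ?N"
    have N: "?N = ennreal N" "N \<ge> 0" using Nfin by (simp_all add: N_def)
    have est: "?V \<le> ennreal (K * (N + 4 * \<epsilon>)\<^sup>2)" if \<epsilon>: "\<epsilon> > 0" for \<epsilon> :: real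
    proof -
      \<comment> \<open>F will be raised to the negative power 1 - a, so \<epsilon> keeps it
        positive on the square; it is removed by a limit at the end.\<close>
      define F where "F z = (if z \<in> zcube then (P z + \<epsilon>) powr (1 / a) else 0)" for z
      have Fm[measurable]: "F \<in> borel_measurable borel" unfolding F_def by measurable
      have F0: "F z \<ge> 0" for z by (simp add: F_def)
      have Fp: "F z > 0" "F z powr a = P z + \<epsilon>" if "z \<in> zcube" for z
        using that P0[of z] \<epsilon> a by (auto simp: F_def powr_powr)
      have Fsnd: "(\<lambda>p :: (real^'n) \<times> real \<times> real. F (snd p)) \<in> borel_measurable borel"
        by (intro borel_measurable_comp_continuous[OF Fm] continuous_intros)
      \<comment> \<open>The powers of F cancel in f0 f1^n = g^(2a). They are chosen so that the
        slice integral of f0 is at most F and that of f1^n at most F^n, the latter because 2a - 1 =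
        n.\<close>
      define f0 where "f0 p = g p powr a * F (snd p) powr (1 - a)" for p
      define f1 where "f1 p = g p powr (a / n) * F (snd p) powr ((a - 1) / n)" for p
      define w where "w x z = \<kappa> x z * F z" for x z
      have nonneg: "f0 p \<ge> 0" "f1 p \<ge> 0" "w x z \<ge> 0" for p x z
        using F0 \<kappa>0 by (auto simp: f0_def f1_def w_def)
      have f01m[measurable]: "f0 \<in> borel_measurable borel" "f1 \<in> borel_measurable borel"
        unfolding f0_def[abs_def] f1_def[abs_def] using Fsnd by measurable
      have wm: "w x \<in> borel_measurable borel" for x
        unfolding w_def[abs_def] using \<kappa>1 by measurable
      have nSuc: "n = real (Suc m)" by (simp add: n_def)
      have f1pow: "f1 p ^ Suc m = g p powr a * F (snd p) powr (a - 1)" for p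
        unfolding f1_def power_mult_distrib using n
        by (simp add: powr_realpow'[symmetric] powr_powr nSuc[symmetric] del: power_Suc of_nat_Suc)
      have "?V \<le> (\<integral>\<^sup>+z1. (\<integral>\<^sup>+x. ennreal (f0 (x, z1)) \<partial>lborel) * (\<integral>\<^sup>+z. ennreal (w z1 z) \<partial>lborel) ^ Suc m \<partial>lborel)"
        unfolding add_2_eq_Suc'
      proof (rule star_estimate[where ?f1.0 = f1 and S = zcube])
        show "g p ^ Suc (Suc m) \<le> f0 p * f1 p ^ Suc m" for p
        proof (cases "snd p \<in> zcube")
          case True
          have FF: "F (snd p) powr (1 - a) * F (snd p) powr (a - 1) = 1"
            using Fp[OF True] by (simp add: powr_add[symmetric])
          have gg: "g p powr a * g p powr a = g p powr (2 * a)"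
            by (simp add: powr_add[symmetric])
          have "f0 p * f1 p ^ Suc m = (g p powr a * g p powr a) * (F (snd p) powr (1 - a) * F (snd p) powr (a - 1))"
            unfolding f1pow by (simp only: f0_def mult_ac)
          also have "\<dots> = g p powr real (Suc (Suc m))"
            unfolding FF gg a(2) by (simp add: n_def)
          also have "\<dots> = g p ^ Suc (Suc m)"
            using g0 by (subst powr_realpow') auto
          finally show ?thesis by simp
        next
          case False
          then have "g p = 0" using supp[of "fst p" "snd p"] by simp
          then show ?thesis by (simp add: f0_def)
        qed
        show "f0 (x, z) = 0" if "z \<notin> zcube" for x z using supp[of x z] that by (simp add: f0_def)
        fix z1 assume z1: "z1 \<in> zcube"
        have nz: "AE z in lborel. z \<in> zcube \<longrightarrow> det_form A B (z - z1) \<noteq> 0"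
          using m by (intro det_form_AE_nonzero[of A B U m] sub z1) auto
        show "AE z in lborel. (\<forall>x. f1 (x, z) = 0) \<or> (w z1 z > 0 \<and> det_form A B (z - z1) \<noteq> 0
          \<and> (\<integral>\<^sup>+x. ennreal (f1 (x, z) ^ Suc m) \<partial>lborel) \<le> ennreal (\<bar>det_form A B (z - z1)\<bar> * w z1 z ^ Suc m))"
          using nz
        proof eventually_elim
          fix z assume z: "z \<in> zcube \<longrightarrow> det_form A B (z - z1) \<noteq> 0"
          show "(\<forall>x. f1 (x, z) = 0) \<or> (w z1 z > 0 \<and> det_form A B (z - z1) \<noteq> 0
            \<and> (\<integral>\<^sup>+x. ennreal (f1 (x, z) ^ Suc m) \<partial>lborel) \<le> ennreal (\<bar>det_form A B (z - z1)\<bar> * w z1 z ^ Suc m))"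
          proof (cases "z \<in> zcube")
            case True
            then have D: "det_form A B (z - z1) \<noteq> 0" using z by simp
            have wp: "w z1 z > 0" using D Fp[OF True] by (simp add: w_def \<kappa>_def kernel_def)
            have "(\<integral>\<^sup>+x. ennreal (f1 (x, z) ^ Suc m) \<partial>lborel) = (\<integral>\<^sup>+x. ennreal (g (x, z) powr a) * ennreal (F z powr (a - 1)) \<partial>lborel)"
              unfolding f1pow by (simp add: ennreal_mult)
            also have "\<dots> = ennreal (P z) * ennreal (F z powr (a - 1))"
              unfolding P by (rule nn_integral_multc) measurable
            also have "\<dots> = ennreal (P z * F z powr (a - 1))" using P0 by (simp add: ennreal_mult)
            also have "\<dots> \<le> ennreal (F z powr a * F z powr (a - 1))"
              using \<epsilon> by (intro ennreal_leI mult_right_mono) (auto simp: Fp(2)[OF True])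
            also have "F z powr a * F z powr (a - 1) = F z powr n"
              using a(2) by (simp add: powr_add[symmetric])
            also have "F z powr n = \<bar>det_form A B (z - z1)\<bar> * w z1 z ^ Suc m"
            proof -
              have "w z1 z ^ Suc m = w z1 z powr n"
                using wp by (simp add: powr_realpow nSuc del: power_Suc of_nat_Suc)
              also have "\<dots> = \<bar>det_form A B (z - z1)\<bar> powr (-1) * F z powr n"
                using F0[of z] n by (simp add: w_def \<kappa>_def kernel_def powr_mult powr_powr)
              finally show ?thesis using D by (simp add: powr_minus)
            qed
            finally show ?thesis using D wp by blast
          next
            case False
            then have "f1 (x, z) = 0" for x using supp[of x z] by (simp add: f1_def)
            then show ?thesis by simp
          qed
        qed
      qed (use g0 wm m nonneg g f01m in auto)
      also have "\<dots> \<le> (\<integral>\<^sup>+z1. ennreal (F z1) * (\<integral>\<^sup>+z. ennreal (w z1 z) \<partial>lborel) ^ Suc m * indicator zcube z1 \<partial>lborel)"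
      proof (rule nn_integral_mono)
        fix z1 :: "real \<times> real"
        show "(\<integral>\<^sup>+x. ennreal (f0 (x, z1)) \<partial>lborel) * (\<integral>\<^sup>+z. ennreal (w z1 z) \<partial>lborel) ^ Suc m
          \<le> ennreal (F z1) * (\<integral>\<^sup>+z. ennreal (w z1 z) \<partial>lborel) ^ Suc m * indicator zcube z1"
        proof (cases "z1 \<in> zcube")
          case True
          have "(\<integral>\<^sup>+x. ennreal (f0 (x, z1)) \<partial>lborel) = (\<integral>\<^sup>+x. ennreal (g (x, z1) powr a) * ennreal (F z1 powr (1 - a)) \<partial>lborel)"
            by (simp add: f0_def ennreal_mult)
          also have "\<dots> = ennreal (P z1) * ennreal (F z1 powr (1 - a))"
            unfolding P by (rule nn_integral_multc) measurable
          also have "\<dots> = ennreal (P z1 * F z1 powr (1 - a))" using P0 by (simp add: ennreal_mult)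
          also have "\<dots> \<le> ennreal (F z1 powr a * F z1 powr (1 - a))"
            using \<epsilon> by (intro ennreal_leI mult_right_mono) (auto simp: Fp(2)[OF True])
          also have "F z1 powr a * F z1 powr (1 - a) = F z1"
            using Fp(1)[OF True] by (simp add: powr_add[symmetric])
          finally show ?thesis using True by (simp add: mult_right_mono)
        next
          case False
          then have "f0 (x, z1) = 0" for x using supp[of x z1] by (simp add: f0_def)
          then show ?thesis by simp
        qed
      qed
      also have "\<dots> = (\<integral>\<^sup>+z1. ennreal (F z1) * (\<integral>\<^sup>+z. ennreal (w z1 z) \<partial>lborel) ^ Suc m \<partial>M)"
        by (simp add: intM)
      also have "\<dots> \<le> ennreal (K * (N + 4 * \<epsilon>)\<^sup>2)"
      proof -
        define FB where "FB = (PB + \<epsilon>) powr (1 / a)"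
        have FB: "F z \<le> FB" for z
          using PB[of z] P0[of z] \<epsilon> a by (auto simp: F_def FB_def intro!: powr_mono2)
        have FB0: "FB \<ge> 0" by (simp add: FB_def)
        have wM: "(\<integral>\<^sup>+z. ennreal (w x z) \<partial>lborel) = (\<integral>\<^sup>+z. ennreal (\<kappa> x z * F z) \<partial>M)" for x
          unfolding intM w_def by (intro nn_integral_cong) (auto simp: F_def indicator_def)
        define H where "H x = enn2real (\<integral>\<^sup>+z. ennreal (\<kappa> x z * F z) \<partial>M)" for x
        have Hle: "(\<integral>\<^sup>+z. ennreal (\<kappa> x z * F z) \<partial>M) \<le> ennreal (\<bar>hc\<bar> * FB)" if "x \<in> zcube" for x
        proof -
          have "(\<integral>\<^sup>+z. ennreal (\<kappa> x z * F z) \<partial>M) \<le> (\<integral>\<^sup>+z. ennreal (\<kappa> x z * 1) * ennreal FB \<partial>M)"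
          proof (rule nn_integral_mono)
            fix z
            have "\<kappa> x z * F z \<le> \<kappa> x z * FB" using FB \<kappa>0 by (rule mult_left_mono)
            then show "ennreal (\<kappa> x z * F z) \<le> ennreal (\<kappa> x z * 1) * ennreal FB"
              using \<kappa>0[of x z] FB0 by (simp add: ennreal_mult[symmetric] ennreal_leI)
          qed
          also have "\<dots> = (\<integral>\<^sup>+z. ennreal (\<kappa> x z * 1) \<partial>M) * ennreal FB"
            using measM[OF \<kappa>1] by (intro nn_integral_multc) auto
          also have "\<dots> \<le> ennreal hc * ennreal FB" using hc[OF that] by (intro mult_right_mono) auto
          also have "\<dots> \<le> ennreal (\<bar>hc\<bar> * FB)" using FB0 by (simp add: ennreal_mult mult_right_mono ennreal_leI)
          finally show ?thesis .
        qed
        have H: "ennreal (H x) = (\<integral>\<^sup>+z. ennreal (\<kappa> x z * F z) \<partial>M)" if "x \<in> zcube" for x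
          using order_le_less_trans[OF Hle[OF that] ennreal_less_top] by (simp add: H_def)
        have HB: "H x \<le> \<bar>hc\<bar> * FB" if "x \<in> zcube" for x
          using Hle[OF that] unfolding H[OF that, symmetric] using FB0 by (simp add: ennreal_le_iff)
        have H0: "H x \<ge> 0" for x by (simp add: H_def)
        have "(\<integral>\<^sup>+z1. ennreal (F z1) * (\<integral>\<^sup>+z. ennreal (w z1 z) \<partial>lborel) ^ Suc m \<partial>M) = (\<integral>\<^sup>+x. ennreal (F x * H x powr n) \<partial>M)"
        proof (rule nn_integral_cong)
          fix x assume "x \<in> space M"
          then have x: "x \<in> zcube" by (simp add: spM)
          have "H x ^ Suc m = H x powr n"
            using H0[of x] by (subst powr_realpow'[symmetric]) (auto simp: nSuc)
          then show "ennreal (F x) * (\<integral>\<^sup>+z. ennreal (w x z) \<partial>lborel) ^ Suc m = ennreal (F x * H x powr n)"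
            unfolding wM H[OF x, symmetric] using H0 F0 by (simp add: ennreal_power ennreal_mult del: power_Suc)
        qed
        also have "\<dots> \<le> ennreal (K * (N + 4 * \<epsilon>)\<^sup>2)"
          unfolding K_def
        proof (rule weak_Young_power[OF fin \<kappa>meas \<kappa>0 \<kappa>sym U weak measM[OF Fm] F0 FB n a_def b_def])
          have "(\<integral>\<^sup>+x. ennreal (F x powr a) \<partial>M) = (\<integral>\<^sup>+x. ennreal (P x) * indicator zcube x + ennreal \<epsilon> * indicator zcube x \<partial>lborel)"
            unfolding intM using P0 \<epsilon> by (intro nn_integral_cong) (auto simp: indicator_def Fp(2))
          also have "\<dots> = (\<integral>\<^sup>+x. ennreal (P x) * indicator zcube x \<partial>lborel) + ennreal \<epsilon> * 4"
            by (subst nn_integral_add) (auto simp: nn_integral_cmult_indicator emeasure_zcube)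
          also have "(\<integral>\<^sup>+x. ennreal (P x) * indicator zcube x \<partial>lborel) = ennreal N"
            unfolding N(1)[symmetric] PN[symmetric] by (intro nn_integral_cong) (auto simp: indicator_def Pz)
          also have "ennreal N + ennreal \<epsilon> * 4 = ennreal (N + 4 * \<epsilon>)"
            using N \<epsilon> by (simp add: ennreal_mult mult.commute)
          finally show "(\<integral>\<^sup>+x. ennreal (F x powr a) \<partial>M) \<le> ennreal (N + 4 * \<epsilon>)" by simp
          show "0 < N + 4 * \<epsilon>" using N \<epsilon> by simp
        qed (use H HB H0 spM in auto)
        finally show ?thesis .
      qed
      finally show ?thesis .
    qed
    have "((\<lambda>\<epsilon>. ennreal (K * (N + 4 * \<epsilon>)\<^sup>2)) \<longlongrightarrow> ennreal (K * (N + 4 * 0)\<^sup>2)) (at_right 0)"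
      by (intro tendsto_intros)
    then have "?V \<le> ennreal (K * (N + 4 * 0)\<^sup>2)"
    proof (rule tendsto_lowerbound)
      show "\<forall>\<^sub>F \<epsilon> in at_right 0. ?V \<le> ennreal (K * (N + 4 * \<epsilon>)\<^sup>2)"
        using eventually_at_right_less[of "0 :: real"] by (rule eventually_mono) (rule est)
    qed simp
    also have "\<dots> = ennreal K * ?N\<^sup>2"
      unfolding N(1) using N(2) by (simp add: K_def ennreal_mult ennreal_power)
    finally show "?V \<le> ennreal K * (\<integral>\<^sup>+p. ennreal (g p powr ((real m + 2) / 2)) \<partial>lborel)\<^sup>2"
      unfolding a(3) .
  qed
qed

subsection \<open>Interpolation\<close>

text \<open>For bounded Borel functions supported in a compact set the transform is finite at every
  point, so estimates need no exceptional sets. General functions are reached from these by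
  truncation.\<close>

definition admissible :: "real \<Rightarrow> ((real^'n) \<times> real \<times> real \<Rightarrow> real) \<Rightarrow> bool" where
  "admissible C g \<longleftrightarrow> g \<in> borel_measurable borel \<and> (\<forall>p. 0 \<le> g p) \<and> (\<exists>b. \<forall>p. g p \<le> b) \<and>
     (\<forall>y z. norm y > C \<or> z \<notin> zcube \<longrightarrow> g (y, z) = 0)"

lemma admissibleD:
  assumes "admissible C g"
  shows "g \<in> borel_measurable borel" "0 \<le> g p" "norm y > C \<or> z \<notin> zcube \<Longrightarrow> g (y, z) = 0"
  using assms by (simp_all only: admissible_def)

lemma admissible_bound:
  assumes "admissible C g"
  obtains b where "\<And>p. g p \<le> b"
  using assms by (simp only: admissible_def) blast

lemma admissible_powr:
  assumes g: "admissible C g" and r: "r > 0"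
  shows "admissible C (\<lambda>p. g p powr r)"
proof -
  obtain b where b: "\<And>p. g p \<le> b" using admissible_bound[OF g] by blast
  have [measurable]: "g \<in> borel_measurable borel" using admissibleD(1)[OF g] .
  have "(\<lambda>p. g p powr r) \<in> borel_measurable borel" by measurable
  moreover have "g p powr r \<le> b powr r" for p
    using r b admissibleD(2)[OF g] by (intro powr_mono2) auto
  moreover have "g (y, z) powr r = 0" if "norm y > C \<or> z \<notin> zcube" for y z
    using admissibleD(3)[OF g that] by simp
  ultimately show ?thesis unfolding admissible_def by (metis powr_ge_zero)
qed

text \<open>For admissible g the integral is finite, so \<open>enn2real\<close> loses nothing; this
  is \<open>transform_eq\<close>.\<close>

definition transform :: "real^'n^'n \<Rightarrow> real^'n^'n \<Rightarrow> ((real^'n) \<times> real \<times> real \<Rightarrow> real) \<Rightarrow> (real^'n) \<times> (real^'n) \<Rightarrow> real" where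
  "transform A B g q = enn2real (\<integral>\<^sup>+z. ennreal (g (fst q - shift A B (snd q) z, z)) \<partial>lborel)"

lemma line_measurable:
  assumes "g \<in> borel_measurable borel"
  shows "(\<lambda>z. g (x - shift A B \<xi> z, z)) \<in> borel_measurable borel"
  by (intro borel_measurable_comp_continuous[OF assms] continuous_intros)

lemma transform_nonneg [simp]: "transform A B g q \<ge> 0"
  by (simp add: transform_def)

lemma transform_eq:
  assumes "admissible C g"
  shows "ennreal (transform A B g q) = (\<integral>\<^sup>+z. ennreal (g (fst q - shift A B (snd q) z, z)) \<partial>lborel)"
proof -
  obtain b where b: "\<And>p. g p \<le> b" using admissible_bound[OF assms] by blast
  have "(\<integral>\<^sup>+z. ennreal (g (fst q - shift A B (snd q) z, z)) \<partial>lborel) \<le> (\<integral>\<^sup>+z. ennreal b * indicator zcube z \<partial>lborel)"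
  proof (rule nn_integral_mono)
    fix z
    show "ennreal (g (fst q - shift A B (snd q) z, z)) \<le> ennreal b * indicator zcube z"
      using admissibleD(3)[OF assms, of "fst q - shift A B (snd q) z" z] ennreal_leI[OF b]
      by (cases "z \<in> zcube") simp_all
  qed
  also have "\<dots> < \<infinity>"
    by (subst nn_integral_cmult_indicator) (auto simp: emeasure_zcube ennreal_mult_less_top)
  finally show ?thesis by (simp add: transform_def)
qed

lemma transform_measurable:
  assumes "g \<in> borel_measurable borel"
  shows "transform A B g \<in> borel_measurable borel"
proof -
  have "(\<lambda>p. g (fst (fst p) - shift A B (snd (fst p)) (snd p), snd p)) \<in> borel_measurable borel"
    by (rule borel_measurable_comp_continuous[OF assms]) (intro continuous_intros)
  from borel_measurable_nn_integral_lborel[OF measurable_compose[OF this measurable_ennreal]]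
  have "(\<lambda>q. \<integral>\<^sup>+z. ennreal (g (fst q - shift A B (snd q) z, z)) \<partial>lborel) \<in> borel_measurable borel" .
  then show ?thesis unfolding transform_def[abs_def] by measurable
qed

lemma transform_Holder:
  assumes g: "admissible C g" and h0: "admissible C h0" and h1: "admissible C h1" and \<theta>: "0 < \<theta>" "\<theta> < 1"
    and le: "\<And>p. g p \<le> h0 p powr \<theta> * h1 p powr (1 - \<theta>)"
  shows "transform A B g q \<le> transform A B h0 q powr \<theta> * transform A B h1 q powr (1 - \<theta>)"
proof -
  let ?l = "\<lambda>z. (fst q - shift A B (snd q) z, z)"
  have "ennreal (transform A B g q) \<le> (\<integral>\<^sup>+z. ennreal (h0 (?l z) powr \<theta> * h1 (?l z) powr (1 - \<theta>)) \<partial>lborel)"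
    unfolding transform_eq[OF g] by (intro nn_integral_mono ennreal_leI le)
  also have "\<dots> \<le> ennreal (transform A B h0 q powr \<theta> * transform A B h1 q powr (1 - \<theta>))"
  proof (rule nn_integral_Holder)
    show "(\<lambda>z. h0 (?l z)) \<in> borel_measurable lborel" "(\<lambda>z. h1 (?l z)) \<in> borel_measurable lborel"
      unfolding measurable_lborel2 by (intro line_measurable admissibleD[OF h0] admissibleD[OF h1])+
    show "(\<integral>\<^sup>+z. ennreal (h0 (?l z)) \<partial>lborel) \<le> ennreal (transform A B h0 q)"
      "(\<integral>\<^sup>+z. ennreal (h1 (?l z)) \<partial>lborel) \<le> ennreal (transform A B h1 q)"
      unfolding transform_eq[OF h0] transform_eq[OF h1] by (rule order_refl)+
  qed (simp_all add: \<theta> admissibleD(2)[OF h0] admissibleD(2)[OF h1])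
  finally show ?thesis by (simp add: ennreal_le_iff)
qed

definition phase_space :: "((real^'n) \<times> (real^'n)) measure" where
  "phase_space = restrict_space lborel (UNIV \<times> unit_cube)"

lemma unit_cube_eq: "unit_cube = cbox (\<chi> i. -1) (\<chi> i. 1)"
  unfolding unit_cube_def by (intro set_eqI) (simp add: mem_box_cart)

lemma unit_cube_closed: "closed unit_cube"
  unfolding unit_cube_eq by (rule closed_cbox)

lemma unit_cube_bounded: "bounded unit_cube"
  unfolding unit_cube_eq by (rule bounded_cbox)

lemma UNIV_times_unit_cube_borel [measurable]: "UNIV \<times> unit_cube \<in> sets (borel :: ((real^'n) \<times> (real^'n)) measure)"
  by (intro borel_closed closed_Times closed_UNIV unit_cube_closed)

lemma space_phase_space: "space phase_space = UNIV \<times> unit_cube"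
  by (simp add: phase_space_def space_restrict_space)

lemma phase_space_measurable:
  "f \<in> borel_measurable borel \<Longrightarrow> f \<in> borel_measurable phase_space"
  unfolding phase_space_def by (intro measurable_restrict_space1) simp

lemma nn_integral_phase_space:
  fixes f :: "(real^'n) \<times> (real^'n) \<Rightarrow> ennreal"
  assumes f: "f \<in> borel_measurable borel"
  shows "(\<integral>\<^sup>+q. f q \<partial>phase_space) = (\<integral>\<^sup>+q. f q * indicator (UNIV \<times> unit_cube) q \<partial>lborel)"
    and "(\<integral>\<^sup>+q. f q \<partial>phase_space) = (\<integral>\<^sup>+\<xi>. (\<integral>\<^sup>+x. f (x, \<xi>) \<partial>lborel) * indicator unit_cube \<xi> \<partial>lborel)"
proof -
  show 1: "(\<integral>\<^sup>+q. f q \<partial>phase_space) = (\<integral>\<^sup>+q. f q * indicator (UNIV \<times> unit_cube) q \<partial>lborel)"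
    unfolding phase_space_def by (subst nn_integral_restrict_space) auto
  have m: "(\<lambda>q. f q * indicator (UNIV \<times> unit_cube) q) \<in> borel_measurable borel"
    using f by measurable
  have "(\<integral>\<^sup>+q. f q * indicator (UNIV \<times> unit_cube) q \<partial>lborel)
      = (\<integral>\<^sup>+x. (\<integral>\<^sup>+\<xi>. f (x, \<xi>) * indicator (UNIV \<times> unit_cube) (x, \<xi>) \<partial>lborel) \<partial>lborel)"
    by (rule nn_integral_lborel_pair[OF m])
  also have "\<dots> = (\<integral>\<^sup>+\<xi>. (\<integral>\<^sup>+x. f (x, \<xi>) * indicator (UNIV \<times> unit_cube) (x, \<xi>) \<partial>lborel) \<partial>lborel)"
    by (rule nn_integral_lborel_swap) (use m in simp)
  also have "\<dots> = (\<integral>\<^sup>+\<xi>. (\<integral>\<^sup>+x. f (x, \<xi>) \<partial>lborel) * indicator unit_cube \<xi> \<partial>lborel)"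
    by (intro nn_integral_cong) (auto simp: indicator_def)
  finally show "(\<integral>\<^sup>+q. f q \<partial>phase_space) = (\<integral>\<^sup>+\<xi>. (\<integral>\<^sup>+x. f (x, \<xi>) \<partial>lborel) * indicator unit_cube \<xi> \<partial>lborel)"
    unfolding 1 .
qed

lemma emeasure_unit_cube: "emeasure lborel (unit_cube :: (real^'n) set) < \<infinity>"
  using emeasure_bounded_finite[OF unit_cube_bounded] by simp

text \<open>For each fixed \<xi>, Fubini and translation in x give back the integral of g exactly.
  This is the trivial endpoint (1, 1) of the interpolation.\<close>

lemma transform_L1:
  assumes g: "admissible C g"
  shows "(\<integral>\<^sup>+q. ennreal (transform A B g q) \<partial>phase_space)
    = emeasure lborel (unit_cube :: (real^'n) set) * (\<integral>\<^sup>+p. ennreal (g (p :: (real^'n) \<times> real \<times> real)) \<partial>lborel)"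
proof -
  have gm: "g \<in> borel_measurable borel" using admissibleD(1)[OF g] .
  have ge: "(\<lambda>p. ennreal (g p)) \<in> borel_measurable borel" using gm by measurable
  note c = borel_measurable_comp_continuous[OF ge]
  have tm: "(\<lambda>q. ennreal (transform A B g q)) \<in> borel_measurable borel"
    using transform_measurable[OF gm] by measurable
  have eq: "(\<integral>\<^sup>+x. (\<integral>\<^sup>+z. ennreal (g (x - shift A B \<xi> z, z)) \<partial>lborel) \<partial>lborel) = (\<integral>\<^sup>+p. ennreal (g p) \<partial>lborel)" for \<xi>
  proof -
    have "(\<integral>\<^sup>+x. (\<integral>\<^sup>+z. ennreal (g (x - shift A B \<xi> z, z)) \<partial>lborel) \<partial>lborel)
        = (\<integral>\<^sup>+z. (\<integral>\<^sup>+x. ennreal (g (x - shift A B \<xi> z, z)) \<partial>lborel) \<partial>lborel)"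
      by (rule nn_integral_lborel_swap) (intro c continuous_intros)
    also have "\<dots> = (\<integral>\<^sup>+z. (\<integral>\<^sup>+x. ennreal (g (x, z)) \<partial>lborel) \<partial>lborel)"
    proof (rule nn_integral_cong)
      fix z
      have "(\<lambda>x. ennreal (g (x, z))) \<in> borel_measurable borel" by (intro c continuous_intros)
      from nn_integral_lborel_translate[OF this, of "- shift A B \<xi> z"]
      show "(\<integral>\<^sup>+x. ennreal (g (x - shift A B \<xi> z, z)) \<partial>lborel) = (\<integral>\<^sup>+x. ennreal (g (x, z)) \<partial>lborel)" by simp
    qed
    also have "\<dots> = (\<integral>\<^sup>+x. (\<integral>\<^sup>+z. ennreal (g (x, z)) \<partial>lborel) \<partial>lborel)"
      by (rule nn_integral_lborel_swap) (intro c continuous_intros)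
    also have "\<dots> = (\<integral>\<^sup>+p. ennreal (g p) \<partial>lborel)" by (rule nn_integral_lborel_pair[OF ge, symmetric])
    finally show ?thesis .
  qed
  show ?thesis
    unfolding nn_integral_phase_space(2)[OF tm]
    unfolding transform_eq[OF g] fst_conv snd_conv eq
    by (subst nn_integral_cmult_indicator) (auto simp: borel_closed unit_cube_closed mult.commute)
qed

lemma admissible_zcube: "C > 0 \<Longrightarrow> admissible C (\<lambda>p. indicator (cball 0 C \<times> zcube) p)"
proof -
  have "closed (cball (0 :: real^'n) C \<times> zcube)" unfolding zcube_def by (intro closed_Times closed_cball) auto
  then have "(\<lambda>p :: (real^'n) \<times> real \<times> real. indicator (cball 0 C \<times> zcube) p :: real) \<in> borel_measurable borel"
    by (intro borel_measurable_indicator borel_closed)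
  then show ?thesis by (auto simp: admissible_def indicator_def intro!: exI[of _ 1])
qed

lemma shift_bound:
  obtains r where "r \<ge> 0" "\<And>\<xi> z. \<xi> \<in> unit_cube \<Longrightarrow> z \<in> zcube \<Longrightarrow> norm (shift A B \<xi> z) \<le> r"
proof -
  have "compact ((\<lambda>p. shift A B (fst p) (snd p)) ` (unit_cube \<times> zcube))"
    unfolding zcube_def
    by (intro compact_continuous_image compact_Times continuous_intros)
      (auto simp: compact_eq_bounded_closed unit_cube_bounded unit_cube_closed)
  then have "bounded ((\<lambda>p. shift A B (fst p) (snd p)) ` (unit_cube \<times> zcube))" by (rule compact_imp_bounded)
  then obtain r where "\<forall>v\<in>(\<lambda>p. shift A B (fst p) (snd p)) ` (unit_cube \<times> zcube). norm v \<le> r"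
    unfolding bounded_iff by blast
  then show ?thesis by (intro that[of "max 0 r"]) fastforce+
qed

text \<open>The transform of an admissible function lives on a set of finite measure, so the exponent
  on the left-hand side can be lowered.\<close>

lemma transform_lower_exponent:
  fixes A B :: "real^'n^'n"
  obtains V where "V > 0" "\<And>g q0 q L. admissible C g \<Longrightarrow> 0 < q \<Longrightarrow> q \<le> q0 \<Longrightarrow> L \<ge> 0 \<Longrightarrow>
    (\<integral>\<^sup>+x. ennreal (transform A B g x powr q0) \<partial>phase_space) \<le> ennreal L \<Longrightarrow>
    (\<integral>\<^sup>+x. ennreal (transform A B g x powr q) \<partial>phase_space) \<le> ennreal (L powr (q / q0) * V powr (1 - q / q0))"
proof -
  obtain r where r: "r \<ge> 0" "\<And>\<xi> z. \<xi> \<in> unit_cube \<Longrightarrow> z \<in> zcube \<Longrightarrow> norm (shift A B \<xi> z) \<le> r"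
    using shift_bound[of A B] by blast
  define X where "X = cball (0 :: real^'n) (C + r) \<times> (unit_cube :: (real^'n) set)"
  have X: "closed X" unfolding X_def by (intro closed_Times closed_cball unit_cube_closed)
  have Xb: "X \<in> sets borel" by (rule borel_closed[OF X])
  have "bounded X" unfolding X_def by (intro bounded_Times bounded_cball unit_cube_bounded)
  then have fin: "emeasure lborel X < \<infinity>" using emeasure_bounded_finite by simp
  \<comment> \<open>The added 1 keeps V positive also when X is a null set.\<close>
  define V where "V = measure lborel X + 1"
  have V: "V > 0" by (simp add: V_def add_nonneg_pos)
  have eX: "(\<integral>\<^sup>+x. ennreal (indicator X x) \<partial>phase_space) \<le> ennreal V"
  proof -
    have "(\<integral>\<^sup>+x. ennreal (indicator X x) \<partial>phase_space) \<le> (\<integral>\<^sup>+x. indicator X x \<partial>lborel)"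
    proof -
      have "(\<lambda>x. ennreal (indicator X x)) \<in> borel_measurable borel" using Xb by simp
      from nn_integral_phase_space(1)[OF this] show ?thesis
        by (simp only:) (rule nn_integral_mono, auto simp: indicator_def)
    qed
    also have "\<dots> = emeasure lborel X" using Xb by simp
    also have "\<dots> \<le> ennreal V"
      using fin by (simp add: V_def emeasure_eq_ennreal_measure less_top ennreal_leI)
    finally show ?thesis .
  qed
  show ?thesis
  proof (rule that[OF V])
    fix g :: "(real^'n) \<times> real \<times> real \<Rightarrow> real" and q0 q L :: real
    assume g: "admissible C g" and q: "0 < q" "q \<le> q0" and L: "L \<ge> 0"
      "(\<integral>\<^sup>+x. ennreal (transform A B g x powr q0) \<partial>phase_space) \<le> ennreal L"
    have [measurable]: "transform A B g \<in> borel_measurable phase_space"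
      by (intro phase_space_measurable transform_measurable admissibleD(1)[OF g])
    show "(\<integral>\<^sup>+x. ennreal (transform A B g x powr q) \<partial>phase_space) \<le> ennreal (L powr (q / q0) * V powr (1 - q / q0))"
    proof (cases "q = q0")
      case True
      then show ?thesis using L q V by simp
    next
      case False
      have [measurable]: "indicat_real X \<in> borel_measurable phase_space"
        by (intro phase_space_measurable borel_measurable_indicator Xb)
      have zero: "transform A B g x = 0" if "x \<in> space phase_space" "x \<notin> X" for x
      proof -
        have x: "snd x \<in> unit_cube" "norm (fst x) > C + r"
          using that by (auto simp: space_phase_space X_def)
        have "g (fst x - shift A B (snd x) z, z) = 0" for z
        proof (cases "z \<in> zcube")
          case True
          have "norm (fst x) \<le> norm (fst x - shift A B (snd x) z) + norm (shift A B (snd x) z)"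
            using norm_triangle_ineq[of "fst x - shift A B (snd x) z" "shift A B (snd x) z"] by simp
          then have "norm (fst x - shift A B (snd x) z) > C" using r(2)[OF x(1) True] x(2) by linarith
          then show ?thesis using admissibleD(3)[OF g] by blast
        next
          case False
          then show ?thesis using admissibleD(3)[OF g] by blast
        qed
        then show ?thesis by (simp add: transform_def)
      qed
      have "(\<integral>\<^sup>+x. ennreal (transform A B g x powr q) \<partial>phase_space)
        = (\<integral>\<^sup>+x. ennreal ((transform A B g x powr q0) powr (q / q0) * indicator X x powr (1 - q / q0)) \<partial>phase_space)"
        using q zero by (intro nn_integral_cong) (auto simp: powr_powr indicator_def)
      also have "\<dots> \<le> ennreal (L powr (q / q0) * V powr (1 - q / q0))"
        using q False L V eX by (intro nn_integral_Holder) auto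
      finally show ?thesis .
    qed
  qed
qed

text \<open>The estimate from L^((m+2)/2) to L^(m+2), raised to the power m + 2; this is why the
  integral on the right is squared. It integrates over all \<xi>, and K is the same for all radii
  C.\<close>

definition endpoint_bound :: "real^'n^'n \<Rightarrow> real^'n^'n \<Rightarrow> nat \<Rightarrow> real \<Rightarrow> bool" where
  "endpoint_bound A B m K \<longleftrightarrow> (\<forall>C g. admissible C g \<longrightarrow>
     (\<integral>\<^sup>+\<xi>. (\<integral>\<^sup>+x. (\<integral>\<^sup>+z. ennreal (g (x - shift A B \<xi> z, z)) \<partial>lborel) ^ (m + 2) \<partial>lborel) \<partial>lborel)
     \<le> ennreal K * (\<integral>\<^sup>+p. ennreal (g p powr ((real m + 2) / 2)) \<partial>lborel)\<^sup>2)"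

lemma transform_endpoint:
  assumes e: "endpoint_bound A B m K" "K \<ge> 0" and g: "admissible C g"
    and N: "(\<integral>\<^sup>+p. ennreal (g p powr ((real m + 2) / 2)) \<partial>lborel) \<le> ennreal N" "N \<ge> 0"
  shows "(\<integral>\<^sup>+x. ennreal (transform A B g x powr (real m + 2)) \<partial>phase_space) \<le> ennreal (K * N\<^sup>2)"
proof -
  have tm: "(\<lambda>x. ennreal (transform A B g x powr (real m + 2))) \<in> borel_measurable borel"
    using transform_measurable[OF admissibleD(1)[OF g]] by measurable
  have pw: "ennreal (transform A B g q powr (real m + 2)) = (\<integral>\<^sup>+z. ennreal (g (fst q - shift A B (snd q) z, z)) \<partial>lborel) ^ (m + 2)" for q
  proof -
    have "transform A B g q powr (real m + 2) = transform A B g q powr real (m + 2)" by (simp add: add.commute)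
    also have "\<dots> = transform A B g q ^ (m + 2)" by (rule powr_realpow') simp_all
    finally show ?thesis by (simp only: transform_eq[OF g, symmetric] ennreal_power transform_nonneg)
  qed
  have "(\<integral>\<^sup>+x. ennreal (transform A B g x powr (real m + 2)) \<partial>phase_space)
     \<le> (\<integral>\<^sup>+\<xi>. (\<integral>\<^sup>+x. (\<integral>\<^sup>+z. ennreal (g (x - shift A B \<xi> z, z)) \<partial>lborel) ^ (m + 2) \<partial>lborel) \<partial>lborel)"
    unfolding nn_integral_phase_space(2)[OF tm]
    unfolding pw fst_conv snd_conv by (intro nn_integral_mono) (simp add: indicator_def)
  also have "\<dots> \<le> ennreal K * (\<integral>\<^sup>+p. ennreal (g p powr ((real m + 2) / 2)) \<partial>lborel)\<^sup>2"
    using e(1) g unfolding endpoint_bound_def by blast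
  also have "\<dots> \<le> ennreal K * (ennreal N)\<^sup>2"
    using N by (intro mult_left_mono power_mono) auto
  also have "\<dots> = ennreal (K * N\<^sup>2)" using e(2) N(2) by (simp add: ennreal_mult ennreal_power)
  finally show ?thesis .
qed

lemma transform_indicator_le: "transform A B (\<lambda>p. indicator (cball 0 C \<times> zcube) p) q \<le> 4"
proof -
  have "(\<integral>\<^sup>+z. ennreal (indicator (cball 0 C \<times> zcube) (fst q - shift A B (snd q) z, z)) \<partial>lborel) \<le> (\<integral>\<^sup>+z. indicator zcube z \<partial>lborel)"
    by (intro nn_integral_mono) (simp add: indicator_def)
  also have "\<dots> = ennreal 4" by (simp add: emeasure_zcube)
  finally show ?thesis unfolding transform_def by (intro enn2real_leI) auto
qed

text \<open>For a positive operator the interpolation with the trivial bounds at $(1,1)$ and $(0,0)$ is pointwise: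
  write \<open>g\<close> as a product of two powers and apply Hoelder on each plane.\<close>

lemma transform_critical_exponent:
  fixes A B :: "real^'n^'n"
  assumes e: "endpoint_bound A B m K" "K \<ge> 0" and m: "m > 0" and C: "C > 0" and p: "p \<ge> (1 :: real)"
    and q: "q > 0" "1 + m / q \<ge> (m + 1) / p" "2 / q \<ge> 1 / p"
  obtains q0 K0 where "q0 \<ge> q" "K0 \<ge> 0"
    "\<And>g N. admissible C g \<Longrightarrow> N \<ge> 0 \<Longrightarrow> (\<integral>\<^sup>+x. ennreal (g x powr p) \<partial>lborel) \<le> ennreal N \<Longrightarrow>
      (\<integral>\<^sup>+x. ennreal (transform A B g x powr q0) \<partial>phase_space) \<le> ennreal (K0 * N powr (q0 / p))"
proof -
  define k where "k = real m + 2"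
  have k: "k > 2" using m by (simp add: k_def)
  consider "p \<ge> k / 2" | "p = 1" | "1 < p" "p < k / 2" using p by linarith
  then show ?thesis
  proof cases
    case 1
    \<comment> \<open>Interpolation with (0, 0): on the support, g = h^t 1^(1-t) with h^(k/2) = g^p.
      The transform of the indicator contributes powers of 4, the area of the square, and the
      exponents stay on the line q0 = 2p.\<close>
    define t where "t = k / (2 * p)"
    have t: "0 < t" "t \<le> 1" using 1 k p by (auto simp: t_def)
    let ?K = "4 powr ((1 - t) * (2 * p)) * K"
    show ?thesis
    proof (rule that[of "2 * p" ?K])
      show "q \<le> 2 * p" using q p by (simp add: field_simps)
      show "?K \<ge> 0" using e by simp
      fix g :: "(real^'n) \<times> real \<times> real \<Rightarrow> real" and N :: real
      assume g: "admissible C g" and N: "N \<ge> 0" "(\<integral>\<^sup>+x. ennreal (g x powr p) \<partial>lborel) \<le> ennreal N"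
      define h where "h x = g x powr (1 / t)" for x
      have h: "admissible C h" unfolding h_def[abs_def] using g t by (intro admissible_powr) auto
      have hp: "h x powr (k / 2) = g x powr p" for x
      proof -
        have "1 / t * (k / 2) = p" using k p by (simp add: t_def)
        then show ?thesis by (simp only: h_def powr_powr)
      qed
      have ht: "h x powr t = g x" for x using t admissibleD(2)[OF g] by (simp add: h_def powr_powr)
      have le: "transform A B g x \<le> transform A B h x powr t * 4 powr (1 - t)" for x
      proof (cases "t = 1")
        case True
        then have "h = g" using admissibleD(2)[OF g] by (auto simp: h_def fun_eq_iff)
        then show ?thesis using True by simp
      next
        case False
        let ?i = "\<lambda>p :: (real^'n) \<times> real \<times> real. indicator (cball 0 C \<times> zcube) p :: real"
        have "transform A B g x \<le> transform A B h x powr t * transform A B ?i x powr (1 - t)"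
        proof (rule transform_Holder[OF g h admissible_zcube[OF C]])
          fix y :: "(real^'n) \<times> real \<times> real"
          show "g y \<le> h y powr t * ?i y powr (1 - t)"
            unfolding ht using admissibleD(3)[OF g, of "fst y" "snd y"] False
            by (cases "y \<in> cball 0 C \<times> zcube") (auto simp: mem_Times_iff)
        qed (use t False in auto)
        also have "\<dots> \<le> transform A B h x powr t * 4 powr (1 - t)"
          using t transform_indicator_le[of A B C x] by (intro mult_left_mono powr_mono2) simp_all
        finally show ?thesis .
      qed
      have "(\<integral>\<^sup>+x. ennreal (transform A B g x powr (2 * p)) \<partial>phase_space)
          \<le> (\<integral>\<^sup>+x. ennreal (4 powr ((1 - t) * (2 * p))) * ennreal (transform A B h x powr k) \<partial>phase_space)"
      proof (rule nn_integral_mono)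
        fix x :: "(real^'n) \<times> (real^'n)"
        have "transform A B g x powr (2 * p) \<le> (transform A B h x powr t * 4 powr (1 - t)) powr (2 * p)"
          using le p by (intro powr_mono2) auto
        also have "\<dots> = 4 powr ((1 - t) * (2 * p)) * transform A B h x powr k"
        proof -
          have "t * (2 * p) = k" using p by (simp add: t_def)
          then show ?thesis by (simp only: powr_mult powr_powr mult.commute)
        qed
        finally show "ennreal (transform A B g x powr (2 * p)) \<le> ennreal (4 powr ((1 - t) * (2 * p))) * ennreal (transform A B h x powr k)"
          by (simp add: ennreal_mult[symmetric] ennreal_leI)
      qed
      also have "\<dots> = ennreal (4 powr ((1 - t) * (2 * p))) * (\<integral>\<^sup>+x. ennreal (transform A B h x powr k) \<partial>phase_space)"
      proof (rule nn_integral_cmult)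
        have "transform A B h \<in> borel_measurable phase_space"
          by (intro phase_space_measurable transform_measurable admissibleD[OF h])
        then show "(\<lambda>x. ennreal (transform A B h x powr k)) \<in> borel_measurable phase_space" by measurable
      qed
      also have "\<dots> \<le> ennreal (4 powr ((1 - t) * (2 * p))) * ennreal (K * N\<^sup>2)"
        unfolding k_def using N by (intro mult_left_mono transform_endpoint[OF e h]) (simp_all add: hp[unfolded k_def])
      also have "\<dots> = ennreal (?K * N powr (2 * p / p))"
        using e(2) N(1) p by (simp add: ennreal_mult[symmetric] mult.assoc powr_numeral)
      finally show "(\<integral>\<^sup>+x. ennreal (transform A B g x powr (2 * p)) \<partial>phase_space) \<le> ennreal (?K * N powr (2 * p / p))" .
    qed
  next
    case 2
    let ?K = "measure lborel (unit_cube :: (real^'n) set)"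
    show ?thesis
    proof (rule that[of 1 ?K])
      show "q \<le> 1" using q 2 m by (simp add: field_simps)
      fix g :: "(real^'n) \<times> real \<times> real \<Rightarrow> real" and N :: real
      assume g: "admissible C g" and N: "N \<ge> 0" "(\<integral>\<^sup>+x. ennreal (g x powr p) \<partial>lborel) \<le> ennreal N"
      have "(\<integral>\<^sup>+x. ennreal (transform A B g x powr 1) \<partial>phase_space) = ennreal ?K * (\<integral>\<^sup>+x. ennreal (g x) \<partial>lborel)"
        using transform_L1[OF g, of A B] emeasure_unit_cube[where 'n='n]
        by (simp add: emeasure_eq_ennreal_measure less_top)
      also have "\<dots> \<le> ennreal ?K * ennreal N"
        using N 2 admissibleD(2)[OF g] by (intro mult_left_mono) auto
      finally show "(\<integral>\<^sup>+x. ennreal (transform A B g x powr 1) \<partial>phase_space) \<le> ennreal (?K * N powr (1 / p))"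
        using N 2 by (simp add: ennreal_mult)
    qed simp
  next
    case 3
    define t where "t = (1 - 1 / p) / (1 - 2 / k)"
    have k2: "1 - 2 / k > 0" using k by simp
    have t: "0 < t" "t < 1"
    proof -
      show "0 < t" unfolding t_def using 3 k2 by (intro divide_pos_pos) auto
      have "2 / k < 1 / p" using 3 k by (simp add: field_simps)
      then show "t < 1" unfolding t_def using k2 by (simp add: field_simps)
    qed
    have up: "1 / p = (1 - t) + t * (2 / k)"
    proof -
      have "1 - 2 / k \<noteq> 0" using k2 by linarith
      from nonzero_eq_divide_eq[OF this, THEN iffD1, OF t_def] have "t * (1 - 2 / k) = 1 - 1 / p" .
      then show ?thesis by (simp add: algebra_simps)
    qed
    define v where "v = (1 - t) + t / k"
    have v: "v > 0" using t k by (auto simp: v_def intro!: add_pos_pos)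
    define q0 where "q0 = 1 / v"
    have q0: "q0 > 0" using v by (simp add: q0_def)
    \<comment> \<open>The weight in the outer Hoelder inequality, the powers there being (1-t) q0
      and t q0 = k (1 - \<phi>). That they fit is the defining relation of
      \<open>q0\<close>.\<close>
    define \<phi> where "\<phi> = q0 * (1 - t)"
    have \<phi>1: "1 - \<phi> = q0 * (t / k)"
    proof -
      have "q0 * v = 1" using v by (simp add: q0_def)
      then show ?thesis by (simp add: \<phi>_def v_def algebra_simps)
    qed
    have \<phi>: "0 < \<phi>" "\<phi> < 1"
    proof -
      show "0 < \<phi>" using q0 t by (simp add: \<phi>_def)
      have "0 < q0 * (t / k)" using q0 t k by simp
      then show "\<phi> < 1" using \<phi>1 by linarith
    qed
    have qv: "q \<le> q0"
    proof -
      have "m * v = (m + 1) * (1 / p) - 1"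
      proof -
        have "m * v - (m + 1) * (1 / p) + 1 = t * (m / k - m - 2 * (m + 1) / k + (m + 1))"
          unfolding up v_def by (simp add: algebra_simps)
        also have "m / k - m - 2 * (m + 1) / k + (m + 1) = 0"
        proof -
          have "m / k - m - 2 * (m + 1) / k + (m + 1) = (m - m * k - 2 * (m + 1) + (m + 1) * k) / k"
            using k by (simp add: add_divide_distrib diff_divide_distrib)
          also have "m - m * k - 2 * (m + 1) + (m + 1) * k = 0" by (simp add: k_def algebra_simps)
          finally show ?thesis by simp
        qed
        finally show ?thesis by simp
      qed
      then have "m * v \<le> m / q" using q(2) by simp
      then have "v \<le> 1 / q" using m q(1) by (simp add: field_simps)
      then show ?thesis using v q(1) by (simp add: q0_def field_simps)
    qed
    let ?c = "measure lborel (unit_cube :: (real^'n) set)"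
    let ?K = "?c powr \<phi> * K powr (1 - \<phi>)"
    show ?thesis
    proof (rule that[OF qv, of ?K])
      fix g :: "(real^'n) \<times> real \<times> real \<Rightarrow> real" and N :: real
      assume g: "admissible C g" and N: "N \<ge> 0" "(\<integral>\<^sup>+x. ennreal (g x powr p) \<partial>lborel) \<le> ennreal N"
      define h0 h1 where "h0 x = g x powr p" and "h1 x = g x powr (2 * p / k)" for x
      have h: "admissible C h0" "admissible C h1"
        unfolding h0_def[abs_def] h1_def[abs_def] using g p k by (auto intro!: admissible_powr)
      have h1p: "h1 x powr (k / 2) = g x powr p" for x
        using k by (simp add: h1_def powr_powr)
      have le: "transform A B g x \<le> transform A B h0 x powr (1 - t) * transform A B h1 x powr (1 - (1 - t))" for x
      proof (rule transform_Holder[OF g h])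
        fix y
        have "p * (1 - t) + 2 * p / k * t = p * (1 / p)" unfolding up by (simp add: algebra_simps)
        then have "p * (1 - t) + 2 * p / k * t = 1" using p by simp
        then have "h0 y powr (1 - t) * h1 y powr t = g y powr 1"
          by (simp only: h0_def h1_def powr_powr powr_add[symmetric])
        then show "g y \<le> h0 y powr (1 - t) * h1 y powr (1 - (1 - t))" using admissibleD(2)[OF g] by simp
      qed (use t in auto)
      have [measurable]: "transform A B h0 \<in> borel_measurable phase_space" "transform A B h1 \<in> borel_measurable phase_space"
        by (intro phase_space_measurable transform_measurable admissibleD[OF h(1)] admissibleD[OF h(2)])+
      have "(\<integral>\<^sup>+x. ennreal (transform A B g x powr q0) \<partial>phase_space)
          \<le> (\<integral>\<^sup>+x. ennreal (transform A B h0 x powr \<phi> * (transform A B h1 x powr k) powr (1 - \<phi>)) \<partial>phase_space)"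
      proof (intro nn_integral_mono ennreal_leI)
        fix x :: "(real^'n) \<times> (real^'n)"
        have "transform A B g x powr q0 \<le> (transform A B h0 x powr (1 - t) * transform A B h1 x powr t) powr q0"
          using le[of x] q0 by (intro powr_mono2) auto
        also have "\<dots> = transform A B h0 x powr \<phi> * (transform A B h1 x powr k) powr (1 - \<phi>)"
        proof -
          have "(1 - t) * q0 = \<phi>" "t * q0 = k * (1 - \<phi>)" using k unfolding \<phi>1 by (simp_all add: \<phi>_def)
          then show ?thesis by (simp only: powr_mult powr_powr)
        qed
        finally show "transform A B g x powr q0 \<le> transform A B h0 x powr \<phi> * (transform A B h1 x powr k) powr (1 - \<phi>)" .
      qed
      also have "\<dots> \<le> ennreal ((?c * N) powr \<phi> * (K * N\<^sup>2) powr (1 - \<phi>))"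
      proof (rule nn_integral_Holder)
        have "(\<integral>\<^sup>+x. ennreal (transform A B h0 x) \<partial>phase_space) = ennreal ?c * (\<integral>\<^sup>+x. ennreal (g x powr p) \<partial>lborel)"
          using transform_L1[OF h(1), of A B] emeasure_unit_cube[where 'n='n]
          by (simp add: emeasure_eq_ennreal_measure less_top h0_def)
        also have "\<dots> \<le> ennreal ?c * ennreal N" using N by (intro mult_left_mono) auto
        finally show "(\<integral>\<^sup>+x. ennreal (transform A B h0 x) \<partial>phase_space) \<le> ennreal (?c * N)"
          using N by (simp add: ennreal_mult)
        show "(\<integral>\<^sup>+x. ennreal (transform A B h1 x powr k) \<partial>phase_space) \<le> ennreal (K * N\<^sup>2)"
          unfolding k_def using N by (intro transform_endpoint[OF e h(2)]) (simp_all add: h1p[unfolded k_def])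
      qed (use \<phi> N e in auto)
      also have "(?c * N) powr \<phi> * (K * N\<^sup>2) powr (1 - \<phi>) = ?K * N powr (q0 / p)"
      proof -
        have "q0 / p = q0 * ((1 - t) + t * (2 / k))" unfolding up[symmetric] by simp
        also have "\<dots> = \<phi> + 2 * (1 - \<phi>)" unfolding \<phi>1 by (simp add: \<phi>_def algebra_simps)
        finally have qp: "q0 / p = \<phi> + 2 * (1 - \<phi>)" .
        have "N powr (q0 / p) = N powr \<phi> * (N\<^sup>2) powr (1 - \<phi>)"
        proof (cases "N = 0")
          case False
          then have "N\<^sup>2 = N powr 2" using N(1) by simp
          then have "(N\<^sup>2) powr (1 - \<phi>) = N powr (2 * (1 - \<phi>))" by (simp only: powr_powr)
          then show ?thesis by (simp only: qp powr_add)
        qed simp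
        then show ?thesis by (simp add: powr_mult mult_ac)
      qed
      finally show "(\<integral>\<^sup>+x. ennreal (transform A B g x powr q0) \<partial>phase_space) \<le> ennreal (?K * N powr (q0 / p))" .
    qed simp
  qed
qed

lemma transform_estimate:
  fixes A B :: "real^'n^'n"
  assumes e: "endpoint_bound A B m K" "K \<ge> 0" and m: "m > 0" and C: "C > 0" and p: "p \<ge> (1 :: real)"
    and q: "q > 0" "1 + m / q \<ge> (m + 1) / p" "2 / q \<ge> 1 / p"
  obtains K' where "K' \<ge> 0"
    "\<And>g N. admissible C g \<Longrightarrow> N \<ge> 0 \<Longrightarrow> (\<integral>\<^sup>+x. ennreal (g x powr p) \<partial>lborel) \<le> ennreal N \<Longrightarrow>
      (\<integral>\<^sup>+x. ennreal (transform A B g x powr q) \<partial>phase_space) \<le> ennreal (K' * N powr (q / p))"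
proof -
  obtain q0 K0 where K0: "q0 \<ge> q" "K0 \<ge> 0"
    "\<And>g N. admissible C g \<Longrightarrow> N \<ge> 0 \<Longrightarrow> (\<integral>\<^sup>+x. ennreal (g x powr p) \<partial>lborel) \<le> ennreal N \<Longrightarrow>
      (\<integral>\<^sup>+x. ennreal (transform A B g x powr q0) \<partial>phase_space) \<le> ennreal (K0 * N powr (q0 / p))"
    using transform_critical_exponent[OF assms] by blast
  obtain V where V: "V > 0" "\<And>g q0 q L. admissible C g \<Longrightarrow> 0 < q \<Longrightarrow> q \<le> q0 \<Longrightarrow> L \<ge> 0 \<Longrightarrow>
    (\<integral>\<^sup>+x. ennreal (transform A B g x powr q0) \<partial>phase_space) \<le> ennreal L \<Longrightarrow>
    (\<integral>\<^sup>+x. ennreal (transform A B g x powr q) \<partial>phase_space) \<le> ennreal (L powr (q / q0) * V powr (1 - q / q0))"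
    using transform_lower_exponent[of C A B] by blast
  show ?thesis
  proof (rule that[of "K0 powr (q / q0) * V powr (1 - q / q0)"])
    fix g :: "(real^'n) \<times> real \<times> real \<Rightarrow> real" and N :: real
    assume g: "admissible C g" and N: "N \<ge> 0" "(\<integral>\<^sup>+x. ennreal (g x powr p) \<partial>lborel) \<le> ennreal N"
    have "(\<integral>\<^sup>+x. ennreal (transform A B g x powr q) \<partial>phase_space)
      \<le> ennreal ((K0 * N powr (q0 / p)) powr (q / q0) * V powr (1 - q / q0))"
      using K0 q by (intro V(2)[OF g q(1) K0(1)] K0(3)[OF g N]) auto
    also have "(K0 * N powr (q0 / p)) powr (q / q0) * V powr (1 - q / q0)
      = K0 powr (q / q0) * V powr (1 - q / q0) * N powr (q / p)"
      using K0 q by (simp add: powr_mult powr_powr)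
    finally show "(\<integral>\<^sup>+x. ennreal (transform A B g x powr q) \<partial>phase_space)
      \<le> ennreal (K0 powr (q / q0) * V powr (1 - q / q0) * N powr (q / p))" .
  qed simp
qed

subsection \<open>From admissible functions to the transform of the statement\<close>

text \<open>A slice of a Lebesgue measurable function need not be measurable. The Borel majorant,
  infinite on a null set, dominates |f| everywhere and so controls every slice, while its L^p norm
  is still that of f.\<close>

lemma borel_majorant:
  fixes f :: "(real^'n) \<times> real \<times> real \<Rightarrow> complex"
  assumes f: "f \<in> borel_measurable lebesgue"
    and supp: "\<And>z. z \<notin> ball 0 C \<times> {-1..1} \<times> {-1..1} \<Longrightarrow> f z = 0"
  obtains G :: "(real^'n) \<times> real \<times> real \<Rightarrow> ennreal" where "G \<in> borel_measurable borel"
    "\<And>p. ennreal (norm (f p)) \<le> G p" "AE p in lborel. G p = ennreal (norm (f p))"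
    "\<And>p. p \<notin> ball 0 C \<times> zcube \<Longrightarrow> G p = 0"
proof -
  have "(\<lambda>p. ennreal (norm (f p))) \<in> borel_measurable lebesgue" using f by measurable
  from completion_ex_borel_measurable[OF this]
  obtain h where h: "h \<in> borel_measurable lborel" "AE p in lborel. ennreal (norm (f p)) = h p" by blast
  obtain N where N: "{p \<in> space lborel. \<not> ennreal (norm (f p)) = h p} \<subseteq> N" "N \<in> null_sets lborel"
    using AE_E[OF h(2)] by (metis (mono_tags, lifting) null_setsI)
  have Nb[measurable]: "N \<in> sets borel" using N(2) by (auto simp: null_sets_def)
  have hb[measurable]: "h \<in> borel_measurable borel" using h(1) by simp
  have "ball (0 :: real^'n) C \<times> zcube = (ball 0 C \<times> UNIV) \<inter> (UNIV \<times> zcube)" by auto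
  also have "\<dots> \<in> sets borel"
    unfolding zcube_def by (intro sets.Int borel_open borel_closed open_Times closed_Times) auto
  finally have Bb[measurable]: "ball (0 :: real^'n) C \<times> zcube \<in> sets borel" .
  define G where "G p = (if p \<in> ball 0 C \<times> zcube then (if p \<in> N then \<top> else h p) else 0)" for p
  show ?thesis
  proof (rule that[of G])
    show "G \<in> borel_measurable borel" unfolding G_def[abs_def] by measurable
    have "ennreal (norm (f p)) = h p" if "p \<notin> N" for p using N(1) that by auto
    then show "ennreal (norm (f p)) \<le> G p" for p
      using supp[of p] by (auto simp: G_def zcube_def)
    have "AE p in lborel. p \<notin> N" using N(2) by (rule AE_not_in)
    with h(2) show "AE p in lborel. G p = ennreal (norm (f p))"
    proof eventually_elim
      fix p assume "ennreal (norm (f p)) = h p" "p \<notin> N"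
      then show "G p = ennreal (norm (f p))"
        using supp[of p] by (cases "p \<in> ball 0 C \<times> zcube") (simp_all add: G_def zcube_def)
    qed
  qed (simp add: G_def)
qed

text \<open>When the plane integral does not converge absolutely, the transform has the value 0 by
  convention, so the bound holds at every point without exception.\<close>

lemma two_plane_transform_bound:
  fixes Q1 Q2 :: "real^'n \<Rightarrow> real"
  assumes Q: "quadratic_form Q1" "quadratic_form Q2"
    and G: "G \<in> borel_measurable borel" "\<And>p. ennreal (norm (f p)) \<le> G p"
  shows "ennreal (norm (two_plane_transform Q1 Q2 f q))
    \<le> (\<integral>\<^sup>+z. G (fst q - shift (hessian Q1 0) (hessian Q2 0) (snd q) z, z) \<partial>lborel)"
proof -
  let ?A = "hessian Q1 0" and ?B = "hessian Q2 0"
  obtain x \<xi> where q: "q = (x, \<xi>)" by (cases q)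
  have gr: "gradient Q1 y = ?A *v y" "gradient Q2 y = ?B *v y" for y
    using quadratic_form_hessian[OF Q(1)] quadratic_form_hessian[OF Q(2)] by metis+
  let ?h = "\<lambda>z :: real \<times> real. f (x - shift ?A ?B \<xi> z, z)"
  have T: "two_plane_transform Q1 Q2 f q = (\<integral>z. indicator ({-1..1} \<times> {-1..1}) z *\<^sub>R ?h z \<partial>lebesgue)"
    by (simp add: two_plane_transform_def q set_lebesgue_integral_def gr shift_def split_def diff_diff_eq)
  have Gm: "(\<lambda>z. G (x - shift ?A ?B \<xi> z, z)) \<in> borel_measurable borel"
    by (intro borel_measurable_comp_continuous[OF G(1)] continuous_intros)
  show ?thesis
  proof (cases "integrable lebesgue (\<lambda>z. indicator ({-1..1} \<times> {-1..1}) z *\<^sub>R ?h z)")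
    case True
    have "ennreal (norm (two_plane_transform Q1 Q2 f q)) \<le> (\<integral>\<^sup>+z. ennreal (norm (indicator ({-1..1} \<times> {-1..1}) z *\<^sub>R ?h z)) \<partial>lebesgue)"
      unfolding T by (rule integral_norm_bound_ennreal[OF True])
    also have "\<dots> \<le> (\<integral>\<^sup>+z. G (x - shift ?A ?B \<xi> z, z) \<partial>lebesgue)"
      using G(2) by (intro nn_integral_mono) (auto simp: indicator_def)
    also have "\<dots> = (\<integral>\<^sup>+z. G (x - shift ?A ?B \<xi> z, z) \<partial>lborel)"
      using Gm by (intro nn_integral_completion)
    finally show ?thesis by (simp add: q)
  next
    case False
    then show ?thesis unfolding T by (simp add: not_integrable_integral_eq)
  qed
qed

lemma nn_integral_lebesgue_on:
  fixes f :: "(real^'n) \<times> (real^'n) \<Rightarrow> ennreal"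
  assumes f: "f \<in> borel_measurable borel"
  shows "(\<integral>\<^sup>+q. f q \<partial>lebesgue_on (UNIV \<times> unit_cube)) = (\<integral>\<^sup>+q. f q \<partial>phase_space)"
proof -
  have "(\<integral>\<^sup>+q. f q \<partial>lebesgue_on (UNIV \<times> unit_cube)) = (\<integral>\<^sup>+q. f q * indicator (UNIV \<times> unit_cube) q \<partial>lebesgue)"
    using UNIV_times_unit_cube_borel[where 'n='n]
    by (subst nn_integral_restrict_space) (auto simp: sets_completionI_sets)
  also have "\<dots> = (\<integral>\<^sup>+q. f q * indicator (UNIV \<times> unit_cube) q \<partial>lborel)"
    using f by (intro nn_integral_completion) measurable
  finally show ?thesis unfolding nn_integral_phase_space(1)[OF f] .
qed

lemma ennreal_powr_mono: "x \<le> y \<Longrightarrow> r \<ge> 0 \<Longrightarrow> ennreal_powr x r \<le> ennreal_powr y r"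
  by (auto simp: ennreal_powr_def top_unique intro!: ennreal_leI powr_mono2 enn2real_mono simp: less_top)

lemma ennreal_powr_ennreal [simp]: "x \<ge> 0 \<Longrightarrow> ennreal_powr (ennreal x) r = ennreal (x powr r)"
  by (simp add: ennreal_powr_def)

text \<open>The truncations of the Borel majorant at height j are admissible and obey one estimate
  with a constant independent of j; monotone convergence, inside the plane integral and outside,
  gives the limit.\<close>

lemma Lp_Lq_estimate_finite:
  fixes Q1 Q2 :: "real^'n \<Rightarrow> real"
  assumes Q: "quadratic_form Q1" "quadratic_form Q2"
    and e: "endpoint_bound (hessian Q1 0) (hessian Q2 0) m K" "K \<ge> 0" and m: "m > 0" and C: "C > 0" and p: "p \<ge> (1 :: real)"
    and q: "q > 0" "1 + m / q \<ge> (m + 1) / p" "2 / q \<ge> 1 / p"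
  shows "Lp_Lq_estimate Q1 Q2 C (ennreal p) (ennreal q)"
proof -
  let ?A = "hessian Q1 0" and ?B = "hessian Q2 0"
  obtain K' where K': "K' \<ge> 0"
    "\<And>g N. admissible C g \<Longrightarrow> N \<ge> 0 \<Longrightarrow> (\<integral>\<^sup>+x. ennreal (g x powr p) \<partial>lborel) \<le> ennreal N \<Longrightarrow>
      (\<integral>\<^sup>+x. ennreal (transform ?A ?B g x powr q) \<partial>phase_space) \<le> ennreal (K' * N powr (q / p))"
    using transform_estimate[OF e m C p q] by blast
  show ?thesis
    unfolding Lp_Lq_estimate_def
  proof (intro exI[of _ "K' powr (1 / q)"] conjI allI impI)
    fix f :: "(real^'n) \<times> real \<times> real \<Rightarrow> complex"
    assume f: "f \<in> borel_measurable lebesgue" and fin: "Lp_norm lebesgue (ennreal p) f < \<infinity>"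
      and supp: "\<forall>z. z \<notin> ball 0 C \<times> {-1..1} \<times> {-1..1} \<longrightarrow> f z = 0"
    define I where "I = (\<integral>\<^sup>+x. ennreal (norm (f x) powr p) \<partial>lebesgue)"
    have Lp: "Lp_norm lebesgue (ennreal p) f = ennreal_powr I (1 / p)"
      using p by (simp add: Lp_norm_def I_def)
    have "I \<noteq> \<infinity>" using fin unfolding Lp by (auto simp: ennreal_powr_def)
    then obtain N where N: "I = ennreal N" "N \<ge> 0" by (cases I) auto
    obtain G where G: "G \<in> borel_measurable borel" "\<And>p. ennreal (norm (f p)) \<le> G p"
      "AE p in lborel. G p = ennreal (norm (f p))" "\<And>p. p \<notin> ball 0 C \<times> zcube \<Longrightarrow> G p = 0"
      using borel_majorant[OF f, of C] supp by blast
    have [measurable]: "G \<in> borel_measurable borel" by (rule G(1))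
    define g where "g j p = enn2real (min (G p) (of_nat j))" for j p
    have eg: "ennreal (g j p) = min (G p) (of_nat j)" for j p
    proof -
      have "min (G p) (of_nat j) < \<top>" by (simp add: min_less_iff_disj ennreal_of_nat_eq_real_of_nat)
      then show ?thesis by (simp add: g_def)
    qed
    have gm: "g j \<in> borel_measurable borel" for j unfolding g_def[abs_def] by measurable
    have adm: "admissible C (g j)" for j
      unfolding admissible_def
    proof (intro conjI allI impI exI[of _ "real j"])
      show "g j \<in> borel_measurable borel" by (rule gm)
      show "0 \<le> g j p" for p by (simp add: g_def)
      show "g j p \<le> real j" for p
        unfolding g_def by (rule enn2real_leI) (simp_all add: ennreal_of_nat_eq_real_of_nat[symmetric])
      show "g j (y, z) = 0" if "C < norm y \<or> z \<notin> zcube" for y z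
        using that G(4)[of "(y, z)"] by (auto simp: g_def)
    qed
    have gN: "(\<integral>\<^sup>+x. ennreal (g j x powr p) \<partial>lborel) \<le> ennreal N" for j
    proof -
      have [measurable]: "g j \<in> borel_measurable borel" by (rule gm)
      have "(\<integral>\<^sup>+x. ennreal (g j x powr p) \<partial>lborel) = (\<integral>\<^sup>+x. ennreal (g j x powr p) \<partial>lebesgue)"
        by (intro nn_integral_completion[symmetric]) measurable
      also have "\<dots> \<le> I"
        unfolding I_def
      proof (rule nn_integral_mono_AE)
        show "AE x in lebesgue. ennreal (g j x powr p) \<le> ennreal (norm (f x) powr p)"
        proof (rule AE_completion, use G(3) in eventually_elim)
          fix x assume "G x = ennreal (norm (f x))"
          then have "ennreal (g j x) \<le> ennreal (norm (f x))" unfolding eg by simp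
          then have "g j x \<le> norm (f x)" by (simp add: ennreal_le_iff)
          then show "ennreal (g j x powr p) \<le> ennreal (norm (f x) powr p)"
            using p by (intro ennreal_leI powr_mono2) (auto simp: g_def)
        qed
      qed
      finally show ?thesis unfolding N(1) .
    qed
    let ?T = "\<lambda>j. transform ?A ?B (g j)"
    have mono_g: "ennreal (g i x) \<le> ennreal (g j x)" if "i \<le> j" for i j x
      unfolding eg using that by (intro min.mono) auto
    have mono_T: "?T i x \<le> ?T j x" if "i \<le> j" for i j x
    proof -
      have "ennreal (?T i x) \<le> ennreal (?T j x)"
        unfolding transform_eq[OF adm] by (intro nn_integral_mono mono_g that)
      then show ?thesis by (simp add: ennreal_le_iff)
    qed
    have TG: "(\<integral>\<^sup>+z. G (fst x - shift ?A ?B (snd x) z, z) \<partial>lborel) = (SUP j. ennreal (?T j x))" for x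
    proof -
      have "G y = (SUP j. ennreal (g j y))" for y
      proof (rule antisym)
        show "(SUP j. ennreal (g j y)) \<le> G y" by (intro SUP_least) (simp add: eg)
        show "G y \<le> (SUP j. ennreal (g j y))"
        proof (cases "G y")
          case (real r)
          obtain j where "r \<le> real j" using real_arch_simple by blast
          then have "G y \<le> ennreal (g j y)"
            using real unfolding eg by (simp add: ennreal_of_nat_eq_real_of_nat ennreal_leI)
          then show ?thesis by (rule order_trans) (intro SUP_upper, simp)
        next
          case top
          then have "(SUP j. ennreal (g j y)) = (SUP j. of_nat j)" unfolding eg by simp
          then show ?thesis by (simp only: ennreal_SUP_of_nat_eq_top top_greatest)
        qed
      qed
      then have "(\<integral>\<^sup>+z. G (fst x - shift ?A ?B (snd x) z, z) \<partial>lborel)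
          = (\<integral>\<^sup>+z. (SUP j. ennreal (g j (fst x - shift ?A ?B (snd x) z, z))) \<partial>lborel)" by simp
      also have "\<dots> = (SUP j. \<integral>\<^sup>+z. ennreal (g j (fst x - shift ?A ?B (snd x) z, z)) \<partial>lborel)"
      proof (rule nn_integral_monotone_convergence_SUP)
        show "incseq (\<lambda>j z. ennreal (g j (fst x - shift ?A ?B (snd x) z, z)))"
          by (intro incseq_SucI le_funI mono_g) simp
        show "(\<lambda>z. ennreal (g j (fst x - shift ?A ?B (snd x) z, z))) \<in> borel_measurable lborel" for j
          unfolding measurable_lborel2 by (intro measurable_compose[OF _ measurable_ennreal] line_measurable gm)
      qed
      finally show ?thesis unfolding transform_eq[OF adm] .
    qed
    \<comment> \<open>If the supremum of the q-th powers is finite, its q-th root bounds all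
      truncated transforms and hence their supremum, the plane integral of the majorant. If it is
      infinite there is nothing to bound.\<close>
    have pw: "ennreal (norm (two_plane_transform Q1 Q2 f x) powr q) \<le> (SUP j. ennreal (?T j x powr q))" for x
    proof (cases "(SUP j. ennreal (?T j x powr q))")
      case (real r)
      have "?T j x \<le> r powr (1 / q)" for j
      proof -
        have "ennreal (?T j x powr q) \<le> ennreal r" unfolding real(2)[symmetric] by (intro SUP_upper) simp
        then have "?T j x powr q \<le> r" using real by (simp add: ennreal_le_iff)
        then have "(?T j x powr q) powr (1 / q) \<le> r powr (1 / q)" using q by (intro powr_mono2) auto
        then show ?thesis using q by (simp add: powr_powr)
      qed
      then have "(SUP j. ennreal (?T j x)) \<le> ennreal (r powr (1 / q))" by (intro SUP_least ennreal_leI)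
      then have "ennreal (norm (two_plane_transform Q1 Q2 f x)) \<le> ennreal (r powr (1 / q))"
        unfolding TG[symmetric] by (rule order_trans[OF two_plane_transform_bound[OF Q G(1,2)]])
      then have "norm (two_plane_transform Q1 Q2 f x) \<le> r powr (1 / q)" by (simp add: ennreal_le_iff)
      then have "norm (two_plane_transform Q1 Q2 f x) powr q \<le> (r powr (1 / q)) powr q" using q by (intro powr_mono2) auto
      then show ?thesis using real q by (simp add: powr_powr ennreal_leI)
    next
      case top
      show ?thesis unfolding top by (rule top_greatest)
    qed
    have Tm: "(\<lambda>x. ennreal (?T j x powr q)) \<in> borel_measurable borel" for j
      using transform_measurable[OF gm, of ?A ?B j] by measurable
    have "(\<integral>\<^sup>+x. ennreal (norm (two_plane_transform Q1 Q2 f x) powr q) \<partial>lebesgue_on (UNIV \<times> unit_cube))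
        \<le> (\<integral>\<^sup>+x. (SUP j. ennreal (?T j x powr q)) \<partial>lebesgue_on (UNIV \<times> unit_cube))"
      by (intro nn_integral_mono pw)
    also have "\<dots> = (\<integral>\<^sup>+x. (SUP j. ennreal (?T j x powr q)) \<partial>phase_space)"
      using Tm by (intro nn_integral_lebesgue_on borel_measurable_SUP) auto
    also have "\<dots> = (SUP j. \<integral>\<^sup>+x. ennreal (?T j x powr q) \<partial>phase_space)"
    proof (rule nn_integral_monotone_convergence_SUP)
      show "incseq (\<lambda>j x. ennreal (?T j x powr q))"
        using q mono_T by (intro incseq_SucI le_funI ennreal_leI powr_mono2) auto
    qed (intro phase_space_measurable Tm)
    also have "\<dots> \<le> ennreal (K' * N powr (q / p))"
      by (intro SUP_least K'(2) adm N(2) gN)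
    finally have "Lp_norm (lebesgue_on (UNIV \<times> unit_cube)) (ennreal q) (two_plane_transform Q1 Q2 f)
        \<le> ennreal_powr (ennreal (K' * N powr (q / p))) (1 / q)"
      using q by (simp add: Lp_norm_def ennreal_powr_mono)
    also have "\<dots> = ennreal ((K' * N powr (q / p)) powr (1 / q))"
      using K'(1) N(2) by simp
    also have "(K' * N powr (q / p)) powr (1 / q) = K' powr (1 / q) * N powr (1 / p)"
      using K'(1) N(2) q by (simp add: powr_mult powr_powr)
    also have "ennreal \<dots> = ennreal (K' powr (1 / q)) * Lp_norm lebesgue (ennreal p) f"
      unfolding Lp N(1) using N(2) by (simp add: ennreal_mult)
    finally show "Lp_norm (lebesgue_on (UNIV \<times> unit_cube)) (ennreal q) (two_plane_transform Q1 Q2 f)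
        \<le> ennreal (K' powr (1 / q)) * Lp_norm lebesgue (ennreal p) f" .
  qed simp
qed

text \<open>The functions live on a set of finite measure, where the sup norm dominates every L^p
  norm up to the factor V^(1/p).\<close>

lemma Lp_Lq_estimate_infinite:
  fixes Q1 Q2 :: "real^'n \<Rightarrow> real"
  assumes fin: "Lp_Lq_estimate Q1 Q2 C (ennreal p) q" and p: "p \<ge> 1" and C: "C > 0"
  shows "Lp_Lq_estimate Q1 Q2 C \<infinity> q"
proof -
  obtain K where K: "K \<ge> 0"
    "\<And>f :: (real^'n) \<times> real \<times> real \<Rightarrow> complex. f \<in> borel_measurable lebesgue \<Longrightarrow> Lp_norm lebesgue (ennreal p) f < \<infinity> \<Longrightarrow>
      (\<forall>z. z \<notin> ball 0 C \<times> {-1..1} \<times> {-1..1} \<longrightarrow> f z = 0) \<Longrightarrow>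
      Lp_norm (lebesgue_on (UNIV \<times> unit_cube)) q (two_plane_transform Q1 Q2 f) \<le> ennreal K * Lp_norm lebesgue (ennreal p) f"
    using fin unfolding Lp_Lq_estimate_def by blast
  let ?X = "cball (0 :: real^'n) C \<times> zcube"
  have X: "closed ?X" unfolding zcube_def by (intro closed_Times closed_cball) auto
  have "bounded ?X" unfolding zcube_def by (intro bounded_Times bounded_cball) auto
  then have fX: "emeasure lborel ?X < \<infinity>" using emeasure_bounded_finite by simp
  define V where "V = measure lborel ?X"
  have eV: "emeasure lborel ?X = ennreal V" using fX by (simp add: V_def emeasure_eq_ennreal_measure less_top)
  have V: "V \<ge> 0" by (simp add: V_def)
  show ?thesis
    unfolding Lp_Lq_estimate_def
  proof (intro exI[of _ "K * V powr (1 / p)"] conjI allI impI)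
    show "K * V powr (1 / p) \<ge> 0" using K V by simp
    fix f :: "(real^'n) \<times> real \<times> real \<Rightarrow> complex"
    assume f: "f \<in> borel_measurable lebesgue" and finf: "Lp_norm lebesgue \<infinity> f < \<infinity>"
      and supp: "\<forall>z. z \<notin> ball 0 C \<times> {-1..1} \<times> {-1..1} \<longrightarrow> f z = 0"
    have Li: "Lp_norm lebesgue \<infinity> f = esssup lebesgue (\<lambda>x. ennreal (norm (f x)))" by (simp add: Lp_norm_def)
    then obtain b where b: "Lp_norm lebesgue \<infinity> f = ennreal b" "b \<ge> 0" using finf by (cases "Lp_norm lebesgue \<infinity> f") auto
    have AEb: "AE x in lebesgue. ennreal (norm (f x)) \<le> ennreal b"
      using esssup_AE[of "\<lambda>x. ennreal (norm (f x))" lebesgue] unfolding Li[symmetric] b(1) .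
    have "(\<integral>\<^sup>+x. ennreal (norm (f x) powr p) \<partial>lebesgue) \<le> (\<integral>\<^sup>+x. ennreal (b powr p) * indicator ?X x \<partial>lebesgue)"
    proof (rule nn_integral_mono_AE, use AEb in eventually_elim)
      fix x assume x: "ennreal (norm (f x)) \<le> ennreal b"
      show "ennreal (norm (f x) powr p) \<le> ennreal (b powr p) * indicator ?X x"
      proof (cases "x \<in> ?X")
        case True
        have "norm (f x) \<le> b" using x b by (simp add: ennreal_le_iff)
        then show ?thesis using True p by (auto intro!: ennreal_leI powr_mono2)
      next
        case False
        then have "x \<notin> ball 0 C \<times> {-1..1} \<times> {-1..1}" by (auto simp: zcube_def)
        then have "f x = 0" by (rule supp[rule_format])
        then show ?thesis by simp
      qed
    qed
    also have "\<dots> = ennreal (b powr p) * emeasure lborel ?X"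
      using borel_closed[OF X] by (subst nn_integral_cmult_indicator) (auto simp: sets_completionI_sets)
    also have "\<dots> = ennreal (b powr p * V)" unfolding eV using V by (simp add: ennreal_mult)
    finally have "Lp_norm lebesgue (ennreal p) f \<le> ennreal_powr (ennreal (b powr p * V)) (1 / p)"
      using p by (simp add: Lp_norm_def ennreal_powr_mono)
    also have "\<dots> = ennreal (b * V powr (1 / p))"
      using b V p by (simp add: powr_mult powr_powr)
    finally have Lp: "Lp_norm lebesgue (ennreal p) f \<le> ennreal (b * V powr (1 / p))" .
    then have "Lp_norm lebesgue (ennreal p) f < \<infinity>" using order_le_less_trans by fastforce
    then have "Lp_norm (lebesgue_on (UNIV \<times> unit_cube)) q (two_plane_transform Q1 Q2 f) \<le> ennreal K * Lp_norm lebesgue (ennreal p) f"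
      using K(2)[OF f] supp by blast
    also have "\<dots> \<le> ennreal K * ennreal (b * V powr (1 / p))" using Lp by (rule mult_left_mono) simp
    also have "\<dots> = ennreal (K * V powr (1 / p)) * Lp_norm lebesgue \<infinity> f"
      unfolding b(1) using K V b by (simp add: ennreal_mult[symmetric] mult_ac)
    finally show "Lp_norm (lebesgue_on (UNIV \<times> unit_cube)) q (two_plane_transform Q1 Q2 f)
        \<le> ennreal (K * V powr (1 / p)) * Lp_norm lebesgue \<infinity> f" .
  qed
qed

text \<open>For each fixed direction \<xi>, Fubini and translation in x show that the planes with
  that direction meet N in total measure |N| = 0.\<close>

lemma line_null_sets:
  fixes A B :: "real^'n^'n"
  assumes N: "N \<in> null_sets (lborel :: ((real^'n) \<times> real \<times> real) measure)"
  shows "AE q in lborel. AE z in lborel. (fst q - shift A B (snd q) z, z) \<notin> N"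
proof -
  have Nb: "N \<in> sets borel" using N by (auto simp: null_sets_def)
  have ind: "(indicator N :: _ \<Rightarrow> ennreal) \<in> borel_measurable borel" using Nb by simp
  note c = borel_measurable_comp_continuous[OF ind]
  let ?T = "\<lambda>q. \<integral>\<^sup>+z. indicator N (fst q - shift A B (snd q) z, z) \<partial>lborel"
  have "(\<lambda>p. indicator N (fst (fst p) - shift A B (snd (fst p)) (snd p), snd p) :: ennreal) \<in> borel_measurable borel"
    by (intro c continuous_intros)
  from borel_measurable_nn_integral_lborel[OF this] have Tm: "?T \<in> borel_measurable borel" .
  have "(\<integral>\<^sup>+q. ?T q \<partial>lborel) = (\<integral>\<^sup>+x. (\<integral>\<^sup>+\<xi>. (\<integral>\<^sup>+z. indicator N (x - shift A B \<xi> z, z) \<partial>lborel) \<partial>lborel) \<partial>lborel)"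
    using nn_integral_lborel_pair[OF Tm] by simp
  also have "\<dots> = (\<integral>\<^sup>+\<xi>. (\<integral>\<^sup>+x. (\<integral>\<^sup>+z. indicator N (x - shift A B \<xi> z, z) \<partial>lborel) \<partial>lborel) \<partial>lborel)"
  proof (rule nn_integral_lborel_swap)
    show "(\<lambda>p. \<integral>\<^sup>+z. indicator N (fst p - shift A B (snd p) z, z) \<partial>lborel) \<in> borel_measurable borel"
      by (rule Tm)
  qed
  also have "\<dots> = (\<integral>\<^sup>+\<xi>. 0 \<partial>(lborel :: (real^'n) measure))"
  proof (rule nn_integral_cong)
    fix \<xi> :: "real^'n"
    have "(\<integral>\<^sup>+x. (\<integral>\<^sup>+z. indicator N (x - shift A B \<xi> z, z) \<partial>lborel) \<partial>lborel)
        = (\<integral>\<^sup>+z. (\<integral>\<^sup>+x. indicator N (x - shift A B \<xi> z, z) \<partial>lborel) \<partial>lborel)"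
      by (rule nn_integral_lborel_swap) (intro c continuous_intros)
    also have "\<dots> = (\<integral>\<^sup>+z. (\<integral>\<^sup>+x. indicator N (x, z) \<partial>lborel) \<partial>lborel)"
    proof (rule nn_integral_cong)
      fix z
      have "(\<lambda>x. indicator N (x, z) :: ennreal) \<in> borel_measurable borel" by (intro c continuous_intros)
      from nn_integral_lborel_translate[OF this, of "- shift A B \<xi> z"]
      show "(\<integral>\<^sup>+x. indicator N (x - shift A B \<xi> z, z) \<partial>lborel) = (\<integral>\<^sup>+x. indicator N (x, z) \<partial>lborel)" by simp
    qed
    also have "\<dots> = (\<integral>\<^sup>+x. (\<integral>\<^sup>+z. indicator N (x, z) \<partial>lborel) \<partial>lborel)"
      by (rule nn_integral_lborel_swap) (intro c continuous_intros)
    also have "\<dots> = (\<integral>\<^sup>+p. indicator N p \<partial>lborel)" by (rule nn_integral_lborel_pair[OF ind, symmetric])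
    also have "\<dots> = 0" using N Nb by (simp add: null_setsD1)
    finally show "(\<integral>\<^sup>+x. (\<integral>\<^sup>+z. indicator N (x - shift A B \<xi> z, z) \<partial>lborel) \<partial>lborel) = 0" .
  qed
  finally have "(\<integral>\<^sup>+q. ?T q \<partial>lborel) = 0" by simp
  then have "AE q in lborel. ?T q = 0" using Tm by (subst (asm) nn_integral_0_iff_AE) auto
  then show ?thesis
  proof eventually_elim
    fix q assume T: "?T q = 0"
    have "(\<lambda>z. indicator N (fst q - shift A B (snd q) z, z) :: ennreal) \<in> borel_measurable borel" by (intro c continuous_intros)
    then have "AE z in lborel. indicator N (fst q - shift A B (snd q) z, z) = (0 :: ennreal)"
      using T by (subst (asm) nn_integral_0_iff_AE) auto
    then show "AE z in lborel. (fst q - shift A B (snd q) z, z) \<notin> N"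
      by eventually_elim (simp add: indicator_eq_0_iff)
  qed
qed

text \<open>An essential supremum can be bounded by an almost everywhere bound only for a measurable
  function. Replacing f by a Borel representative makes the parameter integral measurable, and by
  \<open>line_null_sets\<close> it changes the transform on a null set only.\<close>

lemma two_plane_transform_measurable:
  fixes Q1 Q2 :: "real^'n \<Rightarrow> real"
  assumes Q: "quadratic_form Q1" "quadratic_form Q2" and f: "f \<in> borel_measurable lebesgue"
  shows "two_plane_transform Q1 Q2 f \<in> borel_measurable lebesgue"
proof -
  let ?A = "hessian Q1 0" and ?B = "hessian Q2 0" and ?Z = "{-1..1} \<times> {-1..1} :: (real \<times> real) set"
  have gr: "gradient Q1 y = ?A *v y" "gradient Q2 y = ?B *v y" for y
    using quadratic_form_hessian[OF Q(1)] quadratic_form_hessian[OF Q(2)] by metis+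
  obtain h where h: "h \<in> borel_measurable lborel" "AE p in lborel. f p = h p"
  proof -
    have "(\<lambda>p. Re (f p)) \<in> borel_measurable lebesgue" "(\<lambda>p. Im (f p)) \<in> borel_measurable lebesgue"
      using f by (auto intro: borel_measurable_Re borel_measurable_Im)
    then obtain h1 h2 where h1: "h1 \<in> borel_measurable lborel" "AE p in lborel. Re (f p) = h1 p"
      and h2: "h2 \<in> borel_measurable lborel" "AE p in lborel. Im (f p) = h2 p"
      using completion_ex_borel_measurable_real by blast
    have "(\<lambda>p. complex_of_real (h1 p) + \<i> * complex_of_real (h2 p)) \<in> borel_measurable lborel"
      using h1(1) h2(1) by measurable
    moreover have "AE p in lborel. f p = complex_of_real (h1 p) + \<i> * complex_of_real (h2 p)"
      using h1(2) h2(2) by eventually_elim (simp add: complex_eq_iff)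
    ultimately show thesis by (rule that)
  qed
  obtain N where N: "{p \<in> space lborel. \<not> f p = h p} \<subseteq> N" "N \<in> null_sets lborel"
    using AE_E[OF h(2)] by (metis (mono_tags, lifting) null_setsI)
  have hb: "h \<in> borel_measurable borel" using h(1) by simp
  have T: "two_plane_transform Q1 Q2 f q = (\<integral>z. indicator ?Z z *\<^sub>R f (fst q - shift ?A ?B (snd q) z, z) \<partial>lebesgue)" for f q
    by (cases q) (simp add: two_plane_transform_def set_lebesgue_integral_def gr shift_def split_def diff_diff_eq)
  have Zb: "?Z \<in> sets borel" using zcube_borel by (simp add: zcube_def)
  have hm: "(\<lambda>p. indicator ?Z (snd p) *\<^sub>R h (fst (fst p) - shift ?A ?B (snd (fst p)) (snd p), snd p)) \<in> borel_measurable borel"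
  proof -
    have "(\<lambda>p :: ((real^'n) \<times> (real^'n)) \<times> real \<times> real. h (fst (fst p) - shift ?A ?B (snd (fst p)) (snd p), snd p)) \<in> borel_measurable borel"
      by (intro borel_measurable_comp_continuous[OF hb] continuous_intros)
    moreover have "(\<lambda>p :: ((real^'n) \<times> (real^'n)) \<times> real \<times> real. indicator ?Z (snd p) :: real) \<in> borel_measurable borel"
      by (rule borel_measurable_comp_continuous[OF borel_measurable_indicator[OF Zb] continuous_on_snd[OF continuous_on_id]])
    ultimately show ?thesis by (rule borel_measurable_scaleR[rotated])
  qed
  have hz: "(\<lambda>z. indicator ?Z z *\<^sub>R h (fst q - shift ?A ?B (snd q) z, z)) \<in> borel_measurable lborel" for q
  proof -
    have "(\<lambda>z. h (fst q - shift ?A ?B (snd q) z, z)) \<in> borel_measurable borel"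
      by (intro borel_measurable_comp_continuous[OF hb] continuous_intros)
    then show ?thesis unfolding measurable_lborel2 by (rule borel_measurable_scaleR[OF borel_measurable_indicator[OF Zb]])
  qed
  have Th: "two_plane_transform Q1 Q2 h q = (\<integral>z. indicator ?Z z *\<^sub>R h (fst q - shift ?A ?B (snd q) z, z) \<partial>lborel)" for q
    unfolding T by (rule integral_completion[OF hz])
  have "(\<lambda>q. \<integral>z. indicator ?Z z *\<^sub>R h (fst q - shift ?A ?B (snd q) z, z) \<partial>lborel) \<in> borel_measurable borel"
  proof (rule lborel.borel_measurable_lebesgue_integral)
    show "(\<lambda>(q, z). indicator ?Z z *\<^sub>R h (fst q - shift ?A ?B (snd q) z, z)) \<in> borel_measurable (borel \<Otimes>\<^sub>M lborel)"
      using hm by (simp add: split_def borel_prod[symmetric] cong: measurable_cong_sets)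
  qed
  then have hTm: "two_plane_transform Q1 Q2 h \<in> borel_measurable lebesgue"
    unfolding Th[abs_def] by (intro measurable_completion) simp
  have "AE q in lborel. two_plane_transform Q1 Q2 f q = two_plane_transform Q1 Q2 h q"
    using line_null_sets[OF N(2), of ?A ?B]
  proof eventually_elim
    fix q assume "AE z in lborel. (fst q - shift ?A ?B (snd q) z, z) \<notin> N"
    then have "AE z in lborel. f (fst q - shift ?A ?B (snd q) z, z) = h (fst q - shift ?A ?B (snd q) z, z)"
      by eventually_elim (use N(1) in auto)
    then have ae: "AE z in lebesgue. indicator ?Z z *\<^sub>R f (fst q - shift ?A ?B (snd q) z, z) = indicator ?Z z *\<^sub>R h (fst q - shift ?A ?B (snd q) z, z)"
      unfolding AE_completion_iff by eventually_elim simp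
    have hzc: "(\<lambda>z. indicator ?Z z *\<^sub>R h (fst q - shift ?A ?B (snd q) z, z)) \<in> borel_measurable lebesgue"
      using hz by (rule measurable_completion)
    have "(\<lambda>z. indicator ?Z z *\<^sub>R f (fst q - shift ?A ?B (snd q) z, z)) \<in> borel_measurable lebesgue"
      by (rule borel_measurable_AE[OF hzc]) (use ae in \<open>eventually_elim, simp only:\<close>)
    then show "two_plane_transform Q1 Q2 f q = two_plane_transform Q1 Q2 h q"
      unfolding T using hzc ae by (intro integral_cong_AE)
  qed
  then have "AE q in lebesgue. two_plane_transform Q1 Q2 h q = two_plane_transform Q1 Q2 f q"
    unfolding AE_completion_iff by eventually_elim (rule sym)
  then show ?thesis
    by (rule borel_measurable_AE[OF hTm])
qed

text \<open>Almost every plane meets the null set where |f| exceeds its sup norm in a null set, so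
  the constant is 4, the area of the square of parameters.\<close>

lemma Lp_Lq_estimate_infinity_infinity:
  fixes Q1 Q2 :: "real^'n \<Rightarrow> real"
  assumes Q: "quadratic_form Q1" "quadratic_form Q2"
  shows "Lp_Lq_estimate Q1 Q2 C \<infinity> \<infinity>"
  unfolding Lp_Lq_estimate_def
proof (intro exI[of _ 4] conjI allI impI)
  let ?A = "hessian Q1 0" and ?B = "hessian Q2 0" and ?Z = "{-1..1} \<times> {-1..1} :: (real \<times> real) set"
  have gr: "gradient Q1 y = ?A *v y" "gradient Q2 y = ?B *v y" for y
    using quadratic_form_hessian[OF Q(1)] quadratic_form_hessian[OF Q(2)] by metis+
  fix f :: "(real^'n) \<times> real \<times> real \<Rightarrow> complex"
  assume f: "f \<in> borel_measurable lebesgue" and finf: "Lp_norm lebesgue \<infinity> f < \<infinity>"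
  let ?T = "two_plane_transform Q1 Q2 f" and ?M = "lebesgue_on (UNIV \<times> unit_cube) :: ((real^'n) \<times> (real^'n)) measure"
  have T: "?T q = (\<integral>z. indicator ?Z z *\<^sub>R f (fst q - shift ?A ?B (snd q) z, z) \<partial>lebesgue)" for q
    by (cases q) (simp add: two_plane_transform_def set_lebesgue_integral_def gr shift_def split_def diff_diff_eq)
  have Li: "Lp_norm lebesgue \<infinity> f = esssup lebesgue (\<lambda>x. ennreal (norm (f x)))" by (simp add: Lp_norm_def)
  then obtain b where b: "Lp_norm lebesgue \<infinity> f = ennreal b" "b \<ge> 0" using finf by (cases "Lp_norm lebesgue \<infinity> f") auto
  have AEb: "AE x in lebesgue. ennreal (norm (f x)) \<le> ennreal b"
    using esssup_AE[of "\<lambda>x. ennreal (norm (f x))" lebesgue] unfolding Li[symmetric] b(1) .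
  then have "AE x in lebesgue. norm (f x) \<le> b" by eventually_elim (use b in \<open>simp add: ennreal_le_iff\<close>)
  then have AEb: "AE x in lborel. norm (f x) \<le> b" by (simp add: AE_completion_iff)
  obtain N where N: "{p \<in> space lborel. \<not> norm (f p) \<le> b} \<subseteq> N" "N \<in> null_sets lborel"
    using AE_E[OF AEb] by (metis (mono_tags, lifting) null_setsI)
  have aeT: "AE q in lborel. norm (?T q) \<le> 4 * b"
    using line_null_sets[OF N(2), of ?A ?B]
  proof eventually_elim
    fix q assume "AE z in lborel. (fst q - shift ?A ?B (snd q) z, z) \<notin> N"
    then have "AE z in lborel. norm (f (fst q - shift ?A ?B (snd q) z, z)) \<le> b"
      by eventually_elim (use N(1) in auto)
    then have "AE z in lebesgue. norm (f (fst q - shift ?A ?B (snd q) z, z)) \<le> b"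
      by (rule AE_completion)
    then have "AE z in lebesgue. ennreal (norm (indicator ?Z z *\<^sub>R f (fst q - shift ?A ?B (snd q) z, z))) \<le> ennreal b * indicator zcube z"
      by eventually_elim (auto simp: zcube_def indicator_def intro!: ennreal_leI)
    then have "(\<integral>\<^sup>+z. ennreal (norm (indicator ?Z z *\<^sub>R f (fst q - shift ?A ?B (snd q) z, z))) \<partial>lebesgue)
        \<le> (\<integral>\<^sup>+z. ennreal b * indicator zcube z \<partial>lebesgue)"
      by (rule nn_integral_mono_AE)
    also have "\<dots> = ennreal b * emeasure lborel (zcube :: (real \<times> real) set)"
      using zcube_borel by (subst nn_integral_cmult_indicator) (auto simp: sets_completionI_sets)
    also have "\<dots> = ennreal (4 * b)" using b by (simp add: emeasure_zcube ennreal_mult'' mult.commute)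
    finally have le: "(\<integral>\<^sup>+z. ennreal (norm (indicator ?Z z *\<^sub>R f (fst q - shift ?A ?B (snd q) z, z))) \<partial>lebesgue) \<le> ennreal (4 * b)" .
    show "norm (?T q) \<le> 4 * b"
    proof (cases "integrable lebesgue (\<lambda>z. indicator ?Z z *\<^sub>R f (fst q - shift ?A ?B (snd q) z, z))")
      case True
      have "ennreal (norm (?T q)) \<le> (\<integral>\<^sup>+z. ennreal (norm (indicator ?Z z *\<^sub>R f (fst q - shift ?A ?B (snd q) z, z))) \<partial>lebesgue)"
        unfolding T by (rule integral_norm_bound_ennreal[OF True])
      then have "ennreal (norm (?T q)) \<le> ennreal (4 * b)" using le by (rule order_trans)
      then show ?thesis using b by (simp add: ennreal_le_iff)
    next
      case False
      then have "?T q = 0" unfolding T by (rule not_integrable_integral_eq)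
      then show ?thesis using b by simp
    qed
  qed
  have ae: "AE q in lebesgue. ennreal (norm (?T q)) \<le> ennreal (4 * b)"
    proof (intro AE_completion)
    show "AE q in lborel. ennreal (norm (?T q)) \<le> ennreal (4 * b)"
      using aeT by eventually_elim (rule ennreal_leI)
  qed
  have S: "(UNIV \<times> unit_cube :: ((real^'n) \<times> (real^'n)) set) \<in> sets lebesgue"
    using borel_closed[OF closed_Times[OF closed_UNIV unit_cube_closed]] by (simp add: sets_completionI_sets)
  have aeM: "AE q in ?M. ennreal (norm (?T q)) \<le> ennreal (4 * b)"
    using ae S by (subst AE_restrict_space_iff) (auto elim: eventually_mono)
  have "?T \<in> borel_measurable ?M"
    by (rule measurable_restrict_space1[OF two_plane_transform_measurable[OF Q f]])
  then have "(\<lambda>q. ennreal (norm (?T q))) \<in> borel_measurable ?M" by measurable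
  from esssup_I[OF this aeM] have "Lp_norm ?M \<infinity> ?T \<le> ennreal (4 * b)" by (simp add: Lp_norm_def)
  then show "Lp_norm ?M \<infinity> ?T \<le> ennreal 4 * Lp_norm lebesgue \<infinity> f"
    unfolding b(1) using b(2) by (simp add: ennreal_mult)
qed simp

text \<open>The conditions on the exponents are read in the extended reals, with 1/\<infinity> = 0.
  There q = \<infinity> forces p = \<infinity>, and p = \<infinity> with finite q is reduced to a
  finite auxiliary exponent.\<close>

theorem Lp_Lq_estimate_of_endpoint_bound:
  fixes Q1 Q2 :: "real^'n \<Rightarrow> real"
  assumes Q: "quadratic_form Q1" "quadratic_form Q2"
    and K: "endpoint_bound (hessian Q1 0) (hessian Q2 0) m K" "K \<ge> 0" "m > 0" and C: "C > 0"
    and p: "p \<ge> 1" and q: "q \<ge> 1"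
    and pq: "1 + of_nat m / q \<ge> (of_nat m + 1) / p" "2 / q \<ge> 1 / p"
  shows "Lp_Lq_estimate Q1 Q2 C p q"
proof -
  have mm: "of_nat m = ennreal (real m)" by (simp add: ennreal_of_nat_eq_real_of_nat)
  have mm1: "of_nat m + 1 = ennreal (real m + 1)" unfolding mm by (metis ennreal_1 ennreal_plus of_nat_0_le_iff zero_le_one)
  have two: "(2::ennreal) = ennreal 2" by simp
  note fin = Lp_Lq_estimate_finite[OF Q K C]
  show ?thesis
  proof (cases "q = \<infinity>")
    case True
    then have "1 / p \<le> 0" using pq(2) by (simp add: top_unique)
    then have "p = \<infinity>" by (simp add: divide_ennreal_def ennreal_inverse_eq_0_iff)
    then show ?thesis using True Lp_Lq_estimate_infinity_infinity[OF Q] by simp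
  next
    case qf: False
    then obtain q' where q': "q = ennreal q'" "q' \<ge> 0" by (cases q) auto
    have q1: "q' \<ge> 1" using q unfolding q' using q'(2) by (metis ennreal_1 ennreal_le_iff)
    show ?thesis
    proof (cases "p = \<infinity>")
      case True
      \<comment> \<open>At least m + 1 makes the right-hand side of the first condition at most 1;
        at least q' gives the second condition.\<close>
      define p0 where "p0 = max (real m + 1) q'"
      have p0: "p0 \<ge> 1" "p0 \<ge> real m + 1" "p0 \<ge> q'" by (auto simp: p0_def)
      have a: "1 + real m / q' \<ge> real (m + 1) / p0"
      proof -
        have "real (m + 1) / p0 \<le> 1" using p0 by (simp add: field_simps)
        moreover have "real m / q' \<ge> 0" using q1 by simp
        ultimately show ?thesis by linarith
      qed
      have "1 / p0 \<le> 1 / q'" using p0 q1 by (intro divide_left_mono) auto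
      moreover have "1 / q' \<le> 2 / q'" using q1 by (intro divide_right_mono) auto
      ultimately have c: "2 / q' \<ge> 1 / p0" by linarith
      have "Lp_Lq_estimate Q1 Q2 C (ennreal p0) (ennreal q')"
        using q1 by (intro fin p0(1) a c) simp
      then show ?thesis unfolding True q'(1) by (rule Lp_Lq_estimate_infinite[OF _ p0(1) C])
    next
      case False
      then obtain p' where p': "p = ennreal p'" "p' \<ge> 0" by (cases p) auto
      have p1: "p' \<ge> 1" using p unfolding p' using p'(2) by (metis ennreal_1 ennreal_le_iff)
      have e1: "1 + of_nat m / q = ennreal (1 + real m / q')"
        unfolding mm q' using q1 by (simp add: divide_ennreal)
      have e2: "(of_nat m + 1) / p = ennreal ((real m + 1) / p')"
        unfolding mm1 p' using p1 by (subst divide_ennreal) auto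
      have e3: "2 / q = ennreal (2 / q')" unfolding two q' using q1 by (subst divide_ennreal) auto
      have e4: "1 / p = ennreal (1 / p')" unfolding p' ennreal_1[symmetric] using p1 by (subst divide_ennreal) auto
      have "1 + real m / q' \<ge> (real m + 1) / p'" using pq(1) unfolding e1 e2 using q1 p1 by (subst (asm) ennreal_le_iff) auto
      moreover have "2 / q' \<ge> 1 / p'" using pq(2) unfolding e3 e4 using q1 p1 by (subst (asm) ennreal_le_iff) auto
      ultimately show ?thesis unfolding p'(1) q'(1) using p1 q1 by (intro fin) (simp_all add: add.commute)
    qed
  qed
qed

subsection \<open>Testing an estimate on indicator functions\<close>

lemma powr_eventually_less_1:
  fixes L r \<eta> :: real
  assumes "r > 0" "\<eta> > 0" "L \<ge> 0"
  obtains \<delta> where "0 < \<delta>" "\<delta> < r" "\<delta> \<le> 1" "L * \<delta> powr \<eta> < 1"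
proof -
  define \<delta> where "\<delta> = min (min (r / 2) 1) ((1 / (2 * (L + 1))) powr (1 / \<eta>))"
  have d: "0 < \<delta>" "\<delta> < r" "\<delta> \<le> 1" using assms by (auto simp: \<delta>_def min_less_iff_disj)
  have "\<delta> powr \<eta> \<le> ((1 / (2 * (L + 1))) powr (1 / \<eta>)) powr \<eta>"
    using d assms by (intro powr_mono2) (auto simp: \<delta>_def)
  also have "\<dots> = 1 / (2 * (L + 1))" using assms by (simp add: powr_powr)
  finally have "L * \<delta> powr \<eta> \<le> L * (1 / (2 * (L + 1)))" using assms(3) by (rule mult_left_mono)
  also have "\<dots> < 1" using assms by (simp add: field_simps)
  finally show thesis using d that by blast
qed

lemma matrix_inequality_bound:
  fixes M :: "real^'n^'m"
  obtains b where "b > 0" "\<And>x. norm (M *v x) \<le> b * norm x"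
  using bounded_linear.pos_bounded[OF matrix_vector_mul_bounded_linear[of M]] by (metis mult.commute)

text \<open>The test function is the indicator of S times W. If the planes based in S' with
  direction in \<open>\<Xi>\<close> stay in S over W, the modulus of the transform is the measure of
  W on all of S' times \<open>\<Xi>\<close>. Writing v for 1/q with the value 0 at infinity covers
  the sup norm too; there the positive measures ensure that the value is seen by the essential
  supremum.\<close>

lemma Lp_Lq_estimate_test:
  fixes Q1 Q2 :: "real^'n \<Rightarrow> real" and p :: real and q :: ennreal
  assumes Q: "quadratic_form Q1" "quadratic_form Q2"
    and est: "Lp_Lq_estimate Q1 Q2 C (ennreal p) q" and p: "p \<ge> 1" and q: "q \<ge> 1"
    and v: "v = (if q = \<infinity> then 0 else 1 / enn2real q)"
  obtains K where "K \<ge> 0"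
    "\<And>S W S' \<Xi>. compact S \<Longrightarrow> compact W \<Longrightarrow> compact S' \<Longrightarrow> compact \<Xi> \<Longrightarrow>
      S \<subseteq> ball 0 C \<Longrightarrow> W \<subseteq> zcube \<Longrightarrow> \<Xi> \<subseteq> unit_cube \<Longrightarrow>
      measure lebesgue S' > 0 \<Longrightarrow> measure lebesgue \<Xi> > 0 \<Longrightarrow>
      (\<And>x \<xi> z. x \<in> S' \<Longrightarrow> \<xi> \<in> \<Xi> \<Longrightarrow> z \<in> W \<Longrightarrow> x - shift (hessian Q1 0) (hessian Q2 0) \<xi> z \<in> S) \<Longrightarrow>
      measure lebesgue W * (measure lebesgue S' * measure lebesgue \<Xi>) powr v
        \<le> K * (measure lebesgue S * measure lebesgue W) powr (1 / p)"
proof -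
  let ?A = "hessian Q1 0" and ?B = "hessian Q2 0" and ?Z = "{-1..1} \<times> {-1..1} :: (real \<times> real) set"
  have gr: "gradient Q1 y = ?A *v y" "gradient Q2 y = ?B *v y" for y
    using quadratic_form_hessian[OF Q(1)] quadratic_form_hessian[OF Q(2)] by metis+
  let ?M = "lebesgue_on (UNIV \<times> unit_cube) :: ((real^'n) \<times> (real^'n)) measure"
  obtain K where K: "K \<ge> 0"
    "\<And>f :: (real^'n) \<times> real \<times> real \<Rightarrow> complex. f \<in> borel_measurable lebesgue \<Longrightarrow> Lp_norm lebesgue (ennreal p) f < \<infinity> \<Longrightarrow>
      (\<forall>z. z \<notin> ball 0 C \<times> {-1..1} \<times> {-1..1} \<longrightarrow> f z = 0) \<Longrightarrow>
      Lp_norm ?M q (two_plane_transform Q1 Q2 f) \<le> ennreal K * Lp_norm lebesgue (ennreal p) f"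
    using est unfolding Lp_Lq_estimate_def by blast
  show ?thesis
  proof (rule that[OF K(1)])
    fix S :: "(real^'n) set" and W :: "(real \<times> real) set" and S' \<Xi> :: "(real^'n) set"
    assume cp: "compact S" "compact W" "compact S'" "compact \<Xi>"
      and sub: "S \<subseteq> ball 0 C" "W \<subseteq> zcube" "\<Xi> \<subseteq> unit_cube"
      and pos: "measure lebesgue S' > 0" "measure lebesgue \<Xi> > 0"
      and inc: "\<And>x \<xi> z. x \<in> S' \<Longrightarrow> \<xi> \<in> \<Xi> \<Longrightarrow> z \<in> W \<Longrightarrow> x - shift ?A ?B \<xi> z \<in> S"
    let ?w = "measure lebesgue W" and ?I = "indicator (S \<times> W) :: (real^'n) \<times> real \<times> real \<Rightarrow> real"
    define f where "f x = complex_of_real (?I x)" for x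
    have em: "emeasure lborel (X \<times> Y) = ennreal (measure lebesgue X * measure lebesgue Y)"
      if "compact X" "compact Y" for X :: "'u::euclidean_space set" and Y :: "'v::euclidean_space set"
    proof -
      have "emeasure lborel X < \<infinity>" "emeasure lborel Y < \<infinity>"
        using emeasure_bounded_finite compact_imp_bounded that by blast+
      then have "emeasure lborel X = ennreal (measure lebesgue X)" "emeasure lborel Y = ennreal (measure lebesgue Y)"
        using that by (simp_all add: emeasure_eq_ennreal_measure borel_compact)
      then show ?thesis
        unfolding lborel_prod[symmetric] using that
        by (subst lborel.emeasure_pair_measure_Times) (simp_all add: borel_compact ennreal_mult)
    qed
    have SWc: "compact (S \<times> W)" using cp by (intro compact_Times)
    have SWb: "S \<times> W \<in> sets borel" by (rule borel_compact[OF SWc])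
    have SWl: "S \<times> W \<in> sets lebesgue" using SWb by (simp add: sets_completionI_sets)
    have fm: "f \<in> borel_measurable lebesgue"
    proof -
      have "?I \<in> borel_measurable lebesgue" by (rule borel_measurable_indicator[OF SWl])
      then show ?thesis unfolding f_def[abs_def]
        by (rule measurable_compose) (intro borel_measurable_continuous_onI continuous_intros)
    qed
    have fs: "\<forall>z. z \<notin> ball 0 C \<times> {-1..1} \<times> {-1..1} \<longrightarrow> f z = 0"
    proof (intro allI impI)
      fix z :: "(real^'n) \<times> real \<times> real" assume z: "z \<notin> ball 0 C \<times> {-1..1} \<times> {-1..1}"
      have "S \<times> W \<subseteq> ball 0 C \<times> {-1..1} \<times> {-1..1}" using sub(1,2) unfolding zcube_def by (rule Sigma_mono)
      then have "z \<notin> S \<times> W" using z by blast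
      then show "f z = 0" by (simp add: f_def)
    qed
    have Lp: "Lp_norm lebesgue (ennreal p) f = ennreal ((measure lebesgue S * ?w) powr (1 / p))"
    proof -
      have "(\<integral>\<^sup>+x. ennreal (norm (f x) powr p) \<partial>lebesgue) = (\<integral>\<^sup>+x. indicator (S \<times> W) x \<partial>lebesgue)"
        by (rule nn_integral_cong) (simp add: f_def indicator_def)
      also have "\<dots> = ennreal (measure lebesgue S * ?w)"
        using SWb SWl em[OF cp(1,2)] by simp
      finally show ?thesis using p by (simp add: Lp_norm_def ennreal_powr_ennreal)
    qed
    have Tf: "norm (two_plane_transform Q1 Q2 f r) = ?w" if r: "r \<in> S' \<times> \<Xi>" for r
    proof -
      have "two_plane_transform Q1 Q2 f r = (\<integral>z. indicator ?Z z *\<^sub>R f (fst r - shift ?A ?B (snd r) z, z) \<partial>lebesgue)"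
        by (cases r) (simp add: two_plane_transform_def set_lebesgue_integral_def gr shift_def split_def diff_diff_eq)
      also have "\<dots> = (\<integral>z. complex_of_real (indicator W z) \<partial>lebesgue)"
      proof (rule Bochner_Integration.integral_cong)
        fix z :: "real \<times> real"
        have "fst r - shift ?A ?B (snd r) z \<in> S" if "z \<in> W" using inc[OF _ _ that, of "fst r" "snd r"] r by auto
        moreover have "z \<in> ?Z" if "z \<in> W" using that sub(2) unfolding zcube_def by blast
        ultimately show "indicator ?Z z *\<^sub>R f (fst r - shift ?A ?B (snd r) z, z) = complex_of_real (indicator W z)"
          by (cases "z \<in> W") (simp_all add: f_def)
      qed simp
      also have "\<dots> = complex_of_real (\<integral>z. indicator W z \<partial>lebesgue)"
        using fmeasurableD[OF lmeasurable_compact[OF cp(2)]] fmeasurableD2[OF lmeasurable_compact[OF cp(2)]]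
        by (intro integral_of_real integrable_real_indicator) (simp_all add: less_top)
      also have "(\<integral>z. indicator W z \<partial>lebesgue) = ?w" by simp
      finally show ?thesis by simp
    qed
    have Xb: "S' \<times> \<Xi> \<in> sets borel" by (rule borel_compact[OF compact_Times[OF cp(3,4)]])
    have Xl: "S' \<times> \<Xi> \<in> sets lebesgue" using Xb by (simp add: sets_completionI_sets)
    have Xsub: "S' \<times> \<Xi> \<subseteq> UNIV \<times> unit_cube" using sub(3) by (intro Sigma_mono) auto
    have Ul: "(UNIV \<times> unit_cube :: ((real^'n) \<times> (real^'n)) set) \<in> sets lebesgue"
      using borel_closed[OF closed_Times[OF closed_UNIV unit_cube_closed]] by (simp add: sets_completionI_sets)
    have XM: "S' \<times> \<Xi> \<in> sets ?M" using Xl Xsub Ul by (simp add: sets_restrict_space_iff)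
    have eX: "emeasure ?M (S' \<times> \<Xi>) = ennreal (measure lebesgue S' * measure lebesgue \<Xi>)"
      using emeasure_restrict_space[of "UNIV \<times> unit_cube" lebesgue "S' \<times> \<Xi>"] Ul Xsub Xb em[OF cp(3,4)] by simp
    have le: "ennreal (?w * (measure lebesgue S' * measure lebesgue \<Xi>) powr v) \<le> Lp_norm ?M q (two_plane_transform Q1 Q2 f)"
    proof (cases "q = \<infinity>")
      case True
      let ?g = "\<lambda>r. ennreal (norm (two_plane_transform Q1 Q2 f r))"
      have "ennreal ?w \<le> esssup ?M ?g"
      proof (rule ccontr)
        assume "\<not> ennreal ?w \<le> esssup ?M ?g"
        then have lt: "esssup ?M ?g < ennreal ?w" by simp
        have "AE r in ?M. r \<notin> S' \<times> \<Xi>"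
          using esssup_AE[of ?g ?M]
        proof eventually_elim
          fix r assume "?g r \<le> esssup ?M ?g"
          then have "?g r < ennreal ?w" using lt by (rule order_le_less_trans)
          then show "r \<notin> S' \<times> \<Xi>" using Tf[of r] by force
        qed
        then have "S' \<times> \<Xi> \<in> null_sets ?M" using XM by (subst AE_iff_null_sets) auto
        then show False using eX pos by auto
      qed
      then show ?thesis using True v pos by (simp add: Lp_norm_def)
    next
      case False
      then obtain q' where q': "q = ennreal q'" "q' \<ge> 0" by (cases q) auto
      have q1: "q' \<ge> 1" using q unfolding q' using q'(2) by (metis ennreal_1 ennreal_le_iff)
      have v': "v = 1 / q'" using v False q' by simp
      let ?m = "measure lebesgue S' * measure lebesgue \<Xi>"
      have "ennreal (?w powr q' * ?m) = (\<integral>\<^sup>+r. ennreal (?w powr q') * indicator (S' \<times> \<Xi>) r \<partial>?M)"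
        using XM eX pos by (subst nn_integral_cmult_indicator) (simp_all add: ennreal_mult)
      also have "\<dots> \<le> (\<integral>\<^sup>+r. ennreal (norm (two_plane_transform Q1 Q2 f r) powr q') \<partial>?M)"
      proof (rule nn_integral_mono)
        fix r
        show "ennreal (?w powr q') * indicator (S' \<times> \<Xi>) r \<le> ennreal (norm (two_plane_transform Q1 Q2 f r) powr q')"
          using Tf[of r] by (cases "r \<in> S' \<times> \<Xi>") simp_all
      qed
      finally have "ennreal_powr (ennreal (?w powr q' * ?m)) (1 / q')
          \<le> ennreal_powr (\<integral>\<^sup>+r. ennreal (norm (two_plane_transform Q1 Q2 f r) powr q') \<partial>?M) (1 / q')"
        using q1 by (intro ennreal_powr_mono) simp_all
      moreover have "Lp_norm ?M q (two_plane_transform Q1 Q2 f)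
          = ennreal_powr (\<integral>\<^sup>+r. ennreal (norm (two_plane_transform Q1 Q2 f r) powr q') \<partial>?M) (1 / q')"
        using q1 q' by (simp add: Lp_norm_def)
      moreover have "(?w powr q' * ?m) powr (1 / q') = ?w * ?m powr v"
        using q1 pos unfolding v' by (simp add: powr_mult powr_powr)
      ultimately show ?thesis using pos by (simp add: ennreal_powr_ennreal)
    qed
    have "ennreal (?w * (measure lebesgue S' * measure lebesgue \<Xi>) powr v) \<le> ennreal K * ennreal ((measure lebesgue S * ?w) powr (1 / p))"
    proof -
      have "Lp_norm lebesgue (ennreal p) f < \<infinity>" unfolding Lp by simp
      from order_trans[OF le K(2)[OF fm this fs]] show ?thesis unfolding Lp .
    qed
    also have "\<dots> = ennreal (K * (measure lebesgue S * ?w) powr (1 / p))" using K(1) by (simp add: ennreal_mult)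
    finally show "?w * (measure lebesgue S' * measure lebesgue \<Xi>) powr v \<le> K * (measure lebesgue S * ?w) powr (1 / p)"
      using K(1) by (subst (asm) ennreal_le_iff) auto
  qed
qed

subsection \<open>Powers of a matrix whose resolvent is regular on the unit disc\<close>

lemma holomorphic_on_det:
  fixes F :: "complex \<Rightarrow> complex^'n^'n"
  assumes "\<And>i j. (\<lambda>w. F w $ i $ j) holomorphic_on S"
  shows "(\<lambda>w. det (F w)) holomorphic_on S"
  unfolding det_def by (intro holomorphic_intros assms)

text \<open>By Cramer's rule the resolvent applied to a vector is holomorphic on the unit disc, and its Taylor
  coefficients at the origin are the iterates.\<close>

lemma iterates_bounded:
  fixes Y :: "real^'n^'n" and v :: "real^'n"
  assumes reg: "\<And>w. norm w < 1 \<Longrightarrow> det (mat 1 - (\<chi> i j. w * complex_of_real (Y $ i $ j))) \<noteq> 0"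
  obtains C where "C \<ge> 0" "\<And>i. norm (((*v) Y ^^ i) v) \<le> C * 2 ^ i"
proof -
  define x where "x i = ((*v) Y ^^ i) v" for i
  have xSuc: "x (Suc i) = Y *v x i" for i by (simp add: x_def)
  define F :: "complex \<Rightarrow> complex^'n^'n" where "F w = mat 1 - (\<chi> i j. w * complex_of_real (Y $ i $ j))" for w
  define \<phi> where "\<phi> a w = det (\<chi> i j. if j = a then complex_of_real (v $ i) else F w $ i $ j) / det (F w)" for a w
  have Fnth: "F w $ i $ j = of_bool (i = j) - w * complex_of_real (Y $ i $ j)" for w i j
    by (simp add: F_def mat_def)
  have holF: "(\<lambda>w. F w $ i $ j) holomorphic_on ball 0 1" for i j
    unfolding Fnth by (intro holomorphic_intros)
  have hol: "\<phi> a holomorphic_on ball 0 1" for a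
    unfolding \<phi>_def
  proof (intro holomorphic_on_divide holomorphic_on_det)
    show "(\<lambda>w. (\<chi> i j. if j = a then complex_of_real (v $ i) else F w $ i $ j) $ i $ j) holomorphic_on ball 0 1" for i j
      using holF by (cases "j = a") auto
    show "det (F w) \<noteq> 0" if "w \<in> ball 0 1" for w
      using reg[of w] that by (simp add: F_def)
  qed (rule holF)
  obtain \<kappa> where \<kappa>: "\<kappa> > 0" "\<And>u. norm (Y *v u) \<le> \<kappa> * norm u"
    using bounded_linear.pos_bounded[OF matrix_vector_mul_bounded_linear[of Y]] by (auto simp: mult.commute)
  have xb: "norm (x i) \<le> \<kappa> ^ i * norm v" for i
  proof (induction i)
    case (Suc i)
    have "norm (x (Suc i)) \<le> \<kappa> * norm (x i)" unfolding xSuc by (rule \<kappa>(2))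
    also have "\<dots> \<le> \<kappa> * (\<kappa> ^ i * norm v)" using Suc \<kappa>(1) by (intro mult_left_mono) auto
    finally show ?case by (simp add: mult.assoc)
  qed (simp add: x_def)
  have summ: "summable (\<lambda>i. complex_of_real (x i $ a) * w ^ i)" if w: "norm w < 1 / \<kappa>" for a w
  proof (rule summable_comparison_test')
    show "summable (\<lambda>i. norm v * (\<kappa> * norm w) ^ i)"
      using w \<kappa> by (intro summable_mult summable_geometric) (simp add: field_simps)
    show "norm (complex_of_real (x i $ a) * w ^ i) \<le> norm v * (\<kappa> * norm w) ^ i" if "i \<ge> 0" for i
    proof -
      have "\<bar>x i $ a\<bar> \<le> \<kappa> ^ i * norm v" using component_le_norm_cart[of "x i" a] xb[of i] by linarith
      then have "\<bar>x i $ a\<bar> * norm w ^ i \<le> \<kappa> ^ i * norm v * norm w ^ i" by (intro mult_right_mono) auto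
      then show ?thesis by (simp add: norm_mult norm_power power_mult_distrib mult_ac)
    qed
  qed
  have eq: "(\<Sum>i. complex_of_real (x i $ a) * w ^ i) = \<phi> a w" if w: "norm w < 1 / \<kappa>" "norm w < 1" for a w
  proof -
    define s where "s = (\<chi> a. \<Sum>i. complex_of_real (x i $ a) * w ^ i)"
    have "(F w *v s) $ a = complex_of_real (v $ a)" for a
    proof -
      have "(F w *v s) $ a = s $ a - w * (\<Sum>b\<in>UNIV. complex_of_real (Y $ a $ b) * s $ b)"
        by (simp add: matrix_vector_mult_def Fnth left_diff_distrib sum_subtractf of_bool_def
            if_distrib[where f = "\<lambda>x. x * _"] sum_distrib_left mult.assoc cong: if_cong)
      also have "(\<Sum>b\<in>UNIV. complex_of_real (Y $ a $ b) * s $ b) = (\<Sum>i. complex_of_real (x (Suc i) $ a) * w ^ i)"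
      proof -
        have "(\<Sum>b\<in>UNIV. complex_of_real (Y $ a $ b) * s $ b)
          = (\<Sum>b\<in>UNIV. \<Sum>i. complex_of_real (Y $ a $ b) * (complex_of_real (x i $ b) * w ^ i))"
          using summ[OF w(1)] by (simp add: s_def suminf_mult)
        also have "\<dots> = (\<Sum>i. \<Sum>b\<in>UNIV. complex_of_real (Y $ a $ b) * (complex_of_real (x i $ b) * w ^ i))"
          using summ[OF w(1)] by (intro suminf_sum[symmetric] summable_mult) auto
        also have "\<dots> = (\<Sum>i. complex_of_real (x (Suc i) $ a) * w ^ i)"
          by (simp add: xSuc matrix_vector_mult_def sum_distrib_right mult.assoc)
        finally show ?thesis .
      qed
      also have "w * (\<Sum>i. complex_of_real (x (Suc i) $ a) * w ^ i) = (\<Sum>i. complex_of_real (x (Suc i) $ a) * w ^ Suc i)"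
      proof (cases "w = 0")
        case False
        have "summable (\<lambda>i. complex_of_real (x (Suc i) $ a) * w ^ Suc i)"
          using summ[OF w(1), of a] by (subst summable_Suc_iff)
        then have "summable (\<lambda>i. (1 / w) * (complex_of_real (x (Suc i) $ a) * w ^ Suc i))"
          by (rule summable_mult)
        then have "summable (\<lambda>i. complex_of_real (x (Suc i) $ a) * w ^ i)"
          using False by (simp add: field_simps)
        from suminf_mult[OF this, of w] show ?thesis by (simp add: mult_ac)
      qed simp
      also have "s $ a - \<dots> = complex_of_real (x 0 $ a)"
        using suminf_split_head[OF summ[OF w(1), of a]] by (simp add: s_def)
      finally show ?thesis by (simp add: x_def)
    qed
    then have Fs: "F w *v s = (\<chi> a. complex_of_real (v $ a))" by (simp add: vec_eq_iff)
    have dF: "det (F w) \<noteq> 0" using reg[OF w(2)] by (simp add: F_def)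
    from Fs have "s = (\<chi> k. det (\<chi> i j. if j = k then complex_of_real (v $ i) else F w $ i $ j) / det (F w))"
      unfolding cramer[OF dF] vec_lambda_beta .
    then have "s $ a = \<phi> a w" by (simp add: \<phi>_def)
    then show ?thesis by (simp add: s_def)
  qed
  have "\<exists>C\<ge>0. \<forall>i. \<bar>x i $ a\<bar> \<le> C * 2 ^ i" for a
  proof -
    let ?P = "Abs_fps (\<lambda>i. complex_of_real (x i $ a))"
    have rad: "fps_conv_radius ?P \<ge> ereal (1 / (2 * \<kappa>))"
      unfolding fps_conv_radius_def
    proof (rule conv_radius_geI_ex')
      fix r :: real assume "0 < r" "ereal r < ereal (1 / (2 * \<kappa>))"
      then have "norm (complex_of_real r) < 1 / \<kappa>" using \<kappa>(1) by (simp add: field_simps)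
      then show "summable (\<lambda>n. fps_nth ?P n * of_real r ^ n)" using summ by simp
    qed
    have "\<phi> a has_fps_expansion ?P"
      unfolding has_fps_expansion_def
    proof
      have "0 < ereal (1 / (2 * \<kappa>))" using \<kappa>(1) by simp
      then show "0 < fps_conv_radius ?P" using rad by (rule order_less_le_trans)
      have "eventually (\<lambda>w. w \<in> ball (0 :: complex) (min 1 (1 / \<kappa>))) (nhds 0)"
        using \<kappa>(1) by (intro eventually_nhds_in_open) auto
      then show "\<forall>\<^sub>F w in nhds 0. eval_fps ?P w = \<phi> a w"
        by eventually_elim (simp add: eval_fps_def eq)
    qed
    \<comment> \<open>The expansion is known near 0 only, but holomorphy on the unit disc extends
      the radius to 1. Convergence at 1/2 is the origin of the growth rate 2^i.\<close>
    then have "fps_conv_radius ?P \<ge> ereal 1"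
      using hol[of a] by (intro holomorphic_on_imp_fps_conv_radius_ge) auto
    then have "summable (\<lambda>i. fps_nth ?P i * (1 / 2) ^ i)"
      by (intro summable_fps) (auto intro: order_less_le_trans[of _ 1] simp: one_ereal_def)
    then have "(\<lambda>i. complex_of_real (x i $ a) * (1 / 2) ^ i) \<longlonglongrightarrow> 0"
      using summable_LIMSEQ_zero by fastforce
    then have "Bseq (\<lambda>i. complex_of_real (x i $ a) * (1 / 2) ^ i)"
      by (intro convergent_imp_Bseq convergentI)
    then obtain C where C: "\<And>i. norm (complex_of_real (x i $ a) * (1 / 2) ^ i) \<le> C"
      by (elim BseqE) blast
    have "\<bar>x i $ a\<bar> \<le> C * 2 ^ i" for i
      using C[of i] by (simp add: norm_mult norm_power norm_divide power_divide field_simps)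
    moreover have "C \<ge> 0" using order_trans[OF norm_ge_zero C[of 0]] .
    ultimately show ?thesis by blast
  qed
  then obtain c where c: "\<And>a. c a \<ge> 0" "\<And>a i. \<bar>x i $ a\<bar> \<le> c a * 2 ^ i" by metis
  show ?thesis
  proof (rule that)
    show "(\<Sum>a\<in>UNIV. c a) \<ge> 0" using c(1) by (intro sum_nonneg) auto
    fix i
    have "norm (x i) \<le> (\<Sum>a\<in>UNIV. \<bar>x i $ a\<bar>)" by (rule norm_le_l1_cart)
    also have "\<dots> \<le> (\<Sum>a\<in>UNIV. c a * 2 ^ i)" by (intro sum_mono c(2))
    finally show "norm (((*v) Y ^^ i) v) \<le> (\<Sum>a\<in>UNIV. c a) * 2 ^ i" by (simp add: x_def sum_distrib_right)
  qed
qed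

text \<open>The basis vectors suffice: by linearity their constants add up to one that is uniform in
  v.\<close>

lemma matrix_iterates_bounded:
  fixes Y :: "real^'n^'n"
  assumes reg: "\<And>w. norm w < 1 \<Longrightarrow> det (mat 1 - (\<chi> i j. w * complex_of_real (Y $ i $ j))) \<noteq> 0"
  obtains C where "C > 0" "\<And>i v. norm (((*v) Y ^^ i) v) \<le> C * norm v * 2 ^ i"
proof -
  have "\<exists>c. \<forall>a :: 'n. c a \<ge> 0 \<and> (\<forall>i. norm (((*v) Y ^^ i) (axis a 1)) \<le> c a * 2 ^ i)"
    by (intro choice allI) (meson iterates_bounded[OF reg])
  then obtain c where c: "\<And>a :: 'n. c a \<ge> 0" "\<And>a i. norm (((*v) Y ^^ i) (axis a 1)) \<le> c a * 2 ^ i" by blast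
  have lin: "linear ((*v) Y ^^ i)" for i
  proof (induction i)
    case (Suc i)
    show ?case unfolding funpow.simps by (rule linear_compose[OF Suc matrix_vector_mul_linear])
  qed (simp add: linear_id[unfolded id_def])
  show ?thesis
  proof (rule that)
    show "(\<Sum>a\<in>UNIV. c a) + 1 > 0" using c(1) by (intro add_nonneg_pos sum_nonneg) auto
    fix i and v :: "real^'n"
    have "v = (\<Sum>a\<in>UNIV. (v $ a) *\<^sub>R axis a 1)"
      by (simp add: vec_eq_iff axis_def if_distrib cong: if_cong)
    then have "((*v) Y ^^ i) v = (\<Sum>a\<in>UNIV. (v $ a) *\<^sub>R ((*v) Y ^^ i) (axis a 1))"
      using linear_sum[OF lin[of i], of "\<lambda>a. (v $ a) *\<^sub>R axis a 1" UNIV] by (simp add: linear_scale[OF lin])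
    then have "norm (((*v) Y ^^ i) v) \<le> (\<Sum>a\<in>UNIV. norm ((v $ a) *\<^sub>R ((*v) Y ^^ i) (axis a 1)))"
      by (simp only: norm_sum)
    also have "\<dots> \<le> (\<Sum>a\<in>UNIV. norm v * (c a * 2 ^ i))"
      unfolding norm_scaleR using component_le_norm_cart[of v] c by (intro sum_mono mult_mono) auto
    also have "\<dots> = (\<Sum>a\<in>UNIV. c a) * norm v * 2 ^ i"
      by (simp add: sum_distrib_right sum_distrib_left mult_ac)
    also have "\<dots> \<le> ((\<Sum>a\<in>UNIV. c a) + 1) * norm v * 2 ^ i"
      by (intro mult_right_mono) auto
    finally show "norm (((*v) Y ^^ i) v) \<le> ((\<Sum>a\<in>UNIV. c a) + 1) * norm v * 2 ^ i" .
  qed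
qed

subsection \<open>Necessity of the first condition\<close>

lemma rotated_shift:
  fixes A B :: "real^'n^'n"
  assumes "c\<^sup>2 + s\<^sup>2 = 1"
  shows "shift A B \<xi> z = shift (c *\<^sub>R A + s *\<^sub>R B) ((- s) *\<^sub>R A + c *\<^sub>R B) \<xi> (c * fst z + s * snd z, - s * fst z + c * snd z)"
proof -
  have 1: "(c * x + s * y) * c - (- s * x + c * y) * s = x" "(c * x + s * y) * s + (- s * x + c * y) * c = y" for x y
  proof -
    have "(c * x + s * y) * c - (- s * x + c * y) * s = x * (c\<^sup>2 + s\<^sup>2)" by (simp add: algebra_simps power2_eq_square)
    then show "(c * x + s * y) * c - (- s * x + c * y) * s = x" using assms by simp
    have "(c * x + s * y) * s + (- s * x + c * y) * c = y * (c\<^sup>2 + s\<^sup>2)" by (simp add: algebra_simps power2_eq_square)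
    then show "(c * x + s * y) * s + (- s * x + c * y) * c = y" using assms by simp
  qed
  have "a *\<^sub>R (c *\<^sub>R A + s *\<^sub>R B) + b *\<^sub>R ((- s) *\<^sub>R A + c *\<^sub>R B) = (a * c - b * s) *\<^sub>R A + (a * s + b * c) *\<^sub>R B" for a b
    by (simp add: algebra_simps)
  then show ?thesis unfolding shift_eq fst_conv snd_conv by (simp only: 1)
qed

lemma det_pencil_bound:
  fixes M N :: "real^'n^'n"
  assumes low: "\<And>j. j < m \<Longrightarrow> coeff (pencil_poly M N) j = 0" and d: "0 \<le> \<delta>" "\<delta> \<le> 1"
  shows "\<bar>det (M + \<delta> *\<^sub>R N)\<bar> \<le> (\<Sum>j\<le>CARD('n). \<bar>coeff (pencil_poly M N) j\<bar>) * \<delta> ^ m"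
proof -
  have "det (M + \<delta> *\<^sub>R N) = (\<Sum>j\<le>CARD('n). coeff (pencil_poly M N) j * \<delta> ^ j)"
    using det_pencil_eq_sum[of 1 M \<delta> N] by simp
  also have "\<bar>\<dots>\<bar> \<le> (\<Sum>j\<le>CARD('n). \<bar>coeff (pencil_poly M N) j * \<delta> ^ j\<bar>)" by (rule sum_abs)
  also have "\<dots> \<le> (\<Sum>j\<le>CARD('n). \<bar>coeff (pencil_poly M N) j\<bar> * \<delta> ^ m)"
  proof (rule sum_mono)
    fix j
    show "\<bar>coeff (pencil_poly M N) j * \<delta> ^ j\<bar> \<le> \<bar>coeff (pencil_poly M N) j\<bar> * \<delta> ^ m"
    proof (cases "j < m")
      case False
      then have "\<delta> ^ j \<le> \<delta> ^ m" using d by (intro power_decreasing) auto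
      then show ?thesis using d by (simp add: abs_mult mult_left_mono)
    qed (simp add: low)
  qed
  finally show ?thesis by (simp add: sum_distrib_right)
qed

text \<open>Up to the factor \<open>det (M + \<delta>N)\<close> the determinant is the pencil polynomial at \<open>\<delta>(1 - w)\<close>, a nonzero
  point of modulus below \<open>2\<delta>\<close>.\<close>

lemma pencil_resolvent:
  fixes M N :: "real^'n^'n"
  assumes nz: "j0 \<le> CARD('n)" "coeff (pencil_poly M N) j0 \<noteq> 0"
  obtains r where "r > 0" "\<And>\<delta>. 0 < \<delta> \<Longrightarrow> \<delta> < r \<Longrightarrow>
    \<exists>Y. (M + \<delta> *\<^sub>R N) ** Y = \<delta> *\<^sub>R N \<and> det (M + \<delta> *\<^sub>R N) \<noteq> 0 \<and>
      (\<forall>w. norm w < 1 \<longrightarrow> det (mat 1 - (\<chi> i j. w * complex_of_real (Y $ i $ j))) \<noteq> 0)"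
proof -
  let ?f = "\<lambda>z. \<Sum>j\<le>CARD('n). complex_of_real (coeff (pencil_poly M N) j) * z ^ j"
  have detf: "det (\<chi> i j. complex_of_real (M $ i $ j) + z * complex_of_real (N $ i $ j)) = ?f z" for z
    using det_pencil_homogeneous[of complex_of_real M 1 N z] by (simp add: mult.commute)
  have fin: "finite {z. ?f z = 0}"
    using nz by (subst polyfun_finite_roots) auto
  define Z where "Z = norm ` ({z. ?f z = 0} - {0})"
  have Zf: "finite Z" and Zp: "\<And>x. x \<in> Z \<Longrightarrow> x > 0" using fin by (auto simp: Z_def)
  obtain r0 where r0: "r0 > 0" "\<And>x. x \<in> Z \<Longrightarrow> r0 \<le> x"
  proof (cases "Z = {}")
    case False
    then show ?thesis using Zf Zp that[of "Min Z"] by simp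
  qed (use that[of 1] in simp)
  have f_nz: "?f z \<noteq> 0" if "z \<noteq> 0" "norm z < r0" for z
  proof
    assume "?f z = 0"
    then have "norm z \<in> Z" using that by (auto simp: Z_def)
    then show False using r0(2) that(2) by force
  qed
  show ?thesis
  \<comment> \<open>The half compensates for |1 - w| being as large as 2.\<close>
  proof (rule that[of "r0 / 2"])
    fix \<delta> :: real assume d: "0 < \<delta>" "\<delta> < r0 / 2"
    let ?E = "M + \<delta> *\<^sub>R N"
    have "complex_of_real (det ?E) = ?f (complex_of_real \<delta>)"
      using det_pencil_eq_sum[of 1 M \<delta> N] by simp
    moreover have "?f (complex_of_real \<delta>) \<noteq> 0" using d by (intro f_nz) auto
    ultimately have dE: "det ?E \<noteq> 0" by (metis of_real_0)
    then obtain E' where E': "?E ** E' = mat 1" using invertible_det_nz[of ?E] unfolding invertible_def by blast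
    define Y where "Y = E' ** (\<delta> *\<^sub>R N)"
    have EY: "?E ** Y = \<delta> *\<^sub>R N" unfolding Y_def by (simp add: matrix_mul_assoc E')
    have "det (mat 1 - (\<chi> i j. w * complex_of_real (Y $ i $ j))) \<noteq> 0" if w: "norm w < 1" for w
    proof -
      let ?c = "\<lambda>X :: real^'n^'n. (\<chi> i j. complex_of_real (X $ i $ j)) :: complex^'n^'n"
      have "?c ?E ** (mat 1 - (\<chi> i j. w * complex_of_real (Y $ i $ j)))
          = (\<chi> i j. complex_of_real (M $ i $ j) + (complex_of_real \<delta> * (1 - w)) * complex_of_real (N $ i $ j))"
      proof -
        have "(?c ?E ** (mat 1 - (\<chi> i j. w * complex_of_real (Y $ i $ j)))) $ i $ j
          = complex_of_real (M $ i $ j) + (complex_of_real \<delta> * (1 - w)) * complex_of_real (N $ i $ j)" for i j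
        proof -
          have "(?c ?E ** (mat 1 - (\<chi> i j. w * complex_of_real (Y $ i $ j)))) $ i $ j
            = (\<Sum>k\<in>UNIV. complex_of_real (?E $ i $ k) * ((if k = j then 1 else 0) - w * complex_of_real (Y $ k $ j)))"
            by (simp add: matrix_matrix_mult_def mat_def)
          also have "\<dots> = (\<Sum>k\<in>UNIV. (if k = j then complex_of_real (?E $ i $ k) else 0)) - w * complex_of_real (\<Sum>k\<in>UNIV. ?E $ i $ k * Y $ k $ j)"
            unfolding of_real_sum sum_distrib_left sum_subtractf[symmetric]
            by (rule sum.cong) (simp_all add: algebra_simps)
          also have "(\<Sum>k\<in>UNIV. ?E $ i $ k * Y $ k $ j) = (?E ** Y) $ i $ j"
            by (simp only: matrix_matrix_mult_def vec_lambda_beta)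
          also have "\<dots> = \<delta> * N $ i $ j" unfolding EY by simp
          finally show ?thesis by (simp add: algebra_simps)
        qed
        then show ?thesis by (simp only: vec_eq_iff vec_lambda_beta) blast
      qed
      then have "det (?c ?E) * det (mat 1 - (\<chi> i j. w * complex_of_real (Y $ i $ j))) = ?f (complex_of_real \<delta> * (1 - w))"
        unfolding detf[symmetric] det_mul[symmetric] by (rule arg_cong)
      moreover have "?f (complex_of_real \<delta> * (1 - w)) \<noteq> 0"
      proof (rule f_nz)
        show "complex_of_real \<delta> * (1 - w) \<noteq> 0" using d w by auto
        have "norm (1 - w) \<le> 2" using norm_triangle_ineq4[of 1 w] w by simp
        then have "\<delta> * norm (1 - w) \<le> \<delta> * 2" using d by (intro mult_left_mono) auto
        moreover have "norm (complex_of_real \<delta> * (1 - w)) = \<delta> * norm (1 - w)" using d by (simp add: norm_mult)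
        ultimately show "norm (complex_of_real \<delta> * (1 - w)) < r0" using d by linarith
      qed
      ultimately show ?thesis by auto
    qed
    then show "\<exists>Y. (M + \<delta> *\<^sub>R N) ** Y = \<delta> *\<^sub>R N \<and> det (M + \<delta> *\<^sub>R N) \<noteq> 0 \<and>
      (\<forall>w. norm w < 1 \<longrightarrow> det (mat 1 - (\<chi> i j. w * complex_of_real (Y $ i $ j))) \<noteq> 0)"
      using EY dE by blast
  qed (use r0 in simp)
qed

text \<open>Each coordinate of a point of W is a combination of two numbers of size at most 1/10
  with coefficients of size at most 1, and the area is (1/5)(\<delta>/5). The fraction 1/10 is what
  the stability of the set \<open>\<Xi>\<close> in \<open>necessary_exponent\<close> allows.\<close>

lemma rotated_box:
  fixes c s \<delta> :: real
  assumes cs: "c\<^sup>2 + s\<^sup>2 = 1" and d: "0 < \<delta>" "\<delta> \<le> 1"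
  defines "W \<equiv> {z. \<bar>c * fst z + s * snd z\<bar> \<le> 1 / 10 \<and> \<bar>- s * fst z + c * snd z\<bar> \<le> \<delta> / 10}"
  shows "compact W" "W \<subseteq> zcube" "measure lebesgue W = \<delta> / 25"
proof -
  have c1: "\<bar>c\<bar> \<le> 1" "\<bar>s\<bar> \<le> 1"
  proof -
    have "c\<^sup>2 \<le> 1" "s\<^sup>2 \<le> 1" using cs zero_le_power2[of c] zero_le_power2[of s] by linarith+
    then show "\<bar>c\<bar> \<le> 1" "\<bar>s\<bar> \<le> 1" by (simp_all only: abs_square_le_1)
  qed
  show sub: "W \<subseteq> zcube"
  proof
    fix z assume z: "z \<in> W"
    define a b where "a = c * fst z + s * snd z" and "b = - s * fst z + c * snd z"
    have ab: "\<bar>a\<bar> \<le> 1 / 10" "\<bar>b\<bar> \<le> 1 / 10" using z d by (auto simp: W_def a_def b_def)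
    have "c * a - s * b = fst z * (c\<^sup>2 + s\<^sup>2)" "s * a + c * b = snd z * (c\<^sup>2 + s\<^sup>2)"
      by (simp_all add: a_def b_def algebra_simps power2_eq_square)
    then have e: "fst z = c * a - s * b" "snd z = s * a + c * b" using cs by simp_all
    have "\<bar>x * y\<bar> \<le> 1 / 10" if "\<bar>x\<bar> \<le> 1" "\<bar>y\<bar> \<le> 1 / 10" for x y :: real
      using mult_mono[OF that] by (simp add: abs_mult)
    from this[OF c1(1) ab(1)] this[OF c1(2) ab(2)] this[OF c1(2) ab(1)] this[OF c1(1) ab(2)]
    show "z \<in> zcube" unfolding zcube_iff e by linarith
  qed
  have cl: "closed W" unfolding W_def by (intro closed_Collect_conj closed_Collect_le continuous_intros)
  have "bounded (zcube :: (real \<times> real) set)" unfolding zcube_def by (intro bounded_Times) auto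
  then have "bounded W" using sub bounded_subset by blast
  then show "compact W" using cl compact_eq_bounded_closed by blast
  let ?G = "{-(1/10)..1/10 :: real} \<times> {-(\<delta>/10)..\<delta>/10}"
  have Gi: "(x, y) \<in> ?G \<longleftrightarrow> \<bar>x\<bar> \<le> 1 / 10 \<and> \<bar>y\<bar> \<le> \<delta> / 10" for x y by auto
  have Gb: "?G \<in> sets borel" by (intro borel_closed closed_Times) auto
  have "emeasure lborel W = (\<integral>\<^sup>+z. indicator W z \<partial>lborel)" using borel_closed[OF cl] by simp
  also have "\<dots> = (\<integral>\<^sup>+z. indicator ?G (c * fst z + s * snd z, - s * fst z + c * snd z) \<partial>lborel)"
    by (rule nn_integral_cong) (simp only: W_def indicator_def mem_Collect_eq Gi)
  also have "\<dots> = (\<integral>\<^sup>+z. indicator ?G z \<partial>lborel)"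
    by (rule nn_integral_rotate[OF borel_measurable_indicator[OF Gb] cs])
  also have "\<dots> = emeasure (lborel \<Otimes>\<^sub>M lborel) ?G" using Gb by (simp add: lborel_prod)
  also have "\<dots> = ennreal (\<delta> / 25)"
    using d by (subst lborel.emeasure_pair_measure_Times) (auto simp flip: ennreal_mult)
  finally show "measure lebesgue W = \<delta> / 25" using d borel_closed[OF cl] by (simp add: measure_def)
qed

text \<open>Since M\<xi> = E(\<xi> - Y\<xi>) and \<delta>N\<xi> = EY\<xi>, displacements by W act
  inside the image of E with small coefficients. Let \<sigma> be the measure of S and D = |det E|.
  Then S' has measure 2^(-d) \<sigma> and \<open>\<Xi>\<close> has measure \<sigma>/D; for q = 2p
  both sides of the test carry \<sigma>^2, which cancels. With W of size \<delta> and D =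
  O(\<delta>^m) there remains \<delta>^(2p) = O(\<delta>^(m+2)), which fails for small \<delta> if
  2p < m + 2.\<close>

lemma necessary_exponent:
  fixes Q1 Q2 :: "real^'n \<Rightarrow> real"
  assumes Q: "quadratic_form Q1" "quadratic_form Q2" and cs: "c\<^sup>2 + s\<^sup>2 = 1"
    and M: "M = c *\<^sub>R hessian Q1 0 + s *\<^sub>R hessian Q2 0" and N: "N = (- s) *\<^sub>R hessian Q1 0 + c *\<^sub>R hessian Q2 0"
    and low: "\<And>j. j < m \<Longrightarrow> coeff (pencil_poly M N) j = 0"
    and nz: "j0 \<le> CARD('n)" "coeff (pencil_poly M N) j0 \<noteq> 0"
    and C: "C > 0" and p: "p \<ge> (1 :: real)"
    and est: "Lp_Lq_estimate Q1 Q2 C (ennreal p) (ennreal (2 * p))"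
  shows "real m + 2 \<le> 2 * p"
proof (rule ccontr)
  assume "\<not> real m + 2 \<le> 2 * p"
  then have eta: "real m + 2 - 2 * p > 0" by simp
  have q1: "1 \<le> ennreal (2 * p)" using ennreal_leI[of 1 "2 * p"] p by simp
  have v: "1 / (2 * p) = (if ennreal (2 * p) = \<infinity> then 0 else 1 / enn2real (ennreal (2 * p)))" using p by simp
  obtain K where K: "K \<ge> 0"
    "\<And>S W S' \<Xi>. compact S \<Longrightarrow> compact W \<Longrightarrow> compact S' \<Longrightarrow> compact \<Xi> \<Longrightarrow>
      S \<subseteq> ball 0 C \<Longrightarrow> W \<subseteq> zcube \<Longrightarrow> \<Xi> \<subseteq> unit_cube \<Longrightarrow>
      measure lebesgue S' > 0 \<Longrightarrow> measure lebesgue \<Xi> > 0 \<Longrightarrow>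
      (\<And>x \<xi> z. x \<in> S' \<Longrightarrow> \<xi> \<in> \<Xi> \<Longrightarrow> z \<in> W \<Longrightarrow> x - shift (hessian Q1 0) (hessian Q2 0) \<xi> z \<in> S) \<Longrightarrow>
      measure lebesgue W * (measure lebesgue S' * measure lebesgue \<Xi>) powr (1 / (2 * p))
        \<le> K * (measure lebesgue S * measure lebesgue W) powr (1 / p)"
  proof (rule Lp_Lq_estimate_test[OF Q est p q1 v], goal_cases)
    case (1 K)
    show ?case by (rule 1(1)[OF 1(2,3)])
  qed
  obtain r where r: "r > 0" "\<And>\<delta>. 0 < \<delta> \<Longrightarrow> \<delta> < r \<Longrightarrow>
    \<exists>Y. (M + \<delta> *\<^sub>R N) ** Y = \<delta> *\<^sub>R N \<and> det (M + \<delta> *\<^sub>R N) \<noteq> 0 \<and>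
      (\<forall>w. norm w < 1 \<longrightarrow> det (mat 1 - (\<chi> i j. w * complex_of_real (Y $ i $ j))) \<noteq> 0)"
    using pencil_resolvent[OF nz] by blast
  obtain bM where bM: "bM > 0" "\<And>x. norm (M *v x) \<le> bM * norm x" using matrix_inequality_bound by blast
  obtain bN where bN: "bN > 0" "\<And>x. norm (N *v x) \<le> bN * norm x" using matrix_inequality_bound by blast
  \<comment> \<open>Small enough that \<open>\<Xi>\<close> lies in the unit cube and S in the ball
    of radius C, uniformly in \<delta>.\<close>
  define \<kappa> where "\<kappa> = min 1 (C / (2 * (bM + bN)))"
  have \<kappa>: "0 < \<kappa>" "\<kappa> \<le> 1" "(bM + bN) * \<kappa> < C"
  proof -
    show "0 < \<kappa>" "\<kappa> \<le> 1" using C bM(1) bN(1) by (simp_all add: \<kappa>_def)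
    have "(bM + bN) * \<kappa> \<le> (bM + bN) * (C / (2 * (bM + bN)))"
      using bM(1) bN(1) by (intro mult_left_mono) (auto simp: \<kappa>_def)
    also have "\<dots> = C / 2"
    proof -
      have "x * (C / (2 * x)) = C / 2" if "x > 0" for x using that by simp
      from this[of "bM + bN"] show ?thesis using bM(1) bN(1) by simp
    qed
    finally show "(bM + bN) * \<kappa> < C" using C by simp
  qed
  define e where "e = (1 / 2 :: real) ^ CARD('n)"
  have e: "e > 0" by (simp add: e_def)
  define C0 where "C0 = (\<Sum>j\<le>CARD('n). \<bar>coeff (pencil_poly M N) j\<bar>)"
  have C0: "C0 \<ge> 0" by (simp add: C0_def sum_nonneg)
  have main: "(\<delta> / 25) powr (2 * p) * e \<le> K powr (2 * p) * (\<delta> / 25)\<^sup>2 * (C0 * \<delta> ^ m)"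
    if d: "0 < \<delta>" "\<delta> < r" "\<delta> \<le> 1" for \<delta>
  proof -
    let ?E = "M + \<delta> *\<^sub>R N"
    obtain Y where Y: "?E ** Y = \<delta> *\<^sub>R N" "det ?E \<noteq> 0"
      and reg: "\<And>w. norm w < 1 \<Longrightarrow> det (mat 1 - (\<chi> i j. w * complex_of_real (Y $ i $ j))) \<noteq> 0"
      using r(2)[OF d(1,2)] by blast
    define P where "P i = ((*v) Y ^^ i)" for i
    have P0: "P 0 x = x" for x by (simp add: P_def)
    have PS: "P i (Y *v x) = P (Suc i) x" for i x by (simp add: P_def funpow_swap1)
    have Plin: "linear (P i)" for i
    proof (induction i)
      case (Suc i)
      have "P (Suc i) = P i \<circ> (*v) Y" by (rule ext) (simp add: PS)
      then show ?case using linear_compose[OF matrix_vector_mul_linear Suc, of Y] by (simp only:)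
    qed (simp add: P_def id_def linear_iff)
    obtain CY where CY: "CY > 0" "\<And>i v. norm (P i v) \<le> CY * norm v * 2 ^ i"
      using matrix_iterates_bounded[OF reg] unfolding P_def by blast
    define \<Xi> where "\<Xi> = {\<xi>. \<forall>i. norm (P i \<xi>) \<le> \<kappa> * 2 ^ i}"
    have \<Xi>n: "norm \<xi> \<le> \<kappa>" if "\<xi> \<in> \<Xi>" for \<xi>
      using that P0 unfolding \<Xi>_def by (metis (mono_tags, lifting) mem_Collect_eq mult.right_neutral power_0)
    have \<Xi>c: "compact \<Xi>"
    proof -
      have "continuous_on UNIV (P i)" for i by (rule linear_continuous_on[OF linear_linear[THEN iffD2, OF Plin]])
      then have "closed \<Xi>" unfolding \<Xi>_def
        by (intro closed_Collect_all closed_Collect_le continuous_intros) auto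
      moreover have "bounded \<Xi>" unfolding bounded_iff using \<Xi>n by blast
      ultimately show ?thesis by (simp add: compact_eq_bounded_closed)
    qed
    have \<Xi>u: "\<Xi> \<subseteq> unit_cube"
    proof
      fix \<xi> assume "\<xi> \<in> \<Xi>"
      then have "norm \<xi> \<le> 1" using \<Xi>n \<kappa> by fastforce
      then have "\<bar>\<xi> $ i\<bar> \<le> 1" for i using component_le_norm_cart[of \<xi> i] by linarith
      then show "\<xi> \<in> unit_cube" by (simp add: unit_cube_def abs_le_iff minus_le_iff)
    qed
    \<comment> \<open>The radius \<kappa>/CY depends on \<delta> without any control. Positivity of
      the measure is all that is used, since the measure itself cancels.\<close>
    have \<Xi>m: "measure lebesgue \<Xi> > 0"
    proof -
      have "cball 0 (\<kappa> / CY) \<subseteq> \<Xi>"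
      proof
        fix v :: "real^'n" assume "v \<in> cball 0 (\<kappa> / CY)"
        then have "CY * norm v \<le> \<kappa>" using CY(1) by (simp add: field_simps)
        then have "CY * norm v * 2 ^ i \<le> \<kappa> * 2 ^ i" for i by (intro mult_right_mono) auto
        then show "v \<in> \<Xi>" using CY(2) unfolding \<Xi>_def by (blast intro: order_trans)
      qed
      then have "measure lebesgue (cball (0 :: real^'n) (\<kappa> / CY)) \<le> measure lebesgue \<Xi>"
        by (intro measure_mono_fmeasurable lmeasurable_compact[OF \<Xi>c]) auto
      moreover have "measure lebesgue (cball (0 :: real^'n) (\<kappa> / CY)) > 0"
        using \<kappa> CY(1) by (simp add: content_cball_pos)
      ultimately show ?thesis by linarith
    qed
    define S where "S = (*v) ?E ` \<Xi>"
    define S' where "S' = (*\<^sub>R) (1 / 2) ` S"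
    have Elin: "linear ((*v) ?E)" by (rule matrix_vector_mul_linear)
    have Sc: "compact S" unfolding S_def
      by (rule compact_continuous_image[OF linear_continuous_on[OF linear_linear[THEN iffD2, OF Elin]] \<Xi>c])
    have S'c: "compact S'" unfolding S'_def by (rule compact_scaling[OF Sc])
    have Sm: "measure lebesgue S = \<bar>det ?E\<bar> * measure lebesgue \<Xi>"
      using lmeasurable_linear_image_cart[OF Elin lmeasurable_compact[OF \<Xi>c]] by (simp add: S_def)
    have "linear ((*\<^sub>R) (1 / 2 :: real) :: real^'n \<Rightarrow> real^'n)" by (simp add: linear_iff algebra_simps)
    from lmeasurable_linear_image_cart[OF this lmeasurable_compact[OF Sc]]
    have S'm: "measure lebesgue S' = e * measure lebesgue S"
      by (simp add: S'_def e_def det_matrix_scaleR)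
    have Sb: "S \<subseteq> ball 0 C"
    proof
      fix y assume "y \<in> S"
      then obtain \<xi> where \<xi>: "\<xi> \<in> \<Xi>" "y = ?E *v \<xi>" by (auto simp: S_def)
      have "y = M *v \<xi> + \<delta> *\<^sub>R (N *v \<xi>)" unfolding \<xi>(2) by (simp add: matrix_vector_mult_add_rdistrib scaleR_matrix_vector_assoc)
      then have "norm y \<le> norm (M *v \<xi>) + \<delta> * norm (N *v \<xi>)" using norm_triangle_ineq[of "M *v \<xi>" "\<delta> *\<^sub>R (N *v \<xi>)"] d by simp
      also have "\<dots> \<le> norm (M *v \<xi>) + 1 * norm (N *v \<xi>)" using d by (intro add_left_mono mult_right_mono) auto
      also have "\<dots> \<le> bM * norm \<xi> + bN * norm \<xi>" using bM(2)[of \<xi>] bN(2)[of \<xi>] by simp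
      also have "\<dots> = (bM + bN) * norm \<xi>" by (simp add: algebra_simps)
      also have "\<dots> \<le> (bM + bN) * \<kappa>" using bM(1) bN(1) \<Xi>n[OF \<xi>(1)] by (intro mult_left_mono) auto
      finally show "y \<in> ball 0 C" using \<kappa> by simp
    qed
    define W where "W = {z. \<bar>c * fst z + s * snd z\<bar> \<le> 1 / 10 \<and> \<bar>- s * fst z + c * snd z\<bar> \<le> \<delta> / 10}"
    note W = rotated_box[OF cs d(1,3), folded W_def]
    have inc: "x - shift (hessian Q1 0) (hessian Q2 0) \<xi> z \<in> S"
      if x: "x \<in> S'" and \<xi>: "\<xi> \<in> \<Xi>" and z: "z \<in> W" for x \<xi> z
    proof -
      obtain \<eta> where \<eta>: "\<eta> \<in> \<Xi>" "x = (1 / 2) *\<^sub>R (?E *v \<eta>)" using x by (auto simp: S'_def S_def)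
      define a where "a = c * fst z + s * snd z"
      define b where "b = (- s * fst z + c * snd z) / \<delta>"
      have ab: "\<bar>a\<bar> \<le> 1 / 10" "\<bar>b\<bar> \<le> 1 / 10" using z d by (auto simp: W_def a_def b_def field_simps)
      have bd: "b * \<delta> = - s * fst z + c * snd z" using d by (simp add: b_def)
      \<comment> \<open>The preimage under E of the displaced point, from the expressions of M\<xi>
        and \<delta>N\<xi> through E and Y.\<close>
      define \<zeta> where "\<zeta> = (1 / 2) *\<^sub>R \<eta> - a *\<^sub>R (\<xi> - Y *v \<xi>) - b *\<^sub>R (Y *v \<xi>)"
      have EY: "?E *v (Y *v \<xi>) = \<delta> *\<^sub>R (N *v \<xi>)"
        unfolding matrix_vector_mul_assoc Y(1) by (simp add: scaleR_matrix_vector_assoc)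
      have "?E *v \<xi> = M *v \<xi> + \<delta> *\<^sub>R (N *v \<xi>)" by (simp add: matrix_vector_mult_add_rdistrib scaleR_matrix_vector_assoc)
      then have E\<xi>: "?E *v \<xi> - ?E *v (Y *v \<xi>) = M *v \<xi>" unfolding EY by simp
      have "?E *v \<zeta> = (1 / 2) *\<^sub>R (?E *v \<eta>) - a *\<^sub>R (?E *v \<xi> - ?E *v (Y *v \<xi>)) - b *\<^sub>R (?E *v (Y *v \<xi>))"
        unfolding \<zeta>_def by (simp only: matrix_vector_mult_diff_distrib matrix_vector_mult_scaleR)
      also have "\<dots> = x - (a *\<^sub>R (M *v \<xi>) + (b * \<delta>) *\<^sub>R (N *v \<xi>))"
        unfolding E\<xi> unfolding EY \<eta>(2) by simp
      also have "\<dots> = x - shift M N \<xi> (a, b * \<delta>)" by (simp add: shift_def)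
      also have "shift M N \<xi> (a, b * \<delta>) = shift (hessian Q1 0) (hessian Q2 0) \<xi> z"
        unfolding rotated_shift[OF cs, of "hessian Q1 0" "hessian Q2 0" \<xi> z] M N a_def bd ..
      finally have E\<zeta>: "?E *v \<zeta> = x - shift (hessian Q1 0) (hessian Q2 0) \<xi> z" .
      have "\<zeta> \<in> \<Xi>" unfolding \<Xi>_def
      proof (intro CollectI allI)
        fix i
        define B where "B = \<kappa> * 2 ^ i"
        have n: "norm (P i \<eta>) \<le> B" "norm (P i \<xi>) \<le> B" "norm (P (Suc i) \<xi>) \<le> 2 * B"
          using \<eta>(1) \<xi> by (auto simp: \<Xi>_def B_def mult.left_commute dest: spec[of _ i] spec[of _ "Suc i"])
        have B: "B \<ge> 0" using \<kappa> by (simp add: B_def)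
        have "P i \<zeta> = (1 / 2) *\<^sub>R P i \<eta> - a *\<^sub>R (P i \<xi> - P (Suc i) \<xi>) - b *\<^sub>R P (Suc i) \<xi>"
          unfolding \<zeta>_def PS[symmetric] by (simp only: linear_diff[OF Plin] linear_scale[OF Plin])
        also have "norm \<dots> \<le> norm ((1 / 2) *\<^sub>R P i \<eta>) + norm (a *\<^sub>R (P i \<xi> - P (Suc i) \<xi>)) + norm (b *\<^sub>R P (Suc i) \<xi>)"
          by (meson add_right_mono norm_triangle_ineq4 order_trans)
        \<comment> \<open>The iterate of index i + 1 costs a factor 2, so the three terms add up to
          1/2 + 3/10 + 2/10 = 1, and the set is reproduced without loss.\<close>
        also have "\<dots> \<le> (1 / 2) * B + (1 / 10) * (3 * B) + (1 / 10) * (2 * B)"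
        proof (intro add_mono)
          show "norm ((1 / 2) *\<^sub>R P i \<eta>) \<le> (1 / 2) * B" using n(1) by simp
          have "norm (P i \<xi> - P (Suc i) \<xi>) \<le> 3 * B" using norm_triangle_ineq4[of "P i \<xi>" "P (Suc i) \<xi>"] n by linarith
          then show "norm (a *\<^sub>R (P i \<xi> - P (Suc i) \<xi>)) \<le> (1 / 10) * (3 * B)"
            unfolding norm_scaleR using ab(1) B by (intro mult_mono) auto
          show "norm (b *\<^sub>R P (Suc i) \<xi>) \<le> (1 / 10) * (2 * B)"
            unfolding norm_scaleR using ab(2) B n(3) by (intro mult_mono) auto
        qed
        also have "\<dots> = B" by simp
        finally show "norm (P i \<zeta>) \<le> \<kappa> * 2 ^ i" by (simp add: B_def)
      qed
      then show ?thesis unfolding E\<zeta>[symmetric] S_def by (rule imageI)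
    qed
    define D where "D = \<bar>det ?E\<bar>"
    have D: "D > 0" "D \<le> C0 * \<delta> ^ m"
      using Y(2) det_pencil_bound[OF low, of m \<delta>] d by (simp_all add: D_def C0_def)
    define \<sigma> where "\<sigma> = measure lebesgue S"
    define w where "w = \<delta> / 25"
    have w: "w > 0" using d by (simp add: w_def)
    have \<sigma>: "\<sigma> > 0" "measure lebesgue \<Xi> = \<sigma> / D" using Sm \<Xi>m D(1) by (simp_all add: \<sigma>_def D_def)
    have "measure lebesgue S' > 0" using S'm \<sigma>(1) e by (simp add: \<sigma>_def)
    from K(2)[OF Sc W(1) S'c \<Xi>c Sb W(2) \<Xi>u this \<Xi>m inc]
    have le: "w * (e * \<sigma> * (\<sigma> / D)) powr (1 / (2 * p)) \<le> K * (\<sigma> * w) powr (1 / p)"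
      unfolding W(3) S'm \<sigma>(2) \<sigma>_def[symmetric] w_def[symmetric] by simp
    have pos: "e * \<sigma> * (\<sigma> / D) > 0" using e \<sigma> D by simp
    have x0: "(w * (e * \<sigma> * (\<sigma> / D)) powr (1 / (2 * p))) powr (2 * p) \<le> (K * (\<sigma> * w) powr (1 / p)) powr (2 * p)"
      using le p w by (intro powr_mono2) auto
    have x1: "(w * X powr (1 / (2 * p))) powr (2 * p) = w powr (2 * p) * X" if "X > 0" for X
      using p w that by (simp add: powr_mult powr_powr)
    have x2: "(K * X powr (1 / p)) powr (2 * p) = K powr (2 * p) * X\<^sup>2" if "X > 0" for X
      using p that K(1) by (simp add: powr_mult powr_powr)
    have "\<sigma> * w > 0" using \<sigma>(1) w by simp
    with x1[OF pos] x2 have "w powr (2 * p) * (e * \<sigma> * (\<sigma> / D)) \<le> K powr (2 * p) * (\<sigma> * w)\<^sup>2"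
      using x0 by (simp only:)
    then have "(\<sigma>\<^sup>2 / D) * (w powr (2 * p) * e) \<le> (\<sigma>\<^sup>2 / D) * (K powr (2 * p) * w\<^sup>2 * D)"
      using D by (simp add: power2_eq_square mult_ac)
    then have "w powr (2 * p) * e \<le> K powr (2 * p) * w\<^sup>2 * D"
      using \<sigma>(1) D(1) by (subst (asm) mult_le_cancel_left_pos) auto
    also have "\<dots> \<le> K powr (2 * p) * w\<^sup>2 * (C0 * \<delta> ^ m)" using D(2) by (intro mult_left_mono) auto
    finally show ?thesis by (simp add: w_def)
  qed
  define L where "L = 25 powr (2 * p) * (K powr (2 * p) * C0) / (625 * e)"
  have L: "L \<ge> 0" using C0 e by (simp add: L_def)
  have main': "1 \<le> L * \<delta> powr (real m + 2 - 2 * p)" if d: "0 < \<delta>" "\<delta> < r" "\<delta> \<le> 1" for \<delta>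
  proof -
    have a: "(\<delta> / 25) powr (2 * p) = \<delta> powr (2 * p) / 25 powr (2 * p)" using d by (simp add: powr_divide)
    have "\<delta>\<^sup>2 * \<delta> ^ m = \<delta> powr (real m + 2)" using d by (simp add: powr_add powr_realpow mult.commute)
    then have b: "K powr (2 * p) * (\<delta> / 25)\<^sup>2 * (C0 * \<delta> ^ m) = K powr (2 * p) * C0 / 625 * \<delta> powr (real m + 2)"
      by (simp add: power_divide mult_ac)
    have "\<delta> powr (2 * p) / 25 powr (2 * p) * e \<le> K powr (2 * p) * C0 / 625 * \<delta> powr (real m + 2)"
      using main[OF d] unfolding a b .
    then have "\<delta> powr (2 * p) \<le> L * \<delta> powr (real m + 2)"
      using e by (simp add: L_def field_simps)
    then have "\<delta> powr (2 * p) * 1 \<le> \<delta> powr (2 * p) * (L * \<delta> powr (real m + 2 - 2 * p))"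
      using d by (simp add: powr_diff)
    then show ?thesis using d by (subst (asm) mult_le_cancel_left_pos) auto
  qed
  obtain \<delta> where "0 < \<delta>" "\<delta> < r" "\<delta> \<le> 1" "L * \<delta> powr (real m + 2 - 2 * p) < 1"
    by (rule powr_eventually_less_1[OF r(1) eta L])
  then show False using main'[of \<delta>] by linarith
qed

subsection \<open>Singular pencils\<close>

lemma singular_pencil_kernel:
  fixes A :: "real^'n^'n"
  assumes "det A = 0"
  obtains x where "x \<noteq> 0" "A *v x = 0"
  using assms matrix_left_invertible_ker[of A] invertible_left_inverse[of A] invertible_det_nz[of A] by blast

lemma dim_image_less:
  fixes f :: "'a::euclidean_space \<Rightarrow> 'b::euclidean_space"
  assumes f: "linear f" and U: "subspace U" and v: "v \<in> U" "v \<noteq> 0" "f v = 0"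
  shows "dim (f ` U) < dim U"
proof -
  have "{v} \<subseteq> U" "independent {v}" using v by (auto simp: independent_insert)
  then obtain B where B: "{v} \<subseteq> B" "B \<subseteq> U" "independent B" "U \<subseteq> span B"
    by (rule maximal_independent_subset_extend)
  have fin: "finite B" using B(3) by (rule finiteI_independent)
  have "f ` U \<subseteq> span (f ` (B - {v}))"
  proof -
    have "f ` U \<subseteq> f ` span B" using B(4) by (rule image_mono)
    also have "\<dots> = span (f ` B)" using linear_span_image[OF f] by simp
    also have "f ` B \<subseteq> insert 0 (f ` (B - {v}))" using v(3) by auto
    then have "span (f ` B) \<subseteq> span (f ` (B - {v}))" using span_mono by (metis span_insert_0)
    finally show ?thesis .
  qed
  then have "dim (f ` U) \<le> card (f ` (B - {v}))" using fin by (intro dim_le_card) auto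
  also have "\<dots> \<le> card (B - {v})" using fin by (intro card_image_le) auto
  also have "\<dots> < card B" using fin B(1) by (intro psubset_card_mono) auto
  also have "card B = dim U" using B by (intro basis_card_eq_dim)
  finally show ?thesis .
qed

text \<open>Pick a kernel vector \<xi>(s) of sA + B for each s and let U be their span; B \<xi>(s) =
  A(-s \<xi>(s)) gives the inclusion. Were A injective on U, the vectors \<xi>(s) would be
  eigenvectors of A^(-1)B on U with the distinct eigenvalues -s, hence independent, which is
  impossible for d + 1 of them. So A has a kernel in U and lowers its dimension.\<close>

lemma singular_pencil_subspace:
  fixes A B :: "real^'n^'n"
  assumes sing: "\<And>s. det (s *\<^sub>R A + B) = 0"
  obtains U where "subspace U" "(*v) B ` U \<subseteq> (*v) A ` U" "dim ((*v) A ` U) < dim U"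
proof -
  have "\<exists>x. x \<noteq> 0 \<and> (s *\<^sub>R A + B) *v x = 0" for s
    using singular_pencil_kernel[OF sing[of s]] by metis
  then obtain \<xi> where \<xi>: "\<And>s. \<xi> s \<noteq> 0" "\<And>s. (s *\<^sub>R A + B) *v \<xi> s = 0" by metis
  have B\<xi>: "B *v \<xi> s = A *v ((- s) *\<^sub>R \<xi> s)" for s
  proof -
    have "B *v \<xi> s + s *\<^sub>R (A *v \<xi> s) = 0"
      using \<xi>(2)[of s] by (simp add: matrix_vector_mult_add_rdistrib scaleR_matrix_vector_assoc[symmetric] add.commute)
    then have "B *v \<xi> s = - (s *\<^sub>R (A *v \<xi> s))" by (simp only: eq_neg_iff_add_eq_0)
    moreover have "A *v ((- s) *\<^sub>R \<xi> s) = (- s) *\<^sub>R (A *v \<xi> s)" by (rule matrix_vector_mult_scaleR)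
    ultimately show ?thesis by (metis scaleR_minus_left)
  qed
  define U where "U = span (range \<xi>)"
  have U: "subspace U" "\<And>s. \<xi> s \<in> U" by (auto simp: U_def intro: span_base)
  have BU: "(*v) B ` U \<subseteq> (*v) A ` U"
  proof -
    have "range (\<lambda>s. B *v \<xi> s) \<subseteq> (*v) A ` U"
    proof (rule image_subsetI)
      fix s
      have "(- s) *\<^sub>R \<xi> s \<in> U" using U by (intro subspace_scale)
      then show "B *v \<xi> s \<in> (*v) A ` U" unfolding B\<xi> by (rule imageI)
    qed
    then have "(*v) B ` range \<xi> \<subseteq> (*v) A ` U" by (simp add: image_image)
    moreover have "subspace ((*v) A ` U)" by (rule linear_subspace_image[OF matrix_vector_mul_linear U(1)])
    ultimately have "span ((*v) B ` range \<xi>) \<subseteq> (*v) A ` U" by (rule span_minimal)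
    then show ?thesis unfolding U_def linear_span_image[OF matrix_vector_mul_linear, symmetric] .
  qed
  have "\<exists>v\<in>U. v \<noteq> 0 \<and> A *v v = 0"
  proof (rule ccontr)
    assume "\<not> (\<exists>v\<in>U. v \<noteq> 0 \<and> A *v v = 0)"
    then have inj: "v = 0" if "v \<in> U" "A *v v = 0" for v using that by blast
    have ind: "\<forall>s\<in>F. c s = 0" if "finite F" "(\<Sum>s\<in>F. c s *\<^sub>R \<xi> s) = 0" for F c
      using that
    proof (induction F arbitrary: c rule: finite_induct)
      case (insert t F)
      have "A *v (\<Sum>s\<in>insert t F. (c s * s) *\<^sub>R \<xi> s) = - (B *v (\<Sum>s\<in>insert t F. c s *\<^sub>R \<xi> s))"
        unfolding linear_sum[OF matrix_vector_mul_linear] matrix_vector_mult_scaleR B\<xi> sum_negf[symmetric]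
        by (rule sum.cong) (simp_all add: matrix_vector_mult_scaleR)
      also have "\<dots> = 0" unfolding insert.prems by simp
      \<comment> \<open>Injectivity of A on U stands in for applying A^(-1)B to the linear relation;
        subtracting t times the original relation then eliminates the term of index t.\<close>
      finally have "(\<Sum>s\<in>insert t F. (c s * s) *\<^sub>R \<xi> s) = 0"
        by (rule inj[OF subspace_sum[OF U(1) subspace_scale[OF U(1) U(2)]]])
      then have "(\<Sum>s\<in>insert t F. (c s * s) *\<^sub>R \<xi> s) - t *\<^sub>R (\<Sum>s\<in>insert t F. c s *\<^sub>R \<xi> s) = 0"
        using insert.prems by simp
      then have "(\<Sum>s\<in>insert t F. (c s * (s - t)) *\<^sub>R \<xi> s) = 0"
        unfolding scaleR_sum_right sum_subtractf[symmetric] by (simp add: algebra_simps)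
      then have "(\<Sum>s\<in>F. (c s * (s - t)) *\<^sub>R \<xi> s) = 0" using insert.hyps by simp
      from insert.IH[OF this] have F: "\<forall>s\<in>F. c s = 0" using insert.hyps by auto
      then have "c t *\<^sub>R \<xi> t = 0" using insert.prems insert.hyps by simp
      then show ?case using F \<xi>(1) by simp
    qed simp
    have "inj \<xi>"
    proof (rule injI, rule ccontr)
      fix s t assume st: "\<xi> s = \<xi> t" "s \<noteq> t"
      have "(\<Sum>r\<in>{s, t}. (if r = s then 1 else - 1) *\<^sub>R \<xi> r) = 0" using st by simp
      from ind[OF _ this] show False by auto
    qed
    obtain F :: "real set" where F: "finite F" "card F = CARD('n) + 1"
      using infinite_arbitrarily_large[OF infinite_UNIV_char_0] by blast
    have "independent (\<xi> ` F)"
    proof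
      assume "dependent (\<xi> ` F)"
      then obtain u where u: "\<exists>v\<in>\<xi> ` F. u v \<noteq> 0" "(\<Sum>v\<in>\<xi> ` F. u v *\<^sub>R v) = 0"
        using F(1) by (subst (asm) dependent_finite) auto
      have "(\<Sum>s\<in>F. u (\<xi> s) *\<^sub>R \<xi> s) = 0"
        using u(2) \<open>inj \<xi>\<close> by (subst (asm) sum.reindex) (auto intro: inj_on_subset)
      from ind[OF F(1) this] show False using u(1) by auto
    qed
    then have "card (\<xi> ` F) \<le> CARD('n)" using independent_bound by fastforce
    then show False using F(2) \<open>inj \<xi>\<close> by (simp add: card_image inj_on_subset)
  qed
  then obtain v where "v \<in> U" "v \<noteq> 0" "A *v v = 0" by blast
  from dim_image_less[OF matrix_vector_mul_linear U(1) this] BU U(1) show thesis by (intro that)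
qed

text \<open>Turns neighbourhoods of a subspace into linear images of coordinate slabs, whose volumes
  are explicit. The columns of H are a basis of U completed to a basis of the whole space.\<close>

lemma adapted_coordinates:
  fixes U :: "(real^'n) set"
  assumes U: "subspace U"
  obtains H :: "real^'n^'n" and I where "det H \<noteq> 0" "card I = dim U" "(*v) H ` {x. \<forall>i. i \<notin> I \<longrightarrow> x $ i = 0} = U"
proof -
  obtain Bu where Bu: "Bu \<subseteq> U" "independent Bu" "U \<subseteq> span Bu" "card Bu = dim U" by (rule basis_exists)
  have spU: "span Bu = U" using Bu U by (intro subset_antisym span_minimal)
  obtain B where B: "Bu \<subseteq> B" "B \<subseteq> UNIV" "independent B" "UNIV \<subseteq> span B"
    using maximal_independent_subset_extend[of Bu UNIV] Bu(2) by auto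
  have cB: "card B = CARD('n)" using basis_card_eq_dim[OF B(2,4,3)] by simp
  have fB: "finite B" using B(3) by (rule finiteI_independent)
  obtain f :: "'n \<Rightarrow> real^'n" where f: "bij_betw f UNIV B"
    using finite_same_card_bij[of "UNIV :: 'n set" B] fB cB by auto
  define H :: "real^'n^'n" where "H = transpose (\<chi> j. f j)"
  have H: "H *v x = (\<Sum>j\<in>UNIV. x $ j *\<^sub>R f j)" for x
    unfolding matrix_mult_sum H_def by (simp add: column_transpose row_def scalar_mult_eq_scaleR)
  define I where "I = f -` Bu"
  have fI: "f ` I = Bu" using f B(1) unfolding I_def bij_betw_def by blast
  have injf: "inj f" using f by (simp add: bij_betw_def)
  have onto: "\<exists>x. (\<forall>i. i \<notin> J \<longrightarrow> x $ i = 0) \<and> H *v x = y" if y: "y \<in> span (f ` J)" for y J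
  proof -
    obtain u where u: "y = (\<Sum>v\<in>f ` J. u v *\<^sub>R v)" using y by (subst (asm) span_finite) auto
    have "H *v (\<chi> j. if j \<in> J then u (f j) else 0) = (\<Sum>j\<in>UNIV. if j \<in> J then u (f j) *\<^sub>R f j else 0)"
      unfolding H by (rule sum.cong) auto
    also have "\<dots> = (\<Sum>j\<in>J. u (f j) *\<^sub>R f j)" by (simp add: sum.If_cases)
    also have "\<dots> = y" unfolding u by (subst sum.reindex) (auto intro: inj_on_subset[OF injf])
    finally show ?thesis by (intro exI[of _ "\<chi> j. if j \<in> J then u (f j) else 0"]) simp
  qed
  have "surj ((*v) H)"
    using onto[of _ UNIV] f B(4) unfolding bij_betw_def surj_def by (metis UNIV_I subsetD)
  then have "det H \<noteq> 0"
    using matrix_right_invertible_surjective[of H] invertible_right_inverse[of H] invertible_det_nz[of H] by simp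
  moreover have "card I = dim U" using fI Bu(4) injf by (metis card_image inj_on_subset subset_UNIV)
  moreover have "(*v) H ` {x. \<forall>i. i \<notin> I \<longrightarrow> x $ i = 0} = U"
  proof
    show "U \<subseteq> (*v) H ` {x. \<forall>i. i \<notin> I \<longrightarrow> x $ i = 0}"
      using onto[of _ I] unfolding fI spU by blast
    show "(*v) H ` {x. \<forall>i. i \<notin> I \<longrightarrow> x $ i = 0} \<subseteq> U"
    proof (rule image_subsetI)
      fix x :: "real^'n" assume x: "x \<in> {x. \<forall>i. i \<notin> I \<longrightarrow> x $ i = 0}"
      show "H *v x \<in> U" unfolding H
      proof (rule subspace_sum[OF U])
        fix j
        show "x $ j *\<^sub>R f j \<in> U"
        proof (cases "j \<in> I")
          case True
          then show ?thesis using Bu(1) fI U by (auto intro!: subspace_scale)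
        next
          case False
          then show ?thesis using x subspace_0[OF U] by simp
        qed
      qed
    qed
  qed
  ultimately show thesis by (rule that)
qed

text \<open>A box of half side \<kappa> in the directions of J, thinned by \<delta> in the others:
  the \<delta>-neighbourhood of a coordinate subspace.\<close>

definition slab :: "'n set \<Rightarrow> real \<Rightarrow> real \<Rightarrow> (real^'n) set" where
  "slab J \<kappa> \<delta> = {x. \<forall>i. \<bar>x $ i\<bar> \<le> \<kappa> * (if i \<in> J then 1 else \<delta>)}"

lemma slab_eq_cbox: "slab J \<kappa> \<delta> = cbox (- (\<chi> i. \<kappa> * (if i \<in> J then 1 else \<delta>))) (\<chi> i. \<kappa> * (if i \<in> J then 1 else \<delta>))"
  by (rule set_eqI) (simp only: slab_def mem_Collect_eq mem_box_cart abs_le_iff vector_uminus_component vec_lambda_beta minus_le_iff conj_commute)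

lemma compact_slab: "compact (slab J \<kappa> \<delta>)"
  unfolding slab_eq_cbox by (rule compact_cbox)

lemma measure_slab:
  fixes J :: "'n::finite set"
  assumes "\<kappa> > 0" "\<delta> > 0"
  shows "measure lebesgue (slab J \<kappa> \<delta>) = (2 * \<kappa>) ^ CARD('n) * \<delta> ^ (CARD('n) - card J)"
proof -
  let ?r = "\<lambda>i. \<kappa> * (if i \<in> J then 1 else \<delta>)"
  have "0 \<in> slab J \<kappa> \<delta>" using assms by (simp add: slab_def)
  then have "cbox (- (\<chi> i. ?r i)) (\<chi> i. ?r i) \<noteq> {}" unfolding slab_eq_cbox by blast
  from content_cbox_cart[OF this]
  have "measure lebesgue (slab J \<kappa> \<delta>) = (\<Prod>i\<in>UNIV. 2 * ?r i)" unfolding slab_eq_cbox by simp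
  also have "\<dots> = (\<Prod>i\<in>(UNIV :: 'n set). 2 * \<kappa>) * (\<Prod>i\<in>(UNIV :: 'n set). if i \<in> J then 1 else \<delta>)"
    unfolding prod.distrib[symmetric] by (rule prod.cong) simp_all
  also have "(\<Prod>i\<in>(UNIV :: 'n set). if i \<in> J then 1 else \<delta>) = \<delta> ^ card (- J)"
    by (subst prod.If_cases) (simp_all add: Compl_eq)
  also have "card (- J) = CARD('n) - card J" by (simp add: Compl_eq_Diff_UNIV card_Diff_subset)
  finally show ?thesis by simp
qed

lemma slab_norm:
  fixes x :: "real^'n" and \<kappa> \<delta> :: real
  assumes "x \<in> slab J \<kappa> \<delta>" "\<kappa> > 0" "0 < \<delta>" "\<delta> \<le> 1"
  shows "norm x \<le> CARD('n) * \<kappa>"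
proof -
  have "norm x \<le> (\<Sum>i\<in>UNIV. \<bar>x $ i\<bar>)" by (rule norm_le_l1_cart)
  also have "\<dots> \<le> (\<Sum>i\<in>(UNIV :: 'n set). \<kappa>)"
  proof (rule sum_mono)
    fix i
    have "\<bar>x $ i\<bar> \<le> \<kappa> * (if i \<in> J then 1 else \<delta>)" using assms(1) by (simp only: slab_def mem_Collect_eq)
    also have "\<dots> \<le> \<kappa> * 1" using assms by (intro mult_left_mono) auto
    finally show "\<bar>x $ i\<bar> \<le> \<kappa>" by simp
  qed
  finally show ?thesis by simp
qed

text \<open>The hypothesis says that R maps the coordinate subspace of I into that of I'. A thin
  component of the image thus receives nothing from the wide directions, and in all other cases the
  width can only grow because \<delta> \<le> 1.\<close>

lemma matrix_slab:
  fixes R :: "real^'n^'n" and \<rho> \<kappa> \<delta> :: real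
  assumes R: "\<And>i j. i \<notin> I' \<Longrightarrow> j \<in> I \<Longrightarrow> R $ i $ j = 0" and \<rho>: "\<And>i j. \<bar>R $ i $ j\<bar> \<le> \<rho>"
    and y: "y \<in> slab I \<kappa> \<delta>" and \<kappa>: "\<kappa> > 0" "0 < \<delta>" "\<delta> \<le> 1"
  shows "R *v y \<in> slab I' (CARD('n) * \<rho> * \<kappa>) \<delta>"
  unfolding slab_def
proof (intro CollectI allI)
  fix i
  have "\<bar>(R *v y) $ i\<bar> \<le> (\<Sum>j\<in>UNIV. \<bar>R $ i $ j * y $ j\<bar>)"
    unfolding matrix_vector_mult_def vec_lambda_beta by (rule sum_abs)
  also have "\<dots> \<le> (\<Sum>j\<in>(UNIV :: 'n set). \<rho> * (\<kappa> * (if i \<in> I' then 1 else \<delta>)))"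
  proof (rule sum_mono)
    fix j
    have yj: "\<bar>y $ j\<bar> \<le> \<kappa> * (if j \<in> I then 1 else \<delta>)" using y by (simp only: slab_def mem_Collect_eq)
    have \<rho>0: "\<rho> \<ge> 0" using \<rho>[of i j] by linarith
    show "\<bar>R $ i $ j * y $ j\<bar> \<le> \<rho> * (\<kappa> * (if i \<in> I' then 1 else \<delta>))"
    proof (cases "i \<notin> I' \<and> j \<in> I")
      case True
      then show ?thesis using R \<rho>0 \<kappa> by simp
    next
      case False
      then have "\<kappa> * (if j \<in> I then 1 else \<delta>) \<le> \<kappa> * (if i \<in> I' then 1 else \<delta>)"
        using \<kappa> by (intro mult_left_mono) auto
      with yj have "\<bar>y $ j\<bar> \<le> \<kappa> * (if i \<in> I' then 1 else \<delta>)" by (rule order_trans)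
      then show ?thesis unfolding abs_mult using \<rho>[of i j] \<rho>0 by (intro mult_mono) auto
    qed
  qed
  also have "\<dots> = CARD('n) * \<rho> * \<kappa> * (if i \<in> I' then 1 else \<delta>)" by simp
  finally show "\<bar>(R *v y) $ i\<bar> \<le> CARD('n) * \<rho> * \<kappa> * (if i \<in> I' then 1 else \<delta>)" .
qed

text \<open>Both A and B map U into AU, so in adapted coordinates displacements over the whole
  square keep the slab around AU. With a and b the codimensions of AU and U, S and S' have measure
  of order \<delta>^a and \<open>\<Xi>\<close> of order \<delta>^b, while the square is fixed. As
  \<delta> tends to 0 the test forces a/p \<le> (a + b) v. Now b \<le> a - 1 and a \<le> d bound the
  right-hand side by a (2 - 1/d) v.\<close>

lemma singular_pencil_no_estimate:
  fixes Q1 Q2 :: "real^'n \<Rightarrow> real"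
  assumes Q: "quadratic_form Q1" "quadratic_form Q2"
    and sing: "\<And>s. det (s *\<^sub>R hessian Q1 0 + hessian Q2 0) = 0"
    and C: "C > 0" and p: "p \<ge> (1 :: real)" and q: "q \<ge> 1"
    and est: "Lp_Lq_estimate Q1 Q2 C (ennreal p) q"
    and v: "v = (if q = \<infinity> then 0 else 1 / enn2real q)"
  shows "1 / p \<le> (2 - 1 / CARD('n)) * v"
proof (rule ccontr)
  assume "\<not> 1 / p \<le> (2 - 1 / CARD('n)) * v"
  then have uv: "(2 - 1 / CARD('n)) * v < 1 / p" by simp
  let ?A = "hessian Q1 0" and ?B = "hessian Q2 0"
  obtain K where K: "K \<ge> 0"
    "\<And>S W S' \<Xi>. compact S \<Longrightarrow> compact W \<Longrightarrow> compact S' \<Longrightarrow> compact \<Xi> \<Longrightarrow>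
      S \<subseteq> ball 0 C \<Longrightarrow> W \<subseteq> zcube \<Longrightarrow> \<Xi> \<subseteq> unit_cube \<Longrightarrow>
      measure lebesgue S' > 0 \<Longrightarrow> measure lebesgue \<Xi> > 0 \<Longrightarrow>
      (\<And>x \<xi> z. x \<in> S' \<Longrightarrow> \<xi> \<in> \<Xi> \<Longrightarrow> z \<in> W \<Longrightarrow> x - shift (hessian Q1 0) (hessian Q2 0) \<xi> z \<in> S) \<Longrightarrow>
      measure lebesgue W * (measure lebesgue S' * measure lebesgue \<Xi>) powr v
        \<le> K * (measure lebesgue S * measure lebesgue W) powr (1 / p)"
  proof (rule Lp_Lq_estimate_test[OF Q est p q v], goal_cases)
    case (1 K)
    show ?case by (rule 1(1)[OF 1(2,3)])
  qed
  obtain U where U: "subspace U" "(*v) ?B ` U \<subseteq> (*v) ?A ` U" "dim ((*v) ?A ` U) < dim U"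
    using singular_pencil_subspace[OF sing] by blast
  obtain H I where H: "det H \<noteq> 0" "card I = dim U" "(*v) H ` {x. \<forall>i. i \<notin> I \<longrightarrow> x $ i = 0} = U"
    by (rule adapted_coordinates[OF U(1)])
  obtain G I' where G: "det G \<noteq> 0" "card I' = dim ((*v) ?A ` U)" "(*v) G ` {x. \<forall>i. i \<notin> I' \<longrightarrow> x $ i = 0} = (*v) ?A ` U"
    by (rule adapted_coordinates[OF linear_subspace_image[OF matrix_vector_mul_linear U(1)]])
  obtain G' where G': "G ** G' = mat 1" "G' ** G = mat 1" using G(1) invertible_det_nz[of G] unfolding invertible_def by blast
  have R0: "(G' ** X ** H) $ i $ j = 0" if X: "(*v) X ` U \<subseteq> (*v) ?A ` U" and ij: "i \<notin> I'" "j \<in> I" for X i j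
  proof -
    have "axis j 1 \<in> {x :: real^'n. \<forall>i. i \<notin> I \<longrightarrow> x $ i = 0}" using ij(2) by (auto simp: axis_def)
    then have "H *v axis j 1 \<in> U" using H(3) by blast
    then have "X *v (H *v axis j 1) \<in> (*v) G ` {x. \<forall>i. i \<notin> I' \<longrightarrow> x $ i = 0}" using X G(3) by blast
    then obtain x where x: "X *v (H *v axis j 1) = G *v x" "\<forall>i. i \<notin> I' \<longrightarrow> x $ i = 0" by blast
    have "(G' ** X ** H) $ i $ j = ((G' ** X ** H) *v axis j 1) $ i"
      by (simp add: matrix_vector_mult_basis column_def)
    also have "(G' ** X ** H) *v axis j 1 = G' *v (X *v (H *v axis j 1))" by (simp add: matrix_vector_mul_assoc matrix_mul_assoc)
    also have "\<dots> = x" unfolding x(1) by (simp add: matrix_vector_mul_assoc G')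
    finally show ?thesis using x(2) ij(1) by simp
  qed
  let ?R1 = "G' ** ?A ** H" and ?R2 = "G' ** ?B ** H"
  define \<rho> where "\<rho> = 1 + (\<Sum>i\<in>UNIV. \<Sum>j\<in>UNIV. \<bar>?R1 $ i $ j\<bar> + \<bar>?R2 $ i $ j\<bar>)"
  have \<rho>: "\<bar>?R1 $ i $ j\<bar> \<le> \<rho>" "\<bar>?R2 $ i $ j\<bar> \<le> \<rho>" "\<rho> > 0" for i j
  proof -
    have "\<bar>?R1 $ i $ j\<bar> + \<bar>?R2 $ i $ j\<bar> \<le> (\<Sum>j\<in>UNIV. \<bar>?R1 $ i $ j\<bar> + \<bar>?R2 $ i $ j\<bar>)"
      by (rule member_le_sum) auto
    also have "\<dots> \<le> (\<Sum>i\<in>UNIV. \<Sum>j\<in>UNIV. \<bar>?R1 $ i $ j\<bar> + \<bar>?R2 $ i $ j\<bar>)"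
      by (rule member_le_sum[of i UNIV "\<lambda>i. \<Sum>j\<in>UNIV. \<bar>?R1 $ i $ j\<bar> + \<bar>?R2 $ i $ j\<bar>"]) (auto intro: sum_nonneg)
    finally have "\<bar>?R1 $ i $ j\<bar> + \<bar>?R2 $ i $ j\<bar> + 1 \<le> \<rho>" by (simp add: \<rho>_def)
    then show "\<bar>?R1 $ i $ j\<bar> \<le> \<rho>" "\<bar>?R2 $ i $ j\<bar> \<le> \<rho>" "\<rho> > 0" by linarith+
  qed
  obtain bG where bG: "bG > 0" "\<And>x. norm (G *v x) \<le> bG * norm x" using matrix_inequality_bound by blast
  obtain bH where bH: "bH > 0" "\<And>x. norm (H *v x) \<le> bH * norm x" using matrix_inequality_bound by blast
  define d where "d = real CARD('n)"
  have d: "d \<ge> 1" by (simp add: d_def Suc_leI)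
  define \<kappa> where "\<kappa> = C / (2 * (bG * d))"
  \<comment> \<open>Besides keeping \<open>\<Xi>\<close> in the unit cube, this makes each of the
    two displacements at most a quarter of the slab; together with the half taken by S' they fill it
    exactly.\<close>
  define \<mu> where "\<mu> = min (1 / (bH * d)) (\<kappa> / (4 * (d * \<rho>)))"
  have \<kappa>: "\<kappa> > 0" "bG * (d * \<kappa>) < C"
  proof -
    show "\<kappa> > 0" using C bG(1) d by (simp add: \<kappa>_def)
    have "bG * (d * \<kappa>) = C / 2" using bG(1) d by (simp add: \<kappa>_def)
    then show "bG * (d * \<kappa>) < C" using C by simp
  qed
  have \<mu>: "\<mu> > 0" "bH * (d * \<mu>) \<le> 1" "d * \<rho> * \<mu> \<le> \<kappa> / 4"
  proof -
    show "\<mu> > 0" using \<kappa> bH(1) d \<rho>(3) by (simp add: \<mu>_def)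
    have "\<mu> \<le> 1 / (bH * d)" "\<mu> \<le> \<kappa> / (4 * (d * \<rho>))" by (simp_all add: \<mu>_def)
    then show "bH * (d * \<mu>) \<le> 1" "d * \<rho> * \<mu> \<le> \<kappa> / 4"
      using bH(1) d \<rho>(3) by (simp_all add: pos_le_divide_eq mult_ac)
  qed
  define a b where "a = CARD('n) - card I'" and "b = CARD('n) - card I"
  have ab: "a \<ge> b + 1" "real a \<le> d"
  proof -
    have "card I \<le> CARD('n)" by (rule card_mono) auto
    moreover have "card I' < card I" using U(3) H(2) G(2) by simp
    ultimately show "a \<ge> b + 1" "real a \<le> d" unfolding a_def b_def d_def by linarith+
  qed
  have v0: "v \<ge> 0" unfolding v by simp
  have \<eta>: "real a * (1 / p) - real (a + b) * v > 0"
  proof -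
    have "real (a + b) \<le> 2 * real a - 1" using ab(1) by linarith
    also have "\<dots> \<le> real a * (2 - 1 / d)"
    proof -
      have "real a * (1 / d) \<le> 1" using ab(2) d by simp
      then show ?thesis by (simp add: algebra_simps)
    qed
    finally have "real (a + b) * v \<le> real a * (2 - 1 / d) * v" using v0 by (rule mult_right_mono)
    also have "\<dots> = real a * ((2 - 1 / d) * v)" by simp
    also have "\<dots> < real a * (1 / p)" using uv ab(1) unfolding d_def by (intro mult_strict_left_mono) auto
    finally show ?thesis by simp
  qed
  define c1 where "c1 = (\<bar>det G\<bar> * \<kappa> ^ CARD('n)) * (\<bar>det H\<bar> * (2 * \<mu>) ^ CARD('n))"
  define c2 where "c2 = \<bar>det G\<bar> * (2 * \<kappa>) ^ CARD('n) * 4"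
  have c: "c1 > 0" "c2 > 0" using G(1) H(1) \<kappa>(1) \<mu>(1) by (simp_all add: c1_def c2_def)
  have main: "4 * (c1 * \<delta> powr real (a + b)) powr v \<le> K * (c2 * \<delta> powr real a) powr (1 / p)"
    if \<delta>: "0 < \<delta>" "\<delta> \<le> 1" for \<delta>
  proof -
    define S where "S = (*v) G ` slab I' \<kappa> \<delta>"
    define S' where "S' = (*v) G ` slab I' (\<kappa> / 2) \<delta>"
    define \<Xi> where "\<Xi> = (*v) H ` slab I \<mu> \<delta>"
    have im: "compact ((*v) X ` slab J k \<delta>)" "measure lebesgue ((*v) X ` slab J k \<delta>) = \<bar>det X\<bar> * ((2 * k) ^ CARD('n) * \<delta> ^ (CARD('n) - card J))"
      if "k > 0" for X :: "real^'n^'n" and J k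
    proof -
      show "compact ((*v) X ` slab J k \<delta>)"
        by (rule compact_continuous_image[OF linear_continuous_on[OF linear_linear[THEN iffD2, OF matrix_vector_mul_linear]] compact_slab])
      show "measure lebesgue ((*v) X ` slab J k \<delta>) = \<bar>det X\<bar> * ((2 * k) ^ CARD('n) * \<delta> ^ (CARD('n) - card J))"
        using lmeasurable_linear_image_cart[OF matrix_vector_mul_linear[of X] lmeasurable_compact[OF compact_slab]]
          measure_slab[OF that \<delta>(1), of J] by simp
    qed
    have half: "\<kappa> / 2 > 0" using \<kappa> by simp
    have mS: "measure lebesgue S = \<bar>det G\<bar> * ((2 * \<kappa>) ^ CARD('n) * \<delta> ^ a)"
      unfolding S_def a_def by (rule im(2)[OF \<kappa>(1)])
    have mS': "measure lebesgue S' = \<bar>det G\<bar> * (\<kappa> ^ CARD('n) * \<delta> ^ a)"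
      using im(2)[OF half, of G I'] unfolding S'_def a_def by simp
    have m\<Xi>: "measure lebesgue \<Xi> = \<bar>det H\<bar> * ((2 * \<mu>) ^ CARD('n) * \<delta> ^ b)"
      unfolding \<Xi>_def b_def by (rule im(2)[OF \<mu>(1)])
    have nb: "norm (X *v y) \<le> bX * (d * k)" if "\<And>x. norm (X *v x) \<le> bX * norm x" "bX > 0" "y \<in> slab J k \<delta>" "k > 0"
      for X :: "real^'n^'n" and bX y J k
    proof -
      have "norm (X *v y) \<le> bX * norm y" by (rule that(1))
      also have "\<dots> \<le> bX * (d * k)" using slab_norm[OF that(3,4) \<delta>] that(2) unfolding d_def by (intro mult_left_mono) auto
      finally show ?thesis .
    qed
    have Sb: "S \<subseteq> ball 0 C"
    proof
      fix x assume "x \<in> S"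
      then obtain y where y: "y \<in> slab I' \<kappa> \<delta>" "x = G *v y" unfolding S_def by blast
      have "norm x \<le> bG * (d * \<kappa>)" unfolding y(2) by (rule nb[OF bG(2,1) y(1) \<kappa>(1)])
      then show "x \<in> ball 0 C" using \<kappa>(2) by simp
    qed
    have \<Xi>u: "\<Xi> \<subseteq> unit_cube"
    proof
      fix \<xi> assume "\<xi> \<in> \<Xi>"
      then obtain y where y: "y \<in> slab I \<mu> \<delta>" "\<xi> = H *v y" unfolding \<Xi>_def by blast
      have "norm \<xi> \<le> 1" unfolding y(2) using nb[OF bH(2,1) y(1) \<mu>(1)] \<mu>(2) by linarith
      then have "\<bar>\<xi> $ i\<bar> \<le> 1" for i using component_le_norm_cart[of \<xi> i] by linarith
      then show "\<xi> \<in> unit_cube" by (simp add: unit_cube_def abs_le_iff minus_le_iff)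
    qed
    have inc: "x - shift ?A ?B \<xi> z \<in> S" if x: "x \<in> S'" and \<xi>: "\<xi> \<in> \<Xi>" and z: "z \<in> zcube" for x \<xi> z
    proof -
      obtain y where y: "y \<in> slab I' (\<kappa> / 2) \<delta>" "x = G *v y" using x unfolding S'_def by blast
      obtain e where e: "e \<in> slab I \<mu> \<delta>" "\<xi> = H *v e" using \<xi> unfolding \<Xi>_def by blast
      have s1: "?R1 *v e \<in> slab I' (d * \<rho> * \<mu>) \<delta>" unfolding d_def
        by (rule matrix_slab[OF R0 \<rho>(1) e(1) \<mu>(1) \<delta>]) auto
      have s2: "?R2 *v e \<in> slab I' (d * \<rho> * \<mu>) \<delta>" unfolding d_def
        by (rule matrix_slab[OF R0[OF U(2)] \<rho>(2) e(1) \<mu>(1) \<delta>]) auto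
      have GR: "G *v ((G' ** X ** H) *v e) = X *v \<xi>" for X
        unfolding e(2) matrix_vector_mul_assoc matrix_mul_assoc G'(1) by simp
      define w where "w = y - fst z *\<^sub>R (?R1 *v e) - snd z *\<^sub>R (?R2 *v e)"
      have "G *v w = x - shift ?A ?B \<xi> z"
        unfolding w_def shift_def y(2) GR[symmetric] by (simp add: matrix_vector_mult_diff_distrib matrix_vector_mult_scaleR)
      moreover have "w \<in> slab I' \<kappa> \<delta>" unfolding slab_def
      proof (intro CollectI allI)
        fix i
        define t where "t = (if i \<in> I' then 1 else \<delta>)"
        have t: "t \<ge> 0" using \<delta> by (simp add: t_def)
        have le: "d * \<rho> * \<mu> * t \<le> \<kappa> / 4 * t" using \<mu>(3) t by (rule mult_right_mono)
        have 1: "\<bar>y $ i\<bar> \<le> \<kappa> / 2 * t" using y(1) by (simp only: slab_def mem_Collect_eq t_def)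
        have 2: "\<bar>(?R1 *v e) $ i\<bar> \<le> \<kappa> / 4 * t" 
        proof -
          have "\<bar>(?R1 *v e) $ i\<bar> \<le> d * \<rho> * \<mu> * t" using s1 by (simp only: slab_def mem_Collect_eq t_def)
          then show ?thesis using le by (rule order_trans)
        qed
        have 3: "\<bar>(?R2 *v e) $ i\<bar> \<le> \<kappa> / 4 * t" 
        proof -
          have "\<bar>(?R2 *v e) $ i\<bar> \<le> d * \<rho> * \<mu> * t" using s2 by (simp only: slab_def mem_Collect_eq t_def)
          then show ?thesis using le by (rule order_trans)
        qed
        have "\<bar>fst z * (?R1 *v e) $ i\<bar> \<le> 1 * (\<kappa> / 4 * t)" unfolding abs_mult
          using z 2 by (intro mult_mono) (auto simp: zcube_iff)
        moreover have "\<bar>snd z * (?R2 *v e) $ i\<bar> \<le> 1 * (\<kappa> / 4 * t)" unfolding abs_mult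
          using z 3 by (intro mult_mono) (auto simp: zcube_iff)
        moreover have "w $ i = y $ i - fst z * (?R1 *v e) $ i - snd z * (?R2 *v e) $ i" by (simp add: w_def)
        ultimately have "\<bar>w $ i\<bar> \<le> \<kappa> * t" using 1 by linarith
        then show "\<bar>w $ i\<bar> \<le> \<kappa> * (if i \<in> I' then 1 else \<delta>)" by (simp only: t_def)
      qed
      ultimately show ?thesis unfolding S_def by (metis imageI)
    qed
    have zc: "compact zcube" unfolding zcube_def by (intro compact_Times) auto
    have mz: "measure lebesgue zcube = 4" using zcube_borel by (simp add: measure_def emeasure_zcube)
    have pS': "measure lebesgue S' > 0" using G(1) \<kappa>(1) \<delta> by (simp add: mS')
    have p\<Xi>: "measure lebesgue \<Xi> > 0" using H(1) \<mu>(1) \<delta> by (simp add: m\<Xi>)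
    have cS: "compact S" unfolding S_def by (rule im(1)[OF \<kappa>(1)])
    have cS': "compact S'" unfolding S'_def by (rule im(1)[OF half])
    have c\<Xi>: "compact \<Xi>" unfolding \<Xi>_def by (rule im(1)[OF \<mu>(1)])
    have "4 * (measure lebesgue S' * measure lebesgue \<Xi>) powr v \<le> K * (measure lebesgue S * 4) powr (1 / p)"
      by (rule K(2)[OF cS zc cS' c\<Xi> Sb order_refl \<Xi>u pS' p\<Xi> inc, unfolded mz])
    moreover have "measure lebesgue S' * measure lebesgue \<Xi> = c1 * \<delta> powr real (a + b)"
      unfolding mS' m\<Xi> c1_def using \<delta>(1) by (simp only: powr_realpow power_add mult_ac)
    moreover have "measure lebesgue S * 4 = c2 * \<delta> powr real a"
      unfolding mS c2_def using \<delta>(1) by (simp only: powr_realpow mult_ac)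
    ultimately show ?thesis by (simp only:)
  qed
  define L where "L = K * c2 powr (1 / p) / (4 * c1 powr v)"
  have L: "L \<ge> 0" using K(1) by (simp add: L_def)
  obtain \<delta> where \<delta>: "0 < \<delta>" "\<delta> \<le> 1" "L * \<delta> powr (real a * (1 / p) - real (a + b) * v) < 1"
    using powr_eventually_less_1[OF zero_less_one \<eta> L] by blast
  have "4 * (c1 powr v * \<delta> powr (real (a + b) * v)) \<le> K * (c2 powr (1 / p) * \<delta> powr (real a * (1 / p)))"
    using main[OF \<delta>(1,2)] c \<delta>(1) by (simp only: powr_mult powr_powr)
  then have "\<delta> powr (real (a + b) * v) \<le> L * \<delta> powr (real a * (1 / p))"
    using c by (simp add: L_def field_simps)
  also have "\<delta> powr (real a * (1 / p)) = \<delta> powr (real (a + b) * v) * \<delta> powr (real a * (1 / p) - real (a + b) * v)"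
    using \<delta>(1) by (simp add: powr_add[symmetric])
  finally have "\<delta> powr (real (a + b) * v) * 1 \<le> \<delta> powr (real (a + b) * v) * (L * \<delta> powr (real a * (1 / p) - real (a + b) * v))"
    by (simp only: mult_ac mult_1_right)
  then have "1 \<le> L * \<delta> powr (real a * (1 / p) - real (a + b) * v)"
    using \<delta>(1) by (subst (asm) mult_le_cancel_left_pos) auto
  then show False using \<delta>(3) by linarith
qed

section \<open>From the polynomial determinant to matrices, and the two alternatives\<close>

lemma pencil_det_eq_0:
  fixes Q1 Q2 :: "real^'n \<Rightarrow> real"
  assumes "pencil_det Q1 Q2 = 0"
  shows "det (s *\<^sub>R hessian Q1 0 + t *\<^sub>R hessian Q2 0) = 0"
proof -
  have "pencil_det Q1 Q2 = (\<Sum>j\<le>CARD('n). const2 (coeff (pencil_poly (hessian Q1 0) (hessian Q2 0)) j)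
      * var_t ^ j * var_s ^ (CARD('n) - j))"
    using pencil_det_rotated[of 1 0 Q1 Q2] by (simp add: const2_hom)
  then have "poly (poly (pencil_det Q1 Q2) [:t:]) s
      = (\<Sum>j\<le>CARD('n). coeff (pencil_poly (hessian Q1 0) (hessian Q2 0)) j * t ^ j * s ^ (CARD('n) - j))"
    by (simp add: poly_sum const2_def var_s_def var_t_def mult.assoc)
  then show ?thesis using assms by (simp add: det_pencil_eq_sum)
qed

text \<open>Flatness kills the coefficients of index up to d/2 and the nonzero determinant leaves
  some other one, so the lowest surviving index exceeds d/2. By
  \<open>max_root_multiplicity_pencil\<close> that index is the largest multiplicity.\<close>

lemma flat_surface_vanishing_order:
  fixes Q1 Q2 :: "real^'n \<Rightarrow> real"
  assumes Q: "quadratic_form Q1" "quadratic_form Q2" and flat: "flat_surface Q1 Q2" and nz: "pencil_det Q1 Q2 \<noteq> 0"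
  defines "m \<equiv> max_root_multiplicity (pencil_det Q1 Q2)"
  defines "P \<equiv> \<lambda>c s. pencil_poly (c *\<^sub>R hessian Q1 0 + s *\<^sub>R hessian Q2 0) ((- s) *\<^sub>R hessian Q1 0 + c *\<^sub>R hessian Q2 0)"
  obtains c s where "c\<^sup>2 + s\<^sup>2 = 1" "\<And>j. j < m \<Longrightarrow> coeff (P c s) j = 0"
    "coeff (P c s) m \<noteq> 0" "m \<le> CARD('n)" "CARD('n) < 2 * m"
proof -
  obtain c s where cs: "c\<^sup>2 + s\<^sup>2 = 1" "\<And>j. 2 * j \<le> CARD('n) \<Longrightarrow> coeff (P c s) j = 0"
    unfolding P_def using flat_surface_pencil[OF Q flat] by metis
  have "\<exists>j\<le>CARD('n). coeff (P c s) j \<noteq> 0"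
  proof (rule ccontr)
    assume "\<not> (\<exists>j\<le>CARD('n). coeff (P c s) j \<noteq> 0)"
    then have "pencil_det Q1 Q2 = 0"
      unfolding pencil_det_rotated[OF cs(1)] P_def by (intro sum.neutral) (auto simp: const2_hom)
    with nz show False by contradiction
  qed
  then obtain j0 where j0: "j0 \<le> CARD('n)" "coeff (P c s) j0 \<noteq> 0" by blast
  define k where "k = (LEAST j. coeff (P c s) j \<noteq> 0)"
  have k: "coeff (P c s) k \<noteq> 0" unfolding k_def by (rule LeastI[of _ j0]) (rule j0)
  have kj: "k \<le> j0" unfolding k_def by (rule Least_le) (rule j0)
  have low: "coeff (P c s) j = 0" if "j < k" for j using that not_less_Least unfolding k_def by blast
  have k2: "CARD('n) < 2 * k" using cs(2)[of k] k by (meson not_le)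
  have kn: "k \<le> CARD('n)" using kj j0 by simp
  have "m = k" unfolding m_def
    by (rule max_root_multiplicity_pencil[OF cs(1) refl]) (use low k kn k2 in \<open>simp_all add: P_def\<close>)
  then show thesis using that[OF cs(1)] low k kn k2 by blast
qed

theorem theorem3:
  fixes Q1 Q2 :: "real^'n::finite \<Rightarrow> real"
  assumes "CARD('n) \<ge> 2"
    and "quadratic_form Q1" and "quadratic_form Q2"
  shows
    "(flat_surface Q1 Q2 \<and> pencil_det Q1 Q2 \<noteq> 0 \<longrightarrow>
        (let m = max_root_multiplicity (pencil_det Q1 Q2) in
          real m > real CARD('n) / 2 \<and>
          (\<forall>C>0. \<forall>p q :: ennreal. p \<ge> 1 \<longrightarrow> q \<ge> 1 \<longrightarrow>
             (1 + of_nat m / q \<ge> (of_nat m + 1) / p \<and> 2 / q \<ge> 1 / p \<and>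
                \<not> (p = (of_nat m + 2) / 2 \<and> q = of_nat m + 2)
              \<longrightarrow> Lp_Lq_estimate Q1 Q2 C p q) \<and>
             (1 + of_nat m / q < (of_nat m + 1) / p \<and> 2 / q = 1 / p
              \<longrightarrow> \<not> Lp_Lq_estimate Q1 Q2 C p q)))) \<and>
     (pencil_det Q1 Q2 = 0 \<longrightarrow>
        (\<exists>\<epsilon>::real. 0 < \<epsilon> \<and> \<epsilon> < 1 \<and>
          (\<forall>C>0. \<forall>p q :: ennreal. p \<ge> 1 \<longrightarrow> q \<ge> 1 \<longrightarrow>
             ennreal (2 - \<epsilon>) / q < 1 / p \<longrightarrow> \<not> Lp_Lq_estimate Q1 Q2 C p q)))"
proof (intro conjI impI)
  note Q = assms(2,3)
  assume "flat_surface Q1 Q2 \<and> pencil_det Q1 Q2 \<noteq> 0"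
  then have flat: "flat_surface Q1 Q2" and nz: "pencil_det Q1 Q2 \<noteq> 0" by auto
  define m where "m = max_root_multiplicity (pencil_det Q1 Q2)"
  let ?A = "hessian Q1 0" and ?B = "hessian Q2 0"
  obtain c s where cs: "c\<^sup>2 + s\<^sup>2 = 1"
    and low: "\<And>j. j < m \<Longrightarrow> coeff (pencil_poly (c *\<^sub>R ?A + s *\<^sub>R ?B) ((- s) *\<^sub>R ?A + c *\<^sub>R ?B)) j = 0"
    and m: "coeff (pencil_poly (c *\<^sub>R ?A + s *\<^sub>R ?B) ((- s) *\<^sub>R ?A + c *\<^sub>R ?B)) m \<noteq> 0" "m \<le> CARD('n)" "CARD('n) < 2 * m"
  proof (rule flat_surface_vanishing_order[OF Q flat nz, folded m_def], goal_cases)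
    case (1 c s)
    show ?case by (rule 1(1)[OF 1(2-6)])
  qed
  have m0: "m > 0" using m(3) by simp
  obtain U where U: "U > 0"
    "\<And>\<epsilon>. \<epsilon> > 0 \<Longrightarrow> emeasure lborel {z :: real \<times> real. \<bar>fst z\<bar> \<le> 2 \<and> \<bar>snd z\<bar> \<le> 2 \<and> \<bar>det_form ?A ?B z\<bar> \<le> \<epsilon>}
      \<le> ennreal (U * \<epsilon> powr (1 / m))"
    unfolding det_form_def
  \<comment> \<open>The radius 2 accommodates differences of two points of the square.\<close>
  proof (rule pencil_sublevel[where R=2, OF cs refl low m], goal_cases)
    case (3 U)
    show ?case by (rule 3(1)[OF 3(2,3)])
  qed auto
  obtain K where K: "K \<ge> 0" "endpoint_bound ?A ?B m K"
  proof (rule endpoint_estimate[OF U(2,1) m0], goal_cases)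
    case (2 K)
    have "endpoint_bound ?A ?B m K" unfolding endpoint_bound_def
    proof (intro allI impI)
      fix C and g :: "(real^'n) \<times> real \<times> real \<Rightarrow> real" assume g: "admissible C g"
      obtain b where b: "\<And>p. g p \<le> b" using admissible_bound[OF g] by blast
      show "(\<integral>\<^sup>+\<xi>. (\<integral>\<^sup>+x. (\<integral>\<^sup>+z. ennreal (g (x - shift ?A ?B \<xi> z, z)) \<partial>lborel) ^ (m + 2) \<partial>lborel) \<partial>lborel)
          \<le> ennreal K * (\<integral>\<^sup>+p. ennreal (g p powr ((real m + 2) / 2)) \<partial>lborel)\<^sup>2"
        by (rule 2(3)[OF admissibleD(1,2)[OF g] b admissibleD(3)[OF g]])
    qed
    with 2(2) show ?case by (rule 2(1))
  qed auto
  show "let m = max_root_multiplicity (pencil_det Q1 Q2) in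
          real m > real CARD('n) / 2 \<and>
          (\<forall>C>0. \<forall>p q :: ennreal. p \<ge> 1 \<longrightarrow> q \<ge> 1 \<longrightarrow>
             (1 + of_nat m / q \<ge> (of_nat m + 1) / p \<and> 2 / q \<ge> 1 / p \<and>
                \<not> (p = (of_nat m + 2) / 2 \<and> q = of_nat m + 2)
              \<longrightarrow> Lp_Lq_estimate Q1 Q2 C p q) \<and>
             (1 + of_nat m / q < (of_nat m + 1) / p \<and> 2 / q = 1 / p
              \<longrightarrow> \<not> Lp_Lq_estimate Q1 Q2 C p q))"
    unfolding Let_def m_def[symmetric]
  proof (intro conjI allI impI)
    have "real CARD('n) < 2 * real m" using m(3) by linarith
    then show "real CARD('n) / 2 < real m" by simp
  next
    fix C :: real and p q :: ennreal
    assume "C > 0" "p \<ge> 1" "q \<ge> 1"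
      "(of_nat m + 1) / p \<le> 1 + of_nat m / q \<and> 1 / p \<le> 2 / q \<and> \<not> (p = (of_nat m + 2) / 2 \<and> q = of_nat m + 2)"
    then show "Lp_Lq_estimate Q1 Q2 C p q"
      by (intro Lp_Lq_estimate_of_endpoint_bound[OF Q K(2,1) m0]) blast+
  next
    fix C :: real and p q :: ennreal
    assume C: "C > 0" and p: "p \<ge> 1" and q: "q \<ge> 1" and
      pq: "1 + of_nat m / q < (of_nat m + 1) / p \<and> 2 / q = 1 / p"
    show "\<not> Lp_Lq_estimate Q1 Q2 C p q"
    proof
      assume est: "Lp_Lq_estimate Q1 Q2 C p q"
      have "p \<noteq> \<infinity>" using pq by auto
      then obtain p' where p': "p = ennreal p'" "p' \<ge> 0" by (cases p) auto
      have p1: "p' \<ge> 1" using p unfolding p' using p'(2) by (metis ennreal_1 ennreal_le_iff)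
      have e4: "1 / p = ennreal (1 / p')" unfolding p' ennreal_1[symmetric] using p1 by (subst divide_ennreal) auto
      have "q \<noteq> \<infinity>"
      proof
        assume "q = \<infinity>"
        then have "ennreal (1 / p') = 0" using pq unfolding e4 by auto
        then show False using p1 by (simp add: ennreal_eq_0_iff)
      qed
      then obtain q' where q': "q = ennreal q'" "q' \<ge> 0" by (cases q) auto
      have q1: "q' \<ge> 1" using q unfolding q' using q'(2) by (metis ennreal_1 ennreal_le_iff)
      have mm: "of_nat m = ennreal (real m)" by (simp add: ennreal_of_nat_eq_real_of_nat)
      have mm1: "of_nat m + 1 = ennreal (real m + 1)" unfolding mm by (metis ennreal_1 ennreal_plus of_nat_0_le_iff zero_le_one)
      have e1: "1 + of_nat m / q = ennreal (1 + real m / q')" unfolding mm q' using q1 by (simp add: divide_ennreal)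
      have e2: "(of_nat m + 1) / p = ennreal ((real m + 1) / p')"
        unfolding mm1 p' using p1 by (subst divide_ennreal) auto
      have two: "(2::ennreal) = ennreal 2" by simp
      have e3: "2 / q = ennreal (2 / q')" unfolding two q' using q1 by (subst divide_ennreal) auto
      have "2 / q' = 1 / p'" using pq p1 q1 unfolding e3 e4 by (subst (asm) ennreal_inj) auto
      then have qp: "q' = 2 * p'" using p1 q1 by (simp add: field_simps)
      have "1 + real m / q' < (real m + 1) / p'"
        using pq p1 q1 unfolding e1 e2 by (subst (asm) ennreal_less_iff) auto
      \<comment> \<open>On the line q = 2p, multiplying by q turns the failing condition into 2p < m
        + 2, the exact opposite of \<open>necessary_exponent\<close>.\<close>
      then have "(1 + real m / q') * q' < (real m + 1) / p' * q'" using q1 by (intro mult_strict_right_mono) auto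
      moreover have "(real m + 1) / p' * q' = 2 * (real m + 1)" unfolding qp using p1 by simp
      moreover have "(1 + real m / q') * q' = q' + real m" using q1 by (simp add: distrib_right)
      ultimately have "q' + real m < 2 * (real m + 1)" by (simp only:)
      then have lt: "2 * p' < real m + 2" unfolding qp by simp
      have "real m + 2 \<le> 2 * p'"
        using necessary_exponent[OF Q cs refl refl low m(2,1) C p1] est unfolding p'(1) q'(1) qp by blast
      with lt show False by linarith
    qed
  qed
next
  note Q = assms(2,3)
  assume z: "pencil_det Q1 Q2 = 0"
  have sing: "det (s *\<^sub>R hessian Q1 0 + hessian Q2 0) = 0" for s
    using pencil_det_eq_0[OF z, of s 1] by simp
  define \<epsilon> :: real where "\<epsilon> = 1 / CARD('n)"
  \<comment> \<open>The strict upper bound is where d \<ge> 2 is used.\<close>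
  have \<epsilon>: "0 < \<epsilon>" "\<epsilon> < 1" using assms(1) by (auto simp: \<epsilon>_def)
  show "\<exists>\<epsilon>::real. 0 < \<epsilon> \<and> \<epsilon> < 1 \<and>
          (\<forall>C>0. \<forall>p q :: ennreal. p \<ge> 1 \<longrightarrow> q \<ge> 1 \<longrightarrow>
             ennreal (2 - \<epsilon>) / q < 1 / p \<longrightarrow> \<not> Lp_Lq_estimate Q1 Q2 C p q)"
  proof (intro exI[of _ \<epsilon>] conjI allI impI notI)
    fix C :: real and p q :: ennreal
    assume C: "C > 0" and p: "p \<ge> 1" and q: "q \<ge> 1" and pq: "ennreal (2 - \<epsilon>) / q < 1 / p"
      and est: "Lp_Lq_estimate Q1 Q2 C p q"
    have "p \<noteq> \<infinity>" using pq by auto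
    then obtain p' where p': "p = ennreal p'" "p' \<ge> 0" by (cases p) auto
    have p1: "p' \<ge> 1" using p unfolding p' using p'(2) by (metis ennreal_1 ennreal_le_iff)
    have e4: "1 / p = ennreal (1 / p')" unfolding p' ennreal_1[symmetric] using p1 by (subst divide_ennreal) auto
    define v where "v = (if q = \<infinity> then 0 else 1 / enn2real q)"
    have le: "1 / p' \<le> (2 - \<epsilon>) * v"
      using singular_pencil_no_estimate[OF Q sing C p1 q _ v_def] est unfolding p'(1) \<epsilon>_def by blast
    have "q \<noteq> \<infinity>"
    proof
      assume "q = \<infinity>"
      then show False using le p1 by (simp add: v_def)
    qed
    then obtain q' where q': "q = ennreal q'" "q' \<ge> 0" by (cases q) auto
    have q1: "q' \<ge> 1" using q unfolding q' using q'(2) by (metis ennreal_1 ennreal_le_iff)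
    have e5: "ennreal (2 - \<epsilon>) / q = ennreal ((2 - \<epsilon>) / q')" unfolding q' using q1 \<epsilon> by (subst divide_ennreal) auto
    have "(2 - \<epsilon>) / q' < 1 / p'" using pq q1 \<epsilon> unfolding e4 e5 by (subst (asm) ennreal_less_iff) auto
    moreover have "v = 1 / q'" using \<open>q \<noteq> \<infinity>\<close> q' by (simp add: v_def)
    ultimately show False using le by simp
  qed (use \<epsilon> in auto)
qed

end
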